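(* Let $K$ be a finite 2-dimensional simplicial complex, and let $d\in\mathbb{N}$. Then there exists a constant $C=C(K,d)$ such that any $d$-pattern on $K$ has at most $C$ parallelism classes of tracks.
   Context: $K$ is connected and $\tilde K$ denotes its universal cover, with the lifted simplicial structure; faces are 2-simplices. A drawing on a 2-dimensional simplicial complex is a non-empty union of simple paths in the faces such that: (1) on each face there is a finite number of paths; (2) the two endpoints of each path are in the interior of distinct edges; (3) the interior of a path is in the interior of a face; (4) no two paths in a face have a common endpoint; (5) if a point $x$ on an edge $e$ is an endpoint of a path, then in every face containing $e$ there exists a path having $x$ as an endpoint. A pre-track is a minimal drawing (no proper sub-collection of its paths forms a drawing). A pre-track is self-intersecting if it contains two intersecting paths (paths crossing in the interior of a face). The preimage in $\tilde K$ of a pre-track of $K$ is a drawing on $\tilde K$; the pre-tracks contained in this preimage are called its (pre-track) lifts. A pre-track of $K$ is a track if none of its pre-track lifts in $\tilde K$ is self-intersecting. A pattern is a set of tracks whose union is a drawing. A $d$-pattern is a pattern such that any collection of pairwise intersecting lifts of its tracks in $\tilde K$ has size at most $d$. Each lift $\tilde t$ in $\tilde K$ of a track separates the vertex set $\tilde K^0$ into two components $\mathfrak h_{\tilde t}$ and $\mathfrak h_{\tilde t}^*$, called the halfspaces defined by $\tilde t$. Two lifted tracks in $\tilde K$ are parallel if they define the same pair of halfspaces. Two tracks of a pattern on $K$ are parallel if they have parallel lifts in $\tilde K$; parallelism classes are the classes of this equivalence relation on the tracks of the pattern. *)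

theory Defs
  imports "HOL-Analysis.Analysis"
begin

section \<open>Simplicial complexes and their geometric realization\<close>

text \<open>
  Complexes are abstract and possibly infinite, since the universal cover of a finite complex need
  not be finite; the predicate \<open>simplicial_complex\<close> of HOL-Analysis only covers finite geometric
  complexes in a Euclidean space.
\<close>

definition abstract_complex :: "'v set set \<Rightarrow> bool" where
  "abstract_complex K \<longleftrightarrow>
     (\<forall>s\<in>K. finite s \<and> s \<noteq> {}) \<and> (\<forall>s\<in>K. \<forall>t. t \<subseteq> s \<and> t \<noteq> {} \<longrightarrow> t \<in> K)"

definition two_dimensional :: "'v set set \<Rightarrow> bool" where
  "two_dimensional K \<longleftrightarrow> (\<forall>s\<in>K. card s \<le> 3) \<and> (\<exists>s\<in>K. card s = 3)"

definition edges :: "'v set set \<Rightarrow> 'v set set" where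
  "edges K = {e \<in> K. card e = 2}"

definition faces :: "'v set set \<Rightarrow> 'v set set" where
  "faces K = {f \<in> K. card f = 3}"

text \<open>
  Points of the realization are given by barycentric coordinates. The topology is the one induced
  by the product topology on \<open>'v \<Rightarrow> real\<close>; on a locally finite complex (in particular on a finite
  complex and on its universal cover) it agrees with the weak topology of the CW structure.
\<close>

definition closed_simplex :: "'v set \<Rightarrow> ('v \<Rightarrow> real) set" where
  "closed_simplex s = {x. (\<forall>v. 0 \<le> x v) \<and> (\<forall>v. v \<notin> s \<longrightarrow> x v = 0) \<and> sum x s = 1}"

definition open_simplex :: "'v set \<Rightarrow> ('v \<Rightarrow> real) set" where
  "open_simplex s = {x \<in> closed_simplex s. \<forall>v\<in>s. 0 < x v}"

definition realization :: "'v set set \<Rightarrow> ('v \<Rightarrow> real) set" where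
  "realization K = (\<Union>s\<in>K. closed_simplex s)"

definition vertex_point :: "'v \<Rightarrow> ('v \<Rightarrow> real)" where
  "vertex_point v = (\<lambda>u. if u = v then 1 else 0)"

definition realization_map :: "('w \<Rightarrow> 'v) \<Rightarrow> ('w \<Rightarrow> real) \<Rightarrow> ('v \<Rightarrow> real)" where
  "realization_map p x = (\<lambda>v. \<Sum>w | x w \<noteq> 0 \<and> p w = v. x w)"

text \<open>
  The simplicial structure on the covering space being the lifted one amounts to the projection
  being the realization of a simplicial map. Path-connectedness of the covering space is part of
  \<open>simply_connected\<close>.
\<close>

definition universal_cover :: "'v set set \<Rightarrow> 'w set set \<Rightarrow> ('w \<Rightarrow> 'v) \<Rightarrow> bool" where
  "universal_cover K Kt p \<longleftrightarrow>
     abstract_complex Kt \<and>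
     (\<forall>s\<in>Kt. p ` s \<in> K) \<and>
     covering_space (realization Kt) (realization_map p) (realization K) \<and>
     simply_connected (realization Kt)"

section \<open>Drawings\<close>

text \<open>
  A simple path is represented by its image, so that reparametrizations are identified. A drawing
  is represented by its collection of paths rather than by their union: paths may cross, and then
  the union alone does not determine the paths.
\<close>

definition path_in_face :: "'v set \<Rightarrow> ('v \<Rightarrow> real) set \<Rightarrow> bool" where
  "path_in_face f a \<longleftrightarrow>
     (\<exists>g e e'. arc g \<and> path_image g = a \<and>
        e \<subseteq> f \<and> card e = 2 \<and> e' \<subseteq> f \<and> card e' = 2 \<and> e \<noteq> e' \<and>
        pathstart g \<in> open_simplex e \<and> pathfinish g \<in> open_simplex e' \<and>
        (\<forall>t. 0 < t \<and> t < 1 \<longrightarrow> g t \<in> open_simplex f))"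

definition arc_endpoints :: "('a::topological_space) set \<Rightarrow> 'a set" where
  "arc_endpoints a = {x. \<exists>g. arc g \<and> path_image g = a \<and> x = pathstart g}"

definition drawing :: "'v set set \<Rightarrow> ('v \<Rightarrow> real) set set \<Rightarrow> bool" where
  "drawing K D \<longleftrightarrow>
     D \<noteq> {} \<and>
     (\<forall>a\<in>D. \<exists>f\<in>faces K. path_in_face f a) \<and>
     (\<forall>f\<in>faces K. finite {a \<in> D. path_in_face f a}) \<and>
     (\<forall>f\<in>faces K. \<forall>a\<in>D. \<forall>b\<in>D. path_in_face f a \<and> path_in_face f b \<and> a \<noteq> b \<longrightarrow>
        arc_endpoints a \<inter> arc_endpoints b = {}) \<and>
     (\<forall>e\<in>edges K. \<forall>x\<in>closed_simplex e. (\<exists>a\<in>D. x \<in> arc_endpoints a) \<longrightarrow>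
        (\<forall>f\<in>faces K. e \<subseteq> f \<longrightarrow> (\<exists>b\<in>D. path_in_face f b \<and> x \<in> arc_endpoints b)))"

definition pretrack :: "'v set set \<Rightarrow> ('v \<Rightarrow> real) set set \<Rightarrow> bool" where
  "pretrack K t \<longleftrightarrow> drawing K t \<and> (\<forall>s. s \<subset> t \<longrightarrow> \<not> drawing K s)"

definition self_intersecting :: "'v set set \<Rightarrow> ('v \<Rightarrow> real) set set \<Rightarrow> bool" where
  "self_intersecting K t \<longleftrightarrow>
     (\<exists>a\<in>t. \<exists>b\<in>t. a \<noteq> b \<and> (\<exists>f\<in>faces K. a \<inter> b \<inter> open_simplex f \<noteq> {}))"

section \<open>Lifts, tracks and patterns\<close>

text \<open>The paths of the preimage of a drawing, obtained face by face.\<close>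

definition drawing_preimage ::
  "'w set set \<Rightarrow> ('w \<Rightarrow> 'v) \<Rightarrow> ('v \<Rightarrow> real) set set \<Rightarrow> ('w \<Rightarrow> real) set set" where
  "drawing_preimage Kt p D =
     {closed_simplex f \<inter> realization_map p -` a | f a.
        f \<in> faces Kt \<and> a \<in> D \<and> path_in_face (p ` f) a}"

definition lifts ::
  "'w set set \<Rightarrow> ('w \<Rightarrow> 'v) \<Rightarrow> ('v \<Rightarrow> real) set set \<Rightarrow> ('w \<Rightarrow> real) set set set" where
  "lifts Kt p t = {s. s \<subseteq> drawing_preimage Kt p t \<and> pretrack Kt s}"

definition track ::
  "'v set set \<Rightarrow> 'w set set \<Rightarrow> ('w \<Rightarrow> 'v) \<Rightarrow> ('v \<Rightarrow> real) set set \<Rightarrow> bool" where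
  "track K Kt p t \<longleftrightarrow> pretrack K t \<and> (\<forall>s\<in>lifts Kt p t. \<not> self_intersecting Kt s)"

definition pattern ::
  "'v set set \<Rightarrow> 'w set set \<Rightarrow> ('w \<Rightarrow> 'v) \<Rightarrow> ('v \<Rightarrow> real) set set set \<Rightarrow> bool" where
  "pattern K Kt p P \<longleftrightarrow> (\<forall>t\<in>P. track K Kt p t) \<and> drawing K (\<Union>P)"

definition d_pattern ::
  "nat \<Rightarrow> 'v set set \<Rightarrow> 'w set set \<Rightarrow> ('w \<Rightarrow> 'v) \<Rightarrow> ('v \<Rightarrow> real) set set set \<Rightarrow> bool" where
  "d_pattern d K Kt p P \<longleftrightarrow>
     pattern K Kt p P \<and>
     (\<forall>S. S \<subseteq> (\<Union>t\<in>P. lifts Kt p t) \<and> pairwise (\<lambda>s s'. \<Union>s \<inter> \<Union>s' \<noteq> {}) S \<longrightarrow>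
        finite S \<and> card S \<le> d)"

section \<open>Halfspaces and parallelism\<close>

definition halfspaces :: "'w set set \<Rightarrow> ('w \<Rightarrow> real) set set \<Rightarrow> 'w set set" where
  "halfspaces Kt s =
     {{w \<in> \<Union>Kt. vertex_point w \<in> C} | C. C \<in> components (realization Kt - \<Union>s)}"

definition parallel_tracks ::
  "'w set set \<Rightarrow> ('w \<Rightarrow> 'v) \<Rightarrow> ('v \<Rightarrow> real) set set \<Rightarrow> ('v \<Rightarrow> real) set set \<Rightarrow> bool" where
  "parallel_tracks Kt p t t' \<longleftrightarrow>
     (\<exists>s\<in>lifts Kt p t. \<exists>s'\<in>lifts Kt p t'. halfspaces Kt s = halfspaces Kt s')"

definition parallelism_classes ::
  "'w set set \<Rightarrow> ('w \<Rightarrow> 'v) \<Rightarrow> ('v \<Rightarrow> real) set set set \<Rightarrow> ('v \<Rightarrow> real) set set set set" where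
  "parallelism_classes Kt p P =
     P // {(t, t'). t \<in> P \<and> t' \<in> P \<and> parallel_tracks Kt p t t'}"

end

theory Submission
  imports Defs
begin

text \<open>
  Along a directed edge of the universal cover, order the lifts crossing it by the transitive closure of
  ``before, and equal or disjoint''. Antichains consist of pairwise intersecting lifts, so the width is at
  most \<open>d\<close>. In a face, the points whose path turns around a given corner form an order-convex set of
  the edge, and the order of this set does not depend on from which of the two edges it is read off. A
  canonical choice of a set of next elements above a point of a poset of bounded width changes only at
  boundedly many points when the poset is replaced by an order-convex part. Hence, up to deck
  transformations, there are boundedly many points at which the choice is empty or disagrees with the
  choice of an adjacent face. A lift through no such point can be pushed along the choice to a
  next lift that meets every edge equally often. As the number of points on each edge, modulo two,
  determines the halfspaces, the two lifts define the same halfspaces, and iterating this on a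
  finite edge gives a contradiction. So every parallelism class owns one of the exceptional points.
\<close>

text \<open>The obstacle is the choice of next elements. Minimal elements above a point are not
  stable: for chains \<open>a 1 < a 2 < ...\<close> and \<open>b 1 < b 2 < ...\<close> with
  \<open>a i < b j\<close> iff \<open>i <= j\<close>, a poset of width 2, every \<open>a i\<close>
  is covered by \<open>b i\<close>, and passing to the order-convex chain of the \<open>a i\<close>
  destroys all these covers. Instead, \<open>sel\<close> looks at the least antichain of maximum
  size that has an element above the point. Antichains of maximum size form a lattice, so this is
  canonical, and passing to a convex part disturbs it only near finitely many extreme antichains.
  Points on no such antichain are treated after all of them have been removed, which lowers the
  width; hence the inductions on the width. A choice made from the order alone commutes with order
  isomorphisms, so both with turning around a corner and with deck transformations. The transitive
  closure is forced because disjointness of lifts is not transitive; it can only make antichains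
  smaller. On the topological side, everything rests on one arc in a triangle: the theta curve
  theorem gives its two sides, Janiszewski's theorem combines several arcs, and a mod 2 cocycle on
  the simply connected cover glues the faces.\<close>

abbreviation (input) cs where "cs \<equiv> closed_simplex"
abbreviation (input) ends where "ends \<equiv> arc_endpoints"
abbreviation (input) vp where "vp \<equiv> vertex_point"

section \<open>Stable selections in posets of bounded width\<close>

locale strict_order =
  fixes lt :: "'a \<Rightarrow> 'a \<Rightarrow> bool" (infix "\<sqsubset>" 50)
  assumes irrefl: "\<not> x \<sqsubset> x"
    and trans: "x \<sqsubset> y \<Longrightarrow> y \<sqsubset> z \<Longrightarrow> x \<sqsubset> z"
begin

abbreviation le (infix "\<sqsubseteq>" 50) where "x \<sqsubseteq> y \<equiv> x = y \<or> x \<sqsubset> y"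

definition antich :: "'a set \<Rightarrow> bool" where
  "antich A \<longleftrightarrow> (\<forall>x\<in>A. \<forall>y\<in>A. \<not> x \<sqsubset> y)"

definition width :: "'a set \<Rightarrow> nat" where
  "width Q = Max (card ` {A. A \<subseteq> Q \<and> antich A})"

text \<open>Maximum means maximum size, not maximality under inclusion. Ordered by
  \<open>leA\<close>, these antichains form Dilworth's lattice, with meet
  \<open>mins (A \<union> B)\<close> and join \<open>maxs (A \<union> B)\<close>.\<close>

definition mac :: "'a set \<Rightarrow> 'a set set" where
  "mac Q = {A. A \<subseteq> Q \<and> antich A \<and> card A = width Q}"

definition core :: "'a set \<Rightarrow> 'a set" where
  "core Q = \<Union>(mac Q)"

definition mins :: "'a set \<Rightarrow> 'a set" where
  "mins U = {y \<in> U. \<forall>z\<in>U. \<not> z \<sqsubset> y}"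

definition maxs :: "'a set \<Rightarrow> 'a set" where
  "maxs U = {y \<in> U. \<forall>z\<in>U. \<not> y \<sqsubset> z}"

definition mabove :: "'a set \<Rightarrow> 'a \<Rightarrow> 'a set set" where
  "mabove Q a = {B \<in> mac Q. \<exists>y\<in>B. a \<sqsubset> y}"

text \<open>By \<open>mabove_least\<close> the minimal elements of this union form the least maximum
  antichain that reaches above \<open>a\<close>, if there is one. It may also contain elements that
  are not above \<open>a\<close>; these are discarded.\<close>

definition nxt :: "'a set \<Rightarrow> 'a \<Rightarrow> 'a set" where
  "nxt Q a = {y \<in> mins (\<Union>(mabove Q a)). a \<sqsubset> y}"

definition leA :: "'a set \<Rightarrow> 'a set \<Rightarrow> bool" where
  "leA A B \<longleftrightarrow> (\<forall>a\<in>A. \<exists>b\<in>B. a \<sqsubseteq> b)"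

definition cvx :: "'a set \<Rightarrow> 'a set \<Rightarrow> bool" where
  "cvx Q X \<longleftrightarrow> X \<subseteq> Q \<and> (\<forall>x\<in>X. \<forall>y\<in>X. \<forall>w\<in>Q. x \<sqsubset> w \<and> w \<sqsubset> y \<longrightarrow> w \<in> X)"

definition btw :: "'a set \<Rightarrow> 'a set \<Rightarrow> 'a set \<Rightarrow> 'a set" where
  "btw Q B C = {x \<in> Q. (\<exists>b\<in>B. b \<sqsubseteq> x) \<and> (\<exists>c\<in>C. x \<sqsubseteq> c)}"

lemma le_trans: "x \<sqsubseteq> y \<Longrightarrow> y \<sqsubseteq> z \<Longrightarrow> x \<sqsubseteq> z"
  using trans[of x y z] by auto

lemma le_less_trans: "x \<sqsubseteq> y \<Longrightarrow> y \<sqsubset> z \<Longrightarrow> x \<sqsubset> z"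
  using trans[of x y z] by auto

lemma less_le_trans: "x \<sqsubset> y \<Longrightarrow> y \<sqsubseteq> z \<Longrightarrow> x \<sqsubset> z"
  using trans[of x y z] by auto

lemma antichD: "antich A \<Longrightarrow> x \<in> A \<Longrightarrow> y \<in> A \<Longrightarrow> \<not> x \<sqsubset> y"
  by (simp add: antich_def)

lemma antich_subset: "antich B \<Longrightarrow> A \<subseteq> B \<Longrightarrow> antich A"
  by (auto simp: antich_def)

lemma antich_empty [simp]: "antich {}"
  by (simp add: antich_def)

lemma antich_singleton [simp]: "antich {x}"
  by (simp add: antich_def irrefl)

lemma card_le_width:
  assumes "finite Q" "A \<subseteq> Q" "antich A"
  shows "card A \<le> width Q"
  unfolding width_def using assms by (intro Max_ge) auto

lemma width_le_iff:
  assumes "finite Q"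
  shows "width Q \<le> k \<longleftrightarrow> (\<forall>A. A \<subseteq> Q \<and> antich A \<longrightarrow> card A \<le> k)"
proof -
  have "finite {A. A \<subseteq> Q \<and> antich A}" "{A. A \<subseteq> Q \<and> antich A} \<noteq> {}"
    using assms by auto
  then show ?thesis unfolding width_def by (subst Max_le_iff) auto
qed

lemma mac_nonempty:
  assumes "finite Q"
  shows "mac Q \<noteq> {}"
proof -
  have "width Q \<in> card ` {A. A \<subseteq> Q \<and> antich A}"
    unfolding width_def using assms by (intro Max_in) auto
  then show ?thesis by (auto simp: mac_def)
qed

lemma macD:
  assumes "A \<in> mac Q"
  shows "A \<subseteq> Q" "antich A" "card A = width Q"
  using assms by (auto simp: mac_def)

lemma finite_mac: "finite Q \<Longrightarrow> A \<in> mac Q \<Longrightarrow> finite A"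
  using macD(1) finite_subset by blast

lemma macI: "A \<subseteq> Q \<Longrightarrow> antich A \<Longrightarrow> card A = width Q \<Longrightarrow> A \<in> mac Q"
  by (simp add: mac_def)

lemma width_mono: "finite Q \<Longrightarrow> X \<subseteq> Q \<Longrightarrow> width X \<le> width Q"
  by (subst width_le_iff) (auto intro: finite_subset card_le_width)

lemma width_pos:
  assumes "finite Q" "Q \<noteq> {}"
  shows "width Q > 0"
proof -
  obtain x where "x \<in> Q" using assms by blast
  then show ?thesis using card_le_width[of Q "{x}"] assms by simp
qed

lemma core_subset: "core Q \<subseteq> Q"
  by (auto simp: core_def mac_def)

lemma core_nonempty:
  assumes "finite Q" "Q \<noteq> {}"
  shows "core Q \<noteq> {}"
proof -
  obtain A where "A \<in> mac Q" using mac_nonempty[OF assms(1)] by blast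
  moreover have "A \<noteq> {}" using calculation width_pos[OF assms] by (auto simp: mac_def)
  ultimately show ?thesis by (auto simp: core_def)
qed

lemma width_less:
  assumes "finite Q" "X \<subseteq> Q" "\<And>B. B \<in> mac Q \<Longrightarrow> \<not> B \<subseteq> X"
  shows "width X < width Q"
proof -
  obtain A where A: "A \<in> mac X" using mac_nonempty assms finite_subset by blast
  have "card A \<noteq> width Q"
    using assms(2,3) A by (metis macD(1,2) macI subset_trans)
  moreover have "card A = width X" using A by (simp add: mac_def)
  ultimately show ?thesis using width_mono[OF assms(1,2)] by simp
qed

text \<open>Deleting the core destroys every maximum antichain. This is the decrease that lets the
  later inductions on the width pass from \<open>Q\<close> to \<open>Q - core Q\<close>.\<close>

lemma width_Diff_core:
  assumes "finite Q" "Q \<noteq> {}"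
  shows "width (Q - core Q) < width Q"
proof (rule width_less[OF assms(1)])
  fix B assume B: "B \<in> mac Q"
  have "B \<noteq> {}" using B width_pos[OF assms] by (auto simp: mac_def)
  moreover have "B \<subseteq> core Q" using B by (auto simp: core_def)
  ultimately show "\<not> B \<subseteq> Q - core Q" by blast
qed auto

section \<open>The lattice of maximum antichains\<close>

text \<open>An element incomparable to all of \<open>A\<close> could be added to \<open>A\<close>,
  which already has maximum size.\<close>

lemma mac_tri:
  assumes "finite Q" "A \<in> mac Q" "x \<in> Q"
  obtains "x \<in> A" | y where "y \<in> A" "x \<sqsubset> y" | y where "y \<in> A" "y \<sqsubset> x"
proof (rule ccontr)
  assume n: "\<not> thesis"
  then have *: "x \<notin> A" "\<forall>y\<in>A. \<not> x \<sqsubset> y" "\<forall>y\<in>A. \<not> y \<sqsubset> x"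
    using that by blast+
  then have "antich (insert x A)" using macD(2)[OF assms(2)] irrefl by (auto simp: antich_def)
  then have "card (insert x A) \<le> width Q"
    using card_le_width[OF assms(1)] macD(1)[OF assms(2)] assms(3) by simp
  then show False using * macD(3)[OF assms(2)] finite_mac[OF assms(1,2)] by simp
qed

lemma antich_mins: "antich (mins U)"
  by (auto simp: antich_def mins_def)

lemma antich_maxs: "antich (maxs U)"
  by (auto simp: antich_def maxs_def)

text \<open>Dilworth's counting argument: the minimal and the maximal elements together cover
  \<open>A \<union> B\<close>, and both sets contain \<open>A \<inter> B\<close>, so their sizes add
  up to at least twice the width. Each is an antichain, so neither can exceed the width.\<close>

lemma meet_join_mac:
  assumes Q: "finite Q" and A: "A \<in> mac Q" and B: "B \<in> mac Q"
  shows "mins (A \<union> B) \<in> mac Q" "maxs (A \<union> B) \<in> mac Q"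
proof -
  let ?m = "mins (A \<union> B)" and ?M = "maxs (A \<union> B)"
  have fin: "finite A" "finite B" using finite_mac[OF Q] A B by auto
  have aA: "antich A" and aB: "antich B" using A B macD by auto
  have sub: "?m \<subseteq> Q" "?M \<subseteq> Q" using macD(1)[OF A] macD(1)[OF B] by (auto simp: mins_def maxs_def)
  have "x \<in> ?m \<union> ?M" if x: "x \<in> A \<union> B" for x
  proof (rule ccontr)
    assume "x \<notin> ?m \<union> ?M"
    then obtain y z where y: "y \<in> A \<union> B" "y \<sqsubset> x" and z: "z \<in> A \<union> B" "x \<sqsubset> z"
      using x by (auto simp: mins_def maxs_def)
    have "y \<sqsubset> z" using y z trans by metis
    then show False using x y z antichD[OF aA] antichD[OF aB] by (metis UnE)
  qed
  then have "A \<union> B \<subseteq> ?m \<union> ?M" by blast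
  then have u: "A \<union> B = ?m \<union> ?M" by (auto simp: mins_def maxs_def)
  have i: "A \<inter> B \<subseteq> ?m \<inter> ?M"
    using aA aB unfolding antich_def mins_def maxs_def by blast
  have finm: "finite ?m" "finite ?M" using fin by (auto simp: mins_def maxs_def)
  have "card A + card B = card (A \<union> B) + card (A \<inter> B)" using card_Un_Int[OF fin] .
  also have "\<dots> \<le> card (?m \<union> ?M) + card (?m \<inter> ?M)"
    using u i finm by (simp add: card_mono)
  also have "\<dots> = card ?m + card ?M" using card_Un_Int[OF finm] by simp
  finally have "2 * width Q \<le> card ?m + card ?M" using A B by (simp add: macD)
  moreover have "card ?m \<le> width Q" "card ?M \<le> width Q"
    using card_le_width[OF Q] sub antich_mins antich_maxs by blast+
  ultimately have "card ?m = width Q" "card ?M = width Q" by auto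
  then show "?m \<in> mac Q" "?M \<in> mac Q"
    using sub antich_mins antich_maxs by (auto intro: macI)
qed

text \<open>For maximum antichains, domination from above and from below coincide, by
  \<open>mac_tri\<close>. The order is thus self-dual, which is what allows \<open>cover_dn\<close>
  to be read off from \<open>cover_up\<close>.\<close>

lemma leA_iff:
  assumes "finite Q" "A \<in> mac Q" "B \<in> mac Q"
  shows "leA A B \<longleftrightarrow> (\<forall>b\<in>B. \<exists>a\<in>A. a \<sqsubseteq> b)"
proof
  assume l: "leA A B"
  show "\<forall>b\<in>B. \<exists>a\<in>A. a \<sqsubseteq> b"
  proof
    fix b assume b: "b \<in> B"
    then have "b \<in> Q" using assms macD by blast
    from assms(1,2) this show "\<exists>a\<in>A. a \<sqsubseteq> b"
    proof (cases rule: mac_tri)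
      case (2 y)
      then obtain b' where "b' \<in> B" "y \<sqsubseteq> b'" using l by (auto simp: leA_def)
      then have "b \<sqsubset> b'" using 2 less_le_trans by metis
      then show ?thesis using b \<open>b' \<in> B\<close> macD(2)[OF assms(3)] by (auto simp: antich_def)
    qed auto
  qed
next
  assume l: "\<forall>b\<in>B. \<exists>a\<in>A. a \<sqsubseteq> b"
  show "leA A B" unfolding leA_def
  proof
    fix a assume a: "a \<in> A"
    then have "a \<in> Q" using assms macD by blast
    from assms(1,3) this show "\<exists>b\<in>B. a \<sqsubseteq> b"
    proof (cases rule: mac_tri)
      case (3 y)
      then obtain a' where "a' \<in> A" "a' \<sqsubseteq> y" using l by auto
      then have "a' \<sqsubset> a" using 3 le_less_trans by metis
      then show ?thesis using a \<open>a' \<in> A\<close> macD(2)[OF assms(2)] by (auto simp: antich_def)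
    qed auto
  qed
qed

lemma leA_refl: "leA A A"
  by (auto simp: leA_def)

lemma leA_trans: "leA A B \<Longrightarrow> leA B C \<Longrightarrow> leA A C"
  unfolding leA_def using le_trans by metis

lemma leA_antisym:
  assumes "A \<in> mac Q" "B \<in> mac Q" "leA A B" "leA B A"
  shows "A = B"
proof -
  have *: "A \<subseteq> B" if AB: "A \<in> mac Q" "leA A B" "leA B A" for A B
  proof
    fix a assume a: "a \<in> A"
    then obtain b where b: "b \<in> B" "a \<sqsubseteq> b" using AB by (auto simp: leA_def)
    then obtain a' where a': "a' \<in> A" "b \<sqsubseteq> a'" using AB by (auto simp: leA_def)
    have "a = b" using a a' b antichD[OF macD(2)[OF AB(1)]] trans[of a b a'] by metis
    then show "a \<in> B" using b by simp
  qed
  show ?thesis using *[of A B] *[of B A] assms by auto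
qed

lemma leA_join:
  assumes "finite Q" "A \<in> mac Q" "B \<in> mac Q"
  shows "leA A (maxs (A \<union> B))" "leA B (maxs (A \<union> B))"
    "leA A C \<Longrightarrow> leA B C \<Longrightarrow> leA (maxs (A \<union> B)) C"
proof -
  have *: "\<exists>b\<in>maxs (A \<union> B). a \<sqsubseteq> b" if ab: "a \<in> A \<union> B" for a
  proof (cases "a \<in> maxs (A \<union> B)")
    case False
    then obtain b where b: "b \<in> A \<union> B" "a \<sqsubset> b" using ab by (auto simp: maxs_def)
    have "\<not> b \<sqsubset> c" if "c \<in> A \<union> B" for c
      using b that ab trans[of a b c] antichD[OF macD(2)[OF assms(2)]]
        antichD[OF macD(2)[OF assms(3)]] by (metis UnE)
    then show ?thesis using b by (auto simp: maxs_def)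
  qed auto
  show "leA A (maxs (A \<union> B))" "leA B (maxs (A \<union> B))" unfolding leA_def using * by blast+
  show "leA A C \<Longrightarrow> leA B C \<Longrightarrow> leA (maxs (A \<union> B)) C" by (auto simp: leA_def maxs_def)
qed

lemma leA_meet:
  assumes "finite Q" "A \<in> mac Q" "B \<in> mac Q"
  shows "leA (mins (A \<union> B)) A" "leA (mins (A \<union> B)) B"
    "C \<in> mac Q \<Longrightarrow> leA C A \<Longrightarrow> leA C B \<Longrightarrow> leA C (mins (A \<union> B))"
proof -
  note m = meet_join_mac(1)[OF assms]
  have *: "\<exists>b\<in>mins (A \<union> B). b \<sqsubseteq> a" if ab: "a \<in> A \<union> B" for a
  proof (cases "a \<in> mins (A \<union> B)")
    case False
    then obtain b where b: "b \<in> A \<union> B" "b \<sqsubset> a" using ab by (auto simp: mins_def)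
    have "\<not> c \<sqsubset> b" if "c \<in> A \<union> B" for c
      using b that ab trans[of c b a] antichD[OF macD(2)[OF assms(2)]]
        antichD[OF macD(2)[OF assms(3)]] by (metis UnE)
    then show ?thesis using b by (auto simp: mins_def)
  qed auto
  show "leA (mins (A \<union> B)) A" "leA (mins (A \<union> B)) B"
    using * by (auto simp: leA_iff[OF assms(1) m assms(2)] leA_iff[OF assms(1) m assms(3)])
  show "C \<in> mac Q \<Longrightarrow> leA C A \<Longrightarrow> leA C B \<Longrightarrow> leA C (mins (A \<union> B))"
    unfolding leA_iff[OF assms(1) _ m] leA_iff[OF assms(1) _ assms(2)] leA_iff[OF assms(1) _ assms(3)]
    by (auto simp: mins_def)
qed

text \<open>A member whose down-set has least cardinality has the same down-set as its meet with any
  other member, hence lies below that member. The equation with \<open>mins (\<Union>F)\<close> is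
  what connects the least member with \<open>nxt\<close>.\<close>

lemma least_family:
  assumes Q: "finite Q" and F: "F \<subseteq> mac Q" "F \<noteq> {}"
    and cl: "\<And>A B. A \<in> F \<Longrightarrow> B \<in> F \<Longrightarrow> mins (A \<union> B) \<in> F"
  obtains M where "M \<in> F" "M = mins (\<Union>F)" "\<And>B. B \<in> F \<Longrightarrow> leA M B"
proof -
  define dn where "dn B = {x\<in>Q. \<exists>y\<in>B. x \<sqsubseteq> y}" for B
  obtain M where M: "M \<in> F" "\<And>B. B \<in> F \<Longrightarrow> card (dn M) \<le> card (dn B)"
    using F(2) ex_has_least_nat[of "\<lambda>B. B \<in> F" _ "card \<circ> dn"] by auto
  have le: "leA M B" if B: "B \<in> F" for B
  proof -
    let ?N = "mins (M \<union> B)"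
    have mac: "M \<in> mac Q" "B \<in> mac Q" using M B F by auto
    note N = meet_join_mac(1)[OF Q mac]
    have l: "leA ?N M" "leA ?N B" using leA_meet[OF Q mac] by auto
    have "dn ?N \<subseteq> dn M" using l(1) le_trans unfolding dn_def leA_def by (smt (verit, best) mem_Collect_eq subsetI)
    moreover have "finite (dn M)" using Q by (simp add: dn_def)
    ultimately have e: "dn ?N = dn M" using M(2)[OF cl[OF M(1) B]] card_seteq by metis
    have "M \<subseteq> dn M" using macD(1)[OF mac(1)] by (auto simp: dn_def)
    then have "leA M ?N" unfolding e[symmetric] by (auto simp: leA_def dn_def)
    then show ?thesis using l(2) leA_trans by blast
  qed
  have "M = mins (\<Union>F)"
  proof
    show "M \<subseteq> mins (\<Union>F)"
    proof
      fix y assume y: "y \<in> M"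
      have "\<not> z \<sqsubset> y" if z: "z \<in> B" "B \<in> F" for z B
      proof
        assume zy: "z \<sqsubset> y"
        obtain a where "a \<in> M" "a \<sqsubseteq> z"
          using le[OF z(2)] z leA_iff[OF Q, of M B] M(1) F by blast
        then have "a \<sqsubset> y" using zy le_less_trans by metis
        then show False using \<open>a \<in> M\<close> y macD(2) M(1) F(1) unfolding antich_def by blast
      qed
      then show "y \<in> mins (\<Union>F)" using y M(1) by (auto simp: mins_def)
    qed
    show "mins (\<Union>F) \<subseteq> M"
    proof
      fix y assume y: "y \<in> mins (\<Union>F)"
      then obtain B where B: "B \<in> F" "y \<in> B" by (auto simp: mins_def)
      then obtain a where "a \<in> M" "a \<sqsubseteq> y"
        using le[OF B(1)] leA_iff[OF Q, of M B] M(1) F by blast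
      then show "y \<in> M" using y M(1) by (auto simp: mins_def)
    qed
  qed
  then show ?thesis using that M(1) le by blast
qed

lemma greatest_family:
  assumes Q: "finite Q" and F: "F \<subseteq> mac Q" "F \<noteq> {}"
    and cl: "\<And>A B. A \<in> F \<Longrightarrow> B \<in> F \<Longrightarrow> maxs (A \<union> B) \<in> F"
  obtains M where "M \<in> F" "\<And>B. B \<in> F \<Longrightarrow> leA B M"
proof -
  define dn where "dn B = {x\<in>Q. \<exists>y\<in>B. x \<sqsubseteq> y}" for B
  have bd: "\<forall>B. B \<in> F \<longrightarrow> card (dn B) < Suc (card Q)"
    using Q by (auto simp: dn_def less_Suc_eq_le intro!: card_mono)
  obtain M where M: "M \<in> F" "\<And>B. B \<in> F \<Longrightarrow> card (dn B) \<le> card (dn M)"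
    using F(2) ex_has_greatest_nat[of "\<lambda>B. B \<in> F" _ "card \<circ> dn" "Suc (card Q)"] bd
    by (metis ex_in_conv o_apply)
  have le: "leA B M" if B: "B \<in> F" for B
  proof -
    let ?N = "maxs (M \<union> B)"
    have mac: "M \<in> mac Q" "B \<in> mac Q" using M B F by auto
    note N = meet_join_mac(2)[OF Q mac]
    have l: "leA M ?N" "leA B ?N" using leA_join[OF Q mac] by auto
    have "dn M \<subseteq> dn ?N" using l(1) le_trans unfolding dn_def leA_def by (smt (verit, best) mem_Collect_eq subsetI)
    moreover have "finite (dn ?N)" using Q by (simp add: dn_def)
    ultimately have e: "dn ?N = dn M" using M(2)[OF cl[OF M(1) B]] card_seteq by metis
    have "?N \<subseteq> dn ?N" using macD(1)[OF N] by (auto simp: dn_def)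
    then have "leA ?N M" unfolding e by (auto simp: leA_def dn_def)
    then show ?thesis using l(2) leA_trans by blast
  qed
  then show ?thesis using that M(1) by blast
qed

section \<open>The selection and its first properties\<close>

text \<open>Each call peels off one layer, the core, until \<open>a\<close> lies in the core of what
  remains. The value is empty if \<open>Q\<close> is infinite, if \<open>a\<close> is not in
  \<open>Q\<close>, or if no maximum antichain of the layer reached has an element above
  \<open>a\<close>.\<close>

function sel :: "'a set \<Rightarrow> 'a \<Rightarrow> 'a set" where
  "sel Q a = (if finite Q \<and> Q \<noteq> {} then (if a \<in> core Q then nxt Q a else sel (Q - core Q) a) else {})"
  by pat_completeness auto
termination
proof (relation "Wellfounded.measure (\<lambda>(Q, a). card Q)", goal_cases)
  case (2 Q a)
  then have "Q - core Q \<subset> Q" using core_nonempty[of Q] core_subset[of Q] by auto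
  then show ?case using 2 by (simp add: psubset_card_mono)
qed auto

declare sel.simps [simp del]

lemma sel_core: "finite Q \<Longrightarrow> a \<in> core Q \<Longrightarrow> sel Q a = nxt Q a"
  using core_subset[of Q] by (subst sel.simps) auto

lemma sel_not_core: "finite Q \<Longrightarrow> a \<in> Q \<Longrightarrow> a \<notin> core Q \<Longrightarrow> sel Q a = sel (Q - core Q) a"
  by (subst sel.simps) auto

lemma sel_subset_antich: "sel Q a \<subseteq> {y \<in> Q. a \<sqsubset> y} \<and> antich (sel Q a)"
proof (induction Q a rule: sel.induct)
  case (1 Q a)
  have "nxt Q a \<subseteq> {y \<in> Q. a \<sqsubset> y}"
    by (auto simp: nxt_def mins_def mabove_def mac_def)
  moreover have "antich (nxt Q a)"
    using antich_mins antich_subset by (metis (lifting) mem_Collect_eq nxt_def subsetI)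
  ultimately show ?case using 1 by (subst (1 2) sel.simps) auto
qed

text \<open>An element of the meet at or below \<open>x\<close> would lie strictly below elements of
  both \<open>B\<close> and \<open>C\<close>, although it belongs to one of these antichains. So no
  element of the meet is at or below \<open>x\<close>, and \<open>mac_tri\<close> leaves only an
  element above \<open>x\<close>.\<close>

lemma mabove_meet:
  assumes Q: "finite Q" and x: "x \<in> Q" and BC: "B \<in> mabove Q x" "C \<in> mabove Q x"
  shows "mins (B \<union> C) \<in> mabove Q x"
proof -
  have m: "B \<in> mac Q" "C \<in> mac Q" using BC by (auto simp: mabove_def)
  obtain y z where y: "y \<in> B" "x \<sqsubset> y" and z: "z \<in> C" "x \<sqsubset> z" using BC by (auto simp: mabove_def)
  note mm = meet_join_mac(1)[OF Q m]
  have no: "\<not> u \<sqsubseteq> x" if "u \<in> mins (B \<union> C)" for u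
  proof
    assume "u \<sqsubseteq> x"
    then have "u \<sqsubset> y" "u \<sqsubset> z" using y z le_less_trans by metis+
    moreover have "u \<in> B \<or> u \<in> C" using that by (auto simp: mins_def)
    ultimately show False using y z antichD[OF macD(2)[OF m(1)]] antichD[OF macD(2)[OF m(2)]] by metis
  qed
  from Q mm x show ?thesis
    by (cases rule: mac_tri) (use no mm in \<open>auto simp: mabove_def\<close>)
qed

lemma mabove_least:
  assumes Q: "finite Q" and x: "x \<in> Q" and ne: "mabove Q x \<noteq> {}"
  obtains M where "M \<in> mabove Q x" "nxt Q x = {y \<in> M. x \<sqsubset> y}" "M = mins (\<Union>(mabove Q x))"
    "\<And>B. B \<in> mabove Q x \<Longrightarrow> leA M B"
proof -
  have "mabove Q x \<subseteq> mac Q" by (auto simp: mabove_def)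
  from least_family[OF Q this ne mabove_meet[OF Q x]] obtain M
    where "M \<in> mabove Q x" "M = mins (\<Union>(mabove Q x))" "\<And>B. B \<in> mabove Q x \<Longrightarrow> leA M B" by metis
  then show ?thesis using that by (auto simp: nxt_def)
qed

lemma greatest_mac:
  assumes Q: "finite Q"
  shows "\<exists>T\<in>mac Q. \<forall>B\<in>mac Q. leA B T"
proof (rule greatest_family[OF Q subset_refl[of "mac Q"] mac_nonempty[OF Q]])
  fix A B assume "A \<in> mac Q" "B \<in> mac Q"
  then show "maxs (A \<union> B) \<in> mac Q" by (rule meet_join_mac(2)[OF Q])
next
  fix M assume "M \<in> mac Q" "\<And>B. B \<in> mac Q \<Longrightarrow> leA B M"
  then show ?thesis by blast
qed

lemma least_mac:
  assumes Q: "finite Q"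
  shows "\<exists>T\<in>mac Q. \<forall>B\<in>mac Q. leA T B"
proof (rule least_family[OF Q subset_refl[of "mac Q"] mac_nonempty[OF Q]])
  fix A B assume "A \<in> mac Q" "B \<in> mac Q"
  then show "mins (A \<union> B) \<in> mac Q" by (rule meet_join_mac(1)[OF Q])
next
  fix M assume "M \<in> mac Q" "\<And>B. B \<in> mac Q \<Longrightarrow> leA M B"
  then show ?thesis by blast
qed

text \<open>A common subset of two maximum antichains survives in their join, so the maximum
  antichains containing \<open>Z\<close> are closed under joins.\<close>

lemma top_containing:
  assumes Q: "finite Q" and B0: "B0 \<in> mac Q" "Z \<subseteq> B0"
  shows "\<exists>T\<in>mac Q. Z \<subseteq> T \<and> (\<forall>B\<in>mac Q. Z \<subseteq> B \<longrightarrow> leA B T)"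
proof -
  let ?F = "{B \<in> mac Q. Z \<subseteq> B}"
  have "maxs (B \<union> C) \<in> ?F" if "B \<in> ?F" "C \<in> ?F" for B C
  proof -
    have "Z \<subseteq> maxs (B \<union> C)"
      using that antichD[OF macD(2)[of B Q]] antichD[OF macD(2)[of C Q]] by (auto simp: maxs_def)
    then show ?thesis using meet_join_mac(2)[OF Q] that by auto
  qed
  moreover have "?F \<noteq> {}" using B0 by auto
  ultimately obtain T where "T \<in> ?F" "\<And>B. B \<in> ?F \<Longrightarrow> leA B T"
    using greatest_family[OF Q, of ?F] by (metis (no_types, lifting) mem_Collect_eq subsetI)
  then show ?thesis by auto
qed

lemma cvxD: "cvx Q X \<Longrightarrow> x \<in> X \<Longrightarrow> y \<in> X \<Longrightarrow> w \<in> Q \<Longrightarrow> x \<sqsubset> w \<Longrightarrow> w \<sqsubset> y \<Longrightarrow> w \<in> X"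
  unfolding cvx_def by blast

lemma cvxI: "X \<subseteq> Q \<Longrightarrow> (\<And>x y w. x \<in> X \<Longrightarrow> y \<in> X \<Longrightarrow> w \<in> Q \<Longrightarrow> x \<sqsubset> w \<Longrightarrow> w \<sqsubset> y \<Longrightarrow> w \<in> X) \<Longrightarrow> cvx Q X"
  unfolding cvx_def by blast

lemma cvx_sub: "cvx Q Y \<Longrightarrow> Y \<subseteq> X \<Longrightarrow> X \<subseteq> Q \<Longrightarrow> cvx X Y"
  unfolding cvx_def by blast

section \<open>Covering convex parts by boundedly many pieces\<close>

text \<open>The two kinds of part that an induction on the width can handle: outside the core the
  selection is that of \<open>Q - core Q\<close>, and between two maximum antichains through a
  common \<open>z\<close> the removal of \<open>z\<close> lowers the width by one.\<close>

definition piece :: "'a set \<Rightarrow> 'a set \<Rightarrow> bool" where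
  "piece Q Y \<longleftrightarrow> Y \<inter> core Q = {} \<or>
     (\<exists>B\<in>mac Q. \<exists>C\<in>mac Q. leA B C \<and> (\<exists>z\<in>B \<inter> C. Y \<subseteq> btw Q B C - {z}))"

text \<open>Here \<open>U\<close> is the part of \<open>Q\<close> strictly above the maximum antichain \<open>A\<close>, or all of \<open>Q\<close> if
  \<open>A\<close> is empty.\<close>

lemma cover_up:
  assumes Q: "finite Q"
  shows "\<lbrakk>X \<subseteq> U; A \<in> mac Q \<and> U = {x\<in>Q. \<exists>a\<in>A. a \<sqsubset> x} \<or> A = {} \<and> U = Q;
      \<forall>y\<in>U. \<forall>x\<in>X. y \<sqsubset> x \<longrightarrow> y \<in> X; \<forall>B\<in>mac Q. \<not> B \<subseteq> X; width X \<le> w\<rbrakk> \<Longrightarrow>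
    \<exists>\<Y>. finite \<Y> \<and> card \<Y> \<le> (width Q + 3) * w \<and> \<Union>\<Y> = X \<and> (\<forall>Y\<in>\<Y>. cvx Q Y \<and> piece Q Y)"
proof (induction w arbitrary: X U A)
  case 0
  have "U \<subseteq> Q" using 0(2) by auto
  then have "finite X" using 0(1) finite_subset[OF _ Q, of X] by simp
  then have "X = {}" using 0(5) width_pos[of X] by auto
  then show ?case by (intro exI[of _ "{}"]) auto
next
  case (Suc w)
  have UQ: "U \<subseteq> Q" using Suc.prems(2) by auto
  have XQ: "X \<subseteq> Q" using Suc.prems(1) UQ by auto
  have finX: "finite X" using finite_subset[OF XQ Q] .
  have AQ: "A \<subseteq> Q" using Suc.prems(2) macD(1) by auto
  have finA: "finite A" using finite_subset[OF AQ Q] .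
  have cardA: "card A \<le> width Q" using Suc.prems(2) macD(3) by auto
  have up: "w \<in> U" if "w \<in> Q" "x \<in> X" "x \<sqsubset> w" for x w
  proof -
    have "x \<in> U" using Suc.prems(1) that by auto
    then show ?thesis using Suc.prems(2) that trans[of _ x w] by auto
  qed
  have ideal: "y \<in> X" if "y \<in> U" "x \<in> X" "y \<sqsubset> x" for x y
    using Suc.prems(3) that by blast
  have bel: "\<exists>a\<in>A. a \<sqsubset> x" if "x \<in> U" "A \<noteq> {}" for x
    using Suc.prems(2) that by auto
  have Amac: "A \<in> mac Q" if "A \<noteq> {}" using Suc.prems(2) that by auto
  have AX: "z \<notin> X" if z: "z \<in> A" for z
  proof
    assume "z \<in> X"
    then obtain a where "a \<in> A" "a \<sqsubset> z" using bel Suc.prems(1) z by blast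
    then show False using antichD[OF macD(2)[OF Amac]] z by blast
  qed
  \<comment> \<open>For \<open>z\<close> in the starting antichain, the part of \<open>X\<close>
    below the top maximum antichain \<open>T z\<close> through \<open>z\<close> lies between
    \<open>A\<close> and \<open>T z\<close>, which share \<open>z\<close>. This gives one piece for
    each element of \<open>A\<close>.\<close>
  have "\<exists>T\<in>mac Q. z \<in> T \<and> (\<forall>B\<in>mac Q. z \<in> B \<longrightarrow> leA B T)" if "z \<in> A" for z
    using top_containing[OF Q, of A "{z}"] Amac that by auto
  then obtain T where T: "\<And>z. z \<in> A \<Longrightarrow> T z \<in> mac Q" "\<And>z. z \<in> A \<Longrightarrow> z \<in> T z"
    "\<And>z B. z \<in> A \<Longrightarrow> B \<in> mac Q \<Longrightarrow> z \<in> B \<Longrightarrow> leA B (T z)" by metis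
  define Yz where "Yz z = {x\<in>X. \<exists>t\<in>T z. x \<sqsubseteq> t}" for z
  have Yz: "cvx Q (Yz z) \<and> piece Q (Yz z)" if z: "z \<in> A" for z
  proof
    have "w \<in> Yz z" if h: "x \<in> Yz z" "y \<in> Yz z" "w \<in> Q" "x \<sqsubset> w" "w \<sqsubset> y" for x y w
    proof -
      have "w \<in> X" using ideal[of w y] up[of w x] h by (auto simp: Yz_def)
      then show ?thesis using h less_le_trans[of w y] by (auto simp: Yz_def)
    qed
    moreover have "Yz z \<subseteq> Q" using XQ by (auto simp: Yz_def)
    ultimately show "cvx Q (Yz z)" by (intro cvxI)
    have "Yz z \<subseteq> btw Q A (T z) - {z}"
      using bel AX z XQ Suc.prems(1) by (fastforce simp: Yz_def btw_def)
    moreover have "A \<in> mac Q" using Amac z by auto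
    ultimately show "piece Q (Yz z)" using T z unfolding piece_def by blast
  qed
  \<comment> \<open>What is left over lies below none of the \<open>T z\<close>. Hence no maximum
    antichain through such a point that lies in \<open>A \<union> U\<close> can meet
    \<open>A\<close>: if it met \<open>A\<close> in \<open>z\<close>, it would be below
    \<open>T z\<close>.\<close>
  define R where "R = {x\<in>X. \<forall>z\<in>A. \<not> (\<exists>t\<in>T z. x \<sqsubseteq> t)}"
  have cvxR: "w \<in> R" if h: "x \<in> R" "y \<in> R" "w \<in> Q" "x \<sqsubset> w" "w \<sqsubset> y" for x y w
  proof -
    have "w \<in> X" using ideal[of w y] up[of w x] h by (auto simp: R_def)
    then show ?thesis using h less_le_trans[of x w] by (auto simp: R_def)
  qed
  \<comment> \<open>The join with \<open>A\<close> keeps \<open>x\<close>, because \<open>x\<close>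
    lies above \<open>A\<close>, and moves the rest of the antichain to \<open>A\<close> or above
    it.\<close>
  have lift: "\<exists>B1\<in>mac Q. x \<in> B1 \<and> B1 \<subseteq> A \<union> U" if h: "x \<in> R" "x \<in> B" "B \<in> mac Q" for x B
  proof (cases "A = {}")
    case True
    then have "U = Q" using Suc.prems(2,4) by auto
    then show ?thesis using h macD(1) by blast
  next
    case False
    note Am = Amac[OF False]
    obtain a where a: "a \<in> A" "a \<sqsubset> x" using bel[of x] False h(1) Suc.prems(1) unfolding R_def by blast
    have "\<not> x \<sqsubset> y" if "y \<in> A \<union> B" for y
      using that antichD[OF macD(2)[OF Am] a(1), of y] antichD[OF macD(2)[OF h(3)] h(2), of y] trans[OF a(2), of y] by auto
    then have x: "x \<in> maxs (A \<union> B)" using h by (auto simp: maxs_def)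
    note mj = meet_join_mac(2)[OF Q Am h(3)]
    have "b \<in> A \<union> U" if b: "b \<in> maxs (A \<union> B)" for b
    proof -
      have "b \<in> Q" using b mj macD(1) by blast
      moreover obtain a where "a \<in> A" "a \<sqsubseteq> b"
        using leA_join(1)[OF Q Am h(3)] leA_iff[OF Q Am mj] b by blast
      ultimately show ?thesis using Suc.prems(2) False by auto
    qed
    then show ?thesis using x mj by blast
  qed
  \<comment> \<open>The maximum antichains entirely above \<open>A\<close>. If there are none, the
    remainder \<open>R\<close> cannot meet the core; otherwise the least one, \<open>M\<close>,
    starts the next round.\<close>
  define F where "F = {B \<in> mac Q. B \<subseteq> U}"
  show ?case
  proof (cases "F = {}")
    case True
    have "R \<inter> core Q = {}"
    proof (rule ccontr)
      assume "R \<inter> core Q \<noteq> {}"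
      then obtain x B where h: "x \<in> R" "x \<in> B" "B \<in> mac Q" by (auto simp: core_def)
      then obtain B1 where B1: "B1 \<in> mac Q" "x \<in> B1" "B1 \<subseteq> A \<union> U" using lift by blast
      have "\<not> B1 \<subseteq> U" using True B1(1) by (auto simp: F_def)
      then obtain z where "z \<in> B1" "z \<in> A" using B1(3) by blast
      then have "leA B1 (T z)" using T B1 by auto
      then show False using h B1 \<open>z \<in> A\<close> unfolding R_def leA_def by blast
    qed
    moreover have "R \<subseteq> Q" using XQ by (auto simp: R_def)
    ultimately have "cvx Q R \<and> piece Q R" using cvxI[OF _ cvxR] by (simp add: piece_def)
    moreover have "card (insert R (Yz ` A)) \<le> (width Q + 3) * Suc w"
    proof -
      have "card (insert R (Yz ` A)) \<le> Suc (card A)"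
        using card_image_le[OF finA, of Yz] card_insert_le_m1[of "Suc (card A)" "Yz ` A" R] by simp
      also have "\<dots> \<le> (width Q + 3) * 1" using cardA by simp
      also have "\<dots> \<le> (width Q + 3) * Suc w" by (intro mult_le_mono) auto
      finally show ?thesis .
    qed
    moreover have "\<Union>(insert R (Yz ` A)) = X" by (auto simp: R_def Yz_def)
    ultimately show ?thesis using Yz finA by (intro exI[of _ "insert R (Yz ` A)"]) auto
  next
    case False
    have Fmac: "F \<subseteq> mac Q" by (auto simp: F_def)
    have "mins (B \<union> C) \<in> F" if "B \<in> F" "C \<in> F" for B C
      using meet_join_mac(1)[OF Q] that by (auto simp: F_def mins_def)
    then obtain M where M: "M \<in> F" "\<And>B. B \<in> F \<Longrightarrow> leA M B"
      using least_family[OF Q Fmac False] by metis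
    have Mm: "M \<in> mac Q" and MU: "M \<subseteq> U" using M by (auto simp: F_def)
    note Ma = antichD[OF macD(2)[OF Mm]]
    \<comment> \<open>Below \<open>M\<close> the core is avoided as well: the meet with
      \<open>M\<close> of a maximum antichain through \<open>x\<close> still contains
      \<open>x\<close>. If it lies in \<open>U\<close>, it contradicts the minimality of
      \<open>M\<close>; if it meets \<open>A\<close>, it lies below some \<open>T z\<close>.\<close>
    define R1 where "R1 = {x\<in>R. \<exists>t\<in>M. x \<sqsubset> t}"
    have "R1 \<inter> core Q = {}"
    proof (rule ccontr)
      assume "R1 \<inter> core Q \<noteq> {}"
      then obtain x B t where h: "x \<in> R" "x \<in> B" "B \<in> mac Q" and t: "t \<in> M" "x \<sqsubset> t"
        by (auto simp: core_def R1_def)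
      then obtain B1 where B1: "B1 \<in> mac Q" "x \<in> B1" "B1 \<subseteq> A \<union> U" using lift by blast
      let ?B2 = "mins (B1 \<union> M)"
      note mj = meet_join_mac(1)[OF Q B1(1) Mm]
      have "\<not> y \<sqsubset> x" if "y \<in> B1 \<union> M" for y
        using that Ma[of y t] t trans[of y x t] antichD[OF macD(2)[OF B1(1)], of y x] B1 by auto
      then have x: "x \<in> ?B2" using B1 by (auto simp: mins_def)
      show False
      proof (cases "?B2 \<subseteq> U")
        case True
        then have "leA M ?B2" using M mj by (auto simp: F_def)
        then obtain m where "m \<in> M" "m \<sqsubseteq> x" using leA_iff[OF Q Mm mj] x by blast
        then show False using t Ma[of m t] le_less_trans[of m x t] by auto
      next
        case False
        moreover have "?B2 \<subseteq> A \<union> U" using B1 MU by (auto simp: mins_def)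
        ultimately obtain z where "z \<in> ?B2" "z \<in> A" by blast
        then have "leA ?B2 (T z)" using T mj by auto
        then show False using h x \<open>z \<in> A\<close> unfolding R_def leA_def by blast
      qed
    qed
    moreover have R1c: "w \<in> R1" if "x \<in> R1" "y \<in> R1" "w \<in> Q" "x \<sqsubset> w" "w \<sqsubset> y" for x y w
      using cvxR[of x y w] that trans[of w y] by (auto simp: R1_def)
    have R1Q: "R1 \<subseteq> Q" using XQ by (auto simp: R1_def R_def)
    ultimately have R1: "cvx Q R1 \<and> piece Q R1"
      using cvxI[OF R1Q R1c] by (simp add: piece_def)
    \<comment> \<open>Nonempty since \<open>X\<close> contains no maximum antichain. Every element
      of \<open>X\<close> at or above \<open>M\<close> is incomparable to \<open>Z\<close>, because
      \<open>X\<close> is downward closed in \<open>U\<close>. So any element of \<open>Z\<close>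
      can serve as the common point of a piece.\<close>
    define Z where "Z = M - X"
    have Zne: "Z \<noteq> {}" using Suc.prems(4) Mm by (auto simp: Z_def)
    have Zinc: "\<not> x \<sqsubset> z \<and> \<not> z \<sqsubset> x \<and> x \<noteq> z" if "x \<in> X" "m \<in> M" "m \<sqsubseteq> x" "z \<in> Z" for x m z
    proof -
      have "\<not> x \<sqsubset> z" using that Ma[of m z] le_less_trans[of m x z] by (auto simp: Z_def)
      moreover have "\<not> z \<sqsubset> x" using that MU ideal[of z x] by (auto simp: Z_def)
      ultimately show ?thesis using that by (auto simp: Z_def)
    qed
    obtain T' where T': "T' \<in> mac Q" "Z \<subseteq> T'" "\<And>B. B \<in> mac Q \<Longrightarrow> Z \<subseteq> B \<Longrightarrow> leA B T'"
      using top_containing[OF Q Mm, of Z] by (auto simp: Z_def)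
    note Ta = antichD[OF macD(2)[OF T'(1)]]
    have MT: "leA M T'" using T'(3)[OF Mm] by (auto simp: Z_def)
    define Y2 where "Y2 = {x\<in>X. (\<exists>m\<in>M. m \<sqsubseteq> x) \<and> (\<exists>t\<in>T'. x \<sqsubseteq> t)}"
    have Y2: "cvx Q Y2 \<and> piece Q Y2"
    proof
      have "w \<in> Y2" if h: "x \<in> Y2" "y \<in> Y2" "w \<in> Q" "x \<sqsubset> w" "w \<sqsubset> y" for x y w
      proof -
        have "w \<in> X" using ideal[of w y] up[of w x] h by (auto simp: Y2_def)
        moreover have "\<exists>m\<in>M. m \<sqsubseteq> w" using h le_less_trans[of _ x w] by (auto simp: Y2_def)
        moreover have "\<exists>m\<in>T'. w \<sqsubseteq> m" using h less_le_trans[of w y] by (auto simp: Y2_def)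
        ultimately show ?thesis by (auto simp: Y2_def)
      qed
      moreover have "Y2 \<subseteq> Q" using XQ by (auto simp: Y2_def)
      ultimately show "cvx Q Y2" by (intro cvxI)
      obtain z where z: "z \<in> Z" using Zne by auto
      have "Y2 \<subseteq> btw Q M T' - {z}"
      proof
        fix x assume x: "x \<in> Y2"
        then obtain m where m: "m \<in> M" "m \<sqsubseteq> x" "x \<in> X" by (auto simp: Y2_def)
        have "x \<noteq> z" using Zinc[OF m(3,1,2) z] by simp
        then show "x \<in> btw Q M T' - {z}" using x XQ by (auto simp: btw_def Y2_def)
      qed
      moreover have "z \<in> M \<inter> T'" using z T'(2) by (auto simp: Z_def)
      ultimately show "piece Q Y2" using Mm T'(1) MT unfolding piece_def by blast
    qed
    \<comment> \<open>The part above \<open>T'\<close> is left to the induction hypothesis, with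
      \<open>T'\<close> in the role of \<open>A\<close>.\<close>
    define U3 where "U3 = {x\<in>Q. \<exists>t\<in>T'. t \<sqsubset> x}"
    define X3 where "X3 = {x\<in>X. \<exists>t\<in>T'. t \<sqsubset> x}"
    have mX3: "\<exists>m\<in>M. m \<sqsubset> x" if xU: "x \<in> U3" for x
    proof -
      obtain t where t: "t \<in> T'" "t \<sqsubset> x" using xU by (auto simp: U3_def)
      obtain m where "m \<in> M" "m \<sqsubseteq> t" using MT leA_iff[OF Q Mm T'(1)] t by blast
      then show ?thesis using t le_less_trans[of m t x] by auto
    qed
    have X3U: "X3 \<subseteq> U3" using XQ by (auto simp: X3_def U3_def)
    \<comment> \<open>An antichain of \<open>Suc w\<close> elements of \<open>X3\<close> together
      with \<open>Z\<close> would be a maximum antichain, since \<open>M \<inter> X\<close> has at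
      most \<open>Suc w\<close> elements. It contains \<open>Z\<close>, so it would lie below
      \<open>T'\<close>, whereas \<open>X3\<close> lies strictly above \<open>T'\<close>.\<close>
    have "width X3 \<le> w"
    proof (subst width_le_iff, use finX in \<open>simp add: X3_def\<close>, intro allI impI, elim conjE)
      fix Y assume Y: "Y \<subseteq> X3" "antich Y"
      show "card Y \<le> w"
      proof (rule ccontr)
        assume "\<not> card Y \<le> w"
        then have cY: "card Y \<ge> Suc w" by simp
        have YX: "Y \<subseteq> X" using Y by (auto simp: X3_def)
        have fin: "finite Y" "finite Z" using YX finX finite_subset finite_mac[OF Q Mm] by (auto simp: Z_def)
        have "card (M \<inter> X) \<le> Suc w"
          using card_le_width[of X "M \<inter> X"] antich_subset[OF macD(2)[OF Mm], of "M \<inter> X"] finX Suc.prems(5) by auto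
        moreover have "card M = card (M \<inter> X) + card Z"
          using card_Int_Diff[OF finite_mac[OF Q Mm], of X] by (simp add: Z_def)
        ultimately have c1: "width Q \<le> Suc w + card Z" using macD(3)[OF Mm] by simp
        have disj: "Y \<inter> Z = {}" using YX by (auto simp: Z_def)
        have "antich (Y \<union> Z)"
        proof -
          have "\<not> x \<sqsubset> z \<and> \<not> z \<sqsubset> x" if "x \<in> Y" "z \<in> Z" for x z
          proof -
            have "x \<in> U3" using X3U Y(1) that(1) by blast
            then obtain m where "m \<in> M" "m \<sqsubset> x" using mX3 by blast
            then show ?thesis using Zinc[of x m z] that YX by auto
          qed
          then show ?thesis using Y(2) macD(2)[OF Mm] unfolding antich_def Z_def by blast
        qed
        moreover have sub: "Y \<union> Z \<subseteq> Q" using YX XQ macD(1)[OF Mm] by (auto simp: Z_def)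
        moreover have "card (Y \<union> Z) = card Y + card Z" using card_Un_disjoint fin disj by blast
        ultimately have "Y \<union> Z \<in> mac Q"
          using card_le_width[OF Q sub] c1 cY by (intro macI) auto
        then have l: "leA (Y \<union> Z) T'" using T' by auto
        obtain y where "y \<in> Y" using cY by fastforce
        then obtain t t' where "t \<in> T'" "y \<sqsubseteq> t" "t' \<in> T'" "t' \<sqsubset> y"
          using l Y unfolding leA_def X3_def by blast
        then show False using Ta[of t' t] less_le_trans[of t' y t] by auto
      qed
    qed
    moreover have "\<forall>y\<in>U3. \<forall>x\<in>X3. y \<sqsubset> x \<longrightarrow> y \<in> X3"
    proof (intro ballI impI)
      fix y x assume h: "y \<in> U3" "x \<in> X3" "y \<sqsubset> x"
      obtain m where m: "m \<in> M" "m \<sqsubset> y" using mX3[OF h(1)] by auto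
      have "y \<in> U"
      proof (cases "A = {}")
        case True
        then have "U = Q" using Suc.prems(2,4) by auto
        then show ?thesis using h by (auto simp: U3_def)
      next
        case False
        then obtain a where "a \<in> A" "a \<sqsubset> m" using bel m MU by blast
        then have "a \<sqsubset> y" using m trans[of a m y] by blast
        then show ?thesis using Suc.prems(2) \<open>a \<in> A\<close> h by (auto simp: U3_def)
      qed
      then show "y \<in> X3" using h ideal[of y x] by (auto simp: U3_def X3_def)
    qed
    moreover have "\<forall>B\<in>mac Q. \<not> B \<subseteq> X3" using Suc.prems(4) by (auto simp: X3_def)
    moreover have "T' \<in> mac Q \<and> U3 = {x\<in>Q. \<exists>a\<in>T'. a \<sqsubset> x} \<or> T' = {} \<and> U3 = Q"
      using T'(1) by (simp add: U3_def)
    ultimately obtain \<Y> where \<Y>: "finite \<Y>" "card \<Y> \<le> (width Q + 3) * w" "\<Union>\<Y> = X3"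
      "\<forall>Y\<in>\<Y>. cvx Q Y \<and> piece Q Y"
      using Suc.IH[OF X3U] by blast
    \<comment> \<open>One round costs at most \<open>card A + 2\<close> pieces, which is below
      \<open>width Q + 3\<close>, and there are at most as many rounds as the width of
      \<open>X\<close>.\<close>
    let ?W = "insert R1 (insert Y2 (Yz ` A)) \<union> \<Y>"
    have "card ?W \<le> Suc (Suc (card A)) + card \<Y>"
    proof -
      have "card (Yz ` A) \<le> card A" using card_image_le[OF finA] .
      then have "card (insert R1 (insert Y2 (Yz ` A))) \<le> Suc (Suc (card A))"
        using finA by (simp add: card_insert_if)
      then show ?thesis using card_Un_le[of "insert R1 (insert Y2 (Yz ` A))" \<Y>] by linarith
    qed
    then have "card ?W \<le> (width Q + 3) * Suc w" using \<Y>(2) cardA by simp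
    moreover have "\<Union>?W = X"
    proof
      show "\<Union>?W \<subseteq> X" using \<Y>(3) by (auto simp: R1_def R_def Y2_def Yz_def X3_def)
      show "X \<subseteq> \<Union>?W"
      proof
        fix x assume x: "x \<in> X"
        then have xQ: "x \<in> Q" using XQ by auto
        have "x \<in> \<Union>(Yz ` A) \<or> x \<in> R" using x by (auto simp: R_def Yz_def)
        moreover have "x \<in> R1 \<or> (\<exists>m\<in>M. m \<sqsubseteq> x)" if "x \<in> R"
          using Q Mm xQ by (cases rule: mac_tri) (use that in \<open>auto simp: R1_def\<close>)
        moreover have "x \<in> Y2 \<or> x \<in> X3" if "\<exists>m\<in>M. m \<sqsubseteq> x"
          using Q T'(1) xQ by (cases rule: mac_tri) (use that x in \<open>auto simp: Y2_def X3_def\<close>)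
        ultimately show "x \<in> \<Union>?W" using \<Y>(3) by auto
      qed
    qed
    ultimately show ?thesis using Yz R1 Y2 \<Y> finA by (intro exI[of _ ?W]) auto
  qed
qed

text \<open>Obtained from \<open>cover_up\<close> in the reversed order: maximum antichains, core
  and convexity are the same for both orders, and intervals only exchange their two ends.\<close>

lemma cover_dn:
  assumes Q: "finite Q"
    and X: "X \<subseteq> U" "A \<in> mac Q \<and> U = {x\<in>Q. \<exists>a\<in>A. x \<sqsubset> a} \<or> A = {} \<and> U = Q"
      "\<forall>y\<in>U. \<forall>x\<in>X. x \<sqsubset> y \<longrightarrow> y \<in> X" "\<forall>B\<in>mac Q. \<not> B \<subseteq> X" "width X \<le> w"
  shows "\<exists>\<Y>. finite \<Y> \<and> card \<Y> \<le> (width Q + 3) * w \<and> \<Union>\<Y> = X \<and> (\<forall>Y\<in>\<Y>. cvx Q Y \<and> piece Q Y)"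
proof -
  interpret d: strict_order "\<lambda>x y. y \<sqsubset> x"
    by unfold_locales (rule irrefl, erule (1) trans[rotated])
  have an: "d.antich = antich" by (auto simp: fun_eq_iff d.antich_def antich_def)
  have wi: "d.width = width" by (simp add: fun_eq_iff d.width_def width_def an)
  have ma: "d.mac = mac" by (simp add: fun_eq_iff d.mac_def mac_def an wi)
  have co: "d.core = core" by (simp add: fun_eq_iff d.core_def core_def ma)
  have cv: "d.cvx Q Y \<longleftrightarrow> cvx Q Y" for Y unfolding d.cvx_def cvx_def by blast
  have bt: "d.btw Q B C = btw Q C B" for B C unfolding d.btw_def btw_def by blast
  have lA: "d.leA B C \<longleftrightarrow> leA C B" if "B \<in> mac Q" "C \<in> mac Q" for B C
    unfolding leA_iff[OF Q that(2,1)] d.leA_def by metis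
  have pi: "d.piece Q Y \<Longrightarrow> piece Q Y" for Y
    unfolding d.piece_def piece_def co ma bt using lA by blast
  note X5 = d.cover_up[unfolded ma wi, OF Q X]
  then obtain \<Y> where Y: "finite \<Y>" "card \<Y> \<le> (width Q + 3) * w"
    "\<Union>\<Y> = X" "\<forall>Y\<in>\<Y>. d.cvx Q Y \<and> d.piece Q Y" by (elim exE conjE)
  have "\<forall>Y\<in>\<Y>. cvx Q Y \<and> piece Q Y" using Y(4) cv pi by simp
  then show ?thesis using Y(1-3) by (intro exI[of _ \<Y>] conjI)
qed

text \<open>Replacing \<open>Q\<close> by a part \<open>J\<close> whose maximum antichains are, up to a fixed set \<open>Z\<close>, those
  maximum antichains of \<open>Q\<close> that lie between \<open>B\<close> and \<open>C\<close>.\<close>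

lemma transfer:
  assumes Q: "finite Q" and J: "J \<subseteq> Q" and B: "B \<in> mac Q" and C: "C \<in> mac Q" and BC: "leA B C"
    and Z: "Z \<subseteq> B" and H1: "\<And>D. D \<in> mac Q \<Longrightarrow> leA B D \<Longrightarrow> leA D C \<Longrightarrow> D - Z \<in> mac J"
    and H2: "\<And>E. E \<in> mac J \<Longrightarrow> E \<union> Z \<in> mac Q \<and> leA B (E \<union> Z)"
    and Zinc: "\<And>x z. x \<in> J \<Longrightarrow> z \<in> Z \<Longrightarrow> \<not> x \<sqsubset> z \<and> \<not> z \<sqsubset> x \<and> x \<noteq> z"
    and x: "x \<in> J" "b \<in> B" "b \<sqsubseteq> x"
  shows "c \<in> C \<Longrightarrow> x \<sqsubseteq> c \<Longrightarrow> x \<in> core Q \<Longrightarrow> x \<in> core J"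
    and "c \<in> C \<Longrightarrow> x \<sqsubset> c \<Longrightarrow> nxt J x = nxt Q x"
proof -
  have xQ: "x \<in> Q" using x J by auto
  have nB: "\<not> x \<sqsubset> y" if "y \<in> B" for y
    using antichD[OF macD(2)[OF B] x(2) that] x le_less_trans[of b x y] by blast
  {
    assume c: "c \<in> C" "x \<sqsubseteq> c" and "x \<in> core Q"
    then obtain D where D: "D \<in> mac Q" "x \<in> D" by (auto simp: core_def)
    note j = meet_join_mac(2)[OF Q D(1) B]
    \<comment> \<open>\<open>D\<close> is clamped into the interval by a join with \<open>B\<close>
      and a meet with \<open>C\<close>. The point \<open>x\<close> survives both, because it lies
      between \<open>B\<close> and \<open>C\<close>.\<close>
    let ?D = "maxs (D \<union> B)" and ?E = "mins (maxs (D \<union> B) \<union> C)"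
    note m = meet_join_mac(1)[OF Q j C]
    have "x \<in> ?D" using D antichD[OF macD(2)[OF D(1)]] nB by (auto simp: maxs_def)
    moreover have "\<not> y \<sqsubset> x" if "y \<in> ?D" for y using antichD[OF macD(2)[OF j] that \<open>x \<in> ?D\<close>] .
    moreover have "\<not> y \<sqsubset> x" if "y \<in> C" for y
      using antichD[OF macD(2)[OF C] that c(1)] less_le_trans[of y x c] c by blast
    ultimately have "x \<in> ?E" by (auto simp: mins_def)
    moreover have "leA B ?E" using leA_meet(3)[OF Q j C B leA_join(2)[OF Q D(1) B] BC] .
    moreover have "leA ?E C" using leA_meet(2)[OF Q j C] .
    ultimately have "x \<in> ?E - Z" "?E - Z \<in> mac J" using H1[OF m] Zinc x by auto
    then show "x \<in> core J" by (auto simp: core_def)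
  }
  {
    assume c: "c \<in> C" "x \<sqsubset> c"
    then have Cab: "C \<in> mabove Q x" using C by (auto simp: mabove_def)
    then have "mabove Q x \<noteq> {}" by auto
    from mabove_least[OF Q xQ this] obtain M where M: "M \<in> mabove Q x" "nxt Q x = {y \<in> M. x \<sqsubset> y}"
      "\<And>B. B \<in> mabove Q x \<Longrightarrow> leA M B" by metis
    have Mm: "M \<in> mac Q" using M(1) by (auto simp: mabove_def)
    note j = meet_join_mac(2)[OF Q Mm B]
    \<comment> \<open>Nothing of \<open>B\<close> is above \<open>x\<close>, so the join with
      \<open>B\<close> does not change the part of \<open>M\<close> above \<open>x\<close>. It
      remains below \<open>C\<close>, because \<open>C\<close> itself reaches above \<open>x\<close>
      and \<open>M\<close> is least with this property.\<close>
    let ?M = "maxs (M \<union> B)"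
    have n: "{y \<in> ?M. x \<sqsubset> y} = {y \<in> M. x \<sqsubset> y}"
    proof -
      have "y \<in> ?M" if y: "y \<in> M" "x \<sqsubset> y" for y
      proof -
        have "\<not> y \<sqsubset> u" if "u \<in> M \<union> B" for u
          using that antichD[OF macD(2)[OF Mm] y(1)] nB[of u] trans[OF y(2), of u] by auto
        then show ?thesis using y by (auto simp: maxs_def)
      qed
      then show ?thesis using nB by (auto simp: maxs_def)
    qed
    have MC: "leA ?M C" using leA_join(3)[OF Q Mm B M(3)[OF Cab] BC] .
    have BM: "leA B ?M" using leA_join(2)[OF Q Mm B] .
    have MJ: "?M - Z \<in> mac J" using H1[OF j BM MC] .
    obtain y0 where y0: "y0 \<in> M" "x \<sqsubset> y0" using M(1) by (auto simp: mabove_def)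
    then have "y0 \<in> ?M - Z" using n Zinc[OF x(1), of y0] by blast
    then have MJab: "?M - Z \<in> mabove J x" using MJ y0 by (auto simp: mabove_def)
    then have ne: "mabove J x \<noteq> {}" by auto
    have finJ: "finite J" using finite_subset[OF J Q] .
    from mabove_least[OF finJ x(1) ne] obtain N where N: "N \<in> mabove J x" "nxt J x = {y \<in> N. x \<sqsubset> y}"
      "\<And>B. B \<in> mabove J x \<Longrightarrow> leA N B" by metis
    have Nm: "N \<in> mac J" using N(1) by (auto simp: mabove_def)
    have NZ: "N \<union> Z \<in> mac Q" "leA B (N \<union> Z)" using H2[OF Nm] by auto
    have "N \<union> Z \<in> mabove Q x" using N(1) NZ(1) by (auto simp: mabove_def)
    then have "leA ?M (N \<union> Z)" using leA_join(3)[OF Q Mm B M(3) NZ(2)] by blast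
    then have l: "\<exists>m\<in>?M. m \<sqsubseteq> y" if "y \<in> N" for y
      using leA_iff[OF Q j NZ(1)] that by blast
    \<comment> \<open>The converse inequality is the minimality of \<open>N\<close> in
      \<open>J\<close>. This one holds because \<open>N \<union> Z\<close> is a maximum antichain of
      \<open>Q\<close> reaching above \<open>x\<close>; elements of \<open>Z\<close> cannot be the
      witnesses, being incomparable to \<open>J\<close>.\<close>
    have "leA (?M - Z) N"
    proof (subst leA_iff[OF finJ MJ Nm], intro ballI)
      fix y assume y: "y \<in> N"
      then have "y \<in> J" using macD(1)[OF Nm] by auto
      then show "\<exists>m\<in>?M - Z. m \<sqsubseteq> y" using l[OF y] Zinc[of y] by blast
    qed
    then have "N = ?M - Z" using leA_antisym[OF Nm MJ] N(3)[OF MJab] by blast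
    then have "nxt J x = {y \<in> ?M. x \<sqsubset> y}" using N(2) Zinc[OF x(1)] by auto
    then show "nxt J x = nxt Q x" using n M(2) by simp
  }
qed

section \<open>Stability of the selection, by induction on the width\<close>

definition bnd :: "nat \<Rightarrow> nat \<Rightarrow> bool" where
  "bnd k c \<longleftrightarrow> (\<forall>Q X. finite Q \<and> width Q \<le> k \<and> cvx Q X \<longrightarrow> card {a\<in>X. sel X a \<noteq> sel Q a} \<le> c)"

lemma bndD: "bnd k c \<Longrightarrow> finite Q \<Longrightarrow> width Q \<le> k \<Longrightarrow> cvx Q X \<Longrightarrow> card {a\<in>X. sel X a \<noteq> sel Q a} \<le> c"
  unfolding bnd_def by blast

lemma card_cover2:
  assumes "D \<subseteq> A \<union> B" "finite A" "finite B" "card A \<le> a" "card B \<le> b"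
  shows "card D \<le> a + b"
  using card_mono[of "A \<union> B" D] card_Un_le[of A B] assms by simp

lemma cvx_Diff_core: "cvx Q X \<Longrightarrow> cvx (Q - core Q) (X - core Q)"
  unfolding cvx_def by blast

text \<open>The point \<open>z\<close> is incomparable to all of \<open>J\<close>, so antichains of
  \<open>J\<close> can be extended by \<open>z\<close>. This gives width \<open>k\<close> and
  identifies the maximum antichains of \<open>J\<close> with those of \<open>Q\<close> between
  \<open>B\<close> and \<open>C\<close>, with \<open>z\<close> removed. On the core the selections
  then agree except on \<open>C\<close>, which has \<open>Suc k\<close> elements; off the core the
  hypothesis contributes \<open>c\<close>.\<close>

lemma interval_bound:
  assumes bd: "bnd k c" and Q: "finite Q" and k: "width Q = Suc k"
    and B: "B \<in> mac Q" and C: "C \<in> mac Q" and BC: "leA B C" and z: "z \<in> B" "z \<in> C"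
    and J: "J = btw Q B C - {z}"
  shows "width J = k" "card {a\<in>J. sel J a \<noteq> sel Q a} \<le> Suc k + c" "cvx Q J"
proof -
  have JQ: "J \<subseteq> Q" by (auto simp: J btw_def)
  have finJ: "finite J" using finite_subset[OF JQ Q] .
  note Ba = antichD[OF macD(2)[OF B]] and Ca = antichD[OF macD(2)[OF C]]
  have inc: "\<not> x \<sqsubset> z \<and> \<not> z \<sqsubset> x \<and> x \<noteq> z" if xJ: "x \<in> J" for x
  proof -
    obtain b d where "b \<in> B" "b \<sqsubseteq> x" "d \<in> C" "x \<sqsubseteq> d" using xJ by (auto simp: J btw_def)
    then show ?thesis
      using Ba[of b z] Ca[of z d] z le_less_trans[of b x z] less_le_trans[of z x d] xJ by (auto simp: J)
  qed
  have ins: "antich (insert z Y)" "card (insert z Y) = Suc (card Y)" "insert z Y \<subseteq> Q"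
    if "Y \<subseteq> J" "antich Y" for Y
  proof -
    show "antich (insert z Y)" using that inc irrefl unfolding antich_def by blast
    show "card (insert z Y) = Suc (card Y)"
      using that finite_subset[OF _ finJ, of Y] inc by (auto simp: card_insert_if)
    show "insert z Y \<subseteq> Q" using that JQ macD(1)[OF B] z by auto
  qed
  have le: "card Y \<le> k" if "Y \<subseteq> J" "antich Y" for Y
    using card_le_width[OF Q ins(3)[OF that] ins(1)[OF that]] ins(2)[OF that] k by simp
  \<comment> \<open>A maximum antichain between \<open>B\<close> and \<open>C\<close> must pass
    through \<open>z\<close>: otherwise it would lie in \<open>J\<close>, where antichains have at
    most \<open>k\<close> elements.\<close>
  have mem: "D - {z} \<subseteq> J" "z \<in> D" if D: "D \<in> mac Q" "leA B D" "leA D C" for D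
  proof -
    have "\<exists>b\<in>B. b \<sqsubseteq> x" if "x \<in> D" for x using leA_iff[OF Q B D(1)] D(2) that by blast
    moreover have "\<exists>d\<in>C. x \<sqsubseteq> d" if "x \<in> D" for x using D(3) that unfolding leA_def by blast
    ultimately show s: "D - {z} \<subseteq> J" using macD(1)[OF D(1)] by (auto simp: J btw_def)
    show "z \<in> D"
    proof (rule ccontr)
      assume "z \<notin> D"
      then have "D \<subseteq> J" using s by auto
      then show False using le[of D] macD[OF D(1)] k by auto
    qed
  qed
  have sz: "card (D - {z}) = k" if "D \<in> mac Q" "z \<in> D" for D
    using that k macD(3)[of D Q] by simp
  have "card (B - {z}) \<le> width J"
    using card_le_width[OF finJ mem(1)[OF B leA_refl BC]] antich_subset[OF macD(2)[OF B]] by auto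
  then show w: "width J = k"
    using sz[OF B z(1)] le width_le_iff[OF finJ, of k] by auto
  have H1: "D - {z} \<in> mac J" if "D \<in> mac Q" "leA B D" "leA D C" for D
    using mem[OF that] sz[of D] that antich_subset[OF macD(2)[OF that(1)]] w by (intro macI) auto
  have H2: "E \<union> {z} \<in> mac Q \<and> leA B (E \<union> {z})" if "E \<in> mac J" for E
  proof -
    have E: "E \<subseteq> J" "antich E" "card E = k" using macD[OF that] w by auto
    have m: "insert z E \<in> mac Q" using ins[OF E(1,2)] E(3) k by (intro macI) auto
    have "\<exists>b\<in>B. b \<sqsubseteq> x" if "x \<in> insert z E" for x using that E(1) z by (auto simp: J btw_def)
    then show ?thesis using leA_iff[OF Q B m] m by simp
  qed
  have Zi: "\<not> x \<sqsubset> z' \<and> \<not> z' \<sqsubset> x \<and> x \<noteq> z'" if "x \<in> J" "z' \<in> {z}" for x z'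
    using inc that by simp
  have zB: "{z} \<subseteq> B" using z by simp
  note tr = transfer[OF Q JQ B C BC zB H1 H2 Zi]
  have coreJ: "core J \<subseteq> core Q" using H2 unfolding core_def by blast
  have coreQ: "x \<in> core J" if "x \<in> J" "x \<in> core Q" for x
    using tr(1) that by (auto simp: J btw_def)
  have nx: "nxt J x = nxt Q x" if "x \<in> J" "x \<notin> C" for x
    using tr(2) that by (auto simp: J btw_def)
  show cJ: "cvx Q J"
  proof (rule cvxI[OF JQ])
    fix x y w assume h: "x \<in> J" "y \<in> J" "w \<in> Q" "x \<sqsubset> w" "w \<sqsubset> y"
    have "\<exists>b\<in>B. b \<sqsubseteq> w" using h le_less_trans[of _ x w] by (auto simp: J btw_def)
    moreover have "\<exists>d\<in>C. w \<sqsubseteq> d" using h less_le_trans[of w y] by (auto simp: J btw_def)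
    moreover have "w \<noteq> z" using inc[OF h(1)] h(4) by auto
    ultimately show "w \<in> J" using h(3) by (auto simp: J btw_def)
  qed
  have eqc: "J - core J = J - core Q" using coreJ coreQ by auto
  have cv: "cvx (Q - core Q) (J - core Q)" using cvx_Diff_core[OF cJ] .
  have wd: "width (Q - core Q) \<le> k" using width_Diff_core[OF Q] k macD(1)[OF B] z by fastforce
  have c2: "card {a \<in> J - core Q. sel (J - core Q) a \<noteq> sel (Q - core Q) a} \<le> c"
    using bndD[OF bd _ wd cv] Q by simp
  have sub: "{a\<in>J. sel J a \<noteq> sel Q a} \<subseteq> C \<union> {a \<in> J - core Q. sel (J - core Q) a \<noteq> sel (Q - core Q) a}"
  proof
    fix a assume a: "a \<in> {a\<in>J. sel J a \<noteq> sel Q a}"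
    show "a \<in> C \<union> {a \<in> J - core Q. sel (J - core Q) a \<noteq> sel (Q - core Q) a}"
    proof (cases "a \<in> core Q")
      case True
      then have "a \<in> C" using a nx[of a] sel_core[OF Q, of a] sel_core[OF finJ, of a] coreQ[of a] by auto
      then show ?thesis by simp
    next
      case False
      then have "sel Q a = sel (Q - core Q) a" using sel_not_core[OF Q] a JQ by auto
      moreover have "sel J a = sel (J - core Q) a" using sel_not_core[OF finJ, of a] False a coreJ eqc by auto
      ultimately show ?thesis using a False by auto
    qed
  qed
  have "finite C" "card C \<le> Suc k" using finite_mac[OF Q C] macD(3)[OF C] k by auto
  then show "card {a\<in>J. sel J a \<noteq> sel Q a} \<le> Suc k + c"
    by (intro card_cover2[OF sub _ _ _ c2]) (use finJ in auto)
qed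

text \<open>In the interval case \<open>J\<close> is an intermediate step: \<open>c\<close> for
  passing from \<open>Y\<close> to \<open>J\<close>, which has width \<open>k\<close>, and
  \<open>Suc k + c\<close> for passing from \<open>J\<close> to \<open>Q\<close>. A piece off the
  core is compared with \<open>Q - core Q\<close> directly.\<close>

lemma piece_bound:
  assumes bd: "bnd k c" and Q: "finite Q" and k: "width Q = Suc k"
    and Y: "cvx Q Y" "piece Q Y"
  shows "card {a\<in>Y. sel Y a \<noteq> sel Q a} \<le> Suc k + 2 * c"
proof -
  have YQ: "Y \<subseteq> Q" using Y by (auto simp: cvx_def)
  have finY: "finite Y" using finite_subset[OF YQ Q] .
  have wd: "width (Q - core Q) \<le> k"
  proof -
    have "Q \<noteq> {}" using k by (auto simp: width_def)
    then show ?thesis using width_Diff_core[OF Q] k by simp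
  qed
  from Y(2) consider "Y \<inter> core Q = {}" | B C z where "B \<in> mac Q" "C \<in> mac Q" "leA B C" "z \<in> B" "z \<in> C"
      "Y \<subseteq> btw Q B C - {z}"
    unfolding piece_def by blast
  then show ?thesis
  proof cases
    case 1
    then have "cvx (Q - core Q) Y" using cvx_Diff_core[OF Y(1)] by (simp add: Diff_triv)
    then have "card {a\<in>Y. sel Y a \<noteq> sel (Q - core Q) a} \<le> c" using bndD[OF bd _ wd] Q by simp
    moreover have "sel (Q - core Q) a = sel Q a" if "a \<in> Y" for a
      using sel_not_core[OF Q, of a] 1 that YQ by auto
    then have "{a\<in>Y. sel Y a \<noteq> sel (Q - core Q) a} = {a\<in>Y. sel Y a \<noteq> sel Q a}" by auto
    ultimately show ?thesis by simp
  next
    case 2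
    define J where "J = btw Q B C - {z}"
    note ib = interval_bound[OF bd Q k 2(1-5) J_def]
    have JQ: "J \<subseteq> Q" by (auto simp: J_def btw_def)
    have finJ: "finite J" using finite_subset[OF JQ Q] .
    have "cvx J Y" using cvx_sub[OF Y(1) _ JQ] 2(6) by (simp add: J_def)
    then have c1: "card {a\<in>Y. sel Y a \<noteq> sel J a} \<le> c" using bndD[OF bd finJ] ib(1) by simp
    have sub: "{a\<in>Y. sel Y a \<noteq> sel Q a} \<subseteq> {a\<in>Y. sel Y a \<noteq> sel J a} \<union> {a\<in>J. sel J a \<noteq> sel Q a}"
      using 2(6) by (auto simp: J_def)
    have "card {a\<in>Y. sel Y a \<noteq> sel Q a} \<le> c + (Suc k + c)"
      by (intro card_cover2[OF sub _ _ c1 ib(2)]) (use finJ finY in auto)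
    then show ?thesis by simp
  qed
qed

text \<open>Where \<open>X\<close> and \<open>Q\<close> disagree, at least one of them disagrees
  with the piece containing the point. For \<open>X\<close> the hypothesis applies, since its width
  is at most \<open>k\<close>; for \<open>Q\<close> it is \<open>piece_bound\<close>.\<close>

lemma cover_bound:
  assumes bd: "bnd k c" and Q: "finite Q" and k: "width Q = Suc k"
    and X: "X \<subseteq> Q" "width X \<le> k"
    and cov: "finite \<Y>" "card \<Y> \<le> n" "\<Union>\<Y> = X" "\<forall>Y\<in>\<Y>. cvx Q Y \<and> piece Q Y"
  shows "card {a\<in>X. sel X a \<noteq> sel Q a} \<le> n * (Suc k + 3 * c)"
proof -
  let ?D = "\<lambda>Y. {a\<in>Y. sel Y a \<noteq> sel Q a} \<union> {a\<in>Y. sel Y a \<noteq> sel X a}"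
  have finX: "finite X" using finite_subset[OF X(1) Q] .
  have D: "card (?D Y) \<le> Suc k + 3 * c" if Y: "Y \<in> \<Y>" for Y
  proof -
    have YX: "Y \<subseteq> X" using cov(3) Y by auto
    have "cvx X Y" using cvx_sub[OF _ YX X(1)] cov(4) Y by auto
    then have "card {a\<in>Y. sel Y a \<noteq> sel X a} \<le> c" using bndD[OF bd finX X(2)] by simp
    moreover have "card {a\<in>Y. sel Y a \<noteq> sel Q a} \<le> Suc k + 2 * c"
      using piece_bound[OF bd Q k] cov(4) Y by auto
    ultimately show ?thesis
      using card_Un_le[of "{a\<in>Y. sel Y a \<noteq> sel Q a}" "{a\<in>Y. sel Y a \<noteq> sel X a}"] by linarith
  qed
  have sub: "{a\<in>X. sel X a \<noteq> sel Q a} \<subseteq> (\<Union>Y\<in>\<Y>. ?D Y)"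
  proof
    fix a assume a: "a \<in> {a\<in>X. sel X a \<noteq> sel Q a}"
    then obtain Y where Y: "Y \<in> \<Y>" "a \<in> Y" using cov(3) by auto
    have "a \<in> ?D Y" using a Y by auto
    then show "a \<in> (\<Union>Y\<in>\<Y>. ?D Y)" using Y(1) by blast
  qed
  have "(\<Union>Y\<in>\<Y>. ?D Y) \<subseteq> X" using cov(3) by auto
  then have "card {a\<in>X. sel X a \<noteq> sel Q a} \<le> card (\<Union>Y\<in>\<Y>. ?D Y)"
    using card_mono[OF finite_subset[OF _ finX] sub] by blast
  also have "\<dots> \<le> (\<Sum>Y\<in>\<Y>. card (?D Y))" using card_UN_le[OF cov(1)] .
  also have "\<dots> \<le> (\<Sum>Y\<in>\<Y>. Suc k + 3 * c)" using D by (intro sum_mono) auto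
  also have "\<dots> \<le> n * (Suc k + 3 * c)" using cov(2) by (simp only: sum_constant of_nat_id mult_le_mono1)
  finally show ?thesis .
qed

end

text \<open>The recursion records \<open>bnd_Suc\<close>. The factor 2 is for two passages, to the
  generated down-set and from it to the part. Each costs a bound from \<open>full_bound\<close>:
  \<open>Suc k\<close> for a top antichain, four comparisons off the core, and one covering above
  and one below the maximum antichains of the part.\<close>

fun stab_const :: "nat \<Rightarrow> nat" where
  "stab_const 0 = 0"
| "stab_const (Suc k) =
     2 * (Suc k + 4 * stab_const k + 2 * (((k + 4) * k) * (Suc k + 3 * stab_const k)))"

context strict_order
begin

lemma up_bound:
  assumes bd: "bnd k c" and Q: "finite Q" and k: "width Q = Suc k"
    and X: "X \<subseteq> U" "A \<in> mac Q \<and> U = {x\<in>Q. \<exists>a\<in>A. a \<sqsubset> x} \<or> A = {} \<and> U = Q"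
      "\<forall>y\<in>U. \<forall>x\<in>X. y \<sqsubset> x \<longrightarrow> y \<in> X" "\<forall>B\<in>mac Q. \<not> B \<subseteq> X"
  shows "card {a\<in>X. sel X a \<noteq> sel Q a} \<le> ((k + 4) * k) * (Suc k + 3 * c)"
proof -
  have XQ: "X \<subseteq> Q" using X(1,2) by auto
  have w: "width X \<le> k" using width_less[OF Q XQ] X(4) k by auto
  from cover_up[OF Q X w] obtain \<Y> where Y: "finite \<Y>" "card \<Y> \<le> (width Q + 3) * k" "\<Union>\<Y> = X"
    "\<forall>Y\<in>\<Y>. cvx Q Y \<and> piece Q Y" by (elim exE conjE)
  have "card \<Y> \<le> (k + 4) * k" using Y(2) k by (simp add: add.commute)
  from cover_bound[OF bd Q k XQ w Y(1) this Y(3,4)] show ?thesis .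
qed

lemma dn_bound:
  assumes bd: "bnd k c" and Q: "finite Q" and k: "width Q = Suc k"
    and X: "X \<subseteq> U" "A \<in> mac Q \<and> U = {x\<in>Q. \<exists>a\<in>A. x \<sqsubset> a} \<or> A = {} \<and> U = Q"
      "\<forall>y\<in>U. \<forall>x\<in>X. x \<sqsubset> y \<longrightarrow> y \<in> X" "\<forall>B\<in>mac Q. \<not> B \<subseteq> X"
  shows "card {a\<in>X. sel X a \<noteq> sel Q a} \<le> ((k + 4) * k) * (Suc k + 3 * c)"
proof -
  have XQ: "X \<subseteq> Q" using X(1,2) by auto
  have w: "width X \<le> k" using width_less[OF Q XQ] X(4) k by auto
  from cover_dn[OF Q X w] obtain \<Y> where Y: "finite \<Y>" "card \<Y> \<le> (width Q + 3) * k" "\<Union>\<Y> = X"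
    "\<forall>Y\<in>\<Y>. cvx Q Y \<and> piece Q Y" by (elim exE conjE)
  have "card \<Y> \<le> (k + 4) * k" using Y(2) k by (simp add: add.commute)
  from cover_bound[OF bd Q k XQ w Y(1) this Y(3,4)] show ?thesis .
qed

text \<open>Here \<open>X\<close> has the width of \<open>Q\<close>, and its maximum antichains are
  those of \<open>Q\<close> between a least \<open>A\<close> and a greatest \<open>T\<close>.
  Between them, \<open>transfer\<close> with empty \<open>Z\<close> makes the selections agree on
  the core except on \<open>T\<close>, and off the core the middle part is compared with
  \<open>Q - core Q\<close> and with \<open>X - core X\<close>. The parts above \<open>T\<close> and
  below \<open>A\<close> contain no maximum antichain and fall under \<open>up_bound\<close> and
  \<open>dn_bound\<close>.\<close>

lemma full_bound:
  assumes bd: "bnd k c" and Q: "finite Q" and k: "width Q = Suc k"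
    and X: "cvx Q X" and D0: "D0 \<in> mac Q" "D0 \<subseteq> X"
  shows "card {a\<in>X. sel X a \<noteq> sel Q a} \<le> Suc k + 4 * c + 2 * (((k + 4) * k) * (Suc k + 3 * c))"
proof -
  let ?K = "((k + 4) * k) * (Suc k + 3 * c)"
  have XQ: "X \<subseteq> Q" using X by (auto simp: cvx_def)
  have finX: "finite X" using finite_subset[OF XQ Q] .
  have wX: "width X = Suc k"
    using width_mono[OF Q XQ] card_le_width[OF finX D0(2) macD(2)[OF D0(1)]] macD(3)[OF D0(1)] k by simp
  have macX: "mac X = {D \<in> mac Q. D \<subseteq> X}" using XQ wX k by (auto simp: mac_def)
  obtain A where A: "A \<in> mac X" "\<And>B. B \<in> mac X \<Longrightarrow> leA A B" using least_mac[OF finX] by blast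
  obtain T where T: "T \<in> mac X" "\<And>B. B \<in> mac X \<Longrightarrow> leA B T" using greatest_mac[OF finX] by blast
  have Am: "A \<in> mac Q" "A \<subseteq> X" and Tm: "T \<in> mac Q" "T \<subseteq> X" using A(1) T(1) macX by auto
  have AT: "leA A T" using A(2) T(1) by auto
  have inX: "D \<in> mac X" if D: "D \<in> mac Q" "leA A D" "leA D T" for D
  proof -
    have "x \<in> X" if x: "x \<in> D" for x
    proof -
      obtain a where a: "a \<in> A" "a \<sqsubseteq> x" using leA_iff[OF Q Am(1) D(1)] D(2) x by blast
      obtain t where t: "t \<in> T" "x \<sqsubseteq> t" using D(3) x unfolding leA_def by blast
      show ?thesis using cvxD[OF X, of a t x] a t Am(2) Tm(2) macD(1)[OF D(1)] x by blast
    qed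
    then show ?thesis using D(1) macX by auto
  qed
  have H1: "D - {} \<in> mac X" if "D \<in> mac Q" "leA A D" "leA D T" for D using inX that by simp
  have H2: "E \<union> {} \<in> mac Q \<and> leA A (E \<union> {})" if "E \<in> mac X" for E using that macX A(2) by auto
  have Zi: "\<not> x \<sqsubset> z \<and> \<not> z \<sqsubset> x \<and> x \<noteq> z" if "x \<in> X" "z \<in> {}" for x z using that by simp
  have tr1: "x \<in> core X" if "x \<in> X" "a \<in> A" "a \<sqsubseteq> x" "t \<in> T" "x \<sqsubseteq> t" "x \<in> core Q" for x a t
    by (rule transfer(1)[OF Q XQ Am(1) Tm(1) AT empty_subsetI H1 H2 Zi]) (assumption | rule that)+
  have tr2: "nxt X x = nxt Q x" if "x \<in> X" "a \<in> A" "a \<sqsubseteq> x" "t \<in> T" "x \<sqsubset> t" for x a t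
    by (rule transfer(2)[OF Q XQ Am(1) Tm(1) AT empty_subsetI H1 H2 Zi]) (assumption | rule that)+
  have coreX: "core X \<subseteq> core Q" using macX unfolding core_def by blast
  define Xp where "Xp = {x\<in>X. \<exists>t\<in>T. t \<sqsubset> x}"
  define Xm where "Xm = {x\<in>X. \<exists>a\<in>A. x \<sqsubset> a}"
  define Mo where "Mo = {x\<in>X - core Q. (\<exists>a\<in>A. a \<sqsubset> x) \<and> (\<exists>t\<in>T. x \<sqsubset> t)}"
  have ne: "X \<noteq> {}" "Q \<noteq> {}" using wX k by (auto simp: width_def)
  have wQ': "width (Q - core Q) \<le> k" using width_Diff_core[OF Q ne(2)] k by simp
  have wX': "width (X - core X) \<le> k" using width_Diff_core[OF finX ne(1)] wX by simp
  note As = antichD[OF macD(2)[OF Am(1)]] and Ts = antichD[OF macD(2)[OF Tm(1)]]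
  have nocore: "x \<notin> core X" if x: "x \<in> Xp \<or> x \<in> Xm" for x
  proof
    assume "x \<in> core X"
    then obtain E where E: "E \<in> mac X" "x \<in> E" by (auto simp: core_def)
    have EQ: "E \<in> mac Q" using E macX by auto
    obtain t where t: "t \<in> T" "x \<sqsubseteq> t" using T(2)[OF E(1)] E(2) unfolding leA_def by blast
    obtain a where a: "a \<in> A" "a \<sqsubseteq> x" using A(2)[OF E(1)] E(2) leA_iff[OF Q Am(1) EQ] by blast
    from x show False
    proof
      assume "x \<in> Xp"
      then obtain t' where "t' \<in> T" "t' \<sqsubset> x" by (auto simp: Xp_def)
      then show False using Ts[of t' t] t less_le_trans[of t' x t] by blast
    next
      assume "x \<in> Xm"
      then obtain a' where "a' \<in> A" "x \<sqsubset> a'" by (auto simp: Xm_def)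
      then show False using As[of a a'] a le_less_trans[of a x a'] by blast
    qed
  qed
  have cMQ: "cvx (Q - core Q) Mo"
  proof (rule cvxI)
    fix x y w assume h: "x \<in> Mo" "y \<in> Mo" "w \<in> Q - core Q" "x \<sqsubset> w" "w \<sqsubset> y"
    have "w \<in> X" using cvxD[OF X, of x y w] h by (auto simp: Mo_def)
    moreover have "\<exists>a\<in>A. a \<sqsubset> w" using h trans[of _ x w] by (auto simp: Mo_def)
    moreover have "\<exists>t\<in>T. w \<sqsubset> t" using h trans[of w y] by (auto simp: Mo_def)
    ultimately show "w \<in> Mo" using h(3) by (auto simp: Mo_def)
  qed (use XQ in \<open>auto simp: Mo_def\<close>)
  have cMX: "cvx (X - core X) Mo"
  proof (rule cvxI)
    show "Mo \<subseteq> X - core X" using coreX by (auto simp: Mo_def)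
    fix x y w assume h: "x \<in> Mo" "y \<in> Mo" "w \<in> X - core X" "x \<sqsubset> w" "w \<sqsubset> y"
    have a: "\<exists>a\<in>A. a \<sqsubset> w" using h trans[of _ x w] by (auto simp: Mo_def)
    have t: "\<exists>t\<in>T. w \<sqsubset> t" using h trans[of w y] by (auto simp: Mo_def)
    have "w \<notin> core Q"
    proof
      assume wc: "w \<in> core Q"
      obtain a' t' where "a' \<in> A" "a' \<sqsubset> w" "t' \<in> T" "w \<sqsubset> t'" using a t by blast
      then have "w \<in> core X" using tr1[of w a' t'] wc h(3) by blast
      then show False using h(3) by simp
    qed
    then show "w \<in> Mo" using a t h(3) by (auto simp: Mo_def)
  qed
  have cXp: "cvx (X - core X) Xp"
  proof (rule cvxI)
    fix x y w assume h: "x \<in> Xp" "y \<in> Xp" "w \<in> X - core X" "x \<sqsubset> w" "w \<sqsubset> y"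
    then show "w \<in> Xp" using trans[of _ x w] by (auto simp: Xp_def)
  next
    show "Xp \<subseteq> X - core X" using nocore unfolding Xp_def by blast
  qed
  have cXm: "cvx (X - core X) Xm"
  proof (rule cvxI)
    fix x y w assume h: "x \<in> Xm" "y \<in> Xm" "w \<in> X - core X" "x \<sqsubset> w" "w \<sqsubset> y"
    then show "w \<in> Xm" using trans[of w y] by (auto simp: Xm_def)
  next
    show "Xm \<subseteq> X - core X" using nocore unfolding Xm_def by blast
  qed
  have nomac: "\<not> B \<subseteq> Xp \<and> \<not> B \<subseteq> Xm" if B: "B \<in> mac Q" for B
  proof -
    obtain b where "b \<in> B" using macD(3)[OF B] k by (metis card.empty ex_in_conv nat.distinct(1))
    moreover have "B \<in> mac X" if "B \<subseteq> Xp \<or> B \<subseteq> Xm" using that B macX by (auto simp: Xp_def Xm_def)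
    ultimately show ?thesis using nocore unfolding core_def by blast
  qed
  have b1: "card {a\<in>Mo. sel Mo a \<noteq> sel (Q - core Q) a} \<le> c" using bndD[OF bd _ wQ' cMQ] Q by simp
  have b2: "card {a\<in>Mo. sel Mo a \<noteq> sel (X - core X) a} \<le> c" using bndD[OF bd _ wX' cMX] finX by simp
  have b3: "card {a\<in>Xp. sel Xp a \<noteq> sel (X - core X) a} \<le> c" using bndD[OF bd _ wX' cXp] finX by simp
  have b4: "card {a\<in>Xm. sel Xm a \<noteq> sel (X - core X) a} \<le> c" using bndD[OF bd _ wX' cXm] finX by simp
  have b5: "card {a\<in>Xp. sel Xp a \<noteq> sel Q a} \<le> ?K"
  proof (rule up_bound[OF bd Q k, where U = "{x\<in>Q. \<exists>t\<in>T. t \<sqsubset> x}" and A = T])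
    show "Xp \<subseteq> {x \<in> Q. \<exists>t\<in>T. t \<sqsubset> x}" using XQ by (auto simp: Xp_def)
    show "T \<in> mac Q \<and> {x \<in> Q. \<exists>t\<in>T. t \<sqsubset> x} = {x \<in> Q. \<exists>a\<in>T. a \<sqsubset> x} \<or> T = {} \<and> {x \<in> Q. \<exists>t\<in>T. t \<sqsubset> x} = Q"
      using Tm by simp
    show "\<forall>B\<in>mac Q. \<not> B \<subseteq> Xp" using nomac by blast
    show "\<forall>y\<in>{x \<in> Q. \<exists>t\<in>T. t \<sqsubset> x}. \<forall>x\<in>Xp. y \<sqsubset> x \<longrightarrow> y \<in> Xp"
    proof (intro ballI impI)
      fix y x assume h: "y \<in> {x \<in> Q. \<exists>t\<in>T. t \<sqsubset> x}" "x \<in> Xp" "y \<sqsubset> x"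
      then obtain t where "t \<in> T" "t \<sqsubset> y" "y \<in> Q" by auto
      moreover have "y \<in> X" using cvxD[OF X, of t x y] calculation h Tm(2) by (auto simp: Xp_def)
      ultimately show "y \<in> Xp" by (auto simp: Xp_def)
    qed
  qed
  have b6: "card {a\<in>Xm. sel Xm a \<noteq> sel Q a} \<le> ?K"
  proof (rule dn_bound[OF bd Q k, where U = "{x\<in>Q. \<exists>t\<in>A. x \<sqsubset> t}" and A = A])
    show "Xm \<subseteq> {x \<in> Q. \<exists>t\<in>A. x \<sqsubset> t}" using XQ by (auto simp: Xm_def)
    show "A \<in> mac Q \<and> {x \<in> Q. \<exists>t\<in>A. x \<sqsubset> t} = {x \<in> Q. \<exists>a\<in>A. x \<sqsubset> a} \<or> A = {} \<and> {x \<in> Q. \<exists>t\<in>A. x \<sqsubset> t} = Q"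
      using Am by simp
    show "\<forall>B\<in>mac Q. \<not> B \<subseteq> Xm" using nomac by blast
    show "\<forall>y\<in>{x \<in> Q. \<exists>t\<in>A. x \<sqsubset> t}. \<forall>x\<in>Xm. x \<sqsubset> y \<longrightarrow> y \<in> Xm"
    proof (intro ballI impI)
      fix y x assume h: "y \<in> {x \<in> Q. \<exists>t\<in>A. x \<sqsubset> t}" "x \<in> Xm" "x \<sqsubset> y"
      then obtain t where "t \<in> A" "y \<sqsubset> t" "y \<in> Q" by auto
      moreover have "y \<in> X" using cvxD[OF X, of x t y] calculation h Am(2) by (auto simp: Xm_def)
      ultimately show "y \<in> Xm" by (auto simp: Xm_def)
    qed
  qed
  let ?E = "T \<union> ({a\<in>Mo. sel Mo a \<noteq> sel (Q - core Q) a} \<union> ({a\<in>Mo. sel Mo a \<noteq> sel (X - core X) a}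
    \<union> ({a\<in>Xp. sel Xp a \<noteq> sel (X - core X) a} \<union> ({a\<in>Xm. sel Xm a \<noteq> sel (X - core X) a}
    \<union> ({a\<in>Xp. sel Xp a \<noteq> sel Q a} \<union> {a\<in>Xm. sel Xm a \<noteq> sel Q a})))))"
  have "{a\<in>X. sel X a \<noteq> sel Q a} \<subseteq> ?E"
  proof
    fix x assume x: "x \<in> {a\<in>X. sel X a \<noteq> sel Q a}"
    then have xX: "x \<in> X" and xQ: "x \<in> Q" using XQ by auto
    show "x \<in> ?E"
    proof (cases "x \<in> Xp \<or> x \<in> Xm")
      case True
      then have "sel X x = sel (X - core X) x" using sel_not_core[OF finX xX nocore] by blast
      then show ?thesis using True x by auto
    next
      case False
      have a: "\<exists>a\<in>A. a \<sqsubseteq> x"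
        using Q Am(1) xQ by (cases rule: mac_tri) (use False xX in \<open>auto simp: Xm_def\<close>)
      have t: "\<exists>t\<in>T. x \<sqsubseteq> t"
        using Q Tm(1) xQ by (cases rule: mac_tri) (use False xX in \<open>auto simp: Xp_def\<close>)
      show ?thesis
      proof (cases "x \<in> core Q")
        case True
        obtain a' t' where at: "a' \<in> A" "a' \<sqsubseteq> x" "t' \<in> T" "x \<sqsubseteq> t'" using a t by blast
        have "x \<in> core X" using tr1[OF xX at True] .
        moreover have "nxt X x = nxt Q x" if "x \<notin> T" using tr2[OF xX at(1-3)] at(3,4) that by blast
        ultimately have "x \<in> T" using x sel_core[OF Q True] sel_core[OF finX] by auto
        then show ?thesis by blast
      next
        case nc: False
        have "x \<notin> A" "x \<notin> T" using nc Am(1) Tm(1) by (auto simp: core_def)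
        then have "x \<in> Mo" using nc a t xX unfolding Mo_def by blast
        moreover have "sel Q x = sel (Q - core Q) x" using sel_not_core[OF Q xQ nc] .
        moreover have "sel X x = sel (X - core X) x" using sel_not_core[OF finX xX] nc coreX by blast
        ultimately show ?thesis using x by auto
      qed
    qed
  qed
  moreover have "finite ?E"
    using finite_mac[OF Q Tm(1)] finX by (auto simp: Mo_def Xp_def Xm_def)
  ultimately have "card {a\<in>X. sel X a \<noteq> sel Q a} \<le> card ?E" by (rule card_mono[rotated])
  also have "\<dots> \<le> Suc k + (c + (c + (c + (c + (?K + ?K)))))"
    using macD(3)[OF Tm(1)] k b1 b2 b3 b4 b5 b6
    by (intro order_trans[OF card_Un_le] add_mono) auto
  finally show ?thesis by simp
qed

text \<open>A convex part is an up-set of the down-set \<open>I\<close> that it generates. For each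
  of the two passages, either a maximum antichain survives and \<open>full_bound\<close> applies, or
  none does and \<open>up_bound\<close> or \<open>dn_bound\<close> applies with the empty
  antichain.\<close>

lemma bnd_Suc:
  assumes bd: "bnd k c"
  shows "bnd (Suc k) (2 * (Suc k + 4 * c + 2 * (((k + 4) * k) * (Suc k + 3 * c))))"
proof -
  let ?K = "((k + 4) * k) * (Suc k + 3 * c)"
  let ?L = "Suc k + 4 * c + 2 * ?K"
  have "card {a\<in>X. sel X a \<noteq> sel Q a} \<le> ?L + ?L"
    if Q: "finite Q" and w: "width Q \<le> Suc k" and X: "cvx Q X" for Q X
  proof (cases "width Q \<le> k")
    case True
    then show ?thesis using bndD[OF bd Q True X] by simp
  next
    case False
    then have k: "width Q = Suc k" using w by simp
    have XQ: "X \<subseteq> Q" using X by (auto simp: cvx_def)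
    define I where "I = {q\<in>Q. \<exists>x\<in>X. q \<sqsubseteq> x}"
    have IQ: "I \<subseteq> Q" and XI: "X \<subseteq> I" using XQ by (auto simp: I_def)
    have finI: "finite I" using finite_subset[OF IQ Q] .
    have ideal: "\<forall>y\<in>Q. \<forall>x\<in>I. y \<sqsubset> x \<longrightarrow> y \<in> I"
      unfolding I_def using less_le_trans by blast
    have filt: "\<forall>y\<in>I. \<forall>x\<in>X. x \<sqsubset> y \<longrightarrow> y \<in> X"
    proof (intro ballI impI)
      fix y x assume h: "y \<in> I" "x \<in> X" "x \<sqsubset> y"
      then obtain z where "z \<in> X" "y \<sqsubseteq> z" "y \<in> Q" by (auto simp: I_def)
      then show "y \<in> X" using cvxD[OF X h(2), of z y] h(3) by blast
    qed
    have cI: "cvx Q I" using ideal IQ by (intro cvxI) blast+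
    have cX: "cvx I X" using cvx_sub[OF X XI IQ] .
    have 1: "card {a\<in>I. sel I a \<noteq> sel Q a} \<le> ?L"
    proof (cases "\<exists>D\<in>mac Q. D \<subseteq> I")
      case True
      then show ?thesis using full_bound[OF bd Q k cI] by blast
    next
      case False
      then have "card {a\<in>I. sel I a \<noteq> sel Q a} \<le> ?K"
        using up_bound[OF bd Q k, of I Q "{}"] IQ ideal by blast
      then show ?thesis by linarith
    qed
    have 2: "card {a\<in>X. sel X a \<noteq> sel I a} \<le> ?L"
    proof (cases "width I \<le> k")
      case True
      then show ?thesis using bndD[OF bd finI True cX] by simp
    next
      case False
      then have kI: "width I = Suc k" using width_mono[OF Q IQ] k by simp
      show ?thesis
      proof (cases "\<exists>D\<in>mac I. D \<subseteq> X")
        case True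
        then show ?thesis using full_bound[OF bd finI kI cX] by blast
      next
        case False
        then have "card {a\<in>X. sel X a \<noteq> sel I a} \<le> ?K"
          using dn_bound[OF bd finI kI, of X I "{}"] XI filt by blast
        then show ?thesis by linarith
      qed
    qed
    have "{a\<in>X. sel X a \<noteq> sel Q a} \<subseteq> {a\<in>X. sel X a \<noteq> sel I a} \<union> {a\<in>I. sel I a \<noteq> sel Q a}"
      using XI by auto
    then show ?thesis by (intro card_cover2[OF _ _ _ 2 1]) (use finI finite_subset[OF XI finI] in auto)
  qed
  then show ?thesis unfolding bnd_def mult_2 by blast
qed

theorem sel_stable: "bnd k (stab_const k)"
proof (induction k)
  case 0
  have "bnd 0 0" unfolding bnd_def
  proof (intro allI impI, elim conjE)
    fix Q X :: "'a set" assume h: "finite Q" "width Q \<le> 0" "cvx Q X"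
    then have "Q = {}" using width_pos[of Q] by auto
    then have "X = {}" using h(3) by (auto simp: cvx_def)
    then show "card {a\<in>X. sel X a \<noteq> sel Q a} \<le> 0" by simp
  qed
  then show ?case by simp
next
  case (Suc k)
  then show ?case using bnd_Suc by simp
qed

text \<open>On the core the selection is empty only on the greatest maximum antichain, because every
  other core element has an element of that antichain above it. Each layer thus contributes at most
  the width, and there are at most \<open>k\<close> layers.\<close>

lemma sel_empty_bound:
  "finite Q \<Longrightarrow> width Q \<le> k \<Longrightarrow> card {a\<in>Q. sel Q a = {}} \<le> k * k"
proof (induction k arbitrary: Q)
  case 0
  then have "Q = {}" using width_pos[of Q] by auto
  then show ?case by simp
next
  case (Suc k)
  note Q = Suc.prems(1)
  show ?case
  proof (cases "Q = {}")
    case False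
    obtain T where T: "T \<in> mac Q" "\<And>B. B \<in> mac Q \<Longrightarrow> leA B T" using greatest_mac[OF Q] by blast
    have "{a\<in>Q. sel Q a = {}} \<subseteq> T \<union> {a\<in>Q - core Q. sel (Q - core Q) a = {}}"
    proof
      fix a assume a: "a \<in> {a\<in>Q. sel Q a = {}}"
      then have aQ: "a \<in> Q" by simp
      show "a \<in> T \<union> {a\<in>Q - core Q. sel (Q - core Q) a = {}}"
      proof (cases "a \<in> core Q")
        case True
        then obtain B where B: "B \<in> mac Q" "a \<in> B" by (auto simp: core_def)
        have "a \<in> T"
        proof (rule ccontr)
          assume "a \<notin> T"
          then have "mabove Q a \<noteq> {}" using T(1) T(2)[OF B(1)] B(2) unfolding leA_def mabove_def by blast
          from mabove_least[OF Q aQ this] obtain M where "M \<in> mabove Q a" "nxt Q a = {y\<in>M. a \<sqsubset> y}" by metis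
          then have "nxt Q a \<noteq> {}" by (auto simp: mabove_def)
          then show False using a sel_core[OF Q True] by simp
        qed
        then show ?thesis by simp
      next
        case False
        then show ?thesis using a sel_not_core[OF Q aQ] by simp
      qed
    qed
    then have "card {a\<in>Q. sel Q a = {}} \<le> Suc k + k * k"
    proof (rule card_cover2)
    show "card {a\<in>Q - core Q. sel (Q - core Q) a = {}} \<le> k * k"
      using Suc.IH[of "Q - core Q"] Q width_Diff_core[OF Q False] Suc.prems(2) by simp
    show "card T \<le> Suc k" "finite T" using finite_mac[OF Q T(1)] macD(3)[OF T(1)] Suc.prems(2) by auto
    qed (use Q in auto)
    then show ?thesis by simp
  qed simp
qed

end

section \<open>Invariance of the selection under order isomorphisms\<close>

lemma antich_image:
  assumes o: "strict_order lt" "strict_order lt'"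
    and iso: "\<And>x y. x \<in> Q \<Longrightarrow> y \<in> Q \<Longrightarrow> lt' (g x) (g y) \<longleftrightarrow> lt x y" and A: "A \<subseteq> Q"
  shows "strict_order.antich lt' (g ` A) \<longleftrightarrow> strict_order.antich lt A"
  unfolding strict_order.antich_def[OF o(1)] strict_order.antich_def[OF o(2)] using iso A
  by (auto simp: subset_iff)

text \<open>Everything in the definition of \<open>sel\<close> is expressed by the order. The lemma
  is applied to the passage around a corner, in \<open>S_nb\<close>, and to the comparison of a face
  with its representative, in \<open>bad_rep\<close>.\<close>

lemma sel_image:
  assumes o: "strict_order lt" "strict_order lt'"
    and fin: "finite Q" and inj: "inj_on g Q"
    and iso: "\<And>x y. x \<in> Q \<Longrightarrow> y \<in> Q \<Longrightarrow> lt' (g x) (g y) \<longleftrightarrow> lt x y" and a: "a \<in> Q"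
  shows "strict_order.sel lt' (g ` Q) (g a) = g ` strict_order.sel lt Q a"
proof -
  interpret o: strict_order lt by (rule o)
  interpret o': strict_order lt' by (rule o)
  show ?thesis using fin inj iso a
  proof (induction Q rule: measure_induct_rule[of card])
    case (less Q)
    note fin = less.prems(1) and inj = less.prems(2) and iso = less.prems(3) and a = less.prems(4)
    have an: "o'.antich (g ` A) \<longleftrightarrow> o.antich A" if "A \<subseteq> Q" for A
      using antich_image[OF o iso that] by blast
    have card: "card (g ` A) = card A" if "A \<subseteq> Q" for A
      using card_image[OF inj_on_subset[OF inj that]] .
    have sets: "{A. A \<subseteq> g ` Q \<and> o'.antich A} = image g ` {A. A \<subseteq> Q \<and> o.antich A}"
      using an by (auto simp: subset_image_iff)
    have wd: "o'.width (g ` Q) = o.width Q"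
      unfolding o'.width_def o.width_def sets image_image using card by (intro arg_cong[of _ _ Max]) (auto intro!: image_cong)
    have mac: "o'.mac (g ` Q) = image g ` o.mac Q"
      unfolding o'.mac_def o.mac_def using an card wd by (auto simp: subset_image_iff)
    have core: "o'.core (g ` Q) = g ` o.core Q"
      unfolding o'.core_def o.core_def mac by blast
    have memi: "g x \<in> g ` A \<longleftrightarrow> x \<in> A" if "x \<in> Q" "A \<subseteq> Q" for x A
      using inj_on_image_mem_iff[OF inj that] .
    show ?case
    proof (cases "a \<in> o.core Q")
      case True
      have mabove: "o'.mabove (g ` Q) (g a) = image g ` o.mabove Q a"
      proof -
        have "(\<exists>y\<in>g ` B. lt' (g a) y) \<longleftrightarrow> (\<exists>y\<in>B. lt a y)" if "B \<in> o.mac Q" for B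
          using o.macD(1)[OF that] iso[OF a] by (auto simp: subset_iff)
        then have "{B \<in> image g ` o.mac Q. \<exists>y\<in>B. lt' (g a) y} = image g ` {B \<in> o.mac Q. \<exists>y\<in>B. lt a y}"
          by blast
        then show ?thesis unfolding o'.mabove_def o.mabove_def mac .
      qed
      define M where "M = \<Union>(o.mabove Q a)"
      have MQ: "M \<subseteq> Q" by (auto simp: M_def o.mabove_def o.mac_def)
      have "\<Union>(o'.mabove (g ` Q) (g a)) = g ` M" unfolding mabove M_def by blast
      moreover have "o'.mins (g ` M) = g ` o.mins M"
        unfolding o'.mins_def o.mins_def using MQ iso by (auto simp: subset_iff)
      moreover have "{y \<in> g ` o.mins M. lt' (g a) y} = g ` {y \<in> o.mins M. lt a y}"
        using MQ iso[OF a] by (auto simp: o.mins_def subset_iff)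
      ultimately have "o'.nxt (g ` Q) (g a) = g ` o.nxt Q a"
        unfolding o'.nxt_def o.nxt_def M_def by simp
      then show ?thesis
        using o.sel_core[OF fin True] o'.sel_core[of "g ` Q" "g a"] core True fin by auto
    next
      case False
      have sub: "o.core Q \<subseteq> Q" by (rule o.core_subset)
      have ne: "Q \<noteq> {}" using a by auto
      have "Q - o.core Q \<subset> Q" using o.core_nonempty[OF fin ne] sub by blast
      then have "card (Q - o.core Q) < card Q" using psubset_card_mono[OF fin] by blast
      then have IH: "o'.sel (g ` (Q - o.core Q)) (g a) = g ` o.sel (Q - o.core Q) a"
        using less.IH[of "Q - o.core Q"] fin inj_on_diff[OF inj] iso a False by auto
      have "g ` (Q - o.core Q) = g ` Q - o'.core (g ` Q)"
        using core inj_on_image_set_diff[OF inj, of Q "o.core Q"] sub by auto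
      moreover have "g a \<notin> o'.core (g ` Q)" using core memi[OF a sub] False by simp
      ultimately show ?thesis
        using o.sel_not_core[OF fin a False] o'.sel_not_core[of "g ` Q" "g a"] IH fin a by auto
    qed
  qed
qed

section \<open>Track systems: the combinatorics of a pattern on the cover\<close>

text \<open>A pattern on the universal cover without its topology. \<open>N\<close> consists of the
  points on the edges, \<open>pos x v\<close> is the coordinate of \<open>x\<close> at
  \<open>v\<close>, \<open>nb f x\<close> the other end of the path in \<open>f\<close> that starts
  at \<open>x\<close>, and \<open>lf x\<close> the lift through \<open>x\<close>.
  \<open>U x u v\<close> stands for the side of that lift from which \<open>x\<close> is reached
  when coming from \<open>u\<close>, and \<open>col\<close> for its parallelism class.
  \<open>cross1\<close> and \<open>cross2\<close> say that paths with interleaved ends belong to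
  different, intersecting lifts. \<open>\<Phi>\<close> represents the faces with ordered vertices
  modulo deck transformations.\<close>

locale track_system =
  fixes N :: "'n set" and eg :: "'n \<Rightarrow> 'w set" and pos :: "'n \<Rightarrow> 'w \<Rightarrow> real"
    and F :: "'w set set" and nb :: "'w set \<Rightarrow> 'n \<Rightarrow> 'n"
    and lf :: "'n \<Rightarrow> 'l" and I :: "'l \<Rightarrow> 'l \<Rightarrow> bool" and d :: nat
    and U :: "'n \<Rightarrow> 'w \<Rightarrow> 'w \<Rightarrow> bool" and col :: "'l \<Rightarrow> 'c"
    and \<Phi> :: "('w \<times> 'w \<times> 'w) set"
  assumes card_eg: "x \<in> N \<Longrightarrow> card (eg x) = 2"
    and pos_compl: "x \<in> N \<Longrightarrow> eg x = {u, v} \<Longrightarrow> pos x u = 1 - pos x v"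
    and pos_inj: "x \<in> N \<Longrightarrow> y \<in> N \<Longrightarrow> eg x = {u, v} \<Longrightarrow> eg y = {u, v} \<Longrightarrow> pos x v = pos y v \<Longrightarrow> x = y"
    and fin: "finite {x \<in> N. eg x = e}"
    and card_F: "f \<in> F \<Longrightarrow> card f = 3"
    and in_face: "x \<in> N \<Longrightarrow> \<exists>f\<in>F. eg x \<subseteq> f"
    and nb: "x \<in> N \<Longrightarrow> f \<in> F \<Longrightarrow> eg x \<subseteq> f \<Longrightarrow>
      nb f x \<in> N \<and> eg (nb f x) \<subseteq> f \<and> eg (nb f x) \<noteq> eg x \<and> nb f (nb f x) = x \<and> lf (nb f x) = lf x"
    and conn: "x \<in> N \<Longrightarrow> y \<in> N \<Longrightarrow> lf x = lf y \<Longrightarrow>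
      (x, y) \<in> {(x, nb f x) | x f. x \<in> N \<and> f \<in> F \<and> eg x \<subseteq> f}\<^sup>*"
    and I_sym: "I l l' \<Longrightarrow> I l' l"
    and clique: "finite S \<Longrightarrow> S \<subseteq> lf ` N \<Longrightarrow> (\<And>l l'. l \<in> S \<Longrightarrow> l' \<in> S \<Longrightarrow> l \<noteq> l' \<Longrightarrow> I l l') \<Longrightarrow> card S \<le> d"
    and cross1: "x \<in> N \<Longrightarrow> y \<in> N \<Longrightarrow> {u, v, w} \<in> F \<Longrightarrow> eg x = {u, v} \<Longrightarrow> eg y = {u, v} \<Longrightarrow>
      pos x v < pos y v \<Longrightarrow> eg (nb {u, v, w} x) = {v, w} \<Longrightarrow> eg (nb {u, v, w} y) = {u, w} \<Longrightarrow>
      lf x \<noteq> lf y \<and> I (lf x) (lf y)"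
    and cross2: "x \<in> N \<Longrightarrow> y \<in> N \<Longrightarrow> {u, v, w} \<in> F \<Longrightarrow> eg x = {u, v} \<Longrightarrow> eg y = {u, v} \<Longrightarrow>
      pos x v < pos y v \<Longrightarrow> eg (nb {u, v, w} x) = {u, w} \<Longrightarrow> eg (nb {u, v, w} y) = {u, w} \<Longrightarrow>
      pos (nb {u, v, w} y) w < pos (nb {u, v, w} x) w \<Longrightarrow> lf x \<noteq> lf y \<and> I (lf x) (lf y)"
    and U_flip: "x \<in> N \<Longrightarrow> eg x = {u, v} \<Longrightarrow> U x u v \<longleftrightarrow> \<not> U x v u"
    and U_nb: "x \<in> N \<Longrightarrow> {u, v, w} \<in> F \<Longrightarrow> eg x = {u, v} \<Longrightarrow> eg (nb {u, v, w} x) = {u, w} \<Longrightarrow>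
      U (nb {u, v, w} x) u w \<longleftrightarrow> U x u v"
    and col_eq: "l \<in> lf ` N \<Longrightarrow> l' \<in> lf ` N \<Longrightarrow>
      (\<And>e. card {x \<in> N. eg x = e \<and> lf x = l} = card {x \<in> N. eg x = e \<and> lf x = l'}) \<Longrightarrow> col l = col l'"
    and fin_\<Phi>: "finite \<Phi>"
    and \<Phi>_F: "(u, v, w) \<in> \<Phi> \<Longrightarrow> {u, v, w} \<in> F"
    and rep: "{u, v, w} \<in> F \<Longrightarrow> \<exists>u' v' w' g. (u', v', w') \<in> \<Phi> \<and>
      bij_betw g {x \<in> N. eg x = {u, v}} {x \<in> N. eg x = {u', v'}} \<and>
      (\<forall>x y. x \<in> N \<and> eg x = {u, v} \<and> y \<in> N \<and> eg y = {u, v} \<longrightarrow>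
        (pos (g x) v' < pos (g y) v' \<longleftrightarrow> pos x v < pos y v) \<and>
        (lf (g x) = lf (g y) \<longleftrightarrow> lf x = lf y) \<and> (I (lf (g x)) (lf (g y)) \<longleftrightarrow> I (lf x) (lf y)) \<and>
        (eg (nb {u', v', w'} (g x)) = {u', w'} \<longleftrightarrow> eg (nb {u, v, w} x) = {u, w}) \<and>
        col (lf (g x)) = col (lf x))"
begin

definition Q :: "'w \<Rightarrow> 'w \<Rightarrow> 'n set" where
  "Q u v = {x \<in> N. eg x = {u, v}}"

definition D :: "'w \<Rightarrow> 'w \<Rightarrow> 'n \<Rightarrow> 'n \<Rightarrow> bool" where
  "D u v x y \<longleftrightarrow> x \<in> Q u v \<and> y \<in> Q u v \<and> pos x v < pos y v \<and> (lf x = lf y \<or> \<not> I (lf x) (lf y))"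

definition lt :: "'w \<Rightarrow> 'w \<Rightarrow> 'n \<Rightarrow> 'n \<Rightarrow> bool" where
  "lt u v = (D u v)\<^sup>+\<^sup>+"

lemma lt_D: "lt u v x y \<Longrightarrow> x \<in> Q u v \<and> y \<in> Q u v \<and> pos x v < pos y v"
  unfolding lt_def by (induction rule: tranclp_induct) (auto simp: D_def)

lemma strict_lt: "strict_order (lt u v)"
proof
  show "\<not> lt u v x x" for x using lt_D[of u v x x] by auto
  show "lt u v x y \<Longrightarrow> lt u v y z \<Longrightarrow> lt u v x z" for x y z
    unfolding lt_def by (rule tranclp_trans)
qed

definition S :: "'w \<Rightarrow> 'w \<Rightarrow> 'n set \<Rightarrow> 'n \<Rightarrow> 'n set" where
  "S u v = strict_order.sel (lt u v)"

lemma Q_commute: "Q u v = Q v u"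
  by (auto simp: Q_def insert_commute)

lemma finite_Q: "finite (Q u v)"
  using fin by (simp add: Q_def)

lemma D_commute: "D u v x y \<longleftrightarrow> D v u y x"
  using pos_compl[of x u v] pos_compl[of y u v] I_sym
  unfolding D_def Q_commute[of v u] by (auto simp: Q_def)

lemma lt_commute: "lt u v x y \<longleftrightarrow> lt v u y x"
proof -
  have "D v u = (D u v)\<inverse>\<inverse>" using D_commute by (auto simp: fun_eq_iff)
  then show ?thesis unfolding lt_def by (simp add: tranclp_converse)
qed

lemma width_Q: "strict_order.width (lt u v) (Q u v) \<le> d"
proof -
  interpret o: strict_order "lt u v" by (rule strict_lt)
  have "card A \<le> d" if A: "A \<subseteq> Q u v" "o.antich A" for A
  proof -
    have I': "lf x \<noteq> lf y \<and> I (lf x) (lf y)" if "x \<in> A" "y \<in> A" "x \<noteq> y" for x y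
    proof -
      have "\<not> D u v x y" "\<not> D u v y x"
        using o.antichD[OF A(2)] that(1,2) tranclp.r_into_trancl[of "D u v"] unfolding lt_def by auto
      moreover have "x \<in> Q u v" "y \<in> Q u v" using that A by auto
      moreover have "pos x v \<noteq> pos y v" using calculation pos_inj[of x y u v] that by (auto simp: Q_def)
      ultimately show ?thesis using I_sym by (auto simp: D_def)
    qed
    then have "inj_on lf A" by (meson inj_onI)
    then have "card A = card (lf ` A)" by (simp add: card_image)
    also have "\<dots> \<le> d"
    proof (rule clique)
      show "finite (lf ` A)" using finite_subset[OF A(1) finite_Q] by simp
      show "lf ` A \<subseteq> lf ` N" using A by (auto simp: Q_def)
    qed (use I' in blast)
    finally show ?thesis .
  qed
  then show ?thesis using o.width_le_iff[OF finite_Q] by blast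
qed

text \<open>The points of the edge whose path in the face turns around the corner \<open>u\<close>.
  By \<open>Bc\<close> the remaining ones turn around \<open>v\<close>.\<close>

definition Ac :: "'w \<Rightarrow> 'w \<Rightarrow> 'w \<Rightarrow> 'n set" where
  "Ac u v w = {x \<in> Q u v. eg (nb {u, v, w} x) = {u, w}}"

lemma face_distinct: "{u, v, w} \<in> F \<Longrightarrow> u \<noteq> v \<and> u \<noteq> w \<and> v \<noteq> w"
  using card_F[of "{u, v, w}"] by (auto simp: card_insert_if split: if_splits)

lemma corner_cases:
  assumes "{u, v, w} \<in> F" "x \<in> Q u v"
  shows "eg (nb {u, v, w} x) = {u, w} \<and> eg (nb {u, v, w} x) \<noteq> {v, w} \<or>
    eg (nb {u, v, w} x) = {v, w} \<and> eg (nb {u, v, w} x) \<noteq> {u, w}"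
proof -
  let ?y = "nb {u, v, w} x"
  have x: "x \<in> N" "eg x = {u, v}" using assms by (auto simp: Q_def)
  then have y: "?y \<in> N" "eg ?y \<subseteq> {u, v, w}" "eg ?y \<noteq> {u, v}" using nb[of x "{u, v, w}"] assms by auto
  obtain a b where ab: "eg ?y = {a, b}" "a \<noteq> b" using card_eg[OF y(1)] by (meson card_2_iff)
  have "a \<in> {u, v, w}" "b \<in> {u, v, w}" using ab y by auto
  then show ?thesis using ab y(3) face_distinct[OF assms(1)] by (auto simp: doubleton_eq_iff)
qed

lemma Bc: "{u, v, w} \<in> F \<Longrightarrow> Q u v - Ac u v w = Ac v u w"
  using corner_cases[of u v w] unfolding Ac_def Q_commute[of v u] insert_commute[of v u] by blast

text \<open>If \<open>x\<close> came before \<open>y\<close> and turned around \<open>v\<close>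
  while \<open>y\<close> turns around \<open>u\<close>, the ends of the two paths would interleave.
  By \<open>cross1\<close> the lifts would be distinct and intersect, so no step of \<open>D\<close>
  can lead from \<open>x\<close> to \<open>y\<close>.\<close>

lemma Ac_down:
  assumes f: "{u, v, w} \<in> F"
  shows "lt u v x y \<Longrightarrow> y \<in> Ac u v w \<Longrightarrow> x \<in> Ac u v w"
  unfolding lt_def
proof (induction rule: tranclp_induct)
  have *: "x \<in> Ac u v w" if "D u v x y" "y \<in> Ac u v w" for x y
  proof (rule ccontr)
    assume n: "x \<notin> Ac u v w"
    have x: "x \<in> Q u v" using that by (simp add: D_def)
    then have "eg (nb {u, v, w} x) = {v, w}" using n corner_cases[OF f x] by (auto simp: Ac_def)
    then have "lf x \<noteq> lf y \<and> I (lf x) (lf y)"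
      using that cross1[of x y u v w] f by (auto simp: Ac_def D_def Q_def)
    then show False using that by (auto simp: D_def)
  qed
  {
    case (base y) then show ?case using * by blast
  next
    case (step y z) then show ?case using * by blast
  }
qed

lemma nb_Ac:
  assumes f: "{u, v, w} \<in> F" and x: "x \<in> Ac u v w"
  shows "nb {u, v, w} x \<in> Ac u w v" "nb {u, v, w} (nb {u, v, w} x) = x" "lf (nb {u, v, w} x) = lf x"
proof -
  have *: "x \<in> N" "eg x = {u, v}" "eg (nb {u, v, w} x) = {u, w}" using x by (auto simp: Ac_def Q_def)
  note n = nb[OF *(1) f]
  show "nb {u, v, w} (nb {u, v, w} x) = x" "lf (nb {u, v, w} x) = lf x" using n * by auto
  have "{u, w, v} = {u, v, w}" by auto
  then show "nb {u, v, w} x \<in> Ac u w v" using n * by (simp add: Ac_def Q_def)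
qed

text \<open>If the two paths around the corner arrived in the opposite order, \<open>cross2\<close>
  would make their lifts intersect.\<close>

lemma D_nb:
  assumes f: "{u, v, w} \<in> F" and xy: "x \<in> Ac u v w" "y \<in> Ac u v w"
  shows "D u v x y \<Longrightarrow> D u w (nb {u, v, w} x) (nb {u, v, w} y)"
proof -
  assume D: "D u v x y"
  note nx = nb_Ac[OF f xy(1)] and ny = nb_Ac[OF f xy(2)]
  have "x \<noteq> y" using D by (auto simp: D_def)
  then have "nb {u, v, w} x \<noteq> nb {u, v, w} y" using nx ny by metis
  then have "pos (nb {u, v, w} x) w \<noteq> pos (nb {u, v, w} y) w"
    using pos_inj[of "nb {u, v, w} x" "nb {u, v, w} y" u w] nx ny by (auto simp: Ac_def Q_def)
  moreover have "\<not> pos (nb {u, v, w} y) w < pos (nb {u, v, w} x) w"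
    using cross2[of x y u v w] f xy D by (auto simp: Ac_def D_def Q_def)
  ultimately show ?thesis using D nx ny by (auto simp: D_def Ac_def)
qed

text \<open>A chain of \<open>D\<close> that ends in the corner part stays in it, by
  \<open>Ac_down\<close>, so each of its steps can be carried to the other edge. This is why the
  closure and not only \<open>D\<close> is compatible with turning a corner.\<close>

lemma lt_nb_imp:
  assumes f: "{u, v, w} \<in> F"
  shows "lt u v x y \<Longrightarrow> y \<in> Ac u v w \<Longrightarrow> lt u w (nb {u, v, w} x) (nb {u, v, w} y)"
proof -
  have *: "(D u v)\<^sup>+\<^sup>+ x y \<Longrightarrow> y \<in> Ac u v w \<Longrightarrow> lt u w (nb {u, v, w} x) (nb {u, v, w} y)" for x y
  proof (induction rule: tranclp_induct)
    case (base y)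
    then have "x \<in> Ac u v w" using Ac_down[OF f, of x y] by (auto simp: lt_def)
    then show ?case using D_nb[OF f _ base(2) base(1)] by (auto simp: lt_def)
  next
    case (step y z)
    then have "y \<in> Ac u v w" using Ac_down[OF f, of y z] by (auto simp: lt_def)
    then have "lt u w (nb {u, v, w} x) (nb {u, v, w} y)" "D u w (nb {u, v, w} y) (nb {u, v, w} z)"
      using step D_nb[OF f _ step.prems step(2)] by auto
    then show ?case unfolding lt_def by auto
  qed
  show "lt u v x y \<Longrightarrow> y \<in> Ac u v w \<Longrightarrow> lt u w (nb {u, v, w} x) (nb {u, v, w} y)"
    using * by (simp add: lt_def)
qed

lemma lt_nb:
  assumes f: "{u, v, w} \<in> F" and xy: "x \<in> Ac u v w" "y \<in> Ac u v w"
  shows "lt u w (nb {u, v, w} x) (nb {u, v, w} y) \<longleftrightarrow> lt u v x y"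
proof
  have e: "{u, w, v} = {u, v, w}" by auto
  note nx = nb_Ac[OF f xy(1)] and ny = nb_Ac[OF f xy(2)]
  assume "lt u w (nb {u, v, w} x) (nb {u, v, w} y)"
  from lt_nb_imp[of u w v, unfolded e, OF f this ny(1)] show "lt u v x y" using nx ny by simp
qed (use lt_nb_imp[OF f] xy in blast)

lemma nb_image:
  assumes f: "{u, v, w} \<in> F"
  shows "nb {u, v, w} ` Ac u v w = Ac u w v"
proof -
  have e: "{u, w, v} = {u, v, w}" by auto
  show ?thesis
  proof
    show "nb {u, v, w} ` Ac u v w \<subseteq> Ac u w v" using nb_Ac[OF f] by blast
    show "Ac u w v \<subseteq> nb {u, v, w} ` Ac u v w"
    proof
      fix y assume "y \<in> Ac u w v"
      from nb_Ac[of u w v, unfolded e, OF f this] show "y \<in> nb {u, v, w} ` Ac u v w" by force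
    qed
  qed
qed

lemma S_nb:
  assumes f: "{u, v, w} \<in> F" and x: "x \<in> Ac u v w"
  shows "S u w (Ac u w v) (nb {u, v, w} x) = nb {u, v, w} ` S u v (Ac u v w) x"
    and "S w u (Ac u w v) (nb {u, v, w} x) = nb {u, v, w} ` S v u (Ac u v w) x"
proof -
  have fin: "finite (Ac u v w)" using finite_Q by (simp add: Ac_def)
  have inj: "inj_on (nb {u, v, w}) (Ac u v w)" by (rule inj_on_inverseI) (rule nb_Ac(2)[OF f])
  show "S u w (Ac u w v) (nb {u, v, w} x) = nb {u, v, w} ` S u v (Ac u v w) x"
    unfolding S_def nb_image[OF f, symmetric]
    by (rule sel_image[OF strict_lt strict_lt fin inj lt_nb[OF f] x])
  have "lt w u (nb {u, v, w} x) (nb {u, v, w} y) \<longleftrightarrow> lt v u x y"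
    if "x \<in> Ac u v w" "y \<in> Ac u v w" for x y
    using lt_nb[OF f that(2,1)] lt_commute by metis
  then show "S w u (Ac u w v) (nb {u, v, w} x) = nb {u, v, w} ` S v u (Ac u v w) x"
    unfolding S_def nb_image[OF f, symmetric]
    by (intro sel_image[OF strict_lt strict_lt fin inj _ x])
qed

text \<open>Only the direction from \<open>u\<close> to \<open>v\<close> is meant. The opposite
  direction is \<open>bad x v u w\<close>, in which the two corners exchange their roles.\<close>

definition bad :: "'n \<Rightarrow> 'w \<Rightarrow> 'w \<Rightarrow> 'w \<Rightarrow> bool" where
  "bad x u v w \<longleftrightarrow> S u v (Q u v) x = {} \<or>
     (x \<in> Ac u v w \<and> S u v (Ac u v w) x \<noteq> S u v (Q u v) x) \<or>
     (x \<in> Q u v - Ac u v w \<and> S u v (Q u v - Ac u v w) x \<noteq> S u v (Q u v) x)"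

text \<open>One corner part is a down-set of the edge and the other its complement, so both are
  order-convex. Each contributes \<open>stab_const d\<close>, and \<open>d * d\<close> bounds the
  points with empty selection.\<close>

lemma card_bad:
  assumes f: "{u, v, w} \<in> F"
  shows "card {x \<in> Q u v. bad x u v w} \<le> d * d + 2 * stab_const d"
proof -
  interpret o: strict_order "lt u v" by (rule strict_lt)
  note fQ = finite_Q[of u v] and w = width_Q[of u v]
  have b: "card {a\<in>X. o.sel X a \<noteq> o.sel (Q u v) a} \<le> stab_const d" if "o.cvx (Q u v) X" for X
    using o.bndD[OF o.sel_stable fQ w that] .
  have c1: "o.cvx (Q u v) (Ac u v w)"
  proof (rule o.cvxI)
    fix x y z assume "y \<in> Ac u v w" "lt u v z y"
    then show "z \<in> Ac u v w" using Ac_down[OF f, of z y] by blast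
  qed (auto simp: Ac_def)
  have c2: "o.cvx (Q u v) (Q u v - Ac u v w)"
  proof (rule o.cvxI)
    fix x y z assume "x \<in> Q u v - Ac u v w" "z \<in> Q u v" "lt u v x z"
    then show "z \<in> Q u v - Ac u v w" using Ac_down[OF f, of x z] by blast
  qed auto
  let ?A = "{a\<in>Q u v. o.sel (Q u v) a = {}}"
  let ?B = "{a\<in>Ac u v w. o.sel (Ac u v w) a \<noteq> o.sel (Q u v) a}"
  let ?C = "{a\<in>Q u v - Ac u v w. o.sel (Q u v - Ac u v w) a \<noteq> o.sel (Q u v) a}"
  have "{x \<in> Q u v. bad x u v w} \<subseteq> ?A \<union> (?B \<union> ?C)"
    by (auto simp: bad_def S_def)
  moreover have "finite ?A" "finite ?B" "finite ?C" using fQ by (auto simp: Ac_def)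
  ultimately have "card {x \<in> Q u v. bad x u v w} \<le> card (?A \<union> (?B \<union> ?C))" by (intro card_mono) auto
  also have "\<dots> \<le> d * d + (stab_const d + stab_const d)"
    using o.sel_empty_bound[OF fQ w] b[OF c1] b[OF c2]
    by (intro order_trans[OF card_Un_le] add_mono) auto
  finally show ?thesis by simp
qed

end

section \<open>Pushing a lift to the next one of the same class\<close>

lemma finite_max_exists:
  fixes h :: "'a \<Rightarrow> real"
  assumes "finite W" "W \<noteq> {}"
  obtains m where "m \<in> W" "\<And>z. z \<in> W \<Longrightarrow> h z \<le> h m"
proof -
  have "Max (h ` W) \<in> h ` W" using assms by (intro Max_in) auto
  then obtain m where "m \<in> W" "h m = Max (h ` W)" by auto
  then show ?thesis using that[of m] assms(1) by simp
qed

context track_system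
begin

lemma S_subset: "S u v X x \<subseteq> {y \<in> X. lt u v x y}"
  using strict_order.sel_subset_antich[OF strict_lt] by (simp add: S_def)

lemma S_antich: "y \<in> S u v X x \<Longrightarrow> z \<in> S u v X x \<Longrightarrow> \<not> lt u v y z"
  using strict_order.sel_subset_antich[OF strict_lt[of u v], of X x]
    strict_order.antichD[OF strict_lt[of u v]] unfolding S_def by blast

definition good :: "'c \<Rightarrow> bool" where
  "good t \<longleftrightarrow> (\<forall>x\<in>N. \<forall>u v w. col (lf x) = t \<and> {u, v, w} \<in> F \<and> eg x = {u, v} \<longrightarrow> \<not> bad x u v w)"

text \<open>Neither end of the path is exceptional in either direction. At both ends the selection
  on the edge is therefore the selection within the corner, and these correspond under the path by
  \<open>S_nb\<close>.\<close>

lemma good_step: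
  assumes t: "good t" "x \<in> N" "col (lf x) = t" and f: "{u, v, w} \<in> F" and x: "x \<in> Ac u v w"
  shows "S u w (Q u w) (nb {u, v, w} x) = nb {u, v, w} ` S u v (Q u v) x"
    and "S w u (Q w u) (nb {u, v, w} x) = nb {u, v, w} ` S v u (Q v u) x"
    and "S u v (Q u v) x \<union> S v u (Q v u) x \<subseteq> Ac u v w"
    and "S u v (Q u v) x \<noteq> {}" "S v u (Q v u) x \<noteq> {}"
proof -
  let ?y = "nb {u, v, w} x"
  have e: "{u, w, v} = {u, v, w}" "{w, u, v} = {u, v, w}" "{v, u, w} = {u, v, w}" by auto
  have f': "{u, w, v} \<in> F" "{w, u, v} \<in> F" "{v, u, w} \<in> F" using f e by auto
  note n = nb_Ac[OF f x]
  have ex: "eg x = {u, v}" "eg ?y = {u, w}" using x n(1) by (auto simp: Ac_def Q_def)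
  have y: "?y \<in> N" "col (lf ?y) = t" using n t by (auto simp: Ac_def Q_def)
  have b1: "\<not> bad x u v w" "\<not> bad x v u w"
    using t f f' ex unfolding good_def by (simp_all add: insert_commute)
  have b2: "\<not> bad ?y u w v" "\<not> bad ?y w u v"
    using t(1) y f f' ex unfolding good_def by (simp_all add: insert_commute)
  have B1: "Q v u - Ac v u w = Ac u v w" using Bc[OF f'(3)] .
  have B2: "Q w u - Ac w u v = Ac u w v" using Bc[OF f'(2)] .
  have s1: "S u v (Q u v) x = S u v (Ac u v w) x" "S v u (Q v u) x = S v u (Ac u v w) x"
    using b1 x B1 unfolding bad_def by auto
  have s2: "S u w (Q u w) ?y = S u w (Ac u w v) ?y" "S w u (Q w u) ?y = S w u (Ac u w v) ?y"
    using b2 n(1) B2 unfolding bad_def by auto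
  show "S u w (Q u w) ?y = nb {u, v, w} ` S u v (Q u v) x"
    "S w u (Q w u) ?y = nb {u, v, w} ` S v u (Q v u) x"
    using S_nb[OF f x] s1 s2 by auto
  show "S u v (Q u v) x \<union> S v u (Q v u) x \<subseteq> Ac u v w"
    unfolding s1 using S_subset[of u v "Ac u v w" x] S_subset[of v u "Ac u v w" x] by blast
  show "S u v (Q u v) x \<noteq> {}" "S v u (Q v u) x \<noteq> {}" using b1 by (auto simp: bad_def)
qed

lemma conn_induct:
  assumes x: "x \<in> N" and P: "P x"
    and step: "\<And>y f. y \<in> N \<Longrightarrow> lf y = lf x \<Longrightarrow> P y \<Longrightarrow> f \<in> F \<Longrightarrow> eg y \<subseteq> f \<Longrightarrow> P (nb f y)"
    and z: "z \<in> N" "lf z = lf x"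
  shows "P z"
proof -
  have "(x, z) \<in> {(x, nb f x) | x f. x \<in> N \<and> f \<in> F \<and> eg x \<subseteq> f}\<^sup>*"
    using conn[OF x z(1)] z(2) by simp
  then have "P z \<and> z \<in> N \<and> lf z = lf x"
  proof (induction rule: rtrancl_induct)
    case base then show ?case using x P by simp
  next
    case (step y z)
    then obtain f where f: "z = nb f y" "f \<in> F" "eg y \<subseteq> f" "y \<in> N" by auto
    then show ?case using assms(3)[of y f] step nb[of y f] by auto
  qed
  then show ?thesis by simp
qed

lemma edge_cases:
  assumes "x \<in> N" "f \<in> F" "eg x = {u, v}" "eg x \<subseteq> f"
  obtains w where "f = {u, v, w}" "x \<in> Ac u v w" "eg (nb f x) = {u, w}"
    | w where "f = {v, u, w}" "x \<in> Ac v u w" "eg (nb f x) = {v, w}"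
proof -
  have uv: "u \<noteq> v" using card_eg[OF assms(1)] assms(3) by auto
  have "card (f - {u, v}) = 1" using card_F[OF assms(2)] assms(3,4) uv by (simp add: card_Diff_subset)
  then obtain w where "f - {u, v} = {w}" using card_1_singletonE by blast
  then have f: "f = {u, v, w}" "f = {v, u, w}" using assms(3,4) by auto
  have x: "x \<in> Q u v" "x \<in> Q v u" using assms by (auto simp: Q_def)
  have "{u, v, w} \<in> F" using f assms(2) by simp
  from corner_cases[OF this x(1)] show ?thesis
  proof (elim disjE conjE)
    assume "eg (nb {u, v, w} x) = {u, w}"
    then show ?thesis using that(1)[of w] f x by (simp add: Ac_def)
  next
    assume "eg (nb {u, v, w} x) = {v, w}"
    then have "eg (nb f x) = {v, w}" using f(1) by simp
    moreover have "eg (nb {v, u, w} x) = {v, w}" using calculation f(2) by metis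
    ultimately show ?thesis using that(2)[of w] f x by (simp add: Ac_def)
  qed
qed

text \<open>The next lift on the side of \<open>x0\<close> is obtained by transporting a selected point along the
  lift through \<open>x0\<close>; the two lifts turn out to meet every edge equally often.\<close>

lemma good_next:
  fixes U' :: "'n \<Rightarrow> 'w \<Rightarrow> 'w \<Rightarrow> bool"
  assumes U'_flip: "\<And>x u v. x \<in> N \<Longrightarrow> eg x = {u, v} \<Longrightarrow> U' x u v \<longleftrightarrow> \<not> U' x v u"
    and U'_nb: "\<And>x u v w. x \<in> N \<Longrightarrow> {u, v, w} \<in> F \<Longrightarrow> eg x = {u, v} \<Longrightarrow> eg (nb {u, v, w} x) = {u, w} \<Longrightarrow>
      U' (nb {u, v, w} x) u w \<longleftrightarrow> U' x u v"
    and t: "good t" and x0: "x0 \<in> N" "eg x0 = {u0, v0}" "U' x0 u0 v0" "col (lf x0) = t"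
  shows "\<exists>y\<in>S u0 v0 (Q u0 v0) x0. col (lf y) = t"
proof -
  obtain f0 where f0: "f0 \<in> F" "eg x0 \<subseteq> f0" using in_face[OF x0(1)] by blast
  have "S u0 v0 (Q u0 v0) x0 \<noteq> {}"
  proof (rule edge_cases[OF x0(1) f0(1) x0(2) f0(2)])
    fix w assume "f0 = {u0, v0, w}" "x0 \<in> Ac u0 v0 w"
    then show ?thesis using good_step(4)[OF t x0(1,4)] f0(1) by auto
  next
    fix w assume "f0 = {v0, u0, w}" "x0 \<in> Ac v0 u0 w"
    then show ?thesis using good_step(5)[OF t x0(1,4)] f0(1) by auto
  qed
  then obtain y0 where y0: "y0 \<in> S u0 v0 (Q u0 v0) x0" by auto
  define l where "l = lf x0"
  define l' where "l' = lf y0"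
  define \<epsilon> where "\<epsilon> = U' y0 u0 v0"
  \<comment> \<open>The direction of selection at each point of the first lift is dictated by
    \<open>U'\<close>, so that the selected points always lie on one side of it.
    \<open>\<epsilon>\<close> fixes how the second lift is oriented relative to the first; this
    later excludes that points with a common partner face opposite ways.\<close>
  define T where "T x y \<longleftrightarrow> x \<in> N \<and> lf x = l \<and> lf y = l' \<and>
    (\<exists>u v. eg x = {u, v} \<and> U' x u v \<and> y \<in> S u v (Q u v) x \<and> U' y u v = \<epsilon>)" for x y
  have y0N: "y0 \<in> N" using y0 S_subset[of u0 v0 "Q u0 v0" x0] by (auto simp: Q_def)
  have T0: "T x0 y0" unfolding T_def using x0 y0 by (auto simp: l_def l'_def \<epsilon>_def)
  have Tmem: "y \<in> N \<and> eg y = eg x" if "T x y" for x y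
    using that S_subset unfolding T_def Q_def by blast
  have lcol: "col (lf x) = t" if "lf x = l" for x using that x0 by (simp add: l_def)
  have Tstep: "T (nb f x) (nb f y)" if Txy: "T x y" and f: "f \<in> F" "eg x \<subseteq> f" for x y f
  proof -
    obtain u v where uv: "eg x = {u, v}" "U' x u v" "y \<in> S u v (Q u v) x" "U' y u v = \<epsilon>"
      using Txy by (auto simp: T_def)
    have x: "x \<in> N" "lf x = l" "lf y = l'" using Txy by (auto simp: T_def)
    have y: "y \<in> N" "eg y = {u, v}" using Tmem[OF Txy] uv by auto
    have nx: "nb f x \<in> N" "lf (nb f x) = l" "lf (nb f y) = l'"
      using nb[OF x(1) f] nb[OF y(1) f(1)] f(2) y uv x by auto
    from x(1) f(1) uv(1) f(2) show ?thesis
    proof (cases rule: edge_cases)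
      case (1 w)
      have fF: "{u, v, w} \<in> F" using 1 f by simp
      note gs = good_step[OF t x(1) lcol[OF x(2)] fF 1(2)]
      have yA: "y \<in> Ac u v w" using gs(3) uv(3) by auto
      have "nb f y \<in> S u w (Q u w) (nb f x)" unfolding 1(1) gs(1) using uv(3) by simp
      moreover have "U' (nb f x) u w" using U'_nb[OF x(1) fF uv(1)] 1 uv(2) by simp
      moreover have "U' (nb f y) u w = \<epsilon>"
        using U'_nb[OF y(1) fF y(2)] 1(1) yA uv(4) by (simp add: Ac_def)
      ultimately show ?thesis unfolding T_def using nx 1(3) by blast
    next
      case (2 w)
      have fF: "{v, u, w} \<in> F" using 2 f by simp
      have ex: "eg x = {v, u}" "eg y = {v, u}" using uv(1) y(2) by auto
      note gs = good_step[OF t x(1) lcol[OF x(2)] fF 2(2)]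
      have yA: "y \<in> Ac v u w" using gs(3) uv(3) by auto
      have eny: "eg (nb f y) = {v, w}" using yA 2(1) by (simp add: Ac_def)
      have "nb f y \<in> S w v (Q w v) (nb f x)" unfolding 2(1) gs(2) using uv(3) by simp
      moreover have "U' (nb f x) w v"
        using U'_nb[OF x(1) fF ex(1)] 2 uv(2) U'_flip[OF x(1) uv(1)] U'_flip[OF nx(1) 2(3)] by simp
      moreover have "U' (nb f y) w v = \<epsilon>"
        using U'_nb[OF y(1) fF ex(2)] 2(1) eny uv(4) U'_flip[OF y(1,2)] U'_flip[OF _ eny]
          nb[OF y(1) f(1)] f(2) y uv by auto
      ultimately show ?thesis unfolding T_def using nx 2(3) by (metis insert_commute)
    qed
  qed
  have total: "\<exists>y. T x y" if "x \<in> N" "lf x = l" for x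
  proof (rule conn_induct[OF x0(1), where P = "\<lambda>x. \<exists>y. T x y"])
    show "\<exists>y. T (nb f z) y" if "\<exists>y. T z y" "f \<in> F" "eg z \<subseteq> f" for z f using Tstep that by blast
  qed (use T0 that in \<open>auto simp: l_def\<close>)
  have onto: "\<exists>x. T x y" if "y \<in> N" "lf y = l'" for y
  proof (rule conn_induct[OF y0N, where P = "\<lambda>y. \<exists>x. T x y"])
    show "\<exists>x. T x (nb f z)" if h: "\<exists>x. T x z" "f \<in> F" "eg z \<subseteq> f" for z f
    proof -
      obtain x where "T x z" using h by blast
      then show ?thesis using Tstep[of x z f] Tmem[of x z] h by auto
    qed
  qed (use T0 that in \<open>auto simp: l'_def\<close>)
  have dir: "\<And>u v. eg x = {u, v} \<Longrightarrow> U' x u v \<Longrightarrow> y \<in> S u v (Q u v) x \<and> U' y u v = \<epsilon>" if Txy: "T x y" for x y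
  proof -
    fix u v assume h: "eg x = {u, v}" "U' x u v"
    obtain a b where ab: "eg x = {a, b}" "U' x a b" "y \<in> S a b (Q a b) x" "U' y a b = \<epsilon>"
      using Txy by (auto simp: T_def)
    have "x \<in> N" using Txy by (simp add: T_def)
    then have "a = u \<and> b = v" using h ab(1,2) U'_flip[of x u v] by (auto simp: doubleton_eq_iff)
    then show "y \<in> S u v (Q u v) x \<and> U' y u v = \<epsilon>" using ab by simp
  qed
  \<comment> \<open>Points of one lift on one edge are always comparable, whereas selected points
    are pairwise incomparable. A partner on a given lift is therefore unique.\<close>
  have comp: "D u v x y \<or> D u v y x" if "x \<in> Q u v" "y \<in> Q u v" "x \<noteq> y" "lf x = lf y" for x y u v
    using that pos_inj[of x y u v] unfolding D_def Q_def by fastforce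
  have func: "y = y'" if h: "T x y" "T x y'" for x y y'
  proof (rule ccontr)
    assume ne: "y \<noteq> y'"
    obtain u v where uv: "eg x = {u, v}" "U' x u v" using h by (auto simp: T_def)
    have m: "y \<in> S u v (Q u v) x" "y' \<in> S u v (Q u v) x" using dir[OF h(1) uv] dir[OF h(2) uv] by auto
    then have "y \<in> Q u v" "y' \<in> Q u v" using S_subset by blast+
    moreover have "lf y = lf y'" using h by (simp add: T_def)
    ultimately have "lt u v y y' \<or> lt u v y' y" using comp[of y u v y'] ne by (auto simp: lt_def)
    then show False using S_antich m by blast
  qed
  have inj: "x = x'" if h: "T x y" "T x' y" for x x' y
  proof (rule ccontr)
    assume ne: "x \<noteq> x'"
    \<comment> \<open>If two points shared a partner, then so would their neighbours along the lift,
      and with the same order relative to the direction \<open>U'\<close>. Every point of the lift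
      would then have a higher twin on its edge, which is impossible for the highest point with a
      given direction on a finite edge.\<close>
    define B where "B z \<longleftrightarrow> (\<exists>z' y u v. T z y \<and> T z' y \<and> eg z = {u, v} \<and> U' z u v \<and> U' z' u v \<and> D u v z z')" for z
    have samedir: "U' z' u v" if z: "T z y" "T z' y" "eg z = {u, v}" "U' z u v" for z z' y u v
    proof (rule ccontr)
      assume "\<not> U' z' u v"
      moreover have e: "eg z' = {u, v}" "y \<in> N" "eg y = {u, v}" "z' \<in> N"
        using Tmem[OF z(1)] Tmem[OF z(2)] z(2,3) by (auto simp: T_def)
      ultimately have "U' z' v u" using U'_flip[of z' u v] by simp
      then have "U' y v u = \<epsilon>" using dir[OF z(2), of v u] e by (simp add: insert_commute)
      moreover have "U' y u v = \<epsilon>" using dir[OF z(1,3,4)] by simp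
      ultimately show False using U'_flip[of y u v] e by simp
    qed
    obtain u v where uv: "eg x = {u, v}" "U' x u v" using h by (auto simp: T_def)
    have "x \<in> Q u v" "x' \<in> Q u v" "lf x = lf x'"
      using Tmem[OF h(1)] Tmem[OF h(2)] h uv by (auto simp: T_def Q_def)
    then have "D u v x x' \<or> D u v x' x" using comp ne by blast
    moreover have "U' x' u v" using samedir[OF h uv] .
    moreover have "eg x' = {u, v}" using Tmem[OF h(1)] Tmem[OF h(2)] uv by simp
    ultimately have "B x \<or> B x'" unfolding B_def using h uv by blast
    then obtain b where b: "B b" "b \<in> N" "lf b = l" using h by (auto simp: T_def)
    have allB: "B z" if z: "z \<in> N" "lf z = l" for z
    proof (rule conn_induct[OF b(2), where P = B])
      fix z f assume z: "z \<in> N" "lf z = lf b" "B z" and f: "f \<in> F" "eg z \<subseteq> f"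
      obtain z' y u v where zz: "T z y" "T z' y" "eg z = {u, v}" "U' z u v" "U' z' u v" "D u v z z'"
        using z(3) unfolding B_def by blast
      have e: "eg z' = {u, v}" "eg y = {u, v}" "z' \<in> N" "y \<in> N"
        using Tmem[OF zz(1)] Tmem[OF zz(2)] zz(2,3) by (auto simp: T_def)
      have Tn: "T (nb f z) (nb f y)" "T (nb f z') (nb f y)"
        using Tstep zz f e by auto
      have en: "eg (nb f z') = eg (nb f z)" using Tmem[OF Tn(1)] Tmem[OF Tn(2)] by simp
      have Dn: "\<exists>a b. eg (nb f z) = {a, b} \<and> U' (nb f z) a b \<and> D a b (nb f z) (nb f z')"
        using z(1) f(1) zz(3) f(2)
      proof (cases rule: edge_cases)
        case (1 w)
        have fF: "{u, v, w} \<in> F" using 1 f by simp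
        have z'A: "z' \<in> Ac u v w" using en 1 e by (simp add: Ac_def Q_def)
        have "U' (nb f z) u w" using U'_nb[OF z(1) fF zz(3)] 1 zz(4) by simp
        then show ?thesis using D_nb[OF fF 1(2) z'A zz(6)] 1 by blast
      next
        case (2 w)
        have fF: "{v, u, w} \<in> F" using 2 f by simp
        have ez: "eg z = {v, u}" using zz(3) by auto
        have z'A: "z' \<in> Ac v u w" using en 2 e by (simp add: Ac_def Q_def insert_commute)
        have nN: "nb f z \<in> N" using nb[OF z(1) f] by simp
        have "D v u z' z" using zz(6) D_commute by blast
        then have "D v w (nb f z') (nb f z)" using D_nb[OF fF z'A 2(2)] 2(1) by simp
        then have "D w v (nb f z) (nb f z')" using D_commute by blast
        moreover have "U' (nb f z) w v"
          using U'_nb[OF z(1) fF ez] 2 zz(4) U'_flip[OF z(1) zz(3)] U'_flip[OF nN 2(3)] by simp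
        ultimately show ?thesis using 2(3) by (metis insert_commute)
      qed
      then obtain a c where ac: "eg (nb f z) = {a, c}" "U' (nb f z) a c" "D a c (nb f z) (nb f z')" by blast
      moreover have "U' (nb f z') a c" using samedir[OF Tn ac(1,2)] .
      ultimately show "B (nb f z)" unfolding B_def using Tn by blast
    qed (use b z in auto)
    obtain u v where uv: "eg b = {u, v}" "U' b u v" using b(1) unfolding B_def by blast
    let ?W = "{z \<in> Q u v. lf z = l \<and> U' z u v}"
    have "finite ?W" using finite_subset[OF _ finite_Q[of u v], of ?W] by blast
    moreover have "?W \<noteq> {}" using b uv by (auto simp: Q_def)
    ultimately obtain m where m: "m \<in> ?W" "\<And>z. z \<in> ?W \<Longrightarrow> pos z v \<le> pos m v"
      using finite_max_exists[of ?W "\<lambda>z. pos z v"] by blast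
    have mN: "m \<in> N" "lf m = l" "eg m = {u, v}" "U' m u v" using m(1) by (auto simp: Q_def)
    then obtain m' y a c where mm: "T m y" "T m' y" "eg m = {a, c}" "U' m a c" "U' m' a c" "D a c m m'"
      using allB unfolding B_def by blast
    have "a = u \<and> c = v" using mm(3,4) mN U'_flip[of m u v] by (auto simp: doubleton_eq_iff)
    then have "m' \<in> ?W" "pos m v < pos m' v" using mm by (auto simp: D_def T_def)
    then show False using m(2) by force
  qed
  have "card {x \<in> N. eg x = e \<and> lf x = l} = card {x \<in> N. eg x = e \<and> lf x = l'}" for e
  proof -
    define \<tau> where "\<tau> x = (SOME y. T x y)" for x
    have \<tau>: "T x (\<tau> x)" if "x \<in> N" "lf x = l" for x
      unfolding \<tau>_def using someI_ex[OF total[OF that]] .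
    have "bij_betw \<tau> {x \<in> N. eg x = e \<and> lf x = l} {x \<in> N. eg x = e \<and> lf x = l'}"
      unfolding bij_betw_def
    proof
      show "inj_on \<tau> {x \<in> N. eg x = e \<and> lf x = l}"
      proof (rule inj_onI)
        fix x x' assume h: "x \<in> {x \<in> N. eg x = e \<and> lf x = l}" "x' \<in> {x \<in> N. eg x = e \<and> lf x = l}" "\<tau> x = \<tau> x'"
        have "T x (\<tau> x)" "T x' (\<tau> x)" using \<tau>[of x] \<tau>[of x'] h by simp_all
        then show "x = x'" by (rule inj)
      qed
      show "\<tau> ` {x \<in> N. eg x = e \<and> lf x = l} = {x \<in> N. eg x = e \<and> lf x = l'}"
      proof
        show "\<tau> ` {x \<in> N. eg x = e \<and> lf x = l} \<subseteq> {x \<in> N. eg x = e \<and> lf x = l'}"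
        proof
          fix y assume "y \<in> \<tau> ` {x \<in> N. eg x = e \<and> lf x = l}"
          then obtain x where x: "x \<in> N" "eg x = e" "lf x = l" "y = \<tau> x" by auto
          have Txy: "T x y" using \<tau>[OF x(1,3)] x(4) by simp
          show "y \<in> {x \<in> N. eg x = e \<and> lf x = l'}" using Tmem[OF Txy] Txy x(2) by (simp add: T_def)
        qed
        show "{x \<in> N. eg x = e \<and> lf x = l'} \<subseteq> \<tau> ` {x \<in> N. eg x = e \<and> lf x = l}"
        proof
          fix y assume y: "y \<in> {x \<in> N. eg x = e \<and> lf x = l'}"
          then obtain x where x: "T x y" using onto by blast
          then have xx: "x \<in> N" "lf x = l" "eg x = e" using Tmem[OF x] y by (auto simp: T_def)
          have "y = \<tau> x" using func[OF x \<tau>[OF xx(1,2)]] .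
          then show "y \<in> \<tau> ` {x \<in> N. eg x = e \<and> lf x = l}" using xx by simp
        qed
      qed
    qed
    then show ?thesis by (rule bij_betw_same_card)
  qed
  then have "col l = col l'" using col_eq[of l l'] x0(1) y0N by (auto simp: l_def l'_def)
  then show ?thesis using y0 x0(4) by (auto simp: l_def l'_def)
qed

text \<open>Otherwise the highest point of the colour on an edge would select a still higher point
  of the same colour. Either \<open>U\<close> or its negation plays the role of the side, whichever
  makes the selection at that point go upwards.\<close>

lemma not_good:
  assumes "x \<in> N"
  shows "\<not> good (col (lf x))"
proof
  let ?t = "col (lf x)"
  assume g: "good ?t"
  obtain u v where uv: "eg x = {u, v}" using card_eg[OF assms] by (meson card_2_iff)
  let ?W = "{z \<in> Q u v. col (lf z) = ?t}"
  have "finite ?W" using finite_subset[OF _ finite_Q[of u v], of ?W] by blast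
  moreover have "?W \<noteq> {}" using assms uv by (auto simp: Q_def)
  ultimately obtain m where m: "m \<in> ?W" "\<And>z. z \<in> ?W \<Longrightarrow> pos z v \<le> pos m v"
    using finite_max_exists[of ?W "\<lambda>z. pos z v"] by blast
  have mN: "m \<in> N" "col (lf m) = ?t" "eg m = {u, v}" using m(1) by (auto simp: Q_def)
  have "\<exists>y\<in>S u v (Q u v) m. col (lf y) = ?t"
  proof (cases "U m u v")
    case True
    show ?thesis by (rule good_next[OF U_flip U_nb g mN(1,3) True mN(2)])
  next
    case False
    show ?thesis
    proof (rule good_next[where U' = "\<lambda>x u v. \<not> U x u v", OF _ _ g mN(1,3) False mN(2)])
      show "(\<not> U x u v) \<longleftrightarrow> \<not> (\<not> U x v u)" if "x \<in> N" "eg x = {u, v}" for x u v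
        using U_flip[OF that] by blast
      show "(\<not> U (nb {u, v, w} x) u w) \<longleftrightarrow> (\<not> U x u v)"
        if "x \<in> N" "{u, v, w} \<in> F" "eg x = {u, v}" "eg (nb {u, v, w} x) = {u, w}" for x u v w
        using U_nb[OF that] by blast
    qed
  qed
  then obtain y where y: "y \<in> S u v (Q u v) m" "col (lf y) = ?t" by blast
  then have "y \<in> Q u v" "pos m v < pos y v" using S_subset[of u v "Q u v" m] lt_D by blast+
  then show False using m(2)[of y] y(2) by auto
qed

text \<open>The bijection supplied by \<open>rep\<close> preserves order, equality and intersection
  of lifts, and the corner that is turned around. These data determine the closure
  \<open>lt\<close>, the corner parts and the selections.\<close>

lemma bad_rep:
  assumes f: "{u, v, w} \<in> F" and x: "x \<in> Q u v" "bad x u v w"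
  shows "\<exists>u' v' w' y. (u', v', w') \<in> \<Phi> \<and> y \<in> Q u' v' \<and> bad y u' v' w' \<and> col (lf y) = col (lf x)"
proof -
  obtain u' v' w' g where \<Phi>: "(u', v', w') \<in> \<Phi>" and bij: "bij_betw g (Q u v) (Q u' v')"
    and g: "\<And>x y. x \<in> Q u v \<Longrightarrow> y \<in> Q u v \<Longrightarrow> (pos (g x) v' < pos (g y) v' \<longleftrightarrow> pos x v < pos y v) \<and>
        (lf (g x) = lf (g y) \<longleftrightarrow> lf x = lf y) \<and> (I (lf (g x)) (lf (g y)) \<longleftrightarrow> I (lf x) (lf y)) \<and>
        (eg (nb {u', v', w'} (g x)) = {u', w'} \<longleftrightarrow> eg (nb {u, v, w} x) = {u, w}) \<and>
        col (lf (g x)) = col (lf x)"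
    using rep[OF f] unfolding Q_def by auto
  have inj: "inj_on g (Q u v)" and im: "g ` Q u v = Q u' v'" using bij by (auto simp: bij_betw_def)
  have Dg: "D u' v' (g x) (g y) \<longleftrightarrow> D u v x y" if "x \<in> Q u v" "y \<in> Q u v" for x y
    using g[OF that] that im unfolding D_def by blast
  have l1: "lt u' v' (g x) (g y)" if "lt u v x y" for x y
    using that unfolding lt_def
  proof (induction rule: tranclp_induct)
    case (base y)
    then show ?case using Dg[of x y] by (auto simp: D_def)
  next
    case (step y z)
    have "D u' v' (g y) (g z)" using step(2) Dg[of y z] by (auto simp: D_def)
    then show ?case using step(3) by (rule tranclp.trancl_into_trancl[rotated])
  qed
  have l2: "\<exists>y\<in>Q u v. b = g y \<and> lt u v x y" if "lt u' v' (g x) b" "x \<in> Q u v" for x b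
    using that(1) unfolding lt_def
  proof (induction rule: tranclp_induct)
    case (base b)
    then have "b \<in> Q u' v'" by (auto simp: D_def)
    then obtain y where "y \<in> Q u v" "b = g y" using im by blast
    then show ?case using Dg[of x y] base that(2) by blast
  next
    case (step b c)
    then obtain y where y: "y \<in> Q u v" "b = g y" "(D u v)\<^sup>+\<^sup>+ x y" by blast
    have "c \<in> Q u' v'" using step(2) by (auto simp: D_def)
    then obtain z where z: "z \<in> Q u v" "c = g z" using im by blast
    then have "D u v y z" using Dg[of y z] y step(2) by simp
    with y(3) have "(D u v)\<^sup>+\<^sup>+ x z" by (rule tranclp.trancl_into_trancl)
    then show ?case using z by blast
  qed
  have lg: "lt u' v' (g x) (g y) \<longleftrightarrow> lt u v x y" if "x \<in> Q u v" "y \<in> Q u v" for x y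
  proof
    assume "lt u' v' (g x) (g y)"
    from l2[OF this that(1)] obtain z where "z \<in> Q u v" "g y = g z" "lt u v x z" by blast
    then show "lt u v x y" using inj that by (auto simp: inj_on_def)
  qed (rule l1)
  have Sg: "S u' v' (g ` X) (g x) = g ` S u v X x" if "X \<subseteq> Q u v" "x \<in> X" for X x
    unfolding S_def
    by (rule sel_image[OF strict_lt strict_lt finite_subset[OF that(1) finite_Q] inj_on_subset[OF inj that(1)] _ that(2)])
      (use lg that in blast)
  have Ag: "g ` Ac u v w = Ac u' v' w'"
    unfolding Ac_def im[symmetric] using g by blast
  have AQ: "Ac u v w \<subseteq> Q u v" by (auto simp: Ac_def)
  have Bg: "g ` (Q u v - Ac u v w) = Q u' v' - Ac u' v' w'"
    using inj_on_image_set_diff[OF inj, of "Q u v" "Ac u v w"] AQ im Ag by auto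
  have SQ: "S u v X x \<subseteq> Q u v" if "X \<subseteq> Q u v" for X using S_subset[of u v X x] that by blast
  have eq: "S u' v' (g ` X) (g x) = S u' v' (Q u' v') (g x) \<longleftrightarrow> S u v X x = S u v (Q u v) x"
    if "X \<subseteq> Q u v" "x \<in> X" for X
    unfolding Sg[OF that] im[symmetric] Sg[OF subset_refl x(1)]
    using inj_on_image_eq_iff[OF inj SQ[OF that(1)] SQ[OF subset_refl]] .
  have "bad (g x) u' v' w'"
    unfolding bad_def
    using x(2) eq[of "Ac u v w"] eq[of "Q u v - Ac u v w"] Sg[OF subset_refl x(1)] AQ im Ag Bg
    unfolding bad_def by (metis Diff_subset image_eqI image_is_empty)
  moreover have "g x \<in> Q u' v'" using im x(1) by blast
  moreover have "col (lf (g x)) = col (lf x)" using g[OF x(1) x(1)] by blast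
  ultimately show ?thesis using \<Phi> by blast
qed

text \<open>Every colour is carried by an exceptional point, and \<open>bad_rep\<close> moves such a
  point to one of the representative faces without changing the colour.\<close>

theorem card_colours:
  "finite (col ` lf ` N) \<and> card (col ` lf ` N) \<le> card \<Phi> * (d * d + 2 * stab_const d)"
proof -
  define B where "B = (\<lambda>(u, v, w). (\<lambda>x. col (lf x)) ` {x \<in> Q u v. bad x u v w})"
  have "col (lf x) \<in> (\<Union>\<phi>\<in>\<Phi>. B \<phi>)" if xN: "x \<in> N" for x
  proof -
    obtain y u v w where h: "y \<in> N" "col (lf y) = col (lf x)" "{u, v, w} \<in> F" "eg y = {u, v}" "bad y u v w"
      using not_good[OF xN] unfolding good_def by blast
    then have "y \<in> Q u v" by (simp add: Q_def)
    from bad_rep[OF h(3) this h(5)] obtain u' v' w' z where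
      "(u', v', w') \<in> \<Phi>" "z \<in> Q u' v'" "bad z u' v' w'" "col (lf z) = col (lf y)" by blast
    then have "col (lf x) \<in> B (u', v', w')" using h(2) by (auto simp: B_def image_iff intro!: bexI[of _ z])
    then show ?thesis using \<open>(u', v', w') \<in> \<Phi>\<close> by blast
  qed
  then have sub: "col ` lf ` N \<subseteq> (\<Union>\<phi>\<in>\<Phi>. B \<phi>)" by auto
  have finB: "finite (B \<phi>)" for \<phi> using finite_Q by (auto simp: B_def split: prod.splits)
  have cardB: "card (B \<phi>) \<le> d * d + 2 * stab_const d" if "\<phi> \<in> \<Phi>" for \<phi>
  proof -
    obtain u v w where \<phi>: "\<phi> = (u, v, w)" by (cases \<phi>)
    have "card (B \<phi>) \<le> card {x \<in> Q u v. bad x u v w}"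
      unfolding B_def \<phi> using finite_Q[of u v] by (auto intro!: card_image_le)
    also have "\<dots> \<le> d * d + 2 * stab_const d" using card_bad[OF \<Phi>_F] that \<phi> by blast
    finally show ?thesis .
  qed
  have fin: "finite (\<Union>\<phi>\<in>\<Phi>. B \<phi>)" using fin_\<Phi> finB by blast
  have "card (\<Union>\<phi>\<in>\<Phi>. B \<phi>) \<le> (\<Sum>\<phi>\<in>\<Phi>. card (B \<phi>))" using card_UN_le[OF fin_\<Phi>] .
  also have "\<dots> \<le> (\<Sum>\<phi>\<in>\<Phi>. d * d + 2 * stab_const d)" using cardB by (intro sum_mono) auto
  also have "\<dots> = card \<Phi> * (d * d + 2 * stab_const d)" by simp
  finally show ?thesis using fin finite_subset[OF sub fin] card_mono[OF fin sub] by linarith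
qed

end

section \<open>Realizations and edge paths\<close>

lemma continuous_on_coord: "continuous_on S (\<lambda>x::'i \<Rightarrow> real. x v)"
  using continuous_on_subset[OF continuous_on_product_coordinates subset_UNIV] .

lemma abstract_face: "abstract_complex K \<Longrightarrow> s \<in> K \<Longrightarrow> t \<subseteq> s \<Longrightarrow> t \<noteq> {} \<Longrightarrow> t \<in> K"
  unfolding abstract_complex_def by metis

lemma abstract_finite: "abstract_complex K \<Longrightarrow> s \<in> K \<Longrightarrow> finite s"
  by (simp add: abstract_complex_def)

text \<open>The basic way to find simplices below: vertices whose open stars have a common point
  span a simplex.\<close>

lemma realization_simplex:
  assumes K: "abstract_complex K" and x: "x \<in> realization K" and A: "A \<noteq> {}" "\<And>v. v \<in> A \<Longrightarrow> 0 < x v"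
  shows "A \<in> K"
proof -
  obtain s where s: "s \<in> K" "x \<in> cs s" using x by (auto simp: realization_def)
  have "A \<subseteq> s" using s(2) A(2) by (force simp: closed_simplex_def)
  then show ?thesis using abstract_face[OF K s(1)] A(1) by simp
qed

lemma vertex_point_in:
  assumes "v \<in> s" "finite s"
  shows "vp v \<in> cs s"
  using assms by (auto simp: closed_simplex_def vertex_point_def)

lemma vertex_realization: 
  assumes K: "abstract_complex K" and "v \<in> \<Union>K"
  shows "vp v \<in> realization K" "{v} \<in> K"
proof -
  obtain s where s: "s \<in> K" "v \<in> s" using assms(2) by auto
  then have "finite s" using abstract_finite[OF K] by simp
  then show "vp v \<in> realization K" using vertex_point_in[OF s(2)] s(1) by (auto simp: realization_def)
  show "{v} \<in> K" using abstract_face[OF K s(1), of "{v}"] s(2) by simp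
qed

lemma realization_support:
  assumes K: "abstract_complex K" and x: "x \<in> realization K"
  shows "\<exists>v\<in>\<Union>K. 0 < x v"
proof -
  obtain s where s: "s \<in> K" "x \<in> cs s" using x by (auto simp: realization_def)
  have "\<exists>v\<in>s. x v \<noteq> 0"
  proof (rule ccontr)
    assume "\<not> ?thesis"
    then have "sum x s = 0" by simp
    then show False using s(2) by (simp add: closed_simplex_def)
  qed
  then obtain v where "v \<in> s" "x v \<noteq> 0" by blast
  moreover have "0 \<le> x v" using s(2) by (simp add: closed_simplex_def)
  ultimately show ?thesis using s(1) by (intro bexI[of _ v]) auto
qed

definition seg :: "('v \<Rightarrow> real) \<Rightarrow> ('v \<Rightarrow> real) \<Rightarrow> real \<Rightarrow> ('v \<Rightarrow> real)" where
  "seg x y t = (\<lambda>v. (1 - t) * x v + t * y v)"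

lemma path_seg: "path (seg x y)"
  unfolding path_def seg_def by (intro continuous_intros continuous_on_coordinatewise_then_product)

lemma seg_ends [simp]: "pathstart (seg x y) = x" "pathfinish (seg x y) = y" "seg x y 0 = x" "seg x y 1 = y"
  by (auto simp: pathstart_def pathfinish_def seg_def)

lemma seg_in_simplex:
  assumes "x \<in> cs s" "y \<in> cs s" "0 \<le> t" "t \<le> 1"
  shows "seg x y t \<in> cs s"
  using assms by (auto simp: closed_simplex_def seg_def sum.distrib sum_distrib_left[symmetric])

fun edge_path :: "(nat \<Rightarrow> 'v) \<Rightarrow> nat \<Rightarrow> real \<Rightarrow> ('v \<Rightarrow> real)" where
  "edge_path w 0 = (\<lambda>t. vp (w 0))"
| "edge_path w (Suc m) = edge_path w m +++ seg (vp (w m)) (vp (w (Suc m)))"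

lemma edge_path_ends: "pathstart (edge_path w m) = vp (w 0)" "pathfinish (edge_path w m) = vp (w m)"
  by (induction m) (auto simp: pathstart_def pathfinish_def joinpaths_def seg_def)

lemma path_edge_path: "path (edge_path w m)"
proof (induction m)
  case 0
  then show ?case by (simp add: path_def)
next
  case (Suc m)
  then show ?case by (simp add: path_seg edge_path_ends)
qed

lemma edge_path_image:
  assumes K: "abstract_complex K" and w: "w 0 \<in> \<Union>K" "\<And>i. i < m \<Longrightarrow> {w i, w (Suc i)} \<in> K"
  shows "path_image (edge_path w m) \<subseteq> realization K"
  using w(2)
proof (induction m)
  case 0
  then show ?case using vertex_realization[OF K w(1)] by (auto simp: path_image_def)
next
  case (Suc m)
  have e: "{w m, w (Suc m)} \<in> K" using Suc.prems by simp
  have "path_image (seg (vp (w m)) (vp (w (Suc m)))) \<subseteq> realization K"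
    using seg_in_simplex[OF vertex_point_in vertex_point_in, of "w m" "{w m, w (Suc m)}" "w (Suc m)"] e
    by (auto simp: path_image_def realization_def)
  then show ?case using Suc by (simp add: path_image_join edge_path_ends)
qed

section \<open>Local systems on simply connected complexes\<close>

text \<open>Transport along edges, consistent on triples of vertices of a simplex, where vertices
  may coincide. There are two instances: the fibres of the covering projection, whose sections are
  deck transformations, and boolean fibres twisted by crossing parities, whose sections are
  two-colourings of the vertices.\<close>

locale local_system =
  fixes K :: "'v set set" and Fb :: "'v \<Rightarrow> 'a set" and T :: "'v \<Rightarrow> 'v \<Rightarrow> 'a \<Rightarrow> 'a"
  assumes K: "abstract_complex K"
    and T_Fb: "{u, v} \<in> K \<Longrightarrow> a \<in> Fb u \<Longrightarrow> T u v a \<in> Fb v"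
    and T_id: "{u} \<in> K \<Longrightarrow> a \<in> Fb u \<Longrightarrow> T u u a = a"
    and T_comp: "{u, v, w} \<in> K \<Longrightarrow> a \<in> Fb u \<Longrightarrow> T v w (T u v a) = T u w a"
begin

fun trs :: "(nat \<Rightarrow> 'v) \<Rightarrow> nat \<Rightarrow> 'a \<Rightarrow> 'a" where
  "trs w 0 a = a"
| "trs w (Suc m) a = T (w m) (w (Suc m)) (trs w m a)"

definition walk :: "(nat \<Rightarrow> 'v) \<Rightarrow> nat \<Rightarrow> bool" where
  "walk w m \<longleftrightarrow> w 0 \<in> \<Union>K \<and> (\<forall>i<m. {w i, w (Suc i)} \<in> K)"

lemma sub: "A \<subseteq> B \<Longrightarrow> A \<noteq> {} \<Longrightarrow> B \<in> K \<Longrightarrow> A \<in> K"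
  using abstract_face[OF K] by blast

lemma T_inv: "{u, v} \<in> K \<Longrightarrow> a \<in> Fb u \<Longrightarrow> T v u (T u v a) = a"
  using T_comp[of u v u a] T_id[of u a] sub[of "{u}" "{u, v}"] by (simp add: insert_commute)

lemma trs_Fb: "walk w m \<Longrightarrow> a \<in> Fb (w 0) \<Longrightarrow> trs w m a \<in> Fb (w m)"
  by (induction m) (auto simp: walk_def T_Fb)

lemma walk_vertex: "walk w m \<Longrightarrow> i \<le> m \<Longrightarrow> {w i} \<in> K"
proof (cases i)
  case 0
  then show "walk w m \<Longrightarrow> ?thesis" using vertex_realization(2)[OF K] by (simp add: walk_def)
next
  case (Suc j)
  then show "walk w m \<Longrightarrow> i \<le> m \<Longrightarrow> ?thesis" using sub[of "{w i}" "{w j, w (Suc j)}"] by (simp add: walk_def)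
qed

lemma trs_cong: "(\<And>i. i \<le> m \<Longrightarrow> w i = w' i) \<Longrightarrow> trs w m a = trs w' m a"
  by (induction m) auto

lemma trs_shift: "trs w (Suc m) a = trs (\<lambda>i. w (Suc i)) m (T (w 0) (w 1) a)"
proof (induction m)
  case (Suc m)
  show ?case by (subst trs.simps(2), subst Suc) simp
qed simp

lemma trs_rev:
  assumes "walk w m" "a \<in> Fb (w 0)"
  shows "trs (\<lambda>i. w (m - i)) m (trs w m a) = a"
  using assms
proof (induction m)
  case (Suc m)
  have w: "walk w m" "{w m, w (Suc m)} \<in> K" using Suc.prems(1) by (simp_all add: walk_def)
  have "trs (\<lambda>i. w (Suc m - i)) (Suc m) (trs w (Suc m) a)
      = trs (\<lambda>i. w (m - i)) m (T (w (Suc m)) (w m) (T (w m) (w (Suc m)) (trs w m a)))"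
    by (subst trs_shift) simp
  also have "\<dots> = a" using T_inv[OF w(2) trs_Fb[OF w(1) Suc.prems(2)]] Suc.IH[OF w(1) Suc.prems(2)] by simp
  finally show ?case .
qed simp

lemma trs_append: "trs (\<lambda>i. if i \<le> m then w i else w' (i - m)) (m + k) a = trs w' k (trs w m a)"
  if "w' 0 = w m"
proof (induction k)
  case 0
  have "trs (\<lambda>i. if i \<le> m then w i else w' (i - m)) m a = trs w m a" by (rule trs_cong) simp
  then show ?case by simp
next
  case (Suc k)
  then show ?case using that by (cases k) (auto simp: Suc_diff_le)
qed

lemma trs_const: "(\<And>i. i \<le> m \<Longrightarrow> w i = v) \<Longrightarrow> {v} \<in> K \<Longrightarrow> a \<in> Fb v \<Longrightarrow> trs w m a = a"
  by (induction m) (auto simp: T_id)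

text \<open>Transport along an edge path can be computed from any sufficiently regular subdivision of the
  path whose pieces lie in open stars.\<close>

lemma trs_subdivide:
  assumes "walk w m"
  shows "\<exists>p. \<forall>k>0. \<forall>x. (\<forall>i<2^p*k. \<forall>t::real. real i \<le> t * (2^p * real k) \<and> t * (2^p * real k) \<le> real i + 1 \<longrightarrow> 0 < edge_path w m t (x i)) \<longrightarrow>
    x 0 = w 0 \<and> x (2^p*k - 1) = w m \<and> (\<forall>a\<in>Fb (w 0). trs x (2^p*k - 1) a = trs w m a)"
  using assms
proof (induction m)
  case 0
  show ?case
  proof (intro exI[of _ 0] allI impI)
    fix k :: nat and x
    assume k: "0 < k" and h: "\<forall>i<2^0*k. \<forall>t::real. real i \<le> t * (2^0 * real k) \<and> t * (2^0 * real k) \<le> real i + 1 \<longrightarrow> 0 < edge_path w 0 t (x i)"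
    have x: "x i = w 0" if "i < k" for i
    proof -
      have "0 < edge_path w 0 (real i / k) (x i)" using h[rule_format, of i "real i / real k"] that k by simp
      then show ?thesis by (simp add: vertex_point_def split: if_splits)
    qed
    then show "x 0 = w 0 \<and> x (2^0*k - 1) = w 0 \<and> (\<forall>a\<in>Fb (w 0). trs x (2^0*k - 1) a = trs w 0 a)"
    proof (intro conjI ballI)
      show "x 0 = w 0" "x (2^0*k - 1) = w 0" using x k by auto
      fix a assume a: "a \<in> Fb (w 0)"
      have "trs x (k - 1) a = a"
        by (rule trs_const[OF x walk_vertex[OF 0 le_refl] a]) (use k in simp)
      then show "trs x (2^0*k - 1) a = trs w 0 a" by simp
    qed
  qed
next
  case (Suc m)
  have w: "walk w m" "{w m, w (Suc m)} \<in> K" using Suc.prems by (simp_all add: walk_def)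
  let ?u = "w m" and ?v = "w (Suc m)"
  obtain p where p: "\<forall>k>0. \<forall>x. (\<forall>i<2^p*k. \<forall>t::real. real i \<le> t * (2^p * real k) \<and> t * (2^p * real k) \<le> real i + 1 \<longrightarrow> 0 < edge_path w m t (x i)) \<longrightarrow>
    x 0 = w 0 \<and> x (2^p*k - 1) = w m \<and> (\<forall>a\<in>Fb (w 0). trs x (2^p*k - 1) a = trs w m a)"
    using Suc.IH[OF w(1)] by (elim exE)
  show ?case
  \<comment> \<open>Each \<open>+++\<close> halves the parameter of the earlier part, so the corners
    of the edge path sit at dyadic times. They are division points of every subdivision whose number
    of intervals is a suitable multiple of a power of 2.\<close>
  proof (intro exI[of _ "Suc p"] allI impI)
    fix k :: nat and x
    assume k: "0 < k" and h: "\<forall>i<2^Suc p*k. \<forall>t::real. real i \<le> t * (2^Suc p * real k) \<and> t * (2^Suc p * real k) \<le> real i + 1 \<longrightarrow> 0 < edge_path w (Suc m) t (x i)"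
    define n where "n = 2^p*k"
    have n0: "n > 0" using k by (simp add: n_def)
    have nn: "2^Suc p*k = 2*n" by (simp add: n_def)
    have rn: "real n = 2^p * real k" by (simp add: n_def)
    have h': "0 < edge_path w (Suc m) t (x i)" if "i < 2 * n" "real i \<le> t * (2 * real n)" "t * (2 * real n) \<le> real i + 1" for i and t :: real
      using h that unfolding nn by (simp add: rn mult.assoc)
    have 1: "\<forall>i<2^p*k. \<forall>t::real. real i \<le> t * (2^p * real k) \<and> t * (2^p * real k) \<le> real i + 1 \<longrightarrow> 0 < edge_path w m t (x i)"
    proof (intro allI impI, elim conjE)
      fix i and t :: real
      assume i: "i < 2^p*k" "real i \<le> t * (2^p * real k)" "t * (2^p * real k) \<le> real i + 1"
      then have i': "i < n" "real i \<le> t * n" "t * n \<le> real i + 1" by (auto simp: n_def)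
      have "t * n \<le> n" using i' by linarith
      then have "t \<le> 1" using n0 by simp
      moreover have "0 < edge_path w (Suc m) (t/2) (x i)" using h'[of i "t/2"] i' by simp
      ultimately show "0 < edge_path w m t (x i)" by (simp add: joinpaths_def)
    qed
    note P = p[THEN spec, THEN mp, OF k, THEN spec, THEN mp, OF 1, folded n_def]
    have sg: "0 < seg (vp ?u) (vp ?v) t (x (n + j))"
      if j: "j < n" "real j \<le> t * n" "t * n \<le> real j + 1" for j and t :: real
    proof -
      have "0 < edge_path w (Suc m) ((t + 1)/2) (x (n + j))"
        using h'[of "n + j" "(t+1)/2"] j by (simp add: algebra_simps)
      moreover have "0 \<le> t * n" using j(2) by linarith
      then have t0: "0 \<le> t" using n0 by (simp add: zero_le_mult_iff)
      moreover have "seg (vp ?u) (vp ?v) t = edge_path w (Suc m) ((t + 1)/2)"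
      proof (cases "t = 0")
        case True
        then show ?thesis using edge_path_ends(2)[of w m] by (simp add: joinpaths_def pathfinish_def)
      next
        case False
        then have "\<not> (t + 1)/2 \<le> 1/2" using t0 by simp
        moreover have "2 * ((t + 1)/2) - 1 = t" by (simp add: field_simps)
        ultimately show ?thesis unfolding edge_path.simps joinpaths_def by (simp only: if_False)
      qed
      ultimately show ?thesis by simp
    qed
    have xj: "x (n + j) = ?u \<or> x (n + j) = ?v" if "j < n" for j
      using sg[of j "real j / n"] that n0 by (auto simp: seg_def vertex_point_def split: if_splits)
    have xn: "x n = ?u" using sg[of 0 0] n0 by (auto simp: seg_def vertex_point_def split: if_splits)
    have xe: "x (2 * n - 1) = ?v"
    proof -
      have "0 < seg (vp ?u) (vp ?v) 1 (x (n + (n - 1)))" using sg[of "n - 1" 1] n0 by simp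
      moreover have "n + (n - 1) = 2 * n - 1" using n0 by simp
      ultimately show ?thesis by (auto simp: seg_def vertex_point_def split: if_splits)
    qed
    have uK: "{?u} \<in> K" using walk_vertex[OF w(1)] by simp
    \<comment> \<open>Along the second half only the two ends of the last edge occur as chosen
      vertices, so by \<open>T_comp\<close> the transport collected since the start
      \<open>?u\<close> of that edge collapses to a single \<open>T\<close>.\<close>
    have tr: "trs x (n + j) a = T ?u (x (n + j)) (trs w m a)" if "j < n" "a \<in> Fb (w 0)" for j a
      using that(1)
    proof (induction j)
      case 0
      have b: "trs w m a \<in> Fb ?u" using trs_Fb[OF w(1) that(2)] .
      have "trs x n a = T (x (n - 1)) (x n) (trs x (n - 1) a)" using n0 by (metis Suc_diff_1 trs.simps(2))
      then show ?case using P that(2) xn by simp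
    next
      case (Suc j)
      have b: "trs w m a \<in> Fb ?u" using trs_Fb[OF w(1) that(2)] .
      have "{?u, x (n + j), x (n + Suc j)} \<subseteq> {?u, ?v}" using xj[of j] xj[of "Suc j"] Suc.prems by auto
      then have "{?u, x (n + j), x (n + Suc j)} \<in> K" using sub[OF _ _ w(2)] by blast
      then show ?case using Suc T_comp[OF _ b] by simp
    qed
    have "trs x (2 * n - 1) a = trs w (Suc m) a" if "a \<in> Fb (w 0)" for a
    proof -
      have "n + (n - 1) = 2 * n - 1" using n0 by simp
      then show ?thesis using tr[of "n - 1" a] that xe n0 by simp
    qed
    then show "x 0 = w 0 \<and> x (2^Suc p*k - 1) = ?v \<and> (\<forall>a\<in>Fb (w 0). trs x (2^Suc p*k - 1) a = trs w (Suc m) a)"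
      unfolding nn using P xe by simp
  qed
qed

end

text \<open>The preimages of the open vertex stars cover the square, and a Lebesgue number for this
  cover bounds the mesh; cells have diameter at most \<open>2 / n\<close>. The number of cells per
  side is a multiple of \<open>q\<close> so as to match the dyadic subdivision of an edge
  path.\<close>

lemma grid_stars:
  fixes h :: "real \<times> real \<Rightarrow> ('v \<Rightarrow> real)" and q :: nat
  assumes K: "abstract_complex K" and h: "continuous_on ({0..1} \<times> {0..1}) h"
    "h ` ({0..1} \<times> {0..1}) \<subseteq> realization K" and q: "q > 0"
  obtains k :: nat and x where "k > 0" and "\<And>i j s t. i < q * k \<Longrightarrow> j < q * k \<Longrightarrow>
    real j \<le> s * real (q * k) \<Longrightarrow> s * real (q * k) \<le> real j + 1 \<Longrightarrow>
    real i \<le> t * real (q * k) \<Longrightarrow> t * real (q * k) \<le> real i + 1 \<Longrightarrow> 0 < h (s, t) (x i j)"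
proof -
  let ?sq = "{0..1::real} \<times> {0..1::real}"
  define C where "C = {W. open W \<and> (\<exists>v. \<forall>z\<in>W \<inter> ?sq. 0 < h z v)}"
  have cov: "\<exists>W\<in>C. z \<in> W" if z: "z \<in> ?sq" for z
  proof -
    obtain v where v: "0 < h z v" using realization_support[OF K, of "h z"] h(2) z by auto
    have "continuous_on ?sq (\<lambda>z. h z v)" using continuous_on_product_then_coordinatewise[OF h(1)] .
    then obtain W where W: "open W" "W \<inter> ?sq = (\<lambda>z. h z v) -` {0<..} \<inter> ?sq"
      using continuous_on_open_invariant[of ?sq "\<lambda>z. h z v"] open_greaterThan by blast
    have "W \<in> C" unfolding C_def using W by auto
    moreover have "z \<in> W" using W(2) v z by auto
    ultimately show ?thesis by blast
  qed
  have "(0, 0) \<in> ?sq" by simp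
  then have Cne: "C \<noteq> {}" using cov by blast
  have sqC: "?sq \<subseteq> \<Union>C" using cov by blast
  have comp: "compact ?sq" by (intro compact_Times) auto
  obtain \<delta> where \<delta>: "0 < \<delta>" "\<And>Y. Y \<subseteq> ?sq \<Longrightarrow> diameter Y < \<delta> \<Longrightarrow> \<exists>W\<in>C. Y \<subseteq> W"
    using Lebesgue_number_lemma[OF comp Cne sqC] unfolding C_def by blast
  obtain k0 :: nat where k0: "2 / \<delta> < real k0" using reals_Archimedean2 by blast
  define k where "k = Suc k0"
  define n where "n = real q * real k"
  have n: "n > 0" "2 / n < \<delta>"
  proof -
    have "1 * real k \<le> n" unfolding n_def using q by (intro mult_right_mono) auto
    then have kn: "real k \<le> n" by simp
    then show n0: "n > 0" by (simp add: k_def)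
    have "2 / \<delta> < n" using k0 kn by (simp add: k_def)
    then show "2 / n < \<delta>" using n0 \<delta>(1) by (simp add: field_simps)
  qed
  define cell where "cell i j = {z \<in> ?sq. real j \<le> fst z * n \<and> fst z * n \<le> real j + 1 \<and> real i \<le> snd z * n \<and> snd z * n \<le> real i + 1}" for i j :: nat
  have "\<exists>v. \<forall>z\<in>cell i j. 0 < h z v" for i j
  proof -
    have near: "\<bar>a - b\<bar> \<le> 1 / n" if "real l \<le> a * n" "a * n \<le> real l + 1" "real l \<le> b * n" "b * n \<le> real l + 1" for a b :: real and l :: nat
    proof -
      have "\<bar>a - b\<bar> * n = \<bar>a * n - b * n\<bar>" using n(1) by (simp add: abs_mult left_diff_distrib[symmetric])
      also have "\<dots> \<le> 1" using that by linarith
      finally show ?thesis using n(1) by (simp add: field_simps)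
    qed
    have dd: "dist y z \<le> 2 / n" if "y \<in> cell i j" "z \<in> cell i j" for y z
    proof -
      have "dist y z \<le> \<bar>fst y - fst z\<bar> + \<bar>snd y - snd z\<bar>"
        using sqrt_sum_squares_le_sum_abs by (simp add: dist_prod_def dist_real_def)
      also have "\<dots> \<le> 1 / n + 1 / n" using that by (intro add_mono near) (auto simp: cell_def)
      finally show ?thesis by simp
    qed
    have "diameter (cell i j) < \<delta>"
    proof -
      have "diameter (cell i j) \<le> 2 / n"
        using dd n(1) by (intro diameter_le) (auto simp: dist_norm)
      then show ?thesis using n(2) by simp
    qed
    moreover have "cell i j \<subseteq> ?sq" by (auto simp: cell_def)
    ultimately obtain W where "W \<in> C" "cell i j \<subseteq> W" using \<delta>(2) by blast
    then show ?thesis unfolding C_def cell_def by blast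
  qed
  then obtain x where x: "\<And>i j z. z \<in> cell i j \<Longrightarrow> 0 < h z (x i j)" by metis
  have unit: "0 \<le> a \<and> a \<le> 1" if "real l \<le> a * n" "a * n \<le> real l + 1" "l < q * k" for a :: real and l :: nat
  proof -
    have "real l + 1 \<le> n" using that(3) unfolding n_def by (metis Suc_leI of_nat_Suc of_nat_le_iff of_nat_mult add.commute)
    then have "a * n \<le> 1 * n" using that(2) by linarith
    then have "a \<le> 1" using mult_le_cancel_right_pos[OF n(1), of a 1] by blast
    moreover have "0 \<le> a * n" using that(1) by linarith
    then have "0 \<le> a" using n(1) by (simp add: zero_le_mult_iff)
    ultimately show ?thesis by simp
  qed
  show ?thesis
  proof (rule that[of k x])
    show "k > 0" by (simp add: k_def)
    fix i j :: nat and s t :: real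
    assume a: "i < q * k" "j < q * k" "real j \<le> s * real (q * k)" "s * real (q * k) \<le> real j + 1"
      "real i \<le> t * real (q * k)" "t * real (q * k) \<le> real i + 1"
    then have b: "real j \<le> s * n" "s * n \<le> real j + 1" "real i \<le> t * n" "t * n \<le> real i + 1"
      by (auto simp: n_def)
    have "(s, t) \<in> cell i j" using unit[OF b(1,2) a(2)] unit[OF b(3,4) a(1)] b by (simp add: cell_def)
    then show "0 < h (s, t) (x i j)" using x by blast
  qed
qed

context local_system
begin

text \<open>A null homotopy of the edge loop is cut into cells, each inside an open vertex star.
  Consecutive rows of chosen vertices have holonomies conjugate by vertical transports. The last row
  is constant and has trivial holonomy; the first row computes the transport along the given
  walk.\<close>

theorem closed_walk_trivial:
  assumes sc: "simply_connected (realization K)" and w: "walk w m" "w m = w 0" and a: "a \<in> Fb (w 0)"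
  shows "trs w m a = a"
proof -
  let ?X = "realization K"
  have w0: "w 0 \<in> \<Union>K" and wK: "\<And>i. i < m \<Longrightarrow> {w i, w (Suc i)} \<in> K" using w(1) by (auto simp: walk_def)
  let ?p = "edge_path w m" and ?c = "\<lambda>t::real. vp (w 0)"
  have "path ?p \<and> pathfinish ?p = pathstart ?p \<and> path_image ?p \<subseteq> ?X \<and>
      path ?c \<and> pathfinish ?c = pathstart ?c \<and> path_image ?c \<subseteq> ?X"
    using path_edge_path edge_path_ends[of w m] w(2) edge_path_image[OF K w0 wK] vertex_realization(1)[OF K w0]
    by (auto simp: path_def pathstart_def pathfinish_def path_image_def)
  then have "homotopic_loops ?X ?p ?c" using sc unfolding simply_connected_def by blast
  then obtain h where h: "continuous_on ({0..1::real} \<times> {0..1}) h" "h \<in> ({0..1} \<times> {0..1}) \<rightarrow> ?X"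
    "\<forall>x\<in>{0..1}. h (0, x) = ?p x" "\<forall>x\<in>{0..1}. h (1, x) = vp (w 0)"
    "\<forall>t\<in>{0..1}. pathfinish (h \<circ> Pair t) = pathstart (h \<circ> Pair t)"
    unfolding homotopic_loops by (elim exE conjE)
  have him: "h ` ({0..1} \<times> {0..1}) \<subseteq> ?X" using h(2) by blast
  obtain p where p: "\<forall>k>0. \<forall>x. (\<forall>i<2^p*k. \<forall>t::real. real i \<le> t * (2^p * real k) \<and> t * (2^p * real k) \<le> real i + 1 \<longrightarrow> 0 < edge_path w m t (x i)) \<longrightarrow>
    x 0 = w 0 \<and> x (2^p*k - 1) = w m \<and> (\<forall>a\<in>Fb (w 0). trs x (2^p*k - 1) a = trs w m a)"
    using trs_subdivide[OF w(1)] by blast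
  have q0: "(2::nat)^p > 0" by simp
  obtain k v where k: "k > 0" and v: "\<And>i j s t. i < 2^p * k \<Longrightarrow> j < 2^p * k \<Longrightarrow>
    real j \<le> s * real (2^p * k) \<Longrightarrow> s * real (2^p * k) \<le> real j + 1 \<Longrightarrow>
    real i \<le> t * real (2^p * k) \<Longrightarrow> t * real (2^p * k) \<le> real i + 1 \<Longrightarrow> 0 < h (s, t) (v i j)"
    by (rule grid_stars[OF K h(1) him q0]) blast
  define n where "n = 2^p * k"
  have n0: "n > 0" using k by (simp add: n_def)
  have v': "0 < h (s / n, t / n) (v i j)" if "i < n" "j < n" "s = j \<or> s = Suc j" "t = i \<or> t = Suc i" for i j s t :: nat
    using v[of i j "s / n" "t / n"] that n0 unfolding n_def[symmetric] by auto
  have sq: "real s / n \<in> {0..1}" if "s \<le> n" for s using that n0 by simp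
  have hX: "h (s / n, t / n) \<in> ?X" if "s \<le> n" "t \<le> n" for s t :: nat
    using him sq[OF that(1)] sq[OF that(2)] by blast
  have simp1: "A \<in> K" if "A \<noteq> {}" "s \<le> n" "t \<le> n" "\<And>u. u \<in> A \<Longrightarrow> 0 < h (s / n, t / n) u" for A and s t :: nat
    using realization_simplex[OF K hX[OF that(2,3)] that(1,4)] .
  have simp2: "A \<in> K" if "A \<noteq> {}" "s \<le> n" "t \<le> n"
    and A: "\<And>u. u \<in> A \<Longrightarrow> \<exists>i j. u = v i j \<and> i < n \<and> j < n \<and> (s = j \<or> s = Suc j) \<and> (t = i \<or> t = Suc i)"
    for A and s t :: nat
  proof (rule simp1[OF that(1-3)])
    fix u assume "u \<in> A"
    from A[OF this] obtain i j where "u = v i j" "i < n" "j < n" "s = j \<or> s = Suc j" "t = i \<or> t = Suc i" by blast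
    then show "0 < h (real s / real n, real t / real n) u" using v' by blast
  qed
  \<comment> \<open>Four cells share a corner of the grid, so the image of that corner lies in all
    four stars.\<close>
  have e4: "{v i j, v (Suc i) j, v i (Suc j), v (Suc i) (Suc j)} \<in> K" if "Suc i < n" "Suc j < n" for i j
  proof (rule simp2[of _ "Suc j" "Suc i"])
    fix u assume "u \<in> {v i j, v (Suc i) j, v i (Suc j), v (Suc i) (Suc j)}"
    then obtain i' j' where "u = v i' j'" "i' = i \<or> i' = Suc i" "j' = j \<or> j' = Suc j" by blast
    then show "\<exists>i' j'. u = v i' j' \<and> i' < n \<and> j' < n \<and> (Suc j = j' \<or> Suc j = Suc j') \<and> (Suc i = i' \<or> Suc i = Suc i')"
      using that by (intro exI[of _ i'] exI[of _ j']) auto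
  qed (use that in auto)
  have per: "h (s / n, 1) = h (s / n, 0)" if "s \<le> n" for s :: nat
    using h(5) sq[OF that] by (auto simp: pathfinish_def pathstart_def)
  \<comment> \<open>Each row is a loop, so the left and right borders of the grid have the same
    images and the cells of the last and first columns can be treated as adjacent.\<close>
  have c4: "{v (n - 1) j, v 0 j, v (n - 1) (Suc j), v 0 (Suc j)} \<in> K" if "Suc j < n" for j
  proof (rule simp1[of _ "Suc j" 0])
    fix u assume u: "u \<in> {v (n - 1) j, v 0 j, v (n - 1) (Suc j), v 0 (Suc j)}"
    have A: "0 < h (Suc j / n, 0 / n) (v 0 j')" if "j' = j \<or> j' = Suc j" for j'
      using v'[of 0 j' "Suc j" 0] that \<open>Suc j < n\<close> n0 by auto
    have "0 < h (Suc j / n, n / n) (v (n - 1) j')" if "j' = j \<or> j' = Suc j" for j'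
      using v'[of "n - 1" j' "Suc j" n] that \<open>Suc j < n\<close> n0 by auto
    then have B: "0 < h (Suc j / n, 0 / n) (v (n - 1) j')" if "j' = j \<or> j' = Suc j" for j'
      using per[of "Suc j"] that \<open>Suc j < n\<close> n0 by simp
    show "0 < h (real (Suc j) / real n, real 0 / real n) u" using u A B by auto
  qed (use that in auto)
  have walkrow: "walk (\<lambda>i. v i j) i" if "i < n" "j < n" for i j
  proof -
    have "{v 0 j} \<in> K" 
    proof (rule simp2[of _ j 0])
      show "\<exists>i' j'. u = v i' j' \<and> i' < n \<and> j' < n \<and> (j = j' \<or> j = Suc j') \<and> (0 = i' \<or> 0 = Suc i')"
        if "u \<in> {v 0 j}" for u using that \<open>j < n\<close> n0 by (intro exI[of _ 0] exI[of _ j]) simp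
    qed (use \<open>j < n\<close> in auto)
    moreover have "{v l j, v (Suc l) j} \<in> K" if "l < i" for l
    proof (rule simp2[of _ j "Suc l"])
      have "l < n" "Suc l < n" using that \<open>i < n\<close> by auto
      fix u assume "u \<in> {v l j, v (Suc l) j}"
      then obtain i' where "u = v i' j" "i' = l \<or> i' = Suc l" by blast
      then show "\<exists>i' j'. u = v i' j' \<and> i' < n \<and> j' < n \<and> (j = j' \<or> j = Suc j') \<and> (Suc l = i' \<or> Suc l = Suc i')"
        using \<open>j < n\<close> \<open>l < n\<close> \<open>Suc l < n\<close> by (intro exI[of _ i'] exI[of _ j]) auto
    qed (use that \<open>i < n\<close> \<open>j < n\<close> in auto)
    ultimately show ?thesis unfolding walk_def by blast
  qed
  \<comment> \<open>The holonomy of row \<open>j\<close>, including the closing step from the last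
    column back to the first.\<close>
  define H where "H j b = T (v (n - 1) j) (v 0 j) (trs (\<lambda>i. v i j) (n - 1) b)" for j b
  have vert: "trs (\<lambda>i. v i (Suc j)) i (T (v 0 j) (v 0 (Suc j)) b) = T (v i j) (v i (Suc j)) (trs (\<lambda>i. v i j) i b)"
    if "i < n" "Suc j < n" "b \<in> Fb (v 0 j)" for i j b
    using that(1)
  proof (induction i)
    case (Suc i)
    let ?y = "trs (\<lambda>i. v i j) i b"
    have y: "?y \<in> Fb (v i j)" using trs_Fb[OF walkrow[of i j]] Suc.prems that by simp
    note e = e4[OF Suc.prems that(2)]
    have "T (v i (Suc j)) (v (Suc i) (Suc j)) (T (v i j) (v i (Suc j)) ?y) = T (v i j) (v (Suc i) (Suc j)) ?y"
      by (rule T_comp[OF sub[OF _ _ e] y]) auto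
    moreover have "T (v (Suc i) j) (v (Suc i) (Suc j)) (T (v i j) (v (Suc i) j) ?y) = T (v i j) (v (Suc i) (Suc j)) ?y"
      by (rule T_comp[OF sub[OF _ _ e] y]) auto
    ultimately show ?case using Suc by simp
  qed simp
  have step: "H (Suc j) (T (v 0 j) (v 0 (Suc j)) b) = T (v 0 j) (v 0 (Suc j)) (H j b)"
    if "Suc j < n" "b \<in> Fb (v 0 j)" for j b
  proof -
    let ?y = "trs (\<lambda>i. v i j) (n - 1) b"
    have y: "?y \<in> Fb (v (n - 1) j)" using trs_Fb[OF walkrow[of "n - 1" j]] that n0 by simp
    note e = c4[OF that(1)]
    have "T (v (n - 1) (Suc j)) (v 0 (Suc j)) (T (v (n - 1) j) (v (n - 1) (Suc j)) ?y) = T (v (n - 1) j) (v 0 (Suc j)) ?y"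
      by (rule T_comp[OF sub[OF _ _ e] y]) auto
    moreover have "T (v 0 j) (v 0 (Suc j)) (T (v (n - 1) j) (v 0 j) ?y) = T (v (n - 1) j) (v 0 (Suc j)) ?y"
      by (rule T_comp[OF sub[OF _ _ e] y]) auto
    ultimately show ?thesis unfolding H_def using vert[of "n - 1" j b] that n0 by simp
  qed
  have top: "H (n - 1) b = b" if "b \<in> Fb (v 0 (n - 1))" for b
  proof -
    have c: "v i (n - 1) = w 0" if "i < n" for i
    proof -
      have "0 < h (n / n, i / n) (v i (n - 1))" using v'[of i "n - 1" n i] that n0 by auto
      moreover have "h (n / n, i / n) = vp (w 0)" using h(4) sq[of i] that n0 by simp
      ultimately show ?thesis by (simp add: vertex_point_def split: if_splits)
    qed
    have K0: "{w 0} \<in> K" using walk_vertex[OF w(1), of 0] by simp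
    have "trs (\<lambda>i. v i (n - 1)) (n - 1) b = b"
      by (rule trs_const[of _ _ "w 0"]) (use c K0 that n0 in auto)
    then show ?thesis unfolding H_def using c[of 0] c[of "n - 1"] n0 T_id[OF K0] that by simp
  qed
  \<comment> \<open>Triviality descends from the last row to the first, since holonomies of adjacent
    rows are conjugate by an invertible transport; \<open>l\<close> counts rows from the
    end.\<close>
  have all: "\<forall>b\<in>Fb (v 0 (n - 1 - l)). H (n - 1 - l) b = b" if "l < n" for l
    using that
  proof (induction l)
    case 0
    then show ?case using top by simp
  next
    case (Suc l)
    define j where "j = n - 1 - Suc l"
    have j: "Suc j = n - 1 - l" "Suc j < n" using Suc.prems by (auto simp: j_def)
    have e: "{v 0 j, v 0 (Suc j)} \<in> K" by (rule sub[OF _ _ c4[OF j(2)]]) auto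
    show ?case unfolding j_def[symmetric]
    proof
      fix b assume b: "b \<in> Fb (v 0 j)"
      have "T (v 0 j) (v 0 (Suc j)) b \<in> Fb (v 0 (Suc j))" using T_Fb[OF e b] .
      then have "H (Suc j) (T (v 0 j) (v 0 (Suc j)) b) = T (v 0 j) (v 0 (Suc j)) b"
        using Suc j(1) by simp
      then have eq: "T (v 0 j) (v 0 (Suc j)) (H j b) = T (v 0 j) (v 0 (Suc j)) b" using step[OF j(2) b] by simp
      have "{v (n - 1) j, v 0 j} \<in> K" by (rule sub[OF _ _ c4[OF j(2)]]) auto
      then have "H j b \<in> Fb (v 0 j)" unfolding H_def
        using T_Fb trs_Fb[OF walkrow[of "n - 1" j] b] j(2) n0 by simp
      then show "H j b = b" using T_inv[OF e] b eq by metis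
    qed
  qed
  have H0: "H 0 b = b" if "b \<in> Fb (v 0 0)" for b using all[of "n - 1"] n0 that by simp
  have "\<forall>i<2^p*k. \<forall>t::real. real i \<le> t * (2^p * real k) \<and> t * (2^p * real k) \<le> real i + 1 \<longrightarrow> 0 < edge_path w m t (v i 0)"
  proof (intro allI impI, elim conjE)
    fix i and t :: real
    assume i: "i < 2^p*k" "real i \<le> t * (2^p * real k)" "t * (2^p * real k) \<le> real i + 1"
    have "0 < h (0, t) (v i 0)" using v[of i 0 0 t] i n0 by (simp add: n_def)
    moreover have "t \<in> {0..1}"
    proof -
      have "real i + 1 \<le> real n" using i(1) unfolding n_def[symmetric] by linarith
      moreover have rn: "real n = 2^p * real k" by (simp add: n_def)
      have "real i \<le> t * real n" "t * real n \<le> real i + 1" using i(2,3) unfolding rn .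
      ultimately have "t * real n \<le> 1 * real n" "0 \<le> t * real n" by linarith+
      then show ?thesis using n0 mult_le_cancel_right_pos[of "real n" t 1] by (simp add: zero_le_mult_iff)
    qed
    ultimately show "0 < edge_path w m t (v i 0)" using h(3) by simp
  qed
  then have b: "v 0 0 = w 0 \<and> v (n - 1) 0 = w m \<and> (\<forall>a\<in>Fb (w 0). trs (\<lambda>i. v i 0) (n - 1) a = trs w m a)"
    using p[rule_format, OF k, of "\<lambda>i. v i 0"] unfolding n_def by simp
  have fb: "trs w m a \<in> Fb (w 0)" using trs_Fb[OF w(1) a] w(2) by simp
  have "a = H 0 a" using H0 a b by simp
  also have "\<dots> = T (w 0) (w 0) (trs w m a)" unfolding H_def using b a w(2) by simp
  also have "\<dots> = trs w m a" using T_id[OF _ fb] walk_vertex[OF w(1), of 0] by simp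
  finally show ?thesis by simp
qed

lemma walk_append:
  assumes "walk w m" "walk w' k" "w' 0 = w m"
  shows "walk (\<lambda>i. if i \<le> m then w i else w' (i - m)) (m + k)"
  unfolding walk_def
proof (intro conjI allI impI)
  show "(if 0 \<le> m then w 0 else w' (0 - m)) \<in> \<Union>K" using assms(1) by (simp add: walk_def)
  fix i assume i: "i < m + k"
  consider "Suc i \<le> m" | "i = m" | "m < i" by linarith
  then show "{if i \<le> m then w i else w' (i - m), if Suc i \<le> m then w (Suc i) else w' (Suc i - m)} \<in> K"
  proof cases
    case 1
    then show ?thesis using assms(1) by (simp add: walk_def)
  next
    case 2
    then have "{w' 0, w' (Suc 0)} \<in> K" using assms(2) i by (simp add: walk_def)
    then show ?thesis using 2 assms(3) by simp
  next
    case 3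
    then have "{w' (i - m), w' (Suc (i - m))} \<in> K" using assms(2) i by (simp add: walk_def)
    then show ?thesis using 3 by (simp add: Suc_diff_le)
  qed
qed

lemma walk_rev:
  assumes "walk w m"
  shows "walk (\<lambda>i. w (m - i)) m"
  unfolding walk_def
proof (intro conjI allI impI)
  show "w (m - 0) \<in> \<Union>K" using walk_vertex[OF assms, of m] by auto
  fix i assume i: "i < m"
  then have "{w (m - Suc i), w (Suc (m - Suc i))} \<in> K" using assms unfolding walk_def by simp
  then show "{w (m - i), w (m - Suc i)} \<in> K" using i by (simp add: Suc_diff_Suc insert_commute)
qed

lemma walk_independent:
  assumes sc: "simply_connected (realization K)" and w: "walk w m" "walk w' m'" "w 0 = w' 0" "w m = w' m'"
    and a: "a \<in> Fb (w 0)"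
  shows "trs w m a = trs w' m' a"
proof -
  let ?r = "\<lambda>i. w (m - i)" and ?b = "trs w m a"
  let ?c = "\<lambda>i. if i \<le> m then ?r i else w' (i - m)"
  have j: "w' 0 = ?r m" using w by simp
  have b: "?b \<in> Fb (w m)" using trs_Fb[OF w(1) a] .
  have "trs ?c (m + m') ?b = trs w' m' (trs ?r m ?b)" using trs_append[of w' ?r m m' ?b] j by simp
  also have "\<dots> = trs w' m' a" using trs_rev[OF w(1) a] by simp
  finally have 1: "trs ?c (m + m') ?b = trs w' m' a" .
  have "trs ?c (m + m') ?b = ?b"
  proof (rule closed_walk_trivial[OF sc walk_append[OF walk_rev[OF w(1)] w(2) j]])
    show "(if m + m' \<le> m then w (m - (m + m')) else w' (m + m' - m)) = (if 0 \<le> m then w (m - 0) else w' (0 - m))"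
      using w(3,4) by auto
  qed (use b in simp)
  then show ?thesis using 1 by simp
qed

text \<open>A free homotopy between the constant loops at \<open>u\<close> and \<open>v\<close>
  contains a path from one to the other. The open stars of reachable and of unreachable vertices are
  disjoint, since vertices with meeting stars are adjacent or equal, and would disconnect the
  parameter interval.\<close>

lemma walk_exists:
  assumes sc: "simply_connected (realization K)" and uv: "u \<in> \<Union>K" "v \<in> \<Union>K"
  shows "\<exists>w m. walk w m \<and> w 0 = u \<and> w m = v"
proof (rule ccontr)
  assume no: "\<not> ?thesis"
  define R where "R = {v \<in> \<Union>K. \<exists>w m. walk w m \<and> w 0 = u \<and> w m = v}"
  have "walk (\<lambda>_. u) 0" using uv by (simp add: walk_def)
  then have uR: "u \<in> R" using uv by (auto simp: R_def)
  have vR: "v \<notin> R" using no by (auto simp: R_def)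
  have step: "y \<in> R" if xy: "x \<in> R" "{x, y} \<in> K" for x y
  proof -
    obtain w m where w: "walk w m" "w 0 = u" "w m = x" using xy by (auto simp: R_def)
    have "walk (\<lambda>i. if i \<le> m then w i else (\<lambda>i. if i = 0 then x else y) (i - m)) (m + 1)"
      by (rule walk_append[OF w(1)]) (use xy w in \<open>auto simp: walk_def R_def\<close>)
    then have "\<exists>w m. walk w m \<and> w 0 = u \<and> w m = y"
      using w(2) by (intro exI[of _ "\<lambda>i. if i \<le> m then w i else (\<lambda>i. if i = 0 then x else y) (i - m)"] exI[of _ "m + 1"]) auto
    then show ?thesis using xy(2) by (auto simp: R_def)
  qed
  let ?X = "realization K"
  let ?c = "\<lambda>u (t::real). vp u"
  have loop: "path (?c x) \<and> pathfinish (?c x) = pathstart (?c x) \<and> path_image (?c x) \<subseteq> ?X" if "x \<in> \<Union>K" for x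
    using vertex_realization(1)[OF K that] by (auto simp: path_def pathstart_def pathfinish_def path_image_def)
  have "homotopic_loops ?X (?c u) (?c v)"
    using sc loop[OF uv(1)] loop[OF uv(2)] unfolding simply_connected_def by blast
  then obtain h where h: "continuous_on ({0..1::real} \<times> {0..1::real}) h" "h \<in> ({0..1} \<times> {0..1}) \<rightarrow> ?X"
    "\<forall>x\<in>{0..1}. h (0, x) = vp u" "\<forall>x\<in>{0..1}. h (1, x) = vp v"
    unfolding homotopic_loops by blast
  define g where "g t = h (t, 0)" for t :: real
  have cg: "continuous_on {0..1} g" unfolding g_def
    by (rule continuous_on_compose2[OF h(1)]) (auto intro!: continuous_intros)
  have gX: "g t \<in> ?X" if "t \<in> {0..1}" for t using h(2) that by (auto simp: g_def)
  define A where "A = {t \<in> {0..1}. \<exists>x\<in>R. 0 < g t x}"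
  define B where "B = {t \<in> {0..1}. \<exists>x\<in>\<Union>K - R. 0 < g t x}"
  have op: "openin (top_of_set {0..1}) {t \<in> {0..1}. 0 < g t x}" for x
  proof -
    have "continuous_on {0..1} (\<lambda>t. g t x)" using continuous_on_product_then_coordinatewise[OF cg] .
    then have "openin (top_of_set {0..1}) ({0..1} \<inter> (\<lambda>t. g t x) -` {0<..})"
      using continuous_on_open_gen[of "\<lambda>t. g t x" "{0..1}" UNIV] by (simp add: continuous_openin_preimage_gen)
    moreover have "{0..1} \<inter> (\<lambda>t. g t x) -` {0<..} = {t \<in> {0..1}. 0 < g t x}" by auto
    ultimately show ?thesis by simp
  qed
  have "A = (\<Union>x\<in>R. {t \<in> {0..1}. 0 < g t x})" "B = (\<Union>x\<in>\<Union>K - R. {t \<in> {0..1}. 0 < g t x})"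
    by (auto simp: A_def B_def)
  then have "openin (top_of_set {0..1}) A" "openin (top_of_set {0..1}) B" using op by auto
  moreover have "A \<inter> B = {}"
  proof (rule ccontr)
    assume "A \<inter> B \<noteq> {}"
    then obtain t x y where t: "t \<in> {0..1}" "x \<in> R" "0 < g t x" "y \<in> \<Union>K - R" "0 < g t y"
      by (auto simp: A_def B_def)
    have "{x, y} \<in> K" using realization_simplex[OF K gX[OF t(1)], of "{x, y}"] t by auto
    then show False using step t by blast
  qed
  moreover have "{0..1} \<subseteq> A \<union> B"
  proof
    fix t :: real assume t: "t \<in> {0..1}"
    from realization_support[OF K gX[OF t]] obtain y where "y \<in> \<Union>K" "0 < g t y" by blast
    then show "t \<in> A \<union> B" using t unfolding A_def B_def by blast
  qed
  moreover have "0 \<in> A" using h(3) uR by (auto simp: A_def g_def vertex_point_def)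
  moreover have "1 \<in> B" using h(4) vR uv by (auto simp: B_def g_def vertex_point_def)
  ultimately show False using connected_openin[of "{0..1::real}"] by (metis connected_Icc empty_iff)
qed

text \<open>The value at a vertex is the transport of \<open>a\<close> along any walk from
  \<open>v0\<close>; it does not depend on the walk by \<open>walk_independent\<close>.\<close>

theorem section_exists:
  assumes sc: "simply_connected (realization K)" and v0: "v0 \<in> \<Union>K" and a: "a \<in> Fb v0"
  obtains s where "s v0 = a" "\<And>v. v \<in> \<Union>K \<Longrightarrow> s v \<in> Fb v" "\<And>u v. {u, v} \<in> K \<Longrightarrow> T u v (s u) = s v"
proof -
  define P where "P v b \<longleftrightarrow> (\<exists>w m. walk w m \<and> w 0 = v0 \<and> w m = v \<and> trs w m a = b)" for v b
  define s where "s v = (SOME b. P v b)" for v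
  have ex: "\<exists>b. P v b" if "v \<in> \<Union>K" for v
    using walk_exists[OF sc v0 that] unfolding P_def by blast
  have un: "b = b'" if b: "P v b" "P v b'" for v b b'
  proof -
    obtain w m where w: "walk w m" "w 0 = v0" "w m = v" "trs w m a = b" using b(1) unfolding P_def by blast
    obtain w' m' where w': "walk w' m'" "w' 0 = v0" "w' m' = v" "trs w' m' a = b'" using b(2) unfolding P_def by blast
    show ?thesis using walk_independent[OF sc w(1) w'(1)] w w' a by simp
  qed
  have s: "s v = b" if "P v b" for v b
    unfolding s_def by (rule some_equality[of "P v", OF that]) (rule un[OF _ that])
  show ?thesis
  proof (rule that)
    have "P v0 a" unfolding P_def using v0 by (intro exI[of _ "\<lambda>_. v0"] exI[of _ 0]) (auto simp: walk_def)
    then show "s v0 = a" by (rule s)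
    show "s v \<in> Fb v" if vK: "v \<in> \<Union>K" for v
    proof -
      obtain b where b: "P v b" using ex[OF vK] by blast
      then obtain w m where "walk w m" "w 0 = v0" "w m = v" "trs w m a = b" unfolding P_def by blast
      then have "b \<in> Fb v" using trs_Fb[of w m a] a by simp
      then show ?thesis using s[OF b] by simp
    qed
    show "T u v (s u) = s v" if uv: "{u, v} \<in> K" for u v
    proof -
      obtain b where b: "P u b" using ex[of u] uv by blast
      then obtain w m where w: "walk w m" "w 0 = v0" "w m = u" "trs w m a = b" unfolding P_def by blast
      define w' where "w' i = (if i \<le> m then w i else v)" for i
      have "walk w' (Suc m)" using w uv by (auto simp: walk_def w'_def le_Suc_eq less_Suc_eq)
      moreover have "trs w' (Suc m) a = T u v b"
        using w trs_cong[of m w' w a] by (simp add: w'_def)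
      moreover have "w' 0 = v0" "w' (Suc m) = v" using w by (auto simp: w'_def)
      ultimately have "P v (T u v b)" unfolding P_def by blast
      then show ?thesis using s[OF b] s by simp
    qed
  qed
qed

end

section \<open>Simplicial maps on realizations\<close>

lemma open_near:
  fixes \<gamma> :: "real \<Rightarrow> 'a::topological_space"
  assumes "continuous_on {0..1} \<gamma>" "\<gamma> ` {0..1} \<subseteq> X" "openin (top_of_set X) U" "\<gamma> t0 \<in> U" "t0 \<in> {0..1}"
  obtains \<epsilon> where "\<epsilon> > 0" "\<And>t. t \<in> {0..1} \<Longrightarrow> \<bar>t - t0\<bar> < \<epsilon> \<Longrightarrow> \<gamma> t \<in> U"
proof -
  have "\<gamma> \<in> {0..1} \<rightarrow> X" using assms(2) by blast
  then have "openin (top_of_set {0..1}) ({0..1} \<inter> \<gamma> -` U)"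
    using continuous_openin_preimage[OF assms(1) _ assms(3)] by blast
  then obtain \<epsilon> where "\<epsilon> > 0" "ball t0 \<epsilon> \<inter> {0..1} \<subseteq> {0..1} \<inter> \<gamma> -` U"
    using assms(4,5) by (force simp: openin_contains_ball)
  then show ?thesis using that[of \<epsilon>] by (auto simp: dist_real_def abs_minus_commute subset_iff)
qed

lemma continuous_seg: "continuous_on S (seg x y)"
  unfolding seg_def by (intro continuous_intros continuous_on_coordinatewise_then_product)

definition bary :: "'v set \<Rightarrow> 'v \<Rightarrow> real" where
  "bary s v = (if v \<in> s then 1 / card s else 0)"

lemma bary_in: "finite s \<Longrightarrow> s \<noteq> {} \<Longrightarrow> bary s \<in> cs s"
  by (auto simp: bary_def closed_simplex_def)

lemma realization_map_simplex:
  assumes "x \<in> cs s" "finite s"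
  shows "realization_map p x v = (\<Sum>w\<in>{w\<in>s. p w = v}. x w)"
  unfolding realization_map_def
  by (rule sum.mono_neutral_left) (use assms in \<open>auto simp: closed_simplex_def\<close>)

lemma realization_map_inj:
  assumes "x \<in> cs s" "finite s" "inj_on p s"
  shows "w \<in> s \<Longrightarrow> realization_map p x (p w) = x w" "v \<notin> p ` s \<Longrightarrow> realization_map p x v = 0"
proof -
  assume w: "w \<in> s"
  then have "{w' \<in> s. p w' = p w} = {w}" using assms(3) by (auto dest: inj_onD)
  then show "realization_map p x (p w) = x w" using realization_map_simplex[OF assms(1,2), of p "p w"] by simp
next
  assume v: "v \<notin> p ` s"
  then have "{w' \<in> s. p w' = v} = {}" by auto
  then show "realization_map p x v = 0" unfolding realization_map_simplex[OF assms(1,2)] by (simp only: sum.empty)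
qed

lemma realization_map_closed:
  assumes "x \<in> cs s" "finite s" "inj_on p s"
  shows "realization_map p x \<in> cs (p ` s)"
proof -
  have "0 \<le> realization_map p x v" for v
    unfolding realization_map_simplex[OF assms(1,2)] using assms(1) by (intro sum_nonneg) (auto simp: closed_simplex_def)
  moreover have "sum (realization_map p x) (p ` s) = 1"
    unfolding sum.reindex[OF assms(3)] using realization_map_inj(1)[OF assms] assms(1) by (simp add: closed_simplex_def)
  ultimately show ?thesis using realization_map_inj(2)[OF assms] by (simp add: closed_simplex_def)
qed

lemma seg_vertex_pos: "0 < t \<Longrightarrow> t < 1 \<Longrightarrow> finite s \<Longrightarrow> v \<in> s \<Longrightarrow> 0 < seg (vp w) (bary s) t v"
proof -
  assume "0 < t" "t < 1" "finite s" "v \<in> s"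
  moreover from this have "0 < card s" by (auto simp: card_gt_0_iff)
  ultimately show ?thesis by (auto simp: seg_def vertex_point_def bary_def intro!: add_pos_pos)
qed

lemma seg_vertex_out: "w \<in> s \<Longrightarrow> v \<notin> s \<Longrightarrow> seg (vp w) (bary s) t v = 0"
  by (auto simp: seg_def vertex_point_def bary_def)

section \<open>Combinatorics of the universal cover\<close>

locale ucover =
  fixes K :: "'v set set" and Kt :: "'w set set" and p :: "'w \<Rightarrow> 'v"
  assumes K: "abstract_complex K" and uc: "universal_cover K Kt p"
begin

abbreviation rm where "rm \<equiv> realization_map p"

lemma Kt: "abstract_complex Kt" and p_simp: "s \<in> Kt \<Longrightarrow> p ` s \<in> K"
  and cov: "covering_space (realization Kt) rm (realization K)"
  and sc: "simply_connected (realization Kt)"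
  using uc by (auto simp: universal_cover_def)

lemma sheet:
  assumes "x \<in> realization Kt"
  obtains U T q where "openin (top_of_set (realization Kt)) U" "x \<in> U" "openin (top_of_set (realization K)) T"
    "homeomorphism U T rm q"
proof -
  have "rm x \<in> realization K" using covering_space_imp_surjective[OF cov] assms by blast
  then obtain T v where T: "rm x \<in> T" "openin (top_of_set (realization K)) T" "\<Union>v = realization Kt \<inter> rm -` T"
    "\<forall>u\<in>v. openin (top_of_set (realization Kt)) u" "\<forall>u\<in>v. \<exists>q. homeomorphism u T rm q"
    using cov unfolding covering_space_def by metis
  then obtain U where "U \<in> v" "x \<in> U" using assms by blast
  then show ?thesis using T(2,4,5) that by blast
qed

text \<open>On a collapsed edge the projection would be constant, contradicting its injectivity on a
  sheet around the midpoint.\<close>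

lemma inj_p:
  assumes s: "s \<in> Kt"
  shows "inj_on p s"
proof (rule inj_onI, rule ccontr)
  fix u w assume h: "u \<in> s" "w \<in> s" "p u = p w" "u \<noteq> w"
  have e: "{u, w} \<in> Kt" using abstract_face[OF Kt s, of "{u, w}"] h by auto
  let ?g = "seg (vp u) (vp w)"
  have gin: "?g t \<in> cs {u, w}" if "t \<in> {0..1}" for t
    using seg_in_simplex[OF vertex_point_in vertex_point_in, of u "{u, w}" w t] that by simp
  then have g: "?g ` {0..1} \<subseteq> realization Kt" using e by (auto simp: realization_def)
  have const: "rm (?g t) = vp (p u)" if t: "t \<in> {0..1}" for t
  proof
    fix v
    have "{w' \<in> {u, w}. p w' = v} = (if v = p u then {u, w} else {})" using h(3) by auto
    then have "rm (?g t) v = (if v = p u then ?g t u + ?g t w else 0)"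
      using realization_map_simplex[OF gin[OF t], of p v] h(4) by simp
    moreover have "?g t u + ?g t w = 1" using h(4) by (simp add: seg_def vertex_point_def)
    ultimately show "rm (?g t) v = vp (p u) v" by (simp add: vertex_point_def)
  qed
  have half: "(1/2::real) \<in> {0..1}" by simp
  then have "?g (1/2) \<in> realization Kt" using g by blast
  then obtain U T q where U: "openin (top_of_set (realization Kt)) U" "?g (1/2) \<in> U" "homeomorphism U T rm q"
    using sheet by metis
  obtain \<epsilon> where \<epsilon>: "\<epsilon> > 0" "\<And>t. t \<in> {0..1} \<Longrightarrow> \<bar>t - 1/2\<bar> < \<epsilon> \<Longrightarrow> ?g t \<in> U"
    using open_near[OF continuous_seg g U(1,2) half] by blast
  define t where "t = 1/2 + min (\<epsilon>/2) (1/2)"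
  have t: "t \<in> {0..1}" "\<bar>t - 1/2\<bar> < \<epsilon>" "t > 1/2" using \<epsilon>(1) by (auto simp: t_def min_def)
  have "?g t = ?g (1/2)"
    using const[OF t(1)] const[OF half] \<epsilon>(2)[OF t(1,2)] U(2) homeomorphism_apply1[OF U(3)] by metis
  then have "?g t u = ?g (1/2) u" by simp
  then show False using t(3) h(4) by (simp add: seg_def vertex_point_def)
qed

lemma fin_Kt: "s \<in> Kt \<Longrightarrow> finite s" and ne_Kt: "s \<in> Kt \<Longrightarrow> s \<noteq> {}"
  using Kt by (auto simp: abstract_complex_def)

lemma rm_inj: "x \<in> cs s \<Longrightarrow> s \<in> Kt \<Longrightarrow> w \<in> s \<Longrightarrow> rm x (p w) = x w"
  by (rule realization_map_inj(1)[OF _ fin_Kt inj_p])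

lemma rm_out: "x \<in> cs s \<Longrightarrow> s \<in> Kt \<Longrightarrow> v \<notin> p ` s \<Longrightarrow> rm x v = 0"
  by (rule realization_map_inj(2)[OF _ fin_Kt inj_p])

lemma rm_closed: "x \<in> cs s \<Longrightarrow> s \<in> Kt \<Longrightarrow> rm x \<in> cs (p ` s)"
  by (rule realization_map_closed[OF _ fin_Kt inj_p])

lemma rm_eqI:
  assumes "x \<in> cs s" "s \<in> Kt" "\<And>w. w \<in> s \<Longrightarrow> y (p w) = x w" "\<And>v. v \<notin> p ` s \<Longrightarrow> y v = 0"
  shows "rm x = y"
proof
  fix v show "rm x v = y v"
    using rm_inj[OF assms(1,2)] rm_out[OF assms(1,2)] assms(3,4) by (cases "v \<in> p ` s") auto
qed

text \<open>Points a little way from \<open>w\<close> towards the two barycentres have the same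
  image and lie in one sheet around \<open>w\<close>, so they coincide; the support of such a point
  recovers the simplex.\<close>

lemma lift_unique:
  assumes s: "s1 \<in> Kt" "s2 \<in> Kt" "w \<in> s1" "w \<in> s2" "p ` s1 = p ` s2"
  shows "s1 = s2"
proof -
  let ?g = "\<lambda>s. seg (vp w) (bary s)"
  have gin: "?g s t \<in> cs s" if "s = s1 \<or> s = s2" "t \<in> {0..1}" for s t
    using that s fin_Kt ne_Kt by (auto intro!: seg_in_simplex vertex_point_in bary_in)
  have g: "?g s ` {0..1} \<subseteq> realization Kt" if "s = s1 \<or> s = s2" for s
    using gin[OF that] that s by (auto simp: realization_def)
  have cards: "card (p ` s) = card s" if "s = s1 \<or> s = s2" for s
    using that s inj_p by (auto simp: card_image)
  have push: "rm (?g s t) = seg (vp (p w)) (bary (p ` s)) t" if "s = s1 \<or> s = s2" "t \<in> {0..1}" for s t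
  proof (rule rm_eqI[OF gin[OF that]])
    show "s \<in> Kt" using that s by auto
    show "seg (vp (p w)) (bary (p ` s)) t (p w') = ?g s t w'" if "w' \<in> s" for w'
    proof -
      have "p w' = p w \<longleftrightarrow> w' = w" using inj_p[OF \<open>s \<in> Kt\<close>] that s \<open>s = s1 \<or> s = s2\<close> by (auto dest: inj_onD)
      then show ?thesis using that cards[OF \<open>s = s1 \<or> s = s2\<close>] by (simp add: seg_def vertex_point_def bary_def)
    qed
    show "seg (vp (p w)) (bary (p ` s)) t v = 0" if "v \<notin> p ` s" for v
      by (rule seg_vertex_out) (use that s \<open>s = s1 \<or> s = s2\<close> in auto)
  qed
  have z: "(0::real) \<in> {0..1}" by simp
  have "vp w \<in> realization Kt" using g[of s1] z by (metis image_subset_iff seg_ends(3))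
  then obtain U T q where U: "openin (top_of_set (realization Kt)) U" "vp w \<in> U" "homeomorphism U T rm q"
    using sheet by metis
  have U0: "?g s 0 \<in> U" for s using U(2) by simp
  obtain \<epsilon>1 where \<epsilon>1: "\<epsilon>1 > 0" "\<And>t. t \<in> {0..1} \<Longrightarrow> \<bar>t - 0\<bar> < \<epsilon>1 \<Longrightarrow> ?g s1 t \<in> U"
    using open_near[OF continuous_seg g[of s1] U(1) U0 z] by blast
  obtain \<epsilon>2 where \<epsilon>2: "\<epsilon>2 > 0" "\<And>t. t \<in> {0..1} \<Longrightarrow> \<bar>t - 0\<bar> < \<epsilon>2 \<Longrightarrow> ?g s2 t \<in> U"
    using open_near[OF continuous_seg g[of s2] U(1) U0 z] by blast
  define t where "t = min (1/2) (min (\<epsilon>1/2) (\<epsilon>2/2))"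
  have t: "t \<in> {0..1}" "0 < t" "t < 1" "\<bar>t - 0\<bar> < \<epsilon>1" "\<bar>t - 0\<bar> < \<epsilon>2"
    using \<epsilon>1(1) \<epsilon>2(1) by (auto simp: t_def min_def)
  have "rm (?g s1 t) = rm (?g s2 t)" using push[of s1 t] push[of s2 t] t(1) s(5) by simp
  then have eq: "?g s1 t = ?g s2 t"
    using \<epsilon>1(2)[OF t(1,4)] \<epsilon>2(2)[OF t(1,5)] homeomorphism_apply1[OF U(3)] by metis
  have mem: "v \<in> s \<longleftrightarrow> 0 < ?g s t v" if "finite s" "w \<in> s" for s v
    using seg_vertex_pos[OF t(2,3) that(1), of v w] seg_vertex_out[OF that(2), of v t] by (cases "v \<in> s") auto
  have "v \<in> s1 \<longleftrightarrow> v \<in> s2" for v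
    using mem[OF fin_Kt[OF s(1)] s(3), of v] mem[OF fin_Kt[OF s(2)] s(4), of v] eq by simp
  then show ?thesis by blast
qed

text \<open>A short segment from \<open>p w\<close> towards the barycentre of
  \<open>\<sigma>\<close> is lifted through a sheet at \<open>w\<close>. A lifted point close to
  \<open>w\<close> still has a positive coordinate at \<open>w\<close>, and its support is the
  simplex sought.\<close>

lemma lift_exists:
  assumes w: "w \<in> \<Union>Kt" and \<sigma>: "\<sigma> \<in> K" "p w \<in> \<sigma>"
  shows "\<exists>s\<in>Kt. w \<in> s \<and> p ` s = \<sigma>"
proof -
  have f\<sigma>: "finite \<sigma>" "\<sigma> \<noteq> {}" using K \<sigma> by (auto simp: abstract_complex_def)
  let ?y = "seg (vp (p w)) (bary \<sigma>)"
  have yin: "?y t \<in> cs \<sigma>" if "t \<in> {0..1}" for t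
    using that f\<sigma> \<sigma> by (auto intro!: seg_in_simplex vertex_point_in bary_in)
  have y: "?y ` {0..1} \<subseteq> realization K" using yin \<sigma>(1) by (auto simp: realization_def)
  have z: "(0::real) \<in> {0..1}" by simp
  have wK: "{w} \<in> Kt" using vertex_realization(2)[OF Kt w] .
  obtain U T q where U: "openin (top_of_set (realization Kt)) U" "vp w \<in> U"
    "openin (top_of_set (realization K)) T" "homeomorphism U T rm q"
    using sheet[OF vertex_realization(1)[OF Kt w]] by metis
  have rmw: "rm (vp w) = vp (p w)"
    by (rule rm_eqI[OF vertex_point_in wK]) (auto simp: vertex_point_def)
  have "?y 0 \<in> T" using U(2,4) rmw by (metis homeomorphism_image1 imageI seg_ends(3))
  then obtain \<epsilon> where \<epsilon>: "\<epsilon> > 0" "\<And>t. t \<in> {0..1} \<Longrightarrow> \<bar>t - 0\<bar> < \<epsilon> \<Longrightarrow> ?y t \<in> T"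
    using open_near[OF continuous_seg y U(3) _ z] by blast
  define r where "r = min (1/2) (\<epsilon>/2)"
  have r: "0 < r" "r < 1" "r < \<epsilon>" using \<epsilon>(1) by (auto simp: r_def min_def)
  have yT: "?y t \<in> T" if "t \<in> {0..r}" for t using \<epsilon>(2)[of t] that r by auto
  have "continuous_on {0..r} (\<lambda>t. q (?y t))"
    by (rule continuous_on_compose2[OF homeomorphism_cont2[OF U(4)] continuous_seg]) (use yT in auto)
  then have cq: "continuous_on {0..r} (\<lambda>t. q (?y t) w)" by (rule continuous_on_product_then_coordinatewise)
  have "q (?y 0) w = 1"
  proof -
    have "q (?y 0) = vp w" using homeomorphism_apply1[OF U(4,2)] rmw by simp
    then show ?thesis by (simp add: vertex_point_def)
  qed
  then obtain \<delta> where \<delta>: "\<delta> > 0" "\<And>t. t \<in> {0..r} \<Longrightarrow> dist t 0 < \<delta> \<Longrightarrow> dist (q (?y t) w) 1 < 1"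
  proof -
    have "0 \<in> {0..r}" using r(1) by simp
    then obtain \<delta> where "\<delta> > 0" "\<forall>t\<in>{0..r}. dist t 0 < \<delta> \<longrightarrow> dist (q (?y t) w) (q (?y 0) w) < 1"
      using cq[unfolded continuous_on_iff, rule_format, of 0 1] by auto
    then show ?thesis using that[of \<delta>] \<open>q (?y 0) w = 1\<close> by simp
  qed
  define t where "t = min r (\<delta>/2)"
  have t: "t \<in> {0..r}" "0 < t" "t < 1" "dist t 0 < \<delta>" using \<delta>(1) r by (auto simp: t_def min_def)
  define x where "x = q (?y t)"
  have xw: "0 < x w" using \<delta>(2)[OF t(1,4)] by (auto simp: x_def dist_real_def)
  have rx: "rm x = ?y t" unfolding x_def using homeomorphism_apply2[OF U(4) yT[OF t(1)]] .
  have "x \<in> U" unfolding x_def using U(4) yT[OF t(1)] by (metis homeomorphism_image2 imageI)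
  then have xX: "x \<in> realization Kt" using U(1) openin_imp_subset by blast
  then obtain s0 where s0: "s0 \<in> Kt" "x \<in> cs s0" by (auto simp: realization_def)
  define s where "s = {v. 0 < x v}"
  have sK: "s \<in> Kt" by (rule realization_simplex[OF Kt xX]) (use xw in \<open>auto simp: s_def\<close>)
  have "s \<subseteq> s0" using s0(2) by (force simp: s_def closed_simplex_def)
  moreover have "sum x s = sum x s0"
    by (rule sum.mono_neutral_left) (use fin_Kt s0 calculation in \<open>auto simp: s_def closed_simplex_def not_less order_eq_iff\<close>)
  ultimately have xs: "x \<in> cs s" using s0(2) by (auto simp: closed_simplex_def s_def not_less order_eq_iff)
  have "p ` s = \<sigma>"
  proof
    show "p ` s \<subseteq> \<sigma>"
    proof
      fix v assume "v \<in> p ` s"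
      then obtain u where u: "u \<in> s" "v = p u" by auto
      then have "0 < ?y t v" using rm_inj[OF xs sK u(1)] rx by (simp add: s_def)
      then show "v \<in> \<sigma>" using seg_vertex_out[OF \<sigma>(2), of v t] by fastforce
    qed
    show "\<sigma> \<subseteq> p ` s"
    proof
      fix v assume "v \<in> \<sigma>"
      then have "0 < rm x v" using seg_vertex_pos[OF t(2,3) f\<sigma>(1)] rx by simp
      then show "v \<in> p ` s" using rm_out[OF xs sK, of v] by fastforce
    qed
  qed
  then show ?thesis using sK xw by (intro bexI[of _ s]) (auto simp: s_def)
qed

lemma p_surj:
  assumes "v \<in> \<Union>K"
  shows "\<exists>w\<in>\<Union>Kt. p w = v"
proof -
  have "vp v \<in> realization K" using vertex_realization(1)[OF K assms] .
  then obtain x where x: "x \<in> realization Kt" "rm x = vp v"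
    using covering_space_imp_surjective[OF cov] by (metis imageE)
  obtain s where s: "s \<in> Kt" "x \<in> cs s" using x(1) by (auto simp: realization_def)
  have "rm x v \<noteq> 0" using x(2) by (simp add: vertex_point_def)
  then have "v \<in> p ` s" using rm_out[OF s(2,1), of v] by blast
  then show ?thesis using s(1) by blast
qed

definition Fib :: "'w \<Rightarrow> 'w set" where
  "Fib v = {v' \<in> \<Union>Kt. p v' = p v}"

text \<open>Uniqueness comes from \<open>lift_unique\<close>. If \<open>p v = p a\<close>, the edge
  degenerates to \<open>{a}\<close> and the value is \<open>a\<close>.\<close>

definition mv :: "'w \<Rightarrow> 'w \<Rightarrow> 'w \<Rightarrow> 'w" where
  "mv u v a = (THE b. {a, b} \<in> Kt \<and> p b = p v)"

lemma mv_unique: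
  assumes "{a, b} \<in> Kt" "p b = p v"
  shows "mv u v a = b"
  unfolding mv_def
proof (rule the_equality)
  fix c assume c: "{a, c} \<in> Kt \<and> p c = p v"
  then have "{a, c} = {a, b}" using assms by (intro lift_unique[of _ _ a]) auto
  then show "c = b" by (metis doubleton_eq_iff)
qed (use assms in simp)

lemma mv_simplex:
  assumes s: "s \<in> Kt" "u \<in> s" and a: "a \<in> Fib u"
  shows "\<exists>s'\<in>Kt. a \<in> s' \<and> p ` s' = p ` s \<and> (\<forall>v\<in>s. mv u v a \<in> s' \<and> p (mv u v a) = p v)"
proof -
  have "p a \<in> p ` s" using a s(2) by (simp add: Fib_def)
  then obtain s' where s': "s' \<in> Kt" "a \<in> s'" "p ` s' = p ` s"
    using lift_exists[OF _ p_simp[OF s(1)]] a unfolding Fib_def by blast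
  have "mv u v a \<in> s' \<and> p (mv u v a) = p v" if "v \<in> s" for v
  proof -
    have "p v \<in> p ` s'" using s'(3) imageI[OF that, of p] by simp
    then obtain b where b: "b \<in> s'" "p b = p v" by auto
    have "{a, b} \<in> Kt" using abstract_face[OF Kt s'(1), of "{a, b}"] b s' by simp
    then show ?thesis using mv_unique b by simp
  qed
  then show ?thesis using s' by blast
qed

sublocale loc: local_system Kt Fib mv
proof
  show "abstract_complex Kt" by (rule Kt)
  show "mv u v a \<in> Fib v" if uv: "{u, v} \<in> Kt" "a \<in> Fib u" for u v a
  proof -
    obtain s' where "s' \<in> Kt" "mv u v a \<in> s'" "p (mv u v a) = p v" using mv_simplex[OF uv(1) _ uv(2)] by auto
    then show ?thesis by (auto simp: Fib_def)
  qed
  show "mv u u a = a" if "{u} \<in> Kt" "a \<in> Fib u" for u a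
  proof (rule mv_unique)
    show "{a, a} \<in> Kt" using vertex_realization(2)[OF Kt, of a] that by (simp add: Fib_def)
  qed (use that in \<open>simp add: Fib_def\<close>)
  show "mv v w (mv u v a) = mv u w a" if h: "{u, v, w} \<in> Kt" "a \<in> Fib u" for u v w a
  proof (rule mv_unique)
    obtain s' where s': "s' \<in> Kt" "a \<in> s'" "\<forall>x\<in>{u, v, w}. mv u x a \<in> s' \<and> p (mv u x a) = p x"
      using mv_simplex[OF h(1) _ h(2)] by blast
    then show "{mv u v a, mv u w a} \<in> Kt" "p (mv u w a) = p w"
      using abstract_face[OF Kt s'(1), of "{mv u v a, mv u w a}"] by auto
  qed
qed

text \<open>A section of the fibres compatible with \<open>mv\<close> is a simplicial map over the
  identity, and \<open>section_exists\<close> provides one through any prescribed vertex.\<close>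

lemma deck_map:
  assumes "w \<in> \<Union>Kt" "w' \<in> \<Union>Kt" "p w = p w'"
  obtains g where "g w = w'" "\<And>v. v \<in> \<Union>Kt \<Longrightarrow> g v \<in> \<Union>Kt \<and> p (g v) = p v"
    "\<And>s. s \<in> Kt \<Longrightarrow> g ` s \<in> Kt"
proof -
  have "w' \<in> Fib w" using assms by (simp add: Fib_def)
  from loc.section_exists[OF sc assms(1) this] obtain g where
    g: "g w = w'" "\<And>v. v \<in> \<Union>Kt \<Longrightarrow> g v \<in> Fib v" "\<And>u v. {u, v} \<in> Kt \<Longrightarrow> mv u v (g u) = g v" by blast
  have "g ` s \<in> Kt" if s: "s \<in> Kt" for s
  proof -
    obtain u where u: "u \<in> s" using ne_Kt[OF s] by blast
    then have "g u \<in> Fib u" using g(2)[of u] s by auto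
    from mv_simplex[OF s u this] obtain s' where s': "s' \<in> Kt" "\<forall>v\<in>s. mv u v (g u) \<in> s'" by auto
    have "mv u v (g u) = g v" if "v \<in> s" for v
      using g(3)[of u v] abstract_face[OF Kt s, of "{u, v}"] u that by simp
    then have "g ` s \<subseteq> s'" using s'(2) by auto
    then show ?thesis using abstract_face[OF Kt s'(1)] u by blast
  qed
  then show ?thesis using that[of g] g by (auto simp: Fib_def)
qed

text \<open>Unique lifting along a walk from the fixed vertex: each further edge and its image lie
  over the same edge and share a vertex.\<close>

lemma deck_fix:
  assumes g: "\<And>v. v \<in> \<Union>Kt \<Longrightarrow> g v \<in> \<Union>Kt \<and> p (g v) = p v" "\<And>s. s \<in> Kt \<Longrightarrow> g ` s \<in> Kt"
    and w: "w \<in> \<Union>Kt" "g w = w" and v: "v \<in> \<Union>Kt"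
  shows "g v = v"
proof -
  obtain x m where x: "loc.walk x m" "x 0 = w" "x m = v" using loc.walk_exists[OF sc w(1) v] by blast
  have "g (x i) = x i" if "i \<le> m" for i
    using that
  proof (induction i)
    case 0
    then show ?case using x w by simp
  next
    case (Suc i)
    have e: "{x i, x (Suc i)} \<in> Kt" using x(1) Suc.prems by (simp add: loc.walk_def)
    then have "{x i, g (x (Suc i))} \<in> Kt" using g(2)[OF e] Suc by simp
    moreover have "p (g (x (Suc i))) = p (x (Suc i))" using g(1) e by blast
    ultimately have "{x i, g (x (Suc i))} = {x i, x (Suc i)}" using e by (intro lift_unique[of _ _ "x i"]) auto
    then show ?case by (metis doubleton_eq_iff)
  qed
  then show ?thesis using x(3) by blast
qed

text \<open>Maps taking \<open>w\<close> to \<open>w'\<close> and back compose to maps with a fixed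
  vertex, hence to identities by \<open>deck_fix\<close>.\<close>

theorem deck:
  assumes w: "w \<in> \<Union>Kt" "w' \<in> \<Union>Kt" "p w = p w'"
  obtains g where "g w = w'" "bij_betw g (\<Union>Kt) (\<Union>Kt)" "\<And>v. v \<in> \<Union>Kt \<Longrightarrow> p (g v) = p v"
    "\<And>s. s \<subseteq> \<Union>Kt \<Longrightarrow> g ` s \<in> Kt \<longleftrightarrow> s \<in> Kt"
proof -
  obtain g where g: "g w = w'" "\<And>v. v \<in> \<Union>Kt \<Longrightarrow> g v \<in> \<Union>Kt \<and> p (g v) = p v" "\<And>s. s \<in> Kt \<Longrightarrow> g ` s \<in> Kt"
    using deck_map[OF w] by metis
  obtain h where h: "h w' = w" "\<And>v. v \<in> \<Union>Kt \<Longrightarrow> h v \<in> \<Union>Kt \<and> p (h v) = p v" "\<And>s. s \<in> Kt \<Longrightarrow> h ` s \<in> Kt"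
    using deck_map[OF w(2,1) w(3)[symmetric]] by metis
  have hg: "h (g v) = v" if "v \<in> \<Union>Kt" for v
  proof (rule deck_fix[of "\<lambda>v. h (g v)", OF _ _ w(1) _ that])
    show "(\<lambda>v. h (g v)) ` s \<in> Kt" if "s \<in> Kt" for s using h(3)[OF g(3)[OF that]] by (simp add: image_image)
  qed (use g h in auto)
  have gh: "g (h v) = v" if "v \<in> \<Union>Kt" for v
  proof (rule deck_fix[of "\<lambda>v. g (h v)", OF _ _ w(2) _ that])
    show "(\<lambda>v. g (h v)) ` s \<in> Kt" if "s \<in> Kt" for s using g(3)[OF h(3)[OF that]] by (simp add: image_image)
  qed (use g h in auto)
  show ?thesis
  proof (rule that[of g])
    show "g w = w'" by (rule g(1))
    show "bij_betw g (\<Union>Kt) (\<Union>Kt)"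
      by (rule bij_betwI[of g _ _ h]) (use g(2) h(2) hg gh in auto)
    show "p (g v) = p v" if "v \<in> \<Union>Kt" for v using g(2) that by blast
    fix s assume s: "s \<subseteq> \<Union>Kt"
    have "h ` g ` s = s" using hg s by (force simp: image_iff subset_iff)
    then show "g ` s \<in> Kt \<longleftrightarrow> s \<in> Kt" using g(3) h(3)[of "g ` s"] by auto
  qed
qed

end

section \<open>Crosscuts of a triangle\<close>

text \<open>The model face, with corners 0, 1 and \<open>\<i>\<close>; the complex plane is where
  the Jordan curve theorem and Janiszewski's theorem are applied.\<close>

definition Tri :: "complex set" where
  "Tri = {z. 0 \<le> Re z \<and> 0 \<le> Im z \<and> Re z + Im z \<le> 1}"

definition TriI :: "complex set" where
  "TriI = {z. 0 < Re z \<and> 0 < Im z \<and> Re z + Im z < 1}"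

lemma convex_Tri: "convex Tri"
proof (rule convexI)
  fix x y :: complex and a b :: real
  assume h: "x \<in> Tri" "y \<in> Tri" "0 \<le> a" "0 \<le> b" "a + b = 1"
  have "a * (Re x + Im x) + b * (Re y + Im y) \<le> a * 1 + b * 1"
    using h by (intro add_mono mult_left_mono) (auto simp: Tri_def)
  then show "a *\<^sub>R x + b *\<^sub>R y \<in> Tri" using h by (auto simp: Tri_def algebra_simps)
qed

lemma closed_Tri: "closed Tri"
proof -
  have "Tri = {z. 0 \<le> Re z} \<inter> {z. 0 \<le> Im z} \<inter> {z. Re z + Im z \<le> 1}" by (auto simp: Tri_def)
  moreover have "closed {z. 0 \<le> Re z}" "closed {z. 0 \<le> Im z}" "closed {z. Re z + Im z \<le> 1}"
    by (intro closed_Collect_le continuous_intros)+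
  ultimately show ?thesis by (metis closed_Int)
qed

lemma bounded_Tri: "bounded Tri"
proof (rule boundedI)
  fix z assume "z \<in> Tri"
  then show "norm z \<le> 2" using cmod_le[of z] by (auto simp: Tri_def)
qed

lemma compact_Tri: "compact Tri"
  using closed_Tri bounded_Tri compact_eq_bounded_closed by blast

lemma open_TriI: "open TriI"
proof -
  have "TriI = {z. 0 < Re z} \<inter> {z. 0 < Im z} \<inter> {z. Re z + Im z < 1}" by (auto simp: TriI_def)
  moreover have "open {z. 0 < Re z}" "open {z. 0 < Im z}" "open {z. Re z + Im z < 1}"
    by (intro open_Collect_less continuous_intros)+
  ultimately show ?thesis by (metis open_Int)
qed

lemma interior_Tri: "interior Tri = TriI"
proof
  show "TriI \<subseteq> interior Tri" by (rule interior_maximal[OF _ open_TriI]) (auto simp: Tri_def TriI_def)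
  show "interior Tri \<subseteq> TriI"
  proof
    fix z assume z: "z \<in> interior Tri"
    obtain e where e: "e > 0" "cball z e \<subseteq> Tri" using z by (auto simp: mem_interior_cball)
    have "z + of_real c \<in> Tri" if "\<bar>c\<bar> \<le> e" for c using that e(2) by (auto simp: subset_iff dist_norm)
    from this[of e] this[of "-e"] e(1)
    have r: "0 \<le> Re z - e" "Re z + e + Im z \<le> 1" by (auto simp: Tri_def)
    have "z - \<i> * of_real e \<in> Tri" using e by (auto simp: subset_iff dist_norm norm_mult)
    then have "0 \<le> Im z - e" by (auto simp: Tri_def)
    then show "z \<in> TriI" using r e(1) by (auto simp: TriI_def)
  qed
qed

lemma frontier_Tri: "frontier Tri = Tri - TriI"
  using closed_Tri by (simp add: frontier_def interior_Tri)

lemma inside_frontier_Tri: "inside (frontier Tri) = TriI"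
  using inside_frontier_eq_interior[OF bounded_Tri convex_Tri] interior_Tri by simp

lemma segH: "closed_segment (of_real a) (of_real b) = {z. Im z = 0 \<and> Re z \<in> closed_segment a b}"
  by (subst closed_segment_same_Im) auto

lemma segV: "closed_segment (\<i> * of_real a) (\<i> * of_real b) = {z. Re z = 0 \<and> Im z \<in> closed_segment a b}"
  by (subst closed_segment_same_Re) auto

lemma segD: "closed_segment 1 \<i> = {z. Re z + Im z = 1 \<and> 0 \<le> Re z \<and> 0 \<le> Im z}"
proof
  show "closed_segment 1 \<i> \<subseteq> {z. Re z + Im z = 1 \<and> 0 \<le> Re z \<and> 0 \<le> Im z}"
    by (auto simp: closed_segment_def)
  show "{z. Re z + Im z = 1 \<and> 0 \<le> Re z \<and> 0 \<le> Im z} \<subseteq> closed_segment 1 \<i>"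
  proof
    fix z assume z: "z \<in> {z. Re z + Im z = 1 \<and> 0 \<le> Re z \<and> 0 \<le> Im z}"
    then have "z = (1 - Im z) *\<^sub>R 1 + Im z *\<^sub>R \<i>" by (auto simp: complex_eq_iff)
    moreover have "0 \<le> Im z" "Im z \<le> 1" using z by auto
    ultimately show "z \<in> closed_segment 1 \<i>" unfolding closed_segment_def by blast
  qed
qed

text \<open>The theta curve theorem for the triangle.\<close>

lemma crosscut:
  assumes g: "arc g" "pathstart g = of_real r" "pathfinish g = \<i> * of_real s"
    and rs: "0 < r" "r < 1" "0 < s" "s < 1"
    and int: "\<And>t. 0 < t \<Longrightarrow> t < 1 \<Longrightarrow> g t \<in> TriI"
  obtains A B where "A \<union> B = Tri - path_image g" "A \<inter> B = {}"
    "closedin (top_of_set (Tri - path_image g)) A" "closedin (top_of_set (Tri - path_image g)) B"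
    "connected A" "connected B" "connected (A \<inter> TriI)" "connected (B \<inter> TriI)"
    "\<And>z. z \<in> frontier Tri - path_image g \<Longrightarrow> z \<in> A \<longleftrightarrow> Im z = 0 \<and> Re z < r \<or> Re z = 0 \<and> Im z < s"
proof -
  let ?a = "complex_of_real r" and ?b = "\<i> * complex_of_real s"
  let ?G = "path_image g"
  have g0: "g 0 = ?a" and g1: "g 1 = ?b" using g(2,3) by (auto simp: pathstart_def pathfinish_def)
  have Gsub: "?G \<subseteq> insert ?a (insert ?b TriI)"
  proof
    fix z assume "z \<in> ?G"
    then obtain t where t: "t \<in> {0..1}" "z = g t" by (auto simp: path_image_def)
    then show "z \<in> insert ?a (insert ?b TriI)" using int[of t] g0 g1 by (cases "t = 0 \<or> t = 1") auto
  qed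
  have Gends: "?a \<in> ?G" "?b \<in> ?G" using pathstart_in_path_image[of g] pathfinish_in_path_image[of g] g(2,3) by auto
  \<comment> \<open>The two boundary arcs between the ends of \<open>g\<close>: \<open>c1\<close>
    runs through the corner 0 that \<open>g\<close> cuts off, \<open>c2\<close> through the other
    two corners.\<close>
  define c1 where "c1 = linepath ?a 0 +++ linepath 0 ?b"
  define c2 where "c2 = linepath ?a 1 +++ (linepath 1 \<i> +++ linepath \<i> ?b)"
  have s1: "closed_segment ?a 0 = {z. Im z = 0 \<and> 0 \<le> Re z \<and> Re z \<le> r}"
    using segH[of r 0] rs by (auto simp: closed_segment_eq_real_ivl)
  have s2: "closed_segment 0 ?b = {z. Re z = 0 \<and> 0 \<le> Im z \<and> Im z \<le> s}"
    using segV[of 0 s] rs by (auto simp: closed_segment_eq_real_ivl)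
  have s3: "closed_segment ?a 1 = {z. Im z = 0 \<and> r \<le> Re z \<and> Re z \<le> 1}"
    using segH[of r 1] rs by (auto simp: closed_segment_eq_real_ivl)
  have s4: "closed_segment \<i> ?b = {z. Re z = 0 \<and> s \<le> Im z \<and> Im z \<le> 1}"
    using segV[of 1 s] rs by (auto simp: closed_segment_eq_real_ivl)
  have i1: "path_image c1 = {z. Im z = 0 \<and> 0 \<le> Re z \<and> Re z \<le> r} \<union> {z. Re z = 0 \<and> 0 \<le> Im z \<and> Im z \<le> s}"
    unfolding c1_def by (simp add: path_image_join s1 s2)
  have i2: "path_image c2 = {z. Im z = 0 \<and> r \<le> Re z \<and> Re z \<le> 1} \<union>
     ({z. Re z + Im z = 1 \<and> 0 \<le> Re z \<and> 0 \<le> Im z} \<union> {z. Re z = 0 \<and> s \<le> Im z \<and> Im z \<le> 1})"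
    unfolding c2_def by (simp add: path_image_join s3 s4 segD)
  have arc1: "arc c1" unfolding c1_def
    by (rule arc_join) (use rs in \<open>auto simp: s1 s2 complex_eq_iff intro!: arc_linepath\<close>)
  have "arc (linepath 1 \<i> +++ linepath \<i> ?b)"
    by (rule arc_join) (use rs in \<open>auto simp: segD s4 complex_eq_iff intro!: arc_linepath\<close>)
  then have arc2: "arc c2" unfolding c2_def
    by (intro arc_join) (use rs in \<open>auto simp: path_image_join segD s3 s4 complex_eq_iff intro!: arc_linepath\<close>)
  have ends: "pathstart c1 = ?a" "pathfinish c1 = ?b" "pathstart c2 = ?a" "pathfinish c2 = ?b"
    by (auto simp: c1_def c2_def)
  have ab: "?a \<noteq> ?b" using rs by (auto simp: complex_eq_iff)
  have c12: "path_image c1 \<inter> path_image c2 = {?a, ?b}"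
    unfolding i1 i2 using rs by (auto simp: complex_eq_iff)
  have c1g: "path_image c1 \<inter> ?G = {?a, ?b}"
    using Gsub Gends unfolding i1 using rs by (auto simp: TriI_def)
  have c2g: "path_image c2 \<inter> ?G = {?a, ?b}"
    using Gsub Gends unfolding i2 using rs by (auto simp: TriI_def)
  have fr: "path_image c1 \<union> path_image c2 = frontier Tri"
    unfolding i1 i2 frontier_Tri using rs by (auto simp: Tri_def TriI_def)
  have ne: "?G \<inter> inside (path_image c1 \<union> path_image c2) \<noteq> {}"
  proof -
    have "g (1/2) \<in> ?G \<inter> TriI" using int[of "1/2"] by (auto simp: path_image_def)
    then show ?thesis unfolding fr inside_frontier_Tri by blast
  qed
  let ?I1 = "inside (path_image c1 \<union> ?G)" and ?I2 = "inside (path_image c2 \<union> ?G)"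
  have spl: "?I1 \<inter> ?I2 = {}" "?I1 \<union> ?I2 \<union> (?G - {?a, ?b}) = TriI"
    using split_inside_simple_closed_curve[OF arc_imp_simple_path[OF arc1] ends(1,2)
      arc_imp_simple_path[OF arc2] ends(3,4) arc_imp_simple_path[OF g(1)] g(2,3) ab c12 c1g c2g ne]
    unfolding fr inside_frontier_Tri by blast+
  have J: "open (inside (path_image c \<union> ?G)) \<and> connected (inside (path_image c \<union> ?G)) \<and>
      frontier (inside (path_image c \<union> ?G)) = path_image c \<union> ?G"
    if c: "arc c" "pathstart c = ?a" "pathfinish c = ?b" "path_image c \<inter> ?G = {?a, ?b}" for c
  proof -
    have "simple_path (c +++ reversepath g)"
      by (rule simple_path_join_loop) (use c g arc_reversepath in auto)
    moreover have "pathfinish (c +++ reversepath g) = pathstart (c +++ reversepath g)" using c g by simp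
    moreover have "path_image (c +++ reversepath g) = path_image c \<union> ?G" using c g by (simp add: path_image_join)
    ultimately show ?thesis using Jordan_inside_outside[of "c +++ reversepath g"] by simp
  qed
  note J1 = J[OF arc1 ends(1,2) c1g] and J2 = J[OF arc2 ends(3,4) c2g]
  \<comment> \<open>Each side is the inside of one of the two Jordan curves together with its part
    of the boundary, without the ends of \<open>g\<close>. It lies between a connected open set and
    its closure, hence is connected, and it is the trace of that closure, hence relatively
    closed.\<close>
  define A where "A = ?I1 \<union> (path_image c1 - {?a, ?b})"
  define B where "B = ?I2 \<union> (path_image c2 - {?a, ?b})"
  have d1: "?I1 \<inter> ?G = {}" "?I2 \<inter> ?G = {}" using inside_no_overlap by blast+
  have sub: "?I1 \<subseteq> TriI" "?I2 \<subseteq> TriI" using spl(2) by blast+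
  have nf: "z \<notin> TriI" if "z \<in> path_image c1 \<union> path_image c2" for z
    using that unfolding fr frontier_Tri by blast
  have TT: "Tri = TriI \<union> (path_image c1 \<union> path_image c2)"
    unfolding fr frontier_Tri by (auto simp: Tri_def TriI_def)
  have AB: "A \<union> B = Tri - ?G"
  proof
    show "A \<union> B \<subseteq> Tri - ?G"
      using d1 sub c1g c2g unfolding A_def B_def TT by blast
    show "Tri - ?G \<subseteq> A \<union> B"
      using spl(2) Gends unfolding A_def B_def TT by blast
  qed
  have dis: "A \<inter> B = {}"
    using spl(1) c12 sub nf unfolding A_def B_def by blast
  have clA: "A = closure ?I1 \<inter> (Tri - ?G)"
  proof -
    have "closure ?I1 = ?I1 \<union> (path_image c1 \<union> ?G)"
      using J1 closure_Un_frontier[of ?I1] by simp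
    then show ?thesis using AB Gends c1g unfolding A_def by blast
  qed
  have clB: "B = closure ?I2 \<inter> (Tri - ?G)"
  proof -
    have "closure ?I2 = ?I2 \<union> (path_image c2 \<union> ?G)"
      using J2 closure_Un_frontier[of ?I2] by simp
    then show ?thesis using AB Gends c2g unfolding B_def by blast
  qed
  have conA: "connected A"
    by (rule connected_intermediate_closure[of ?I1]) (use J1 clA in \<open>auto simp: A_def\<close>)
  have conB: "connected B"
    by (rule connected_intermediate_closure[of ?I2]) (use J2 clB in \<open>auto simp: B_def\<close>)
  have AI: "A \<inter> TriI = ?I1" "B \<inter> TriI = ?I2"
    using sub nf unfolding A_def B_def by blast+
  show ?thesis
  proof (rule that[OF AB dis _ _ conA conB])
    show "closedin (top_of_set (Tri - ?G)) A" using clA by (auto simp: closedin_closed)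
    show "closedin (top_of_set (Tri - ?G)) B" using clB by (auto simp: closedin_closed)
    show "connected (A \<inter> TriI)" "connected (B \<inter> TriI)" unfolding AI using J1 J2 by auto
    fix z assume z: "z \<in> frontier Tri - ?G"
    then have zz: "z \<in> path_image c1 \<or> z \<in> path_image c2" "z \<noteq> ?a" "z \<noteq> ?b" "z \<notin> TriI"
      using fr Gends frontier_Tri by blast+
    have "z \<in> A \<longleftrightarrow> z \<in> path_image c1" using zz sub unfolding A_def by blast
    also have "\<dots> \<longleftrightarrow> Im z = 0 \<and> Re z < r \<or> Re z = 0 \<and> Im z < s"
      using z zz(2,3) rs unfolding i1 frontier_Tri by (auto simp: complex_eq_iff Tri_def)
    finally show "z \<in> A \<longleftrightarrow> Im z = 0 \<and> Re z < r \<or> Re z = 0 \<and> Im z < s" .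
  qed
qed

text \<open>By disjointness, the union reached so far and the next set \<open>C \<union> a\<close>
  meet exactly in \<open>C\<close>, whose connectedness is what Janiszewski's theorem asks for. It
  is used with \<open>C\<close> empty to leave a face and with \<open>C\<close> the boundary of the
  triangle to remain inside it.\<close>

lemma Janiszewski_Union:
  assumes fin: "finite \<A>" and ar: "\<And>a. a \<in> \<A> \<Longrightarrow> compact a" and C: "compact C"
    and disj: "\<And>a b. a \<in> \<A> \<Longrightarrow> b \<in> \<A> \<Longrightarrow> a \<noteq> b \<Longrightarrow> a \<inter> b = {}" and con: "connected C"
    and base: "connected_component (- C) y z"
    and cc: "\<And>a. a \<in> \<A> \<Longrightarrow> connected_component (- (C \<union> a)) y (z :: complex)"
  shows "connected_component (- (C \<union> \<Union>\<A>)) y z"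
  using fin ar disj cc
proof (induction \<A>)
  case empty
  then show ?case using base by simp
next
  case (insert a \<A>)
  have "(C \<union> \<Union>\<A>) \<inter> (C \<union> a) = C"
  proof -
    have "b \<inter> a = {}" if "b \<in> \<A>" for b using insert.prems(2)[of b a] insert.hyps(2) that by auto
    then show ?thesis by blast
  qed
  then have c1: "connected ((C \<union> \<Union>\<A>) \<inter> (C \<union> a))" using con by simp
  have c2: "compact (C \<union> \<Union>\<A>)" using C insert.hyps(1) insert.prems(1) by (intro compact_Un compact_Union) auto
  have c3: "closed (C \<union> a)" using C insert.prems(1) by (intro closed_Un) (auto intro: compact_imp_closed)
  have c4: "connected_component (- (C \<union> \<Union>\<A>)) y z"
  proof (rule insert.IH)
    show "compact b" if "b \<in> \<A>" for b using insert.prems(1)[of b] that by simp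
    show "b \<inter> c = {}" if "b \<in> \<A>" "c \<in> \<A>" "b \<noteq> c" for b c using insert.prems(2)[of b c] that by simp
    show "connected_component (- (C \<union> b)) y z" if "b \<in> \<A>" for b using insert.prems(3)[of b] that by simp
  qed
  have c5: "connected_component (- (C \<union> a)) y z" using insert.prems(3)[of a] by simp
  have "connected_component (- ((C \<union> \<Union>\<A>) \<union> (C \<union> a))) y z"
    by (rule Janiszewski[OF c2 c3 c1 c4 c5])
  moreover have "(C \<union> \<Union>\<A>) \<union> (C \<union> a) = C \<union> \<Union>(insert a \<A>)" by auto
  ultimately show ?case by simp
qed

text \<open>Two parametrizations of one arc differ by a continuous injection of the unit interval
  onto itself, which maps ends to ends. This is needed because paths are represented by their
  images.\<close>

lemma arc_ends_unique:
  fixes g g' :: "real \<Rightarrow> 'a::t2_space"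
  assumes "arc g" "arc g'" "path_image g' = path_image g"
  shows "pathstart g' \<in> {pathstart g, pathfinish g}"
proof -
  obtain h where h: "homeomorphism {0..1} (path_image g) g h" using homeomorphism_arc[OF assms(1)] .
  let ?k = "h \<circ> g'"
  have c: "continuous_on (closed_segment 0 1) ?k"
    using assms(2,3) homeomorphism_cont2[OF h]
    by (intro continuous_on_compose) (auto simp: arc_def path_def path_image_def closed_segment_eq_real_ivl)
  have inj: "inj_on ?k (closed_segment 0 1)"
  proof -
    have "inj_on h (path_image g)" using homeomorphism_apply2[OF h] by (metis inj_on_inverseI)
    then show ?thesis using assms(2,3) by (intro comp_inj_on) (auto simp: arc_def path_image_def closed_segment_eq_real_ivl)
  qed
  have "?k ` {0..1} = h ` path_image g'" by (simp add: path_image_def image_comp)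
  then have "?k ` {0..1} = {0..1}" using assms(3) homeomorphism_image2[OF h] by simp
  then have "closed_segment (?k 0) (?k 1) = {0..1}"
    using continuous_injective_image_segment_1[OF c inj] by (simp add: closed_segment_eq_real_ivl)
  then have "?k 0 = 0 \<or> ?k 0 = 1"
    by (auto simp: closed_segment_eq_real_ivl Icc_eq_Icc split: if_splits)
  moreover have "g (?k 0) = g' 0"
  proof -
    have "g' 0 \<in> path_image g" using assms(3) by (force simp: path_image_def)
    then show ?thesis using homeomorphism_apply2[OF h] by simp
  qed
  ultimately show ?thesis by (auto simp: pathstart_def pathfinish_def)
qed

text \<open>The path \<open>a\<close> turns around the corner \<open>u\<close>, from
  \<open>x\<close> on the edge towards \<open>v\<close> to \<open>y\<close> on the edge towards
  \<open>w\<close>.\<close>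

definition crossing :: "'v \<Rightarrow> 'v \<Rightarrow> 'v \<Rightarrow> ('v \<Rightarrow> real) set \<Rightarrow> ('v \<Rightarrow> real) \<Rightarrow> ('v \<Rightarrow> real) \<Rightarrow> bool" where
  "crossing u v w a x y \<longleftrightarrow> u \<noteq> v \<and> u \<noteq> w \<and> v \<noteq> w \<and> (\<exists>g. arc g \<and> path_image g = a \<and> pathstart g = x \<and> pathfinish g = y \<and>
     x \<in> open_simplex {u, v} \<and> y \<in> open_simplex {u, w} \<and> (\<forall>t. 0 < t \<and> t < 1 \<longrightarrow> g t \<in> open_simplex {u, v, w}))"

text \<open>For a point on the boundary of the triangle and off the path, this says that it lies on
  the piece of boundary between \<open>x\<close> and \<open>y\<close> that contains the corner
  \<open>u\<close>.\<close>

definition near :: "'v \<Rightarrow> 'v \<Rightarrow> ('v \<Rightarrow> real) \<Rightarrow> ('v \<Rightarrow> real) \<Rightarrow> ('v \<Rightarrow> real) \<Rightarrow> bool" where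
  "near v w x y z \<longleftrightarrow> z w = 0 \<and> z v < x v \<or> z v = 0 \<and> z w < y w"

lemma crossing_sym: "crossing u v w a x y \<Longrightarrow> crossing u w v a y x"
  unfolding crossing_def
proof (elim conjE exE, intro conjI)
  fix g assume g: "arc g" "path_image g = a" "pathstart g = x" "pathfinish g = y" "x \<in> open_simplex {u, v}"
    "y \<in> open_simplex {u, w}" "\<forall>t. 0 < t \<and> t < 1 \<longrightarrow> g t \<in> open_simplex {u, v, w}"
  have "{u, w, v} = {u, v, w}" by auto
  then show "\<exists>g. arc g \<and> path_image g = a \<and> pathstart g = y \<and> pathfinish g = x \<and> y \<in> open_simplex {u, w} \<and>
     x \<in> open_simplex {u, v} \<and> (\<forall>t. 0 < t \<and> t < 1 \<longrightarrow> g t \<in> open_simplex {u, w, v})"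
  proof (intro exI[of _ "reversepath g"] conjI allI impI)
    show "reversepath g t \<in> open_simplex {u, w, v}" if "0 < t \<and> t < 1" for t
      using g(7) that \<open>{u, w, v} = _\<close> by (simp add: reversepath_def)
  qed (use g in \<open>simp_all add: arc_reversepath\<close>)
qed auto

lemma face_crossing:
  assumes "path_in_face f a" "card f = 3"
  obtains u v w x y where "f = {u, v, w}" "crossing u v w a x y"
proof -
  obtain g e e' where g: "arc g" "path_image g = a" "e \<subseteq> f" "card e = 2" "e' \<subseteq> f" "card e' = 2" "e \<noteq> e'"
    "pathstart g \<in> open_simplex e" "pathfinish g \<in> open_simplex e'" "\<forall>t. 0 < t \<and> t < 1 \<longrightarrow> g t \<in> open_simplex f"
    using assms(1) unfolding path_in_face_def by blast
  have ff: "finite f" using assms(2) card.infinite by fastforce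
  have fe: "finite e" "finite e'" using g ff finite_subset by auto
  have "card (e \<union> e') \<le> 3" using card_mono[of f "e \<union> e'"] g ff assms(2) by simp
  moreover have "card e + card e' = card (e \<union> e') + card (e \<inter> e')" using card_Un_Int fe by blast
  moreover have "card (e \<inter> e') < 2"
  proof -
    have "e \<inter> e' \<noteq> e" using g(4,6,7) fe card_seteq[of e' e] by auto
    then have "e \<inter> e' \<subset> e" by blast
    then show ?thesis using psubset_card_mono[OF fe(1), of "e \<inter> e'"] g(4) by linarith
  qed
  ultimately have c: "card (e \<inter> e') = 1" "card (e \<union> e') = 3" using g(4,6) by auto
  obtain u where u: "e \<inter> e' = {u}" using c(1) card_1_singletonE by blast
  have "u \<in> e" "u \<in> e'" using u by blast+
  then have "card (e - {u}) = 1" "card (e' - {u}) = 1" using g(4,6) by (simp_all add: card_Diff_singleton)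
  obtain v where v: "e - {u} = {v}" using \<open>card (e - {u}) = 1\<close> by (rule card_1_singletonE)
  obtain w where w: "e' - {u} = {w}" using \<open>card (e' - {u}) = 1\<close> by (rule card_1_singletonE)
  have ee: "e = {u, v}" "e' = {u, w}" using u v w by blast+
  have "e \<union> e' = f"
  proof (rule card_seteq[OF ff])
    show "e \<union> e' \<subseteq> f" using g(3,5) by (rule Un_least)
    show "card f \<le> card (e \<union> e')" using c(2) assms(2) by simp
  qed
  then have f: "f = {u, v, w}" unfolding ee by blast
  have d: "u \<noteq> v \<and> u \<noteq> w \<and> v \<noteq> w" using assms(2) unfolding f by (auto simp: card_insert_if split: if_splits)
  have "crossing u v w a (pathstart g) (pathfinish g)"
    unfolding crossing_def f[symmetric] ee[symmetric] using d g(1,2,8-10) by blast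
  then show ?thesis using that f by blast
qed

lemma crossing_path_in_face: "crossing u v w a x y \<Longrightarrow> path_in_face {u, v, w} a"
  unfolding crossing_def path_in_face_def
proof (elim conjE exE)
  fix g assume h: "u \<noteq> v" "u \<noteq> w" "v \<noteq> w" "arc g" "path_image g = a" "pathstart g = x" "pathfinish g = y" "x \<in> open_simplex {u, v}"
    "y \<in> open_simplex {u, w}" "\<forall>t. 0 < t \<and> t < 1 \<longrightarrow> g t \<in> open_simplex {u, v, w}"
  then show "\<exists>g e e'. arc g \<and> path_image g = a \<and> e \<subseteq> {u, v, w} \<and> card e = 2 \<and> e' \<subseteq> {u, v, w} \<and> card e' = 2 \<and> e \<noteq> e' \<and>
    pathstart g \<in> open_simplex e \<and> pathfinish g \<in> open_simplex e' \<and> (\<forall>t. 0 < t \<and> t < 1 \<longrightarrow> g t \<in> open_simplex {u, v, w})"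
    by (intro exI[of _ g] exI[of _ "{u, v}"] exI[of _ "{u, w}"]) (auto simp: doubleton_eq_iff)
qed

lemma same_side:
  assumes "A \<union> B = X" "A \<inter> B = {}" "closedin (top_of_set X) A" "closedin (top_of_set X) B"
    and "connected C" "C \<subseteq> X" "p \<in> C" "q \<in> C"
  shows "p \<in> A \<longleftrightarrow> q \<in> A"
proof (rule ccontr)
  assume n: "\<not> ?thesis"
  have "closedin (top_of_set C) (C \<inter> A)" "closedin (top_of_set C) (C \<inter> B)"
    using assms(3,4,6) closedin_subtopology_Int_closed by (metis closedin_closed_subset inf_commute closedin_subset_trans closedin_closed Int_assoc inf.absorb_iff2)+
  moreover have "C \<subseteq> (C \<inter> A) \<union> (C \<inter> B)" "(C \<inter> A) \<inter> (C \<inter> B) = {}" "C \<inter> A \<noteq> {}" "C \<inter> B \<noteq> {}"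
    using assms n by blast+
  ultimately show False using assms(5) unfolding connected_closedin by blast
qed

section \<open>Sides of paths in a face of the complex\<close>

locale tri =
  fixes u v w :: 'v
  assumes d: "u \<noteq> v" "u \<noteq> w" "v \<noteq> w"
begin

abbreviation Tf where "Tf \<equiv> cs {u, v, w}"
abbreviation Of where "Of \<equiv> open_simplex {u, v, w}"

text \<open>The chart sends \<open>u\<close> to 0, \<open>v\<close> to 1 and \<open>w\<close> to
  \<open>\<i>\<close>, so a path around \<open>u\<close> becomes the crosscut treated above.\<close>

definition ch :: "('v \<Rightarrow> real) \<Rightarrow> complex" where "ch x = Complex (x v) (x w)"

definition ich :: "complex \<Rightarrow> 'v \<Rightarrow> real" where
  "ich z = (\<lambda>y. if y = u then 1 - Re z - Im z else if y = v then Re z else if y = w then Im z else 0)"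

lemma mem_Tf: "x \<in> Tf \<longleftrightarrow> 0 \<le> x u \<and> 0 \<le> x v \<and> 0 \<le> x w \<and> x u + x v + x w = 1 \<and> (\<forall>y. y \<notin> {u, v, w} \<longrightarrow> x y = 0)"
proof
  assume "x \<in> Tf"
  then show "0 \<le> x u \<and> 0 \<le> x v \<and> 0 \<le> x w \<and> x u + x v + x w = 1 \<and> (\<forall>y. y \<notin> {u, v, w} \<longrightarrow> x y = 0)"
    using d by (auto simp: closed_simplex_def)
next
  assume h: "0 \<le> x u \<and> 0 \<le> x v \<and> 0 \<le> x w \<and> x u + x v + x w = 1 \<and> (\<forall>y. y \<notin> {u, v, w} \<longrightarrow> x y = 0)"
  then have "0 \<le> x y" for y by (cases "y \<in> {u, v, w}") auto
  then show "x \<in> Tf" using h d by (auto simp: closed_simplex_def)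
qed

lemma mem_Of: "x \<in> Of \<longleftrightarrow> x \<in> Tf \<and> 0 < x u \<and> 0 < x v \<and> 0 < x w"
  by (auto simp: open_simplex_def)

lemma ch_ich [simp]: "ch (ich z) = z"
  using d by (simp add: ch_def ich_def complex_eq_iff)

lemma ich_ch: "x \<in> Tf \<Longrightarrow> ich (ch x) = x"
  using d by (auto simp: ch_def ich_def mem_Tf fun_eq_iff)

lemma ch_Tri: "x \<in> Tf \<Longrightarrow> ch x \<in> Tri"
  by (simp add: mem_Tf Tri_def ch_def)

lemma ich_Tf: "z \<in> Tri \<Longrightarrow> ich z \<in> Tf"
  using d by (simp add: mem_Tf Tri_def ich_def)

lemma ch_TriI: "x \<in> Tf \<Longrightarrow> ch x \<in> TriI \<longleftrightarrow> x \<in> Of"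
  by (auto simp: mem_Of mem_Tf TriI_def ch_def)

lemma cont_ch: "continuous_on S ch"
  unfolding ch_def Complex_eq by (intro continuous_intros continuous_on_coord)

lemma cont_ich: "continuous_on S ich"
  unfolding ich_def
proof (rule continuous_on_coordinatewise_then_product)
  fix i show "continuous_on S (\<lambda>z. if i = u then 1 - Re z - Im z else if i = v then Re z else if i = w then Im z else 0)"
    by (cases "i = u"; cases "i = v"; cases "i = w") (auto intro!: continuous_intros)
qed

lemma inj_ch: "inj_on ch Tf"
  using ich_ch by (metis inj_on_inverseI)

lemma arc_ch:
  assumes "arc g" "path_image g \<subseteq> Tf"
  shows "arc (ch \<circ> g)" "path_image (ch \<circ> g) = ch ` path_image g"
    "pathstart (ch \<circ> g) = ch (pathstart g)" "pathfinish (ch \<circ> g) = ch (pathfinish g)"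
proof -
  have "path (ch \<circ> g)" unfolding path_def
    by (rule continuous_on_compose[OF _ cont_ch]) (use assms(1) in \<open>simp add: arc_def path_def\<close>)
  moreover have "inj_on (ch \<circ> g) {0..1}"
    using assms inj_ch by (intro comp_inj_on) (auto simp: arc_def path_image_def intro: inj_on_subset)
  ultimately show "arc (ch \<circ> g)" by (simp add: arc_def)
qed (auto simp: path_image_def pathstart_def pathfinish_def image_comp)

lemma edge_sub: "cs {u, v} \<subseteq> Tf" "cs {u, w} \<subseteq> Tf"
  using d by (auto simp: closed_simplex_def)

lemma crossing_sub:
  assumes "crossing u v w a x y"
  shows "a \<subseteq> insert x (insert y Of)" "x \<in> a" "y \<in> a" "x \<in> Tf - Of" "y \<in> Tf - Of"
    "0 < x v" "x v < 1" "x w = 0" "0 < y w" "y w < 1" "y v = 0"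
proof -
  obtain g where g: "arc g" "path_image g = a" "pathstart g = x" "pathfinish g = y" "x \<in> open_simplex {u, v}"
    "y \<in> open_simplex {u, w}" "\<forall>t. 0 < t \<and> t < 1 \<longrightarrow> g t \<in> Of" using assms unfolding crossing_def by blast
  have cx: "0 < x u" "0 < x v" "x u + x v = 1" "x w = 0"
    using g(5) d by (auto simp: open_simplex_def closed_simplex_def)
  have cy: "0 < y u" "0 < y w" "y u + y w = 1" "y v = 0"
    using g(6) d by (auto simp: open_simplex_def closed_simplex_def)
  show "x \<in> a" "y \<in> a" using g pathstart_in_path_image pathfinish_in_path_image by metis+
  have "z \<in> insert x (insert y Of)" if "z \<in> a" for z
  proof -
    obtain t where "t \<in> {0..1}" "z = g t" using \<open>z \<in> a\<close> g(2) by (auto simp: path_image_def)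
    then show ?thesis using g(3,4,7) by (cases "t = 0 \<or> t = 1") (auto simp: pathstart_def pathfinish_def)
  qed
  then show "a \<subseteq> insert x (insert y Of)" by blast
  have "x \<in> Tf" "y \<in> Tf" using edge_sub g(5,6) by (auto simp: open_simplex_def)
  then show "x \<in> Tf - Of" "y \<in> Tf - Of" using cx cy by (auto simp: mem_Of)
  show "0 < x v" "x v < 1" "x w = 0" "0 < y w" "y w < 1" "y v = 0" using cx cy by auto
qed

lemma crossing_ends:
  assumes "crossing u v w a x y"
  shows "ends a = {x, y}"
proof -
  obtain g where g: "arc g" "path_image g = a" "pathstart g = x" "pathfinish g = y"
    using assms unfolding crossing_def by blast
  have aT: "a \<subseteq> Tf" using crossing_sub[OF assms] by (auto simp: mem_Of)
  have "z \<in> {x, y}" if za: "z \<in> ends a" for z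
  proof -
    obtain g' where g': "arc g'" "path_image g' = a" "z = pathstart g'"
      using za by (auto simp: arc_endpoints_def)
    have "ch z \<in> {ch x, ch y}"
      using arc_ends_unique[of "ch \<circ> g" "ch \<circ> g'"] arc_ch[of g] arc_ch[of g'] g g' aT by simp
    moreover have "z \<in> Tf" "x \<in> Tf" "y \<in> Tf" using g' aT crossing_sub[OF assms] pathstart_in_path_image by blast+
    ultimately show ?thesis using inj_ch by (auto dest: inj_onD)
  qed
  moreover have "x \<in> ends a" using g by (auto simp: arc_endpoints_def)
  moreover have "y \<in> ends a"
    unfolding arc_endpoints_def using g by (intro CollectI exI[of _ "reversepath g"]) (simp add: arc_reversepath)
  ultimately show ?thesis by blast
qed

lemma sides:
  assumes "crossing u v w a x y"
  obtains A B where "A \<union> B = Tf - a" "A \<inter> B = {}"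
    "closedin (top_of_set (Tf - a)) A" "closedin (top_of_set (Tf - a)) B"
    "connected A" "connected B" "connected (A \<inter> Of)" "connected (B \<inter> Of)"
    "\<And>z. z \<in> Tf - Of - a \<Longrightarrow> z \<in> A \<longleftrightarrow> near v w x y z"
proof -
  obtain g where g: "arc g" "path_image g = a" "pathstart g = x" "pathfinish g = y"
    "\<forall>t. 0 < t \<and> t < 1 \<longrightarrow> g t \<in> Of" using assms unfolding crossing_def by blast
  note cs = crossing_sub[OF assms]
  have aT: "a \<subseteq> Tf" using cs by (auto simp: mem_Of)
  note ac = arc_ch[OF g(1), unfolded g(2), OF aT]
  have st: "pathstart (ch \<circ> g) = of_real (x v)" "pathfinish (ch \<circ> g) = \<i> * of_real (y w)"
    using cs g ac by (auto simp: ch_def complex_eq_iff)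
  have it: "(ch \<circ> g) t \<in> TriI" if "0 < t" "t < 1" for t
    using g(5) that ch_TriI[of "g t"] by (auto simp: mem_Of)
  obtain A B where AB: "A \<union> B = Tri - path_image (ch \<circ> g)" "A \<inter> B = {}"
    "closedin (top_of_set (Tri - path_image (ch \<circ> g))) A" "closedin (top_of_set (Tri - path_image (ch \<circ> g))) B"
    "connected A" "connected B" "connected (A \<inter> TriI)" "connected (B \<inter> TriI)"
    "\<And>z. z \<in> frontier Tri - path_image (ch \<circ> g) \<Longrightarrow> z \<in> A \<longleftrightarrow> Im z = 0 \<and> Re z < x v \<or> Re z = 0 \<and> Im z < y w"
  proof (rule crosscut[OF ac(1) st cs(6,7,9,10)])
    show "(ch \<circ> g) t \<in> TriI" if "0 < t" "t < 1" for t using it that .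
  next
    fix A B
    assume h: "A \<union> B = Tri - path_image (ch \<circ> g)" "A \<inter> B = {}"
      "closedin (top_of_set (Tri - path_image (ch \<circ> g))) A" "closedin (top_of_set (Tri - path_image (ch \<circ> g))) B"
      "connected A" "connected B" "connected (A \<inter> TriI)" "connected (B \<inter> TriI)"
      "\<And>z. z \<in> frontier Tri - path_image (ch \<circ> g) \<Longrightarrow> z \<in> A \<longleftrightarrow> Im z = 0 \<and> Re z < x v \<or> Re z = 0 \<and> Im z < y w"
    show thesis by (rule that[OF h(1-8)]) (rule h(9))
  qed
  have mapT: "ch z \<in> Tri - path_image (ch \<circ> g) \<longleftrightarrow> z \<notin> a" if "z \<in> Tf" for z
    using ac(2) ch_Tri[OF that] inj_on_image_mem_iff[OF inj_ch that aT] by simp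
  define P where "P C = (Tf - a) \<inter> ch -` C" for C
  have PI: "P C = ich ` C" if "C \<subseteq> Tri - path_image (ch \<circ> g)" for C
  proof
    show "P C \<subseteq> ich ` C" unfolding P_def using ich_ch by force
    show "ich ` C \<subseteq> P C"
    proof
      fix y assume "y \<in> ich ` C"
      then obtain c where c: "c \<in> C" "y = ich c" by blast
      then have y: "y \<in> Tf" "ch y = c" using that ich_Tf[of c] by auto
      then have "y \<notin> a" using mapT[OF y(1)] that c by auto
      then show "y \<in> P C" unfolding P_def using y c by simp
    qed
  qed
  have ABs: "A \<subseteq> Tri - path_image (ch \<circ> g)" "B \<subseteq> Tri - path_image (ch \<circ> g)" using AB(1) by blast+
  have PO: "P C \<inter> Of = P (C \<inter> TriI)" for C unfolding P_def using ch_TriI by auto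
  have con: "connected (P C)" if "C \<subseteq> Tri - path_image (ch \<circ> g)" "connected C" for C
    unfolding PI[OF that(1)] using connected_continuous_image[OF cont_ich that(2)] .
  have fn: "ch \<in> Tf - a \<rightarrow> Tri - path_image (ch \<circ> g)" using mapT by auto
  show ?thesis
  proof (rule that[of "P A" "P B"])
    show "P A \<union> P B = Tf - a" using AB(1) mapT unfolding P_def by blast
    show "P A \<inter> P B = {}" using AB(2) unfolding P_def by blast
    show "closedin (top_of_set (Tf - a)) (P A)" "closedin (top_of_set (Tf - a)) (P B)"
      unfolding P_def using continuous_closedin_preimage_gen[OF cont_ch fn] AB(3,4) by blast+
    show "connected (P A)" "connected (P B)" using con ABs AB(5,6) by blast+
    show "connected (P A \<inter> Of)" "connected (P B \<inter> Of)"
      unfolding PO using con[of "A \<inter> TriI"] con[of "B \<inter> TriI"] ABs AB(7,8) by blast+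
    fix z assume z: "z \<in> Tf - Of - a"
    then have "ch z \<in> frontier Tri - path_image (ch \<circ> g)"
      unfolding frontier_Tri using ch_Tri[of z] ch_TriI[of z] mapT[of z] by blast
    then show "z \<in> P A \<longleftrightarrow> near v w x y z" using AB(9) z unfolding P_def near_def by (simp add: ch_def)
  qed
qed

lemma connected_near:
  assumes "crossing u v w a x y" "connected C" "C \<subseteq> Tf - a" "p \<in> C - Of" "q \<in> C - Of"
  shows "near v w x y p \<longleftrightarrow> near v w x y q"
proof -
  obtain A B where AB: "A \<union> B = Tf - a" "A \<inter> B = {}"
    "closedin (top_of_set (Tf - a)) A" "closedin (top_of_set (Tf - a)) B"
    "\<And>z. z \<in> Tf - Of - a \<Longrightarrow> z \<in> A \<longleftrightarrow> near v w x y z" using sides[OF assms(1)] by metis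
  have "p \<in> A \<longleftrightarrow> q \<in> A" using same_side[OF AB(1-4) assms(2,3)] assms(4,5) by blast
  then show ?thesis using AB(5)[of p] AB(5)[of q] assms(3-5) by blast
qed

lemma pif_arc:
  assumes "path_in_face {u, v, w} a"
  obtains g where "arc g" "path_image g = a" "a \<subseteq> Tf"
proof -
  obtain u' v' w' x y where l: "{u, v, w} = {u', v', w'}" "crossing u' v' w' a x y"
    by (rule face_crossing[OF assms]) (use d in auto)
  interpret t: tri u' v' w' using l(2) by unfold_locales (auto simp: crossing_def)
  have "t.Of \<subseteq> t.Tf" by (auto simp: open_simplex_def)
  then have "a \<subseteq> Tf" using t.crossing_sub(1,4,5)[OF l(2)] unfolding l(1) by blast
  then show ?thesis using that l(2) unfolding crossing_def by blast
qed

context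
  fixes \<A>
  assumes fin: "finite \<A>" and pf: "\<And>a. a \<in> \<A> \<Longrightarrow> path_in_face {u, v, w} a"
begin

lemma arcs_sub: "a \<in> \<A> \<Longrightarrow> a \<subseteq> Tf"
  using pif_arc[OF pf] by metis

lemma ch_arc:
  assumes "a \<in> \<A>"
  obtains g where "arc g" "path_image g = ch ` a"
proof -
  obtain g where "arc g" "path_image g = a" "a \<subseteq> Tf" using pif_arc[OF pf[OF assms]] .
  then show ?thesis using arc_ch[of g] that by simp
qed

lemma ch_compact: "b \<in> image ch ` \<A> \<Longrightarrow> compact b"
  using ch_arc compact_arc_image by (metis imageE)

lemma ch_mem:
  assumes "y \<in> Tf"
  shows "ch y \<in> \<Union>(image ch ` \<A>) \<longleftrightarrow> y \<in> \<Union>\<A>"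
proof -
  have "ch y \<in> ch ` a \<longleftrightarrow> y \<in> a" if "a \<in> \<A>" for a
    using inj_on_image_mem_iff[OF inj_ch assms arcs_sub[OF that]] .
  then show ?thesis by simp
qed

lemma ch_disjoint:
  assumes disj: "\<And>a b. a \<in> \<A> \<Longrightarrow> b \<in> \<A> \<Longrightarrow> a \<noteq> b \<Longrightarrow> a \<inter> b = {}"
    and "b \<in> image ch ` \<A>" "c \<in> image ch ` \<A>" "b \<noteq> c"
  shows "b \<inter> c = {}"
proof -
  obtain a a' where a: "a \<in> \<A>" "a' \<in> \<A>" "b = ch ` a" "c = ch ` a'" using assms(2,3) by blast
  then have "a \<inter> a' = {}" using disj assms(4) by blast
  then show ?thesis unfolding a(3,4) using inj_on_image_Int[OF inj_ch arcs_sub[OF a(1)] arcs_sub[OF a(2)]] by simp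
qed

text \<open>Disjoint arcs do not separate the plane: no single arc does, and
  \<open>Janiszewski_Union\<close> combines them. So a path leads from the point to 2, outside the
  triangle, and its initial part up to the boundary is the connection wanted.\<close>

lemma to_boundary:
  assumes disj: "\<And>a b. a \<in> \<A> \<Longrightarrow> b \<in> \<A> \<Longrightarrow> a \<noteq> b \<Longrightarrow> a \<inter> b = {}" and z: "z \<in> Tf - \<Union>\<A>"
  shows "\<exists>q\<in>Tf - Of - \<Union>\<A>. connected_component (Tf - \<Union>\<A>) z q"
proof (cases "z \<in> Of")
  case False
  then show ?thesis using z by (intro bexI[of _ z]) auto
next
  case True
  let ?\<B> = "image ch ` \<A>"
  have 2: "2 \<notin> Tri" by (simp add: Tri_def)
  have Bsub: "b \<subseteq> Tri" if "b \<in> ?\<B>" for b using that arcs_sub ch_Tri by blast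
  have "connected_component (- ({} \<union> \<Union>?\<B>)) (ch z) 2"
  proof (rule Janiszewski_Union)
    show "connected_component (- {}) (ch z) 2" by (simp add: connected_component_def) (metis UNIV_I connected_UNIV)
    show "b \<inter> c = {}" if "b \<in> ?\<B>" "c \<in> ?\<B>" "b \<noteq> c" for b c by (rule ch_disjoint[OF disj that])
    fix b assume b: "b \<in> ?\<B>"
    then obtain g where "arc g" "path_image g = b" using ch_arc by (metis imageE)
    then have "connected (- b)" using connected_arc_complement[of g] by (simp add: DIM_complex)
    moreover have "ch z \<notin> b" using ch_mem[of z] z b by blast
    moreover have "2 \<notin> b" using Bsub[OF b] 2 by blast
    ultimately show "connected_component (- ({} \<union> b)) (ch z) 2" unfolding connected_component_def by auto
  qed (use fin ch_compact in auto)
  moreover have "open (- \<Union>?\<B>)" using ch_compact fin by (intro open_Compl closed_Union) (auto intro: compact_imp_closed)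
  ultimately have "path_component (- \<Union>?\<B>) (ch z) 2" by (simp add: open_path_connected_component)
  then obtain \<gamma> where \<gamma>: "path \<gamma>" "path_image \<gamma> \<subseteq> - \<Union>?\<B>" "pathstart \<gamma> = ch z" "pathfinish \<gamma> = 2"
    by (auto simp: path_component_def)
  have "pathstart \<gamma> \<in> Tri" "pathfinish \<gamma> \<notin> Tri" using \<gamma> ch_Tri z 2 by auto
  from exists_path_subpath_to_frontier_closed[OF closed_Tri \<gamma>(1) this] obtain h where
    h: "path h" "pathstart h = ch z" "path_image h \<subseteq> path_image \<gamma> \<inter> Tri" "pathfinish h \<in> frontier Tri"
    using \<gamma>(3) by metis
  let ?C = "ich ` path_image h"
  let ?q = "ich (pathfinish h)"
  have C: "connected ?C" by (intro connected_continuous_image cont_ich connected_path_image h(1))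
  have Csub: "?C \<subseteq> Tf - \<Union>\<A>"
  proof
    fix y assume "y \<in> ?C"
    then obtain c where c: "c \<in> path_image h" "y = ich c" by blast
    have "y \<in> Tf" using c h(3) ich_Tf by auto
    moreover have "ch y \<notin> \<Union>?\<B>" using c h(3) \<gamma>(2) by auto
    ultimately show "y \<in> Tf - \<Union>\<A>" using ch_mem by blast
  qed
  have "z \<in> ?C" using h(2) pathstart_in_path_image[of h] ich_ch[of z] z by (metis DiffD1 imageI)
  moreover have q: "?q \<in> ?C" using pathfinish_in_path_image by blast
  ultimately have "connected_component (Tf - \<Union>\<A>) z ?q" unfolding connected_component_def using C Csub by blast
  moreover have "?q \<notin> Of" using h(4) ch_TriI[of ?q] ich_Tf[of "pathfinish h"] by (auto simp: frontier_Tri)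
  ultimately show ?thesis using q Csub by blast
qed

text \<open>The point may lie on the boundary. Since the arcs form a closed set, a sufficiently
  short segment into the open triangle avoids them.\<close>

lemma to_interior:
  assumes z: "z \<in> Tf - \<Union>\<A>"
  obtains C z' where "connected C" "C \<subseteq> Tf - \<Union>\<A>" "z \<in> C" "z' \<in> C" "z' \<in> Of"
proof -
  define S where "S = \<Union>(image ch ` \<A>)"
  have mem: "ch y \<in> S \<longleftrightarrow> y \<in> \<Union>\<A>" if "y \<in> Tf" for y unfolding S_def by (rule ch_mem[OF that])
  have "closed S" unfolding S_def using ch_compact fin by (intro closed_Union) (auto intro: compact_imp_closed)
  moreover have "ch z \<notin> S" using mem z by blast
  ultimately obtain e where e: "0 < e" "\<And>y. dist y (ch z) < e \<Longrightarrow> y \<notin> S"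
    using open_Compl[of S] unfolding open_dist by force
  have "Complex (1/3) (1/3) \<in> interior Tri" unfolding interior_Tri by (simp add: TriI_def)
  then have "closure (interior Tri) = Tri" using convex_closure_interior[OF convex_Tri] closed_Tri by auto
  moreover have zT: "ch z \<in> Tri" using z ch_Tri by blast
  ultimately obtain P where "P \<in> interior Tri" and dP: "dist P (ch z) < e"
    using e(1) closure_approachable[of "ch z" "interior Tri"] by auto
  let ?s = "closed_segment (ch z) P"
  have sT: "?s \<subseteq> Tri" using zT \<open>P \<in> interior Tri\<close> interior_subset closed_segment_subset[OF _ _ convex_Tri] by blast
  have sS: "y \<notin> S" if y: "y \<in> ?s" for y
  proof -
    have "dist (ch z) y \<le> dist (ch z) P" using dist_in_closed_segment[OF y] by (metis dist_commute)
    then show ?thesis using e(2)[of y] dP by (simp add: dist_commute)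
  qed
  have "ich ` ?s \<subseteq> Tf - \<Union>\<A>"
  proof
    fix y assume "y \<in> ich ` ?s"
    then obtain b where b: "b \<in> ?s" "y = ich b" by blast
    then have "y \<in> Tf" "ch y = b" using sT ich_Tf by auto
    then show "y \<in> Tf - \<Union>\<A>" using sS[OF b(1)] mem by auto
  qed
  moreover have "connected (ich ` ?s)" by (intro connected_continuous_image cont_ich) simp
  moreover have "z \<in> ich ` ?s" using ich_ch[of z] z ends_in_segment(1) by (metis DiffD1 imageI)
  moreover have "ich P \<in> ich ` ?s" by simp
  moreover have "ich P \<in> Of"
  proof -
    have "P \<in> TriI" "P \<in> Tri" using \<open>P \<in> interior Tri\<close> interior_subset[of Tri] unfolding interior_Tri by blast+
    then show ?thesis using ch_TriI[of "ich P"] ich_Tf[of P] by simp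
  qed
  ultimately show ?thesis using that[of "ich ` ?s" "ich P"] by blast
qed

lemma connected_frontier_Tri: "connected (frontier Tri)"
proof -
  have "connected (- Tri)"
    by (rule connected_complement_bounded_convex[OF bounded_Tri convex_Tri]) simp
  then show ?thesis
    using connected_frontier_simple[of "Tri"] convex_connected[OF convex_Tri] by simp
qed

text \<open>Boundary points that no single arc separates are not separated by all of them. They are
  first moved into the open triangle, so that its frontier, which is connected, can be the common
  part in Janiszewski's theorem; this also keeps the resulting connection inside the
  triangle.\<close>

lemma cell_connected:
  assumes disj: "\<And>a b. a \<in> \<A> \<Longrightarrow> b \<in> \<A> \<Longrightarrow> a \<noteq> b \<Longrightarrow> a \<inter> b = {}"
    and p: "p \<in> Tf - Of - \<Union>\<A>" and q: "q \<in> Tf - Of - \<Union>\<A>"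
    and nr: "\<And>a u' v' w' x y. a \<in> \<A> \<Longrightarrow> {u, v, w} = {u', v', w'} \<Longrightarrow> crossing u' v' w' a x y \<Longrightarrow>
      near v' w' x y p \<longleftrightarrow> near v' w' x y q"
  shows "connected_component (Tf - \<Union>\<A>) p q"
proof -
  obtain C p' where p': "connected C" "C \<subseteq> Tf - \<Union>\<A>" "p \<in> C" "p' \<in> C" "p' \<in> Of"
    by (rule to_interior[of p]) (use p in blast)+
  obtain C' q' where q': "connected C'" "C' \<subseteq> Tf - \<Union>\<A>" "q \<in> C'" "q' \<in> C'" "q' \<in> Of"
    by (rule to_interior[of q]) (use q in blast)+
  have one: "\<exists>E. connected E \<and> E \<subseteq> Of - a \<and> p' \<in> E \<and> q' \<in> E" if a: "a \<in> \<A>" for a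
  proof -
    obtain u' v' w' x y where l: "{u, v, w} = {u', v', w'}" "crossing u' v' w' a x y"
      by (rule face_crossing[OF pf[OF a]]) (use d in auto)
    interpret t: tri u' v' w' using l(2) by unfold_locales (auto simp: crossing_def)
    obtain A B where AB: "A \<union> B = Tf - a" "A \<inter> B = {}"
      "closedin (top_of_set (Tf - a)) A" "closedin (top_of_set (Tf - a)) B"
      "connected (A \<inter> Of)" "connected (B \<inter> Of)"
      "\<And>z. z \<in> Tf - Of - a \<Longrightarrow> z \<in> A \<longleftrightarrow> near v' w' x y z"
      using t.sides[OF l(2), folded l(1)] by metis
    have Ca: "C \<subseteq> Tf - a" "C' \<subseteq> Tf - a" using p'(2) q'(2) a by blast+
    have "p \<in> A \<longleftrightarrow> p' \<in> A" using same_side[OF AB(1-4) p'(1) Ca(1) p'(3,4)] .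
    moreover have "q \<in> A \<longleftrightarrow> q' \<in> A" using same_side[OF AB(1-4) q'(1) Ca(2) q'(3,4)] .
    moreover have "p \<in> A \<longleftrightarrow> q \<in> A" using AB(7)[of p] AB(7)[of q] p q a nr[OF a l] by blast
    ultimately have e: "p' \<in> A \<longleftrightarrow> q' \<in> A" by blast
    have u: "p' \<in> A \<union> B" "q' \<in> A \<union> B" using AB(1) Ca p'(4) q'(4) by blast+
    have s: "A \<inter> Of \<subseteq> Of - a" "B \<inter> Of \<subseteq> Of - a" using AB(1) by blast+
    show ?thesis
    proof (cases "p' \<in> A")
      case True
      then show ?thesis using e AB(5) s(1) p'(5) q'(5) by blast
    next
      case False
      then show ?thesis using e AB(6) s(2) p'(5) q'(5) u by blast
    qed
  qed
  let ?\<B> = "image ch ` \<A>"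
  have OT: "Of \<subseteq> Tf" by (auto simp: mem_Of)
  have pT: "ch p' \<in> TriI" "ch q' \<in> TriI" using p'(5) q'(5) ch_TriI OT by blast+
  have cI: "connected TriI" using convex_connected[OF convex_interior[OF convex_Tri]] by (simp add: interior_Tri)
  have "connected_component (- (frontier Tri \<union> \<Union>?\<B>)) (ch p') (ch q')"
  proof (rule Janiszewski_Union)
    show "connected_component (- frontier Tri) (ch p') (ch q')"
      unfolding connected_component_def using cI pT by (intro exI[of _ TriI]) (auto simp: frontier_Tri)
    show "b \<inter> c = {}" if "b \<in> ?\<B>" "c \<in> ?\<B>" "b \<noteq> c" for b c by (rule ch_disjoint[OF disj that])
    show "compact (frontier Tri)" using compact_frontier[OF compact_Tri] .
    show "connected (frontier Tri)" using connected_frontier_Tri .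
    show "finite ?\<B>" using fin by simp
    show "compact b" if "b \<in> ?\<B>" for b by (rule ch_compact[OF that])
    fix b assume "b \<in> ?\<B>"
    then obtain a where a: "a \<in> \<A>" "b = ch ` a" by blast
    obtain E where E: "connected E" "E \<subseteq> Of - a" "p' \<in> E" "q' \<in> E" using one[OF a(1)] by blast
    have "ch ` E \<subseteq> - (frontier Tri \<union> b)"
    proof
      fix z assume "z \<in> ch ` E"
      then obtain y where y: "y \<in> E" "z = ch y" by blast
      then have "y \<in> Of" "y \<notin> a" using E(2) by blast+
      then have "ch y \<in> TriI" "ch y \<notin> ch ` a"
        using ch_TriI OT inj_on_image_mem_iff[OF inj_ch _ arcs_sub[OF a(1)], of y] by blast+
      then show "z \<in> - (frontier Tri \<union> b)" using y a by (simp add: frontier_Tri)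
    qed
    moreover have "connected (ch ` E)" using connected_continuous_image[OF cont_ch E(1)] .
    ultimately show "connected_component (- (frontier Tri \<union> b)) (ch p') (ch q')"
      unfolding connected_component_def using E(3,4) by blast
  qed
  then obtain S where S: "connected S" "S \<subseteq> - (frontier Tri \<union> \<Union>?\<B>)" "ch p' \<in> S" "ch q' \<in> S"
    unfolding connected_component_def by blast
  have "S \<subseteq> Tri"
  proof (rule ccontr)
    assume "\<not> ?thesis"
    then have "S \<inter> frontier Tri \<noteq> {}"
      using connected_Int_frontier[OF S(1), of Tri] S(3) pT(1) interior_subset[of Tri] unfolding interior_Tri by blast
    then show False using S(2) by blast
  qed
  have "ich ` S \<subseteq> Tf - \<Union>\<A>"
  proof
    fix y assume "y \<in> ich ` S"
    then obtain b where b: "b \<in> S" "y = ich b" by blast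
    then have "y \<in> Tf" "ch y = b" using \<open>S \<subseteq> Tri\<close> ich_Tf by auto
    then show "y \<in> Tf - \<Union>\<A>" using S(2) b(1) ch_mem[of y] by blast
  qed
  moreover have "connected (ich ` S)" by (intro connected_continuous_image cont_ich S(1))
  moreover have "p' \<in> ich ` S" "q' \<in> ich ` S" using ich_ch[of p'] ich_ch[of q'] OT p'(5) q'(5) S(3,4) by (metis imageI subsetD)+
  ultimately have 1: "connected_component (Tf - \<Union>\<A>) p' q'" unfolding connected_component_def by blast
  have 2: "connected_component (Tf - \<Union>\<A>) p p'" unfolding connected_component_def using p' by blast
  have 3: "connected_component (Tf - \<Union>\<A>) q' q" unfolding connected_component_def using q' by blast
  show ?thesis using connected_component_trans[OF connected_component_trans[OF 2 1] 3] .
qed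

end

text \<open>The path \<open>b\<close> is itself a connected set missing \<open>a\<close>. Read
  contrapositively, paths with interleaved ends must meet, which is the source of
  \<open>cross1\<close> and \<open>cross2\<close>.\<close>

lemma disjoint_near:
  assumes "crossing u v w a x y" "path_in_face {u, v, w} b" "a \<inter> b = {}" "p \<in> ends b" "q \<in> ends b"
  shows "near v w x y p \<longleftrightarrow> near v w x y q"
proof -
  obtain u' v' w' x' y' where l: "{u, v, w} = {u', v', w'}" "crossing u' v' w' b x' y'"
    by (rule face_crossing[OF assms(2)]) (use d in auto)
  interpret t: tri u' v' w' using l(2) by unfold_locales (auto simp: crossing_def)
  have pq: "p \<in> b - Of" "q \<in> b - Of"
    using assms(4,5) t.crossing_sub[OF l(2)] t.crossing_ends[OF l(2)] unfolding l(1) by auto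
  obtain g where "arc g" "path_image g = b" "b \<subseteq> Tf" using pif_arc[OF assms(2)] by metis
  then have "connected b" "b \<subseteq> Tf - a" using connected_arc_image assms(3) by blast+
  then show ?thesis using connected_near[OF assms(1)] pq by blast
qed

end

section \<open>Drawings and their components\<close>

definition supp :: "('v \<Rightarrow> real) \<Rightarrow> 'v set" where "supp x = {v. x v \<noteq> 0}"

lemma supp_open: "x \<in> open_simplex s \<Longrightarrow> supp x = s"
  by (force simp: supp_def open_simplex_def closed_simplex_def)

lemma supp_closed: "x \<in> cs s \<Longrightarrow> supp x \<subseteq> s"
  by (auto simp: supp_def closed_simplex_def)

lemma closed_supp:
  assumes "x \<in> cs s" "finite s" "supp x \<subseteq> t" "finite t"
  shows "x \<in> cs t"
proof -
  have "sum x t = sum x (supp x)"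
    by (rule sum.mono_neutral_right) (use assms in \<open>auto simp: supp_def\<close>)
  moreover have "sum x s = sum x (supp x)"
    by (rule sum.mono_neutral_right) (use assms supp_closed[OF assms(1)] in \<open>auto simp: supp_def\<close>)
  moreover have "x v = 0" if "v \<notin> t" for v using assms(3) that by (auto simp: supp_def)
  ultimately show ?thesis using assms(1) by (simp add: closed_simplex_def)
qed

lemma open_supp:
  assumes "x \<in> cs s" "finite s"
  shows "x \<in> open_simplex (supp x)"
proof -
  have f: "finite (supp x)" using supp_closed[OF assms(1)] assms(2) by (rule finite_subset)
  have "x \<in> cs (supp x)" using closed_supp[OF assms order_refl f] .
  moreover have "0 < x v" if "v \<in> supp x" for v
    using assms(1) that by (auto simp: supp_def closed_simplex_def less_le)
  ultimately show ?thesis by (simp add: open_simplex_def)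
qed

lemma closed_simplex_mono: "s \<subseteq> t \<Longrightarrow> finite t \<Longrightarrow> cs s \<subseteq> cs t"
proof
  fix x assume h: "s \<subseteq> t" "finite t" "x \<in> cs s"
  have "finite s" using h(1,2) by (rule finite_subset)
  then show "x \<in> cs t" using closed_supp[OF h(3) _ _ h(2)] supp_closed[OF h(3)] h(1) by blast
qed

lemma supp_vertex: "supp (vp v) = {v}"
  by (auto simp: supp_def vertex_point_def)

text \<open>The path alone determines its face, so paths need not carry a face as additional
  data.\<close>

lemma path_in_face_supp:
  assumes "path_in_face f a"
  shows "(\<Union>z\<in>a. supp z) = f"
proof -
  obtain g e e' where g: "path_image g = a" "e \<subseteq> f" "e' \<subseteq> f"
    "pathstart g \<in> open_simplex e" "pathfinish g \<in> open_simplex e'" "\<forall>t. 0 < t \<and> t < 1 \<longrightarrow> g t \<in> open_simplex f"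
    using assms unfolding path_in_face_def by blast
  have "supp z \<subseteq> f" if za: "z \<in> a" for z
  proof -
    obtain t where t: "0 \<le> t" "t \<le> 1" "z = g t" using za g(1) by (auto simp: path_image_def)
    consider "t = 0" | "t = 1" | "0 < t \<and> t < 1" using t by linarith
    then show ?thesis
    proof cases
      case 1
      then show ?thesis using supp_open[OF g(4)] g(2) t by (simp add: pathstart_def)
    next
      case 2
      then show ?thesis using supp_open[OF g(5)] g(3) t by (simp add: pathfinish_def)
    next
      case 3
      then show ?thesis using supp_open[of z f] g(6) t by simp
    qed
  qed
  moreover have "g (1/2) \<in> a" using g(1) by (auto simp: path_image_def)
  moreover have "supp (g (1/2)) = f" using g(6) supp_open[of "g (1/2)" f] by simp
  ultimately show ?thesis by blast
qed

lemma path_in_face_unique: "path_in_face f a \<Longrightarrow> path_in_face f' a \<Longrightarrow> f = f'"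
  using path_in_face_supp by metis

lemma crossingD:
  assumes "crossing u v w a x y"
  shows "tri u v w" "path_in_face {u, v, w} a" "ends a = {x, y}" "supp x = {u, v}" "supp y = {u, w}" "x \<noteq> y"
    "a \<subseteq> insert x (insert y (open_simplex {u, v, w}))" "x \<in> a" "y \<in> a" "a \<subseteq> cs {u, v, w}"
    "x \<in> open_simplex {u, v}" "y \<in> open_simplex {u, w}" "connected a" "cs {u, v} \<subseteq> cs {u, v, w}"
    "cs {u, w} \<subseteq> cs {u, v, w}"
proof -
  show t: "tri u v w" using assms by unfold_locales (auto simp: crossing_def)
  interpret tri u v w by (rule t)
  show "path_in_face {u, v, w} a" by (rule crossing_path_in_face[OF assms])
  show "ends a = {x, y}" by (rule crossing_ends[OF assms])
  show o: "x \<in> open_simplex {u, v}" "y \<in> open_simplex {u, w}" using assms by (auto simp: crossing_def)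
  show s: "supp x = {u, v}" "supp y = {u, w}" using o supp_open by blast+
  show "x \<noteq> y"
  proof
    assume "x = y"
    then have "v \<in> {u, w}" using s by auto
    then show False using d by simp
  qed
  show "a \<subseteq> insert x (insert y Of)" "x \<in> a" "y \<in> a" using crossing_sub[OF assms] by blast+
  show "a \<subseteq> Tf" using crossing_sub[OF assms] by (auto simp: mem_Of)
  show "connected a" using assms connected_arc_image unfolding crossing_def by blast
  show "cs {u, v} \<subseteq> Tf" "cs {u, w} \<subseteq> Tf" by (rule edge_sub)+
qed

lemma endpoint_crossing:
  assumes "path_in_face f a" "card f = 3" "x \<in> ends a"
  obtains u v w y where "f = {u, v, w}" "crossing u v w a x y"
proof -
  obtain u v w x' y' where c: "f = {u, v, w}" "crossing u v w a x' y'" using face_crossing[OF assms(1,2)] .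
  then have "x = x' \<or> x = y'" using crossingD(3)[OF c(2)] assms(3) by blast
  then show ?thesis
  proof
    assume "x = x'"
    then show ?thesis using that c by blast
  next
    assume "x = y'"
    moreover have "f = {u, w, v}" using c(1) by blast
    ultimately show ?thesis using that crossing_sym[OF c(2)] by blast
  qed
qed

lemma finite_endpoints:
  assumes "path_in_face f a" "card f = 3"
  shows "finite (ends a)"
proof -
  obtain u v w x y where c: "f = {u, v, w}" "crossing u v w a x y" using face_crossing[OF assms] .
  show ?thesis using crossingD(3)[OF c(2)] by simp
qed

definition opp :: "('v \<Rightarrow> real) set \<Rightarrow> ('v \<Rightarrow> real) \<Rightarrow> 'v \<Rightarrow> real" where
  "opp a x = (THE y. ends a = {x, y})"

lemma opp_crossing: "crossing u v w a x y \<Longrightarrow> opp a x = y"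
  unfolding opp_def using crossingD(3,6)[of u v w a x y] by (intro the_equality) (auto simp: doubleton_eq_iff)

text \<open>A path meets the boundary of its face only in its endpoints, and these are disjoint for
  the two paths. A common point is therefore an intersection in the sense of
  \<open>self_intersecting\<close>.\<close>

lemma arcs_meet:
  assumes "path_in_face f a" "path_in_face f b" "card f = 3" "ends a \<inter> ends b = {}" "z \<in> a" "z \<in> b"
  shows "z \<in> open_simplex f"
proof (rule ccontr)
  assume n: "z \<notin> open_simplex f"
  have "z \<in> ends c" if c: "path_in_face f c" "z \<in> c" for c
  proof -
    obtain u v w x y where l: "f = {u, v, w}" "crossing u v w c x y" using face_crossing[OF c(1) assms(3)] .
    show ?thesis using crossingD(3,7)[OF l(2)] n c(2) l(1) by blast
  qed
  then show False using assms by blast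
qed

locale drw =
  fixes L :: "'v set set" and D :: "('v \<Rightarrow> real) set set"
  assumes L: "abstract_complex L" and D: "drawing L D"
begin

definition N :: "('v \<Rightarrow> real) set" where "N = (\<Union>a\<in>D. ends a)"

lemma D_face: "a \<in> D \<Longrightarrow> \<exists>f\<in>faces L. path_in_face f a"
  and D_fin: "f \<in> faces L \<Longrightarrow> finite {a \<in> D. path_in_face f a}"
  and D_disj: "f \<in> faces L \<Longrightarrow> a \<in> D \<Longrightarrow> b \<in> D \<Longrightarrow> path_in_face f a \<Longrightarrow> path_in_face f b \<Longrightarrow> a \<noteq> b \<Longrightarrow>
    ends a \<inter> ends b = {}"
  and D_ext: "e \<in> edges L \<Longrightarrow> x \<in> cs e \<Longrightarrow> a \<in> D \<Longrightarrow> x \<in> ends a \<Longrightarrow> f \<in> faces L \<Longrightarrow> e \<subseteq> f \<Longrightarrow>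
    \<exists>b\<in>D. path_in_face f b \<and> x \<in> ends b"
  using D[unfolded drawing_def, THEN conjunct2] by (elim conjE, meson)+

lemma face_card: "f \<in> faces L \<Longrightarrow> card f = 3" and face_L: "f \<in> faces L \<Longrightarrow> f \<in> L"
  by (auto simp: faces_def)

lemma node_supp:
  assumes "a \<in> D" "x \<in> ends a"
  shows "supp x \<in> edges L" "card (supp x) = 2" "x \<in> open_simplex (supp x)"
    and "path_in_face f a \<Longrightarrow> supp x \<subseteq> f"
proof -
  obtain f where f: "f \<in> faces L" "path_in_face f a" using D_face[OF assms(1)] by blast
  obtain u v w y where c: "f = {u, v, w}" "crossing u v w a x y" using endpoint_crossing[OF f(2) face_card[OF f(1)] assms(2)] .
  note s = crossingD(4)[OF c(2)]
  have "u \<noteq> v" using crossingD(1)[OF c(2)] by (simp add: tri_def)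
  then show "card (supp x) = 2" using s by simp
  then show "supp x \<in> edges L"
    using abstract_face[OF L face_L[OF f(1)], of "supp x"] c(1) s by (simp add: edges_def)
  show "x \<in> open_simplex (supp x)" using crossingD(11)[OF c(2)] s by simp
  show "supp x \<subseteq> f" if "path_in_face f a" for f
    using path_in_face_unique[OF that f(2)] c(1) s by blast
qed

lemma node_closed: "x \<in> N \<Longrightarrow> x \<in> cs (supp x)"
  using node_supp(3) by (auto simp: N_def open_simplex_def)

lemma D_cont:
  assumes "x \<in> N" "f \<in> faces L" "supp x \<subseteq> f"
  shows "\<exists>b\<in>D. path_in_face f b \<and> x \<in> ends b"
proof -
  obtain a where a: "a \<in> D" "x \<in> ends a" using assms(1) by (auto simp: N_def)
  then show ?thesis using D_ext[OF node_supp(1)[OF a] node_closed[OF assms(1)] a assms(2,3)] by blast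
qed

definition arc_at :: "'v set \<Rightarrow> ('v \<Rightarrow> real) \<Rightarrow> ('v \<Rightarrow> real) set" where
  "arc_at f x = (THE b. b \<in> D \<and> path_in_face f b \<and> x \<in> ends b)"

definition nb :: "'v set \<Rightarrow> ('v \<Rightarrow> real) \<Rightarrow> 'v \<Rightarrow> real" where "nb f x = opp (arc_at f x) x"

lemma arc_at_eq:
  assumes "f \<in> faces L" "b \<in> D" "path_in_face f b" "x \<in> ends b"
  shows "arc_at f x = b"
  unfolding arc_at_def
proof (rule the_equality)
  fix c assume "c \<in> D \<and> path_in_face f c \<and> x \<in> ends c"
  then show "c = b" using D_disj[OF assms(1), of c b] assms by blast
qed (use assms in blast)

lemma arc_at_D:
  assumes "x \<in> N" "f \<in> faces L" "supp x \<subseteq> f"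
  shows "arc_at f x \<in> D" "path_in_face f (arc_at f x)" "x \<in> ends (arc_at f x)"
  using D_cont[OF assms] arc_at_eq[OF assms(2)] by metis+

lemma arc_at_crossing:
  assumes "x \<in> N" "f \<in> faces L" "supp x \<subseteq> f"
  obtains u v w where "f = {u, v, w}" "crossing u v w (arc_at f x) x (nb f x)"
proof -
  obtain u v w y where c: "f = {u, v, w}" "crossing u v w (arc_at f x) x y"
    using endpoint_crossing[OF arc_at_D(2)[OF assms] face_card[OF assms(2)] arc_at_D(3)[OF assms]] .
  then show ?thesis using that opp_crossing[OF c(2)] by (simp add: nb_def)
qed

lemma nb:
  assumes "x \<in> N" "f \<in> faces L" "supp x \<subseteq> f"
  shows "nb f x \<in> N" "supp (nb f x) \<subseteq> f" "supp (nb f x) \<noteq> supp x" "arc_at f (nb f x) = arc_at f x" "nb f (nb f x) = x"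
    "ends (arc_at f x) = {x, nb f x}"
proof -
  obtain u v w where c: "f = {u, v, w}" "crossing u v w (arc_at f x) x (nb f x)" using arc_at_crossing[OF assms] .
  note cf = crossingD[OF c(2)]
  show ends: "ends (arc_at f x) = {x, nb f x}" by (rule cf(3))
  then show "nb f x \<in> N" using arc_at_D(1)[OF assms] by (auto simp: N_def)
  show "supp (nb f x) \<subseteq> f" using cf(5) c(1) by blast
  show "supp (nb f x) \<noteq> supp x" unfolding cf(4,5) using cf(1) by (auto simp: tri_def doubleton_eq_iff)
  show at_nb: "arc_at f (nb f x) = arc_at f x" using arc_at_eq[OF assms(2) arc_at_D(1,2)[OF assms]] ends by blast
  show "nb f (nb f x) = x" unfolding nb_def[of f "nb f x"] at_nb using opp_crossing[OF crossing_sym[OF c(2)]] .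
qed

lemma nb_crossing:
  assumes "x \<in> N" "{u, v, w} \<in> faces L" "supp x = {u, v}" "supp (nb {u, v, w} x) = {u, w}"
  shows "crossing u v w (arc_at {u, v, w} x) x (nb {u, v, w} x)"
proof -
  have s: "supp x \<subseteq> {u, v, w}" using assms(3) by blast
  obtain u' v' w' where c: "{u, v, w} = {u', v', w'}" "crossing u' v' w' (arc_at {u, v, w} x) x (nb {u, v, w} x)"
    using arc_at_crossing[OF assms(1,2) s] .
  have e: "{u', v'} = {u, v}" "{u', w'} = {u, w}" using crossingD(4,5)[OF c(2)] assms(3,4) by simp_all
  have "u' \<noteq> v'" "u' \<noteq> w'" "v' \<noteq> w'" using crossingD(1)[OF c(2)] by (simp_all add: tri_def)
  then have "u' = u" "v' = v" "w' = w" using e face_card[OF assms(2)] by (auto simp: doubleton_eq_iff card_insert_if split: if_splits)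
  then show ?thesis using c(2) by simp
qed

lemma fin_nodes: "finite {x \<in> N. supp x = e}"
proof (cases "{x \<in> N. supp x = e} = {}")
  case False
  then obtain x where x: "x \<in> N" "supp x = e" by blast
  then obtain a where a: "a \<in> D" "x \<in> ends a" by (auto simp: N_def)
  obtain f where f: "f \<in> faces L" "path_in_face f a" using D_face[OF a(1)] by blast
  have ef: "e \<subseteq> f" using node_supp(4)[OF a f(2)] x by simp
  note fe = finite_endpoints[OF _ face_card[OF f(1)]]
  have "{x \<in> N. supp x = e} \<subseteq> (\<Union>b\<in>{b \<in> D. path_in_face f b}. ends b)"
    using D_cont[OF _ f(1)] ef by blast
  then show ?thesis by (rule finite_subset) (use D_fin[OF f(1)] fe in simp)
next
  case True
  then show ?thesis by (metis finite.emptyI)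
qed

lemma node_face:
  assumes "x \<in> N"
  shows "\<exists>f\<in>faces L. supp x \<subseteq> f"
proof -
  obtain a where a: "a \<in> D" "x \<in> ends a" using assms by (auto simp: N_def)
  then show ?thesis using D_face[OF a(1)] node_supp(4)[OF a] by blast
qed

definition R where "R = {(a, b). a \<in> D \<and> b \<in> D \<and> ends a \<inter> ends b \<noteq> {}}"

text \<open>Components under sharing an endpoint. The pre-tracks contained in \<open>D\<close> are
  exactly these components, by \<open>cp_pretrack\<close> and \<open>pretrack_cp\<close>.\<close>

definition cp :: "('v \<Rightarrow> real) set \<Rightarrow> ('v \<Rightarrow> real) set set" where "cp a = {b. (a, b) \<in> R\<^sup>*}"

lemma R_sym: "(a, b) \<in> R\<^sup>* \<Longrightarrow> (b, a) \<in> R\<^sup>*"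
  by (rule symD[OF sym_rtrancl]) (auto simp: R_def sym_def)

lemma cp_self: "a \<in> cp a" by (simp add: cp_def)

lemma cp_eq:
  assumes "b \<in> cp a"
  shows "cp b = cp a"
proof -
  have ab: "(a, b) \<in> R\<^sup>*" using assms by (simp add: cp_def)
  have "(b, c) \<in> R\<^sup>* \<longleftrightarrow> (a, c) \<in> R\<^sup>*" for c
    using rtrancl_trans[OF ab] rtrancl_trans[OF R_sym[OF ab]] by (rule iffI)
  then show ?thesis by (simp add: cp_def)
qed

lemma cp_D: "a \<in> D \<Longrightarrow> cp a \<subseteq> D"
proof
  fix b assume "a \<in> D" "b \<in> cp a"
  then have "(a, b) \<in> R\<^sup>*" "a \<in> D" by (auto simp: cp_def)
  then show "b \<in> D" by (induction) (auto simp: R_def)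
qed

lemma cp_step:
  assumes "b \<in> cp a" "a \<in> D" "c \<in> D" "x \<in> ends b" "x \<in> ends c"
  shows "c \<in> cp a"
proof -
  have "(a, b) \<in> R\<^sup>*" using assms(1) by (simp add: cp_def)
  moreover have "(b, c) \<in> R" using cp_D[OF assms(2)] assms by (auto simp: R_def)
  ultimately have "(a, c) \<in> R\<^sup>*" by (rule rtrancl_into_rtrancl)
  then show ?thesis by (simp add: cp_def)
qed

lemma cp_drawing:
  assumes a: "a \<in> D"
  shows "drawing L (cp a)"
  unfolding drawing_def
proof (intro conjI ballI impI)
  note s = cp_D[OF a]
  show "cp a \<noteq> {}" using cp_self by blast
  show "\<exists>f\<in>faces L. path_in_face f b" if "b \<in> cp a" for b using that s D_face by blast
  show "finite {b \<in> cp a. path_in_face f b}" if "f \<in> faces L" for f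
    by (rule finite_subset[OF _ D_fin[OF that]]) (use s in blast)
  show "ends b \<inter> ends c = {}" if "f \<in> faces L" "b \<in> cp a" "c \<in> cp a"
    "path_in_face f b \<and> path_in_face f c \<and> b \<noteq> c" for f b c using D_disj[OF that(1)] that s by blast
  fix e x f assume h: "e \<in> edges L" "x \<in> cs e" "\<exists>b\<in>cp a. x \<in> ends b" "f \<in> faces L" "e \<subseteq> f"
  then obtain b where b: "b \<in> cp a" "x \<in> ends b" by blast
  then have "x \<in> N" using s by (auto simp: N_def)
  moreover have "supp x \<subseteq> f" using supp_closed[OF h(2)] h(5) by blast
  ultimately obtain c where c: "c \<in> D" "path_in_face f c" "x \<in> ends c" using D_cont[OF _ h(4)] by blast
  then show "\<exists>c\<in>cp a. path_in_face f c \<and> x \<in> ends c" using cp_step[OF b(1) a c(1) b(2) c(3)] by blast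
qed

text \<open>At a common endpoint the smaller drawing must continue in the face of the neighbouring
  path, and \<open>D\<close> has only one path with that endpoint in that face. So the neighbour
  already belongs to \<open>s\<close>.\<close>

lemma drawing_cp:
  assumes s: "drawing L s" "s \<subseteq> D" and a: "a \<in> s"
  shows "cp a \<subseteq> s"
proof
  fix b assume "b \<in> cp a"
  then have "(a, b) \<in> R\<^sup>*" by (simp add: cp_def)
  then show "b \<in> s"
  proof (induction)
    case base
    then show ?case using a .
  next
    case (step b c)
    interpret s: drw L s by unfold_locales (use L s in auto)
    obtain x where x: "x \<in> ends b" "x \<in> ends c" "c \<in> D" using step(2) by (auto simp: R_def)
    obtain f where f: "f \<in> faces L" "path_in_face f c" using D_face[OF x(3)] by blast
    have "x \<in> s.N" using x step(3) by (auto simp: s.N_def)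
    from s.D_cont[OF this f(1) node_supp(4)[OF x(3,2) f(2)]] obtain c' where
      c': "c' \<in> s" "path_in_face f c'" "x \<in> ends c'" by blast
    then have "c' = c" using D_disj[OF f(1) _ x(3) _ f(2), of c'] x s(2) by blast
    then show ?case using c' by simp
  qed
qed

lemma cp_pretrack:
  assumes a: "a \<in> D"
  shows "pretrack L (cp a)"
  unfolding pretrack_def
proof (intro conjI allI impI notI)
  show "drawing L (cp a)" by (rule cp_drawing[OF a])
  fix s assume s: "s \<subset> cp a" "drawing L s"
  then obtain b where b: "b \<in> s" by (auto simp: drawing_def)
  have "cp b \<subseteq> s" using drawing_cp[OF s(2) _ b] s(1) cp_D[OF a] by blast
  moreover have "cp b = cp a" by (rule cp_eq) (use b s(1) in blast)
  ultimately show False using s(1) by blast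
qed

lemma pretrack_cp:
  assumes s: "pretrack L s" "s \<subseteq> D" and a: "a \<in> s"
  shows "s = cp a"
proof -
  have "cp a \<subseteq> s" using drawing_cp[OF _ s(2) a] s(1) by (simp add: pretrack_def)
  moreover have "drawing L (cp a)" using cp_drawing a s(2) by blast
  ultimately show ?thesis using s(1) unfolding pretrack_def by (metis psubsetI)
qed

definition lf :: "('v \<Rightarrow> real) \<Rightarrow> ('v \<Rightarrow> real) set set" where
  "lf x = cp (SOME a. a \<in> D \<and> x \<in> ends a)"

lemma lf_eq:
  assumes "a \<in> D" "x \<in> ends a"
  shows "lf x = cp a"
proof -
  let ?b = "SOME a. a \<in> D \<and> x \<in> ends a"
  have b: "?b \<in> D \<and> x \<in> ends ?b" by (rule someI[of _ a]) (use assms in blast)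
  have "?b \<in> cp a" by (rule cp_step[OF cp_self assms(1) _ assms(2)]) (use b in blast)+
  then show ?thesis unfolding lf_def by (rule cp_eq)
qed

lemma lf_arc_at: "x \<in> N \<Longrightarrow> f \<in> faces L \<Longrightarrow> supp x \<subseteq> f \<Longrightarrow> lf x = cp (arc_at f x)"
  by (rule lf_eq[OF arc_at_D(1,3)])

lemma lf_nb: "x \<in> N \<Longrightarrow> f \<in> faces L \<Longrightarrow> supp x \<subseteq> f \<Longrightarrow> lf (nb f x) = lf x"
  by (simp add: lf_arc_at nb(1,2,4))

lemma lf_image: "lf ` N = cp ` D"
proof (intro equalityI subsetI)
  fix l assume "l \<in> lf ` N"
  then obtain x a where "l = lf x" "a \<in> D" "x \<in> ends a" by (auto simp: N_def)
  then show "l \<in> cp ` D" using lf_eq by blast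
next
  fix l assume "l \<in> cp ` D"
  then obtain a where a: "a \<in> D" "l = cp a" by blast
  obtain f where f: "f \<in> faces L" "path_in_face f a" using D_face[OF a(1)] by blast
  obtain u v w x y where c: "f = {u, v, w}" "crossing u v w a x y" using face_crossing[OF f(2) face_card[OF f(1)]] .
  have x: "x \<in> ends a" using crossingD(3)[OF c(2)] by simp
  then have "x \<in> N" using a(1) by (auto simp: N_def)
  then show "l \<in> lf ` N" using lf_eq[OF a(1) x] a(2) by (simp add: rev_image_eqI)
qed

lemma nb_conn:
  assumes "x \<in> N" "y \<in> N" "lf x = lf y"
  shows "(x, y) \<in> {(x, nb f x) | x f. x \<in> N \<and> f \<in> faces L \<and> supp x \<subseteq> f}\<^sup>*" (is "_ \<in> ?S\<^sup>*")
proof -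
  obtain a where a: "a \<in> D" "x \<in> ends a" using assms(1) by (auto simp: N_def)
  obtain b where b: "b \<in> D" "y \<in> ends b" using assms(2) by (auto simp: N_def)
  have within: "(x, y) \<in> ?S\<^sup>*" if h: "c \<in> D" "x \<in> ends c" "y \<in> ends c" for c x y
  proof -
    obtain f where f: "f \<in> faces L" "path_in_face f c" using D_face[OF h(1)] by blast
    have x: "x \<in> N" using h(1,2) by (auto simp: N_def)
    have x2: "supp x \<subseteq> f" using node_supp(4)[OF h(1,2) f(2)] .
    note x = x x2 arc_at_eq[OF f(1) h(1) f(2) h(2)]
    then have "y = x \<or> y = nb f x" using nb(6)[OF x(1) f(1) x(2)] h(3) by auto
    moreover have "(x, nb f x) \<in> ?S" using x f by blast
    ultimately show ?thesis by auto
  qed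
  have "b \<in> cp a" using lf_eq[OF a] lf_eq[OF b] assms(3) cp_self[of b] by simp
  then have "(a, b) \<in> R\<^sup>*" by (simp add: cp_def)
  then show ?thesis using b(2)
  proof (induction arbitrary: y)
    case base
    then show ?case using within[OF a] by blast
  next
    case (step b c)
    obtain z where z: "z \<in> ends b" "z \<in> ends c" "c \<in> D" using step(2) by (auto simp: R_def)
    show ?case using rtrancl_trans[OF step.IH[OF z(1)] within[OF z(3,2) step.prems]] .
  qed
qed

end

section \<open>Halfspaces and parity\<close>

lemma odd_card_neq:
  assumes "finite A"
  shows "odd (card {a \<in> A. P a \<noteq> Q a}) \<longleftrightarrow> odd (card {a \<in> A. P a}) \<noteq> odd (card {a \<in> A. Q a})"
  using assms
proof (induction A)
  case (insert a A)
  have i: "{b \<in> insert a A. S b} = (if S a then insert a {b \<in> A. S b} else {b \<in> A. S b})" for S by auto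
  have c: "card {b \<in> insert a A. S b} = (if S a then Suc (card {b \<in> A. S b}) else card {b \<in> A. S b})" for S
    unfolding i using insert.hyps by (auto simp: card_insert_if)
  show ?case unfolding c using insert.IH by auto
qed simp

lemma crossing_unique:
  assumes "crossing u v w a x y" "crossing u' v' w' a x' y'"
  shows "u' = u" "{u', v', w'} = {u, v, w}"
proof -
  note c = crossingD[OF assms(1)] and c' = crossingD[OF assms(2)]
  have "supp x \<inter> supp y = {u}" using c(1) unfolding c(4,5) by (auto simp: tri_def)
  moreover have "supp x' \<inter> supp y' = {u'}" using c'(1) unfolding c'(4,5) by (auto simp: tri_def)
  moreover have "{x, y} = {x', y'}" using c(3) c'(3) by simp
  then have "x = x' \<and> y = y' \<or> x = y' \<and> y = x'" by (auto simp: doubleton_eq_iff)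
  ultimately show "u' = u" by (elim disjE conjE) (simp_all add: Int_commute)
  show "{u', v', w'} = {u, v, w}" using path_in_face_unique[OF c'(2) c(2)] .
qed

text \<open>Membership in the side of \<open>a\<close> that contains the corner cut off by it. The
  corner and the face are determined by \<open>a\<close>, by \<open>crossing_unique\<close>.\<close>

definition sd :: "('v \<Rightarrow> real) set \<Rightarrow> ('v \<Rightarrow> real) \<Rightarrow> bool" where
  "sd a z \<longleftrightarrow> (\<exists>u v w x y. crossing u v w a x y \<and> connected_component (cs {u, v, w} - a) (vp u) z)"

lemma sd_component:
  assumes "crossing u v w a x y"
  shows "sd a z \<longleftrightarrow> connected_component (cs {u, v, w} - a) (vp u) z"
proof
  assume "sd a z"
  then obtain u' v' w' x' y' where h: "crossing u' v' w' a x' y'"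
    "connected_component (cs {u', v', w'} - a) (vp u') z" unfolding sd_def by blast
  show "connected_component (cs {u, v, w} - a) (vp u) z"
  proof -
    have "connected_component (cs {u, v, w} - a) (vp u') z"
      using h(2) unfolding crossing_unique(2)[OF assms h(1)] .
    then show ?thesis unfolding crossing_unique(1)[OF assms h(1)] .
  qed
next
  assume "connected_component (cs {u, v, w} - a) (vp u) z"
  then show "sd a z" using assms unfolding sd_def by blast
qed

lemma sd_connected:
  assumes "crossing u v w a x y" "connected C" "C \<subseteq> cs {u, v, w} - a" "p \<in> C" "q \<in> C"
  shows "sd a p \<longleftrightarrow> sd a q"
proof -
  have zz: "connected_component (cs {u, v, w} - a) p q"
    unfolding connected_component_def using assms(2-5) by blast
  show ?thesis unfolding sd_component[OF assms(1)]
    using connected_component_trans[OF _ zz] connected_component_trans[OF _ connected_component_sym[OF zz]] by (rule iffI)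
qed

lemma vertex_point_tri:
  assumes "crossing u v w a x y" "z \<in> {u, v, w}"
  shows "vp z \<in> cs {u, v, w} - open_simplex {u, v, w} - a"
proof -
  note c = crossingD[OF assms(1)]
  have 1: "vp z \<in> cs {u, v, w}" by (rule vertex_point_in) (use assms(2) in simp_all)
  have d: "u \<noteq> v" "u \<noteq> w" "v \<noteq> w" using c(1) by (simp_all add: tri_def)
  have n: "vp z \<notin> open_simplex {u, v, w}"
  proof
    assume "vp z \<in> open_simplex {u, v, w}"
    then have "{z} = {u, v, w}" using supp_open supp_vertex by metis
    then show False using d by blast
  qed
  have s: "{z} \<noteq> {u, v}" "{z} \<noteq> {u, w}" using d by auto
  have m: "vp z \<noteq> x" using s(1) c(4) supp_vertex[of z] by metis
  have m': "vp z \<noteq> y" using s(2) c(5) supp_vertex[of z] by metis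
  show ?thesis using 1 n m m' c(7) by blast
qed

lemma sd_sides:
  assumes c: "crossing u v w a x y"
  defines "T \<equiv> cs {u, v, w}"
  shows "closedin (top_of_set (T - a)) {z \<in> T - a. sd a z}" "closedin (top_of_set (T - a)) {z \<in> T - a. \<not> sd a z}"
    "z \<in> T - open_simplex {u, v, w} - a \<Longrightarrow> sd a z \<longleftrightarrow> near v w x y z"
proof -
  interpret tri u v w by (rule crossingD(1)[OF c])
  obtain A B where AB: "A \<union> B = Tf - a" "A \<inter> B = {}"
    "closedin (top_of_set (Tf - a)) A" "closedin (top_of_set (Tf - a)) B"
    "connected A" "connected B" "connected (A \<inter> Of)" "connected (B \<inter> Of)"
    "\<And>z. z \<in> Tf - Of - a \<Longrightarrow> z \<in> A \<longleftrightarrow> near v w x y z" using sides[OF c] by metis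
  have vu: "vp u \<in> Tf - Of - a" using vertex_point_tri[OF c] by blast
  have "near v w x y (vp u)" using d crossing_sub[OF c] by (simp add: near_def vertex_point_def)
  then have uA: "vp u \<in> A" using AB(9)[OF vu] by simp
  have s: "sd a z \<longleftrightarrow> z \<in> A" for z
  proof
    assume "sd a z"
    then obtain C where C: "connected C" "C \<subseteq> Tf - a" "vp u \<in> C" "z \<in> C"
      unfolding sd_component[OF c] connected_component_def by blast
    show "z \<in> A" using same_side[OF AB(1-4) C] uA by simp
  next
    assume "z \<in> A"
    moreover have "A \<subseteq> Tf - a" using AB(1) by blast
    ultimately show "sd a z" unfolding sd_component[OF c] connected_component_def using AB(5) uA by blast
  qed
  have "{z \<in> Tf - a. sd a z} = A" unfolding s using AB(1) by blast
  then show "closedin (top_of_set (T - a)) {z \<in> T - a. sd a z}" using AB(3) unfolding T_def by simp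
  have "{z \<in> Tf - a. \<not> sd a z} = B" unfolding s using AB(1,2) by blast
  then show "closedin (top_of_set (T - a)) {z \<in> T - a. \<not> sd a z}" using AB(4) unfolding T_def by simp
  show "sd a z \<longleftrightarrow> near v w x y z" if "z \<in> T - open_simplex {u, v, w} - a" for z
    unfolding s using AB(9) that T_def by simp
qed

lemma edge_not_open:
  assumes "q \<in> cs {s, t}" "card f = 3"
  shows "q \<notin> open_simplex f"
proof
  assume "q \<in> open_simplex f"
  then have "supp q = f" by (rule supp_open)
  then have "f \<subseteq> {s, t}" using supp_closed[OF assms(1)] by simp
  then have "card f \<le> card {s, t}" by (rule card_mono[rotated]) simp
  also have "\<dots> \<le> 2" by (simp add: card_insert_if)
  finally show False using assms(2) by simp
qed

lemma closed_edge:
  assumes "q \<in> cs {s, t}" "s \<noteq> t"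
  shows "q s = 1 - q t" "0 \<le> q t" "0 \<le> q s" "r \<noteq> s \<Longrightarrow> r \<noteq> t \<Longrightarrow> q r = 0"
  using assms by (auto simp: closed_simplex_def)

lemma edge_eqI:
  assumes "q \<in> cs {s, t}" "q' \<in> cs {s, t}" "s \<noteq> t" "q t = q' t"
  shows "q = q'"
proof
  fix r show "q r = q' r"
    using closed_edge(1)[OF assms(1,3)] closed_edge(1)[OF assms(2,3)] closed_edge(4)[OF assms(1,3), of r] closed_edge(4)[OF assms(2,3), of r] assms(4) by (cases "r = s"; cases "r = t") auto
qed

text \<open>The ends of \<open>a\<close> lie on two different edges, so at most one of them is on
  this edge, and \<open>a\<close> separates \<open>s\<close> from \<open>q\<close> exactly if that
  end comes before \<open>q\<close>. The six cases are the positions of the directed edge relative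
  to the corner \<open>u\<close>.\<close>

lemma arc_parity:
  assumes c: "crossing u v w a x y" and st: "{s, t} \<subseteq> {u, v, w}" "s \<noteq> t" and q: "q \<in> cs {s, t}" "q \<noteq> x" "q \<noteq> y"
  shows "odd (card {z \<in> ends a. supp z = {s, t} \<and> z t < q t}) \<longleftrightarrow> (sd a (vp s) \<noteq> sd a q)"
proof -
  note cf = crossingD[OF c]
  interpret tri u v w by (rule cf(1))
  note cs = crossing_sub[OF c]
  have qn: "q \<in> Tf - Of - a"
  proof -
    have "q \<notin> Of" by (rule edge_not_open[OF q(1)]) (use d in simp)
    moreover have "q \<in> Tf" using closed_simplex_mono[OF st(1)] q(1) by blast
    ultimately show ?thesis using q(2,3) cf(7) by blast
  qed
  have vs: "vp s \<in> Tf - Of - a" by (rule vertex_point_tri[OF c]) (use st in blast)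
  have S: "sd a q \<longleftrightarrow> near v w x y q" "sd a (vp s) \<longleftrightarrow> near v w x y (vp s)"
    using sd_sides(3)[OF c] qn vs by blast+
  have E: "{z \<in> ends a. supp z = {s, t} \<and> z t < q t} =
      (if {u, v} = {s, t} \<and> x t < q t then {x} else {}) \<union> (if {u, w} = {s, t} \<and> y t < q t then {y} else {})"
    unfolding cf(3) using cf(4,5) by auto
  have xu: "x u = 1 - x v" "y u = 1 - y w" using cf(11,12) closed_edge(1) d by (auto simp: open_simplex_def)
  have m: "s = u \<or> s = v \<or> s = w" "t = u \<or> t = v \<or> t = w" using st by simp_all
  note ce = closed_edge[OF q(1) st(2)]
  have xq: "q v \<noteq> x v" if "{s, t} = {u, v}"
    using edge_eqI[of q u v x] q(1,2) that d(1) cf(11) by (auto simp: open_simplex_def)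
  have yq: "q w \<noteq> y w" if "{s, t} = {u, w}"
    using edge_eqI[of q u w y] q(1,3) that d(2) cf(12) by (auto simp: open_simplex_def)
  consider "s = u \<and> t = v" | "s = u \<and> t = w" | "s = v \<and> t = u" | "s = w \<and> t = u" | "s = v \<and> t = w" | "s = w \<and> t = v"
    using m st(2) by blast
  then show ?thesis
  proof cases
    case 1
    then show ?thesis unfolding E S using d cs ce(1-3) ce(4)[of w] xq by (auto simp: doubleton_eq_iff near_def vertex_point_def)
  next
    case 2
    then show ?thesis unfolding E S using d cs ce(1-3) ce(4)[of v] yq by (auto simp: doubleton_eq_iff near_def vertex_point_def)
  next
    case 3
    then show ?thesis unfolding E S using d cs ce(1-3) ce(4)[of w] xq xu by (auto simp: doubleton_eq_iff near_def vertex_point_def)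
  next
    case 4
    then show ?thesis unfolding E S using d cs ce(1-3) ce(4)[of v] yq xu by (auto simp: doubleton_eq_iff near_def vertex_point_def)
  next
    case 5
    then show ?thesis unfolding E S using d cs ce by (auto simp: doubleton_eq_iff near_def vertex_point_def)
  next
    case 6
    then show ?thesis unfolding E S using d cs ce by (auto simp: doubleton_eq_iff near_def vertex_point_def)
  qed
qed

lemma face_parity:
  assumes "finite \<A>" and f: "card f = 3" and pf: "\<And>a. a \<in> \<A> \<Longrightarrow> path_in_face f a"
    and dis: "\<And>a b. a \<in> \<A> \<Longrightarrow> b \<in> \<A> \<Longrightarrow> a \<noteq> b \<Longrightarrow> ends a \<inter> ends b = {}"
    and st: "{s, t} \<subseteq> f" "s \<noteq> t" and q: "q \<in> cs {s, t}" "q \<notin> (\<Union>a\<in>\<A>. ends a)"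
  shows "odd (card {z \<in> (\<Union>a\<in>\<A>. ends a). supp z = {s, t} \<and> z t < q t}) \<longleftrightarrow>
    odd (card {a \<in> \<A>. sd a (vp s) \<noteq> sd a q})"
  using assms(1) pf dis q(2)
proof (induction \<A>)
  case empty
  then show ?case by simp
next
  case (insert a \<A>)
  let ?E = "\<lambda>\<A>. {z \<in> (\<Union>a\<in>\<A>. ends a). supp z = {s, t} \<and> z t < q t}"
  let ?e = "{z \<in> ends a. supp z = {s, t} \<and> z t < q t}"
  have IH: "odd (card (?E \<A>)) \<longleftrightarrow> odd (card {a \<in> \<A>. sd a (vp s) \<noteq> sd a q})"
  proof (rule insert.IH)
    show "path_in_face f b" if "b \<in> \<A>" for b using insert.prems(1) that by blast
    show "ends b \<inter> ends c = {}" if "b \<in> \<A>" "c \<in> \<A>" "b \<noteq> c" for b c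
      using insert.prems(2)[of b c] that by blast
    show "q \<notin> \<Union> (ends ` \<A>)" using insert.prems(3) by blast
  qed
  obtain u v w x y where c: "f = {u, v, w}" "crossing u v w a x y"
    using face_crossing[OF insert.prems(1)[OF insertI1] f] .
  have ends: "ends a = {x, y}" by (rule crossingD(3)[OF c(2)])
  have qa: "q \<noteq> x" "q \<noteq> y" using insert.prems(3) ends by blast+
  have one: "odd (card ?e) \<longleftrightarrow> (sd a (vp s) \<noteq> sd a q)"
    using arc_parity[OF c(2) _ st(2) q(1) qa] st(1) c(1) by simp
  note fe = finite_endpoints[OF _ f]
  have fin: "finite (?E \<A>)" "finite ?e" using insert.hyps(1) insert.prems(1) fe by simp_all
  have disj: "?E \<A> \<inter> ?e = {}"
  proof -
    have "ends b \<inter> ends a = {}" if "b \<in> \<A>" for b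
      using insert.prems(2)[of b a] that insert.hyps(2) by blast
    then show ?thesis by blast
  qed
  have "?E (insert a \<A>) = ?E \<A> \<union> ?e" by blast
  then have "card (?E (insert a \<A>)) = card (?E \<A>) + card ?e" using card_Un_disjoint[OF fin disj] by simp
  moreover have "card {b \<in> insert a \<A>. sd b (vp s) \<noteq> sd b q} =
    card {b \<in> \<A>. sd b (vp s) \<noteq> sd b q} + (if sd a (vp s) \<noteq> sd a q then 1 else 0)"
  proof -
    have "{b \<in> insert a \<A>. sd b (vp s) \<noteq> sd b q} = (if sd a (vp s) \<noteq> sd a q
      then insert a {b \<in> \<A>. sd b (vp s) \<noteq> sd b q} else {b \<in> \<A>. sd b (vp s) \<noteq> sd b q})" by auto
    then show ?thesis using insert.hyps by (simp add: card_insert_if)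
  qed
  ultimately show ?case using IH one by simp
qed

lemma closedin_restrict:
  "closedin (top_of_set X) A \<Longrightarrow> Y \<subseteq> X \<Longrightarrow> closedin (top_of_set Y) (Y \<inter> A)"
  unfolding closedin_closed by (metis Int_assoc Int_absorb2 Int_commute)

lemma cs_closed: "closed (cs s :: ('v \<Rightarrow> real) set)"
proof -
  have "cs s = (\<Inter>v. {x. 0 \<le> x v}) \<inter> (\<Inter>v\<in>-s. {x :: 'v \<Rightarrow> real. x v = 0}) \<inter> {x. sum x s = 1}"
    by (auto simp: closed_simplex_def)
  moreover have "closed {x :: 'v \<Rightarrow> real. 0 \<le> x v}" "closed {x :: 'v \<Rightarrow> real. x v = 0}" for v
    by (intro closed_Collect_le closed_Collect_eq continuous_on_coord continuous_on_const)+
  moreover have "closed {x :: 'v \<Rightarrow> real. sum x s = 1}"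
    by (intro closed_Collect_eq continuous_on_sum continuous_on_coord continuous_on_const)
  ultimately show ?thesis by (simp add: closed_INT closed_Int)
qed

section \<open>Two-colouring the complement of one lift\<close>

text \<open>One lift on its own: connected along its paths by \<open>pre\<close>, without crossings
  by \<open>nx\<close>, in a simply connected and locally finite complex.\<close>

locale single = drw L D for L :: "'v set set" and D +
  assumes pre: "a \<in> D \<Longrightarrow> b \<in> D \<Longrightarrow> b \<in> cp a"
    and nx: "f \<in> faces L \<Longrightarrow> a \<in> D \<Longrightarrow> b \<in> D \<Longrightarrow> path_in_face f a \<Longrightarrow> path_in_face f b \<Longrightarrow> a \<noteq> b \<Longrightarrow> a \<inter> b = {}"
    and sc: "simply_connected (realization L)"
    and lfin: "v \<in> \<Union>L \<Longrightarrow> finite {s \<in> L. v \<in> s}"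
    and dim: "s \<in> L \<Longrightarrow> card s \<le> 3"
begin

definition arcs :: "'v set \<Rightarrow> ('v \<Rightarrow> real) set set" where "arcs f = {a \<in> D. path_in_face f a}"

lemma node_edge:
  assumes "y \<in> N" "supp y = {s, t}"
  shows "s \<noteq> t" "y \<in> cs {s, t}" "0 < y t" "y t < 1" "0 < y s"
proof -
  obtain a where a: "a \<in> D" "y \<in> ends a" using assms(1) by (auto simp: N_def)
  show st: "s \<noteq> t" using node_supp(2)[OF a] assms(2) by auto
  have o: "y \<in> open_simplex {s, t}" using node_supp(3)[OF a] assms(2) by simp
  then show c: "y \<in> cs {s, t}" by (simp add: open_simplex_def)
  show "0 < y t" "0 < y s" using o by (auto simp: open_simplex_def)
  then show "y t < 1" using closed_edge(1)[OF c st] by simp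
qed

lemma node_not_single: "y \<in> N \<Longrightarrow> supp y \<noteq> {s, s}"
  using node_edge(1) by blast

lemma arcs_disj: "f \<in> faces L \<Longrightarrow> a \<in> arcs f \<Longrightarrow> b \<in> arcs f \<Longrightarrow> a \<noteq> b \<Longrightarrow> ends a \<inter> ends b = {}"
  using D_disj by (simp add: arcs_def)

lemma arcs_fin: "f \<in> faces L \<Longrightarrow> finite (arcs f)"
  using D_fin by (simp add: arcs_def)

lemma ends_N: "a \<in> D \<Longrightarrow> ends a \<subseteq> N" by (auto simp: N_def)

lemma nodes_arcs:
  assumes "f \<in> faces L" "{s, t} \<subseteq> f"
  shows "{z \<in> N. supp z = {s, t} \<and> P z} = {z \<in> (\<Union>a\<in>arcs f. ends a). supp z = {s, t} \<and> P z}"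
proof -
  have "z \<in> (\<Union>a\<in>arcs f. ends a)" if z: "z \<in> N" "supp z = {s, t}" for z
  proof -
    obtain b where "b \<in> D" "path_in_face f b" "z \<in> ends b" using D_cont[OF z(1) assms(1)] z(2) assms(2) by auto
    then show ?thesis by (auto simp: arcs_def)
  qed
  moreover have "z \<in> N" if "z \<in> (\<Union>a\<in>arcs f. ends a)" for z
    using that ends_N by (auto simp: arcs_def)
  ultimately show ?thesis by blast
qed

definition bf :: "'v \<Rightarrow> 'v \<Rightarrow> ('v \<Rightarrow> real) \<Rightarrow> ('v \<Rightarrow> real) set" where
  "bf s t q = {z \<in> N. supp z = {s, t} \<and> z t < q t}"

text \<open>The mod 2 cochain of crossing numbers of the lift with the edges.\<close>

definition \<theta> :: "'v \<Rightarrow> 'v \<Rightarrow> bool" where "\<theta> s t = odd (card {z \<in> N. supp z = {s, t}})"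

lemma fin_bf: "finite (bf s t q)"
  by (rule finite_subset[OF _ fin_nodes[of "{s, t}"]]) (auto simp: bf_def)

lemma bf_vertex: "bf s t (vp t) = {z \<in> N. supp z = {s, t}}"
  using node_edge(4) by (auto simp: bf_def vertex_point_def)

lemma bf_parity:
  assumes "f \<in> faces L" "{s, t} \<subseteq> f" "s \<noteq> t" "q \<in> cs {s, t}" "q \<notin> N"
  shows "odd (card (bf s t q)) \<longleftrightarrow> odd (card {a \<in> arcs f. sd a (vp s) \<noteq> sd a q})"
  unfolding bf_def nodes_arcs[OF assms(1,2)]
proof (rule face_parity[OF arcs_fin[OF assms(1)] face_card[OF assms(1)] _ arcs_disj[OF assms(1)] assms(2-4)])
  show "q \<notin> \<Union> (ends ` arcs f)" using assms(5) ends_N by (auto simp: arcs_def)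
qed (auto simp: arcs_def)

lemma vertex_not_node: "vp t \<notin> N"
proof
  assume "vp t \<in> N"
  then obtain a where "a \<in> D" "vp t \<in> ends a" by (auto simp: N_def)
  from node_supp(2)[OF this] show False by (simp add: supp_vertex)
qed

lemma \<theta>_self: "\<not> \<theta> s s"
proof -
  have e: "{z \<in> N. supp z = {s, s}} = {}" using node_not_single by auto
  show ?thesis unfolding \<theta>_def e by simp
qed

lemma \<theta>_parity:
  assumes "f \<in> faces L" "{s, t} \<subseteq> f"
  shows "\<theta> s t \<longleftrightarrow> odd (card {a \<in> arcs f. sd a (vp s) \<noteq> sd a (vp t)})"
proof (cases "s = t")
  case True
  show ?thesis unfolding True using \<theta>_self by simp
next
  case False
  have "vp t \<in> cs {s, t}" by (rule vertex_point_in) simp_all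
  from bf_parity[OF assms False this vertex_not_node] show ?thesis by (simp add: bf_vertex \<theta>_def)
qed

lemma \<theta>_sym: "\<theta> s t = \<theta> t s"
  by (simp add: \<theta>_def insert_commute)

text \<open>On a face, each value counts modulo 2 the paths that separate the two vertices, and for
  each path these separations add up to zero around the triangle.\<close>

lemma \<theta>_cocycle:
  assumes "{u, v, w} \<in> L"
  shows "\<theta> u w \<longleftrightarrow> \<theta> u v \<noteq> \<theta> v w"
proof (cases "u = v \<or> u = w \<or> v = w")
  case True
  then show ?thesis using \<theta>_self \<theta>_sym[of u v] by auto
next
  case False
  then have f: "{u, v, w} \<in> faces L" using assms by (simp add: faces_def)
  have "\<theta> u v \<longleftrightarrow> odd (card {a \<in> arcs {u, v, w}. sd a (vp u) \<noteq> sd a (vp v)})"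
    "\<theta> v w \<longleftrightarrow> odd (card {a \<in> arcs {u, v, w}. sd a (vp v) \<noteq> sd a (vp w)})"
    "\<theta> u w \<longleftrightarrow> odd (card {a \<in> arcs {u, v, w}. sd a (vp u) \<noteq> sd a (vp w)})"
    by (rule \<theta>_parity[OF f]; simp)+
  then show ?thesis unfolding odd_card_neq[OF arcs_fin[OF f]] by blast
qed

text \<open>A section of this system is a colouring of the vertices whose coboundary is
  \<open>\<theta>\<close>; it exists because the complex is simply connected.\<close>

sublocale par: local_system L "\<lambda>_. UNIV :: bool set" "\<lambda>u v b. b \<noteq> \<theta> u v"
proof
  show "((a \<noteq> \<theta> u v) \<noteq> \<theta> v w) = (a \<noteq> \<theta> u w)" if "{u, v, w} \<in> L" for u v w a
    using \<theta>_cocycle[OF that] by blast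
qed (use L \<theta>_self in auto)

lemma c_exists: "\<exists>c :: 'v \<Rightarrow> bool. \<forall>u v. {u, v} \<in> L \<longrightarrow> (c u \<noteq> c v \<longleftrightarrow> \<theta> u v)"
proof -
  obtain x where "x \<in> N" using D_face D lf_image unfolding drawing_def by (metis empty_is_image ex_in_conv)
  then obtain f where "f \<in> faces L" using node_face by blast
  then have "f \<in> L" "f \<noteq> {}" using face_L face_card by fastforce+
  then obtain v0 where v0: "v0 \<in> \<Union>L" by blast
  from par.section_exists[OF sc v0 UNIV_I[of True]] obtain c where
    h: "\<And>u v. {u, v} \<in> L \<Longrightarrow> (c u \<noteq> \<theta> u v) = c v" by metis
  have "\<forall>u v. {u, v} \<in> L \<longrightarrow> (c u \<noteq> c v \<longleftrightarrow> \<theta> u v)"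
  proof (rule allI, rule allI, rule impI)
    fix u v assume "{u, v} \<in> L"
    from h[OF this] show "c u \<noteq> c v \<longleftrightarrow> \<theta> u v" by (cases "c u"; cases "c v") simp_all
  qed
  then show ?thesis by (rule exI[of _ c])
qed

definition c where "c = (SOME c :: 'v \<Rightarrow> bool. \<forall>u v. {u, v} \<in> L \<longrightarrow> (c u \<noteq> c v \<longleftrightarrow> \<theta> u v))"

lemma c: "{u, v} \<in> L \<Longrightarrow> c u \<noteq> c v \<longleftrightarrow> \<theta> u v"
proof -
  assume uv: "{u, v} \<in> L"
  have "\<forall>u v. {u, v} \<in> L \<longrightarrow> (c u \<noteq> c v \<longleftrightarrow> \<theta> u v)" unfolding c_def by (rule someI_ex[OF c_exists])
  from this[rule_format, OF uv] show "c u \<noteq> c v \<longleftrightarrow> \<theta> u v" .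
qed

text \<open>The colour of \<open>s\<close>, switched at every point of the lift passed strictly
  before \<open>q\<close>. At a point of the lift it is therefore the colour of the side just left
  behind, and this is the value that orients the lift.\<close>

definition se :: "'v \<Rightarrow> 'v \<Rightarrow> ('v \<Rightarrow> real) \<Rightarrow> bool" where "se s t q \<longleftrightarrow> (c s \<longleftrightarrow> even (card (bf s t q)))"

definition sf :: "'v set \<Rightarrow> 'v \<Rightarrow> ('v \<Rightarrow> real) \<Rightarrow> bool" where
  "sf f u z \<longleftrightarrow> (c u \<longleftrightarrow> even (card {a \<in> arcs f. sd a (vp u) \<noteq> sd a z}))"

lemma sf_indep:
  assumes f: "f \<in> faces L" and uv: "u \<in> f" "v \<in> f"
  shows "sf f u z = sf f v z"
proof -
  have "{u, v} \<in> L" using abstract_face[OF L face_L[OF f]] uv by simp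
  from c[OF this] have "c u \<noteq> c v \<longleftrightarrow> odd (card {a \<in> arcs f. sd a (vp u) \<noteq> sd a (vp v)})"
    using \<theta>_parity[OF f] uv by simp
  with odd_card_neq[OF arcs_fin[OF f], of "\<lambda>a. sd a (vp u)" "\<lambda>a. sd a z"]
    odd_card_neq[OF arcs_fin[OF f], of "\<lambda>a. sd a (vp v)" "\<lambda>a. sd a z"]
    odd_card_neq[OF arcs_fin[OF f], of "\<lambda>a. sd a (vp u)" "\<lambda>a. sd a (vp v)"]
  show ?thesis unfolding sf_def by argo
qed

lemma se_sf: "f \<in> faces L \<Longrightarrow> {s, t} \<subseteq> f \<Longrightarrow> s \<noteq> t \<Longrightarrow> q \<in> cs {s, t} \<Longrightarrow> q \<notin> N \<Longrightarrow> se s t q = sf f s q"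
  unfolding se_def sf_def using bf_parity by blast

lemma se_swap:
  assumes e: "{s, t} \<in> L" "s \<noteq> t" and z: "z \<in> cs {s, t}" "z \<notin> N"
  shows "se s t z = se t s z"
proof -
  have un: "bf s t z \<union> bf t s z = {y \<in> N. supp y = {s, t}}"
  proof (intro equalityI subsetI)
    fix y assume y: "y \<in> {y \<in> N. supp y = {s, t}}"
    then have c: "y \<in> cs {s, t}" using node_edge(2) by blast
    have "y t \<noteq> z t" using edge_eqI[OF c z(1) e(2)] y z(2) by blast
    then show "y \<in> bf s t z \<union> bf t s z"
      using y closed_edge(1)[OF c e(2)] closed_edge(1)[OF z(1) e(2)] by (auto simp: bf_def insert_commute)
  qed (auto simp: bf_def insert_commute)
  have "bf s t z \<inter> bf t s z = {}"
  proof (rule equals0I)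
    fix y assume y: "y \<in> bf s t z \<inter> bf t s z"
    then have c: "y \<in> cs {s, t}" using node_edge(2)[of y s t] by (simp add: bf_def)
    show False using y closed_edge(1)[OF c e(2)] closed_edge(1)[OF z(1) e(2)] by (auto simp: bf_def)
  qed
  then have "card (bf s t z) + card (bf t s z) = card {y \<in> N. supp y = {s, t}}"
    using card_Un_disjoint[OF fin_bf fin_bf] un by metis
  then have "\<theta> s t \<longleftrightarrow> odd (card (bf s t z)) \<noteq> odd (card (bf t s z))" unfolding \<theta>_def by (metis odd_add)
  then show ?thesis unfolding se_def using c[OF e(1)] by blast
qed

lemma se_vertex:
  assumes "{s, t} \<in> L" "r \<in> {s, t}"
  shows "se s t (vp r) = c r"
proof (cases "r = s")
  case True
  have "bf s t (vp s) = {}"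
    using node_edge(1,3,4) by (cases "s = t") (fastforce simp: bf_def vertex_point_def)+
  then show ?thesis using True by (simp add: se_def)
next
  case False
  then have r: "r = t" using assms(2) by blast
  show ?thesis unfolding se_def r bf_vertex using c[OF assms(1)] unfolding \<theta>_def by blast
qed

lemma single_supp:
  assumes "z \<in> cs s" "supp z \<subseteq> {r}" "finite s"
  shows "z = vp r" "r \<in> s"
proof -
  have "z \<in> cs {r}" using closed_supp[OF assms(1,3,2)] by simp
  then show "z = vp r" by (auto simp: closed_simplex_def vertex_point_def fun_eq_iff)
  then show "r \<in> s" using supp_closed[OF assms(1)] supp_vertex[of r] by simp
qed

lemma se_indep:
  assumes e: "{s, t} \<in> L" "{s', t'} \<in> L" and z: "z \<in> cs {s, t}" "z \<in> cs {s', t'}" "z \<notin> N"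
  shows "se s t z = se s' t' z"
proof (cases "\<exists>r. supp z \<subseteq> {r}")
  case True
  then obtain r where r: "supp z \<subseteq> {r}" by blast
  have "z = vp r" "r \<in> {s, t}" "r \<in> {s', t'}" using single_supp[OF z(1) r] single_supp[OF z(2) r] by simp_all
  then show ?thesis using se_vertex[OF e(1)] se_vertex[OF e(2)] by simp
next
  case False
  have "supp z \<subseteq> {s, t}" "supp z \<subseteq> {s', t'}" using supp_closed z(1,2) by blast+
  then have s: "supp z = {s, t}" "supp z = {s', t'}" using False by blast+
  then have n: "s \<noteq> t" using False by blast
  consider "s' = s \<and> t' = t" | "s' = t \<and> t' = s" using s by (auto simp: doubleton_eq_iff)
  then show ?thesis using se_swap[OF e(1) n z(1,3)] by cases simp_all
qed

text \<open>The colouring of the whole complement, put together from faces and edges; vertices are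
  covered by degenerate edges. Off the lift the result is independent of the choices, by
  \<open>sg_edge\<close> and \<open>sg_face\<close>.\<close>

definition sg :: "('v \<Rightarrow> real) \<Rightarrow> bool" where
  "sg z \<longleftrightarrow> (\<exists>f u. f \<in> faces L \<and> u \<in> f \<and> z \<in> open_simplex f \<and> sf f u z) \<or>
     (\<exists>s t. {s, t} \<in> L \<and> z \<in> cs {s, t} \<and> se s t z)"

lemma sg_edge:
  assumes "{s, t} \<in> L" "z \<in> cs {s, t}" "z \<notin> N"
  shows "sg z = se s t z"
proof -
  have "\<not> (f \<in> faces L \<and> z \<in> open_simplex f)" for f using edge_not_open[OF assms(2)] face_card by blast
  moreover have "(\<exists>s t. {s, t} \<in> L \<and> z \<in> cs {s, t} \<and> se s t z) = se s t z"
    using se_indep[OF _ assms(1) _ assms(2,3)] assms(1,2) by blast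
  ultimately show ?thesis unfolding sg_def by blast
qed

lemma boundary_edge:
  assumes "card f = 3" "z \<in> cs f" "z \<notin> open_simplex f"
  obtains s t where "{s, t} \<subseteq> f" "s \<noteq> t" "z \<in> cs {s, t}"
proof -
  have ff: "finite f" using assms(1) card.infinite by fastforce
  have "\<exists>r\<in>f. \<not> 0 < z r" using assms(2,3) by (simp add: open_simplex_def)
  then obtain r where r: "r \<in> f" "\<not> 0 < z r" by blast
  have "0 \<le> z r" using assms(2) by (simp add: closed_simplex_def)
  then have "z r = 0" using r(2) by simp
  note r = r(1) this
  have "card (f - {r}) = 2" using r assms(1) by simp
  then obtain s t where st: "f - {r} = {s, t}" "s \<noteq> t" by (auto simp: card_2_iff)
  have "supp z \<subseteq> {s, t}" using supp_closed[OF assms(2)] r(2) st(1) by (auto simp: supp_def)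
  then have "z \<in> cs {s, t}" using closed_supp[OF assms(2) ff] by simp
  then show ?thesis using that[of s t] st by blast
qed

lemma sg_face:
  assumes f: "f \<in> faces L" "u \<in> f" and z: "z \<in> cs f" "z \<notin> N"
  shows "sg z = sf f u z"
proof (cases "z \<in> open_simplex f")
  case True
  have "\<not> (z \<in> cs {s, t})" for s t using edge_not_open[OF _ face_card[OF f(1)]] True by blast
  moreover have "f' = f" if "z \<in> open_simplex f'" for f' using supp_open[OF that] supp_open[OF True] by simp
  ultimately show ?thesis unfolding sg_def using True f sf_indep[OF f(1) _ f(2)] by blast
next
  case False
  obtain s t where st: "{s, t} \<subseteq> f" "s \<noteq> t" "z \<in> cs {s, t}" using boundary_edge[OF face_card[OF f(1)] z(1) False] .
  have "{s, t} \<in> L" using abstract_face[OF L face_L[OF f(1)] st(1)] by simp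
  then have "sg z = se s t z" using sg_edge st(3) z(2) by blast
  also have "\<dots> = sf f s z" using se_sf[OF f(1) st z(2)] .
  also have "\<dots> = sf f u z" using sf_indep[OF f(1) _ f(2)] st(1) by blast
  finally show ?thesis .
qed

lemma edge_D:
  assumes "z \<in> cs {s, t}" "z \<in> \<Union>D"
  shows "z \<in> N"
proof -
  obtain a where a: "a \<in> D" "z \<in> a" using assms(2) by blast
  obtain f where f: "f \<in> faces L" "path_in_face f a" using D_face[OF a(1)] by blast
  obtain u v w x y where c: "f = {u, v, w}" "crossing u v w a x y" using face_crossing[OF f(2) face_card[OF f(1)]] .
  have "z \<notin> open_simplex f" by (rule edge_not_open[OF assms(1) face_card[OF f(1)]])
  then have "z \<in> {x, y}" using crossingD(7)[OF c(2)] a(2) c(1) by blast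
  then show ?thesis using crossingD(3)[OF c(2)] ends_N[OF a(1)] by blast
qed

lemma N_D: "N \<subseteq> \<Union>D"
proof
  fix z assume "z \<in> N"
  then obtain a where a: "a \<in> D" "z \<in> ends a" by (auto simp: N_def)
  then obtain g where "path_image g = a" "z = pathstart g" by (auto simp: arc_endpoints_def)
  then show "z \<in> \<Union>D" using a(1) by auto
qed

lemma arcs_Union:
  assumes f: "f \<in> faces L"
  shows "cs f \<inter> \<Union>D = \<Union>(arcs f)"
proof (intro equalityI subsetI)
  fix z assume "z \<in> \<Union>(arcs f)"
  then obtain a where a: "a \<in> D" "path_in_face f a" "z \<in> a" by (auto simp: arcs_def)
  obtain u v w x y where c: "f = {u, v, w}" "crossing u v w a x y" using face_crossing[OF a(2) face_card[OF f]] .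
  show "z \<in> cs f \<inter> \<Union>D" using crossingD(10)[OF c(2)] c(1) a by blast
next
  fix z assume z: "z \<in> cs f \<inter> \<Union>D"
  show "z \<in> \<Union>(arcs f)"
  proof (cases "z \<in> open_simplex f")
    case True
    obtain a where a: "a \<in> D" "z \<in> a" using z by blast
    obtain f' where f': "f' \<in> faces L" "path_in_face f' a" using D_face[OF a(1)] by blast
    have "supp z \<subseteq> f'" using path_in_face_supp[OF f'(2)] a(2) by blast
    then have "f \<subseteq> f'" using supp_open[OF True] by simp
    then have "f = f'" using card_seteq[of f' f] face_card[OF f] face_card[OF f'(1)] abstract_finite[OF L face_L[OF f'(1)]] by simp
    then show ?thesis using a f'(2) by (auto simp: arcs_def)
  next
    case False
    obtain s t where st: "{s, t} \<subseteq> f" "s \<noteq> t" "z \<in> cs {s, t}" using boundary_edge[OF face_card[OF f] _ False] z by blast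
    have zN: "z \<in> N" using edge_D[OF st(3)] z by blast
    have "supp z \<subseteq> f" using supp_closed[OF st(3)] st(1) by blast
    then obtain b where b: "b \<in> D" "path_in_face f b" "z \<in> ends b" using D_cont[OF zN f] by blast
    obtain u v w x y where c: "f = {u, v, w}" "crossing u v w b x y" using face_crossing[OF b(2) face_card[OF f]] .
    have "z = x \<or> z = y" using b(3) crossingD(3)[OF c(2)] by simp
    then have "z \<in> b" using crossingD(8,9)[OF c(2)] by auto
    then show ?thesis using b by (auto simp: arcs_def)
  qed
qed

text \<open>On a face the colour depends only on the set of paths having the point on their corner
  side. There are finitely many such sets, and each occurs on a relatively closed part by
  \<open>sd_sides\<close>.\<close>

lemma face_closedin:
  assumes f: "f \<in> faces L"
  defines "X \<equiv> cs f - \<Union>D"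
  shows "closedin (top_of_set X) {z \<in> X. sg z = b}"
proof -
  obtain u where u: "u \<in> f" using face_card[OF f] by fastforce
  define F where "F S \<longleftrightarrow> (c u \<longleftrightarrow> even (card {a \<in> arcs f. sd a (vp u) \<noteq> (a \<in> S)}))" for S
  have XN: "z \<notin> N" "z \<in> cs f" if "z \<in> X" for z using that N_D unfolding X_def by blast+
  have sgF: "sg z = F {a \<in> arcs f. sd a z}" if z: "z \<in> X" for z
  proof -
    have e: "{a \<in> arcs f. sd a (vp u) \<noteq> (a \<in> {a \<in> arcs f. sd a z})} = {a \<in> arcs f. sd a (vp u) \<noteq> sd a z}" by blast
    show ?thesis unfolding sg_face[OF f u XN(2,1)[OF z]] sf_def F_def e ..
  qed
  have one: "closedin (top_of_set X) {z \<in> X. {a \<in> arcs f. sd a z} = S}" if S: "S \<subseteq> arcs f" for S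
  proof -
    have "closedin (top_of_set X) {z \<in> X. sd a z = (a \<in> S)}" if a: "a \<in> arcs f" for a
    proof -
      have pf: "path_in_face f a" using a by (simp add: arcs_def)
      obtain u v w x y where c: "f = {u, v, w}" "crossing u v w a x y" using face_crossing[OF pf face_card[OF f]] .
      have sub: "X \<subseteq> cs f - a" using a unfolding X_def arcs_def by blast
      have "closedin (top_of_set (cs f - a)) {z \<in> cs f - a. sd a z = (a \<in> S)}"
        using sd_sides(1,2)[OF c(2)] c(1) by (cases "a \<in> S") simp_all
      from closedin_restrict[OF this sub] show ?thesis
        by (rule back_subst[of "closedin (top_of_set X)"]) (use sub in blast)
    qed
    then have "closedin (top_of_set X) (\<Inter>(insert X ((\<lambda>a. {z \<in> X. sd a z = (a \<in> S)}) ` arcs f)))"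
      by (intro closedin_Inter) auto
    then show ?thesis by (rule back_subst[of "closedin (top_of_set X)"]) (use S in blast)
  qed
  have "closedin (top_of_set X) (\<Union>S\<in>{S. S \<subseteq> arcs f \<and> F S = b}. {z \<in> X. {a \<in> arcs f. sd a z} = S})"
    using arcs_fin[OF f] one by (intro closedin_Union) auto
  then show ?thesis by (rule back_subst[of "closedin (top_of_set X)"]) (use sgF in auto)
qed

lemma small_simplex:
  assumes s: "s \<in> L" "card s \<noteq> 3"
  shows "\<exists>p q. s = {p, q}"
proof -
  have "finite s" "s \<noteq> {}" using L s by (auto simp: abstract_complex_def)
  then have "card s = 1 \<or> card s = 2" using dim[OF s(1)] s(2) by (cases "card s") auto
  then show ?thesis
  proof
    assume "card s = 1"
    then obtain p where "s = {p}" by (rule card_1_singletonE)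
    then have "s = {p, p}" by simp
    then show ?thesis by blast
  next
    assume "card s = 2"
    then show ?thesis unfolding card_2_iff by blast
  qed
qed

lemma simplex_closedin:
  assumes s: "s \<in> L"
  shows "closedin (top_of_set (cs s - \<Union>D)) {z \<in> cs s - \<Union>D. sg z = b}"
proof (cases "\<exists>f\<in>faces L. s \<subseteq> f")
  case True
  then obtain f where f: "f \<in> faces L" "s \<subseteq> f" by blast
  have sub: "cs s - \<Union>D \<subseteq> cs f - \<Union>D"
    using closed_simplex_mono[OF f(2) abstract_finite[OF L face_L[OF f(1)]]] by blast
  from closedin_restrict[OF face_closedin[OF f(1)] sub] show ?thesis
    by (rule back_subst[of "closedin (top_of_set (cs s - \<Union>D))"]) (use sub in blast)
next
  case False
  have "card s \<noteq> 3" using False s by (auto simp: faces_def)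
  then obtain p q where pq: "s = {p, q}" using small_simplex[OF s] by blast
  have noN: "{y \<in> N. supp y = {p, q}} = {}"
  proof (rule equals0I)
    fix y assume "y \<in> {y \<in> N. supp y = {p, q}}"
    then have "y \<in> N" "supp y = s" using pq by simp_all
    then show False using node_face[of y] False by blast
  qed
  have "sg z = c p" if z: "z \<in> cs s - \<Union>D" for z
  proof -
    have "z \<notin> N" using z N_D by blast
    then have "sg z = se p q z" using sg_edge s z pq by simp
    moreover have "bf p q z = {}" using noN by (auto simp: bf_def)
    ultimately show ?thesis by (simp add: se_def)
  qed
  then have "{z \<in> cs s - \<Union>D. sg z = b} = (if c p = b then cs s - \<Union>D else {})" by auto
  then show ?thesis by simp
qed

abbreviation X where "X \<equiv> realization L - \<Union>D"

text \<open>Near a point with positive coordinate at \<open>w\<close> only simplices containing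
  \<open>w\<close> matter. There are finitely many of them, so closedness can be tested on each
  simplex.\<close>

lemma closedin_simplexwise:
  assumes A: "A \<subseteq> X" and cl: "\<And>s. s \<in> L \<Longrightarrow> closedin (top_of_set (cs s - \<Union>D)) (A \<inter> cs s)"
  shows "closedin (top_of_set X) A"
proof -
  have "\<exists>T. openin (top_of_set X) T \<and> z \<in> T \<and> T \<subseteq> X - A" if z: "z \<in> X - A" for z
  proof -
    have "z \<in> realization L" using z by simp
    from realization_support[OF L this] obtain w where w: "w \<in> \<Union>L" "0 < z w" by (elim bexE)
    have "\<exists>T. closed T \<and> A \<inter> cs s = (cs s - \<Union>D) \<inter> T" if "s \<in> L" for s
      using cl[OF that] unfolding closedin_closed .
    then obtain T where T: "\<And>s. s \<in> L \<Longrightarrow> closed (T s)"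
      "\<And>s. s \<in> L \<Longrightarrow> A \<inter> cs s = (cs s - \<Union>D) \<inter> T s" by metis
    define V where "V = {x. 0 < x w} - (\<Union>s\<in>{s \<in> L. w \<in> s}. T s \<inter> cs s)"
    have "open {x :: 'v \<Rightarrow> real. 0 < x w}" by (intro open_Collect_less continuous_on_const continuous_on_coord)
    moreover have "closed (\<Union>s\<in>{s \<in> L. w \<in> s}. T s \<inter> cs s)"
      using lfin[OF w(1)] T(1) cs_closed by (intro closed_UN) auto
    ultimately have "open V" unfolding V_def by (rule open_Diff)
    moreover have "z \<in> V"
    proof -
      have "z \<notin> T s \<inter> cs s" if s: "s \<in> L" for s
      proof
        assume "z \<in> T s \<inter> cs s"
        then have "z \<in> (cs s - \<Union>D) \<inter> T s" using z by blast
        then have "z \<in> A" unfolding T(2)[OF s, symmetric] by blast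
        then show False using z by blast
      qed
      then show ?thesis using w(2) unfolding V_def by blast
    qed
    moreover have "X \<inter> V \<subseteq> X - A"
    proof
      fix x assume x: "x \<in> X \<inter> V"
      then obtain s where s: "s \<in> L" "x \<in> cs s" by (auto simp: realization_def)
      have xw: "0 < x w" and xT: "x \<notin> (\<Union>s\<in>{s \<in> L. w \<in> s}. T s \<inter> cs s)" using x unfolding V_def by simp_all
      have "w \<in> s" using xw s(2) unfolding closed_simplex_def by force
      then have "x \<notin> T s \<inter> cs s" using xT s(1) by blast
      then have "x \<notin> A" using T(2)[OF s(1)] s(2) by blast
      then show "x \<in> X - A" using x by blast
    qed
    ultimately show ?thesis using z by (intro exI[of _ "X \<inter> V"]) (auto intro: openin_open_Int)
  qed
  then have "openin (top_of_set X) (X - A)" by (subst openin_subopen) blast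
  then show ?thesis using A by (simp add: closedin_def)
qed

lemma sg_connected:
  assumes "connected C" "C \<subseteq> X" "p \<in> C" "q \<in> C"
  shows "sg p = sg q"
proof -
  have cl: "closedin (top_of_set X) {z \<in> X. sg z = b}" for b
  proof (rule closedin_simplexwise)
    fix s assume s: "s \<in> L"
    have "{z \<in> X. sg z = b} \<inter> cs s = {z \<in> cs s - \<Union>D. sg z = b}"
      using s by (auto simp: realization_def)
    then show "closedin (top_of_set (cs s - \<Union>D)) ({z \<in> X. sg z = b} \<inter> cs s)"
      using simplex_closedin[OF s] by simp
  qed blast
  have "p \<in> {z \<in> X. sg z = True} \<longleftrightarrow> q \<in> {z \<in> X. sg z = True}"
    by (rule same_side[OF _ _ cl[of True] cl[of False] assms]) auto
  then show ?thesis using assms(2-4) by blast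
qed

end

section \<open>The complement of a lift has exactly two components\<close>

lemma seg_edge:
  assumes "z \<in> cs {s, t}" "z' \<in> cs {s, t}" "y \<in> seg z z' ` {0..1}"
  shows "y \<in> cs {s, t}" "min (z t) (z' t) \<le> y t" "y t \<le> max (z t) (z' t)"
proof -
  obtain r where r: "0 \<le> r" "r \<le> 1" "y = seg z z' r" using assms(3) by auto
  then show "y \<in> cs {s, t}" using seg_in_simplex[OF assms(1,2)] by simp
  have y: "y t = (1 - r) * z t + r * z' t" using r(3) by (simp add: seg_def)
  have a: "(1 - r) * min (z t) (z' t) \<le> (1 - r) * z t" "r * min (z t) (z' t) \<le> r * z' t"
    "(1 - r) * z t \<le> (1 - r) * max (z t) (z' t)" "r * z' t \<le> r * max (z t) (z' t)"
    using r(1,2) by (intro mult_left_mono; simp)+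
  show "min (z t) (z' t) \<le> y t" using a(1,2) unfolding y by (simp add: algebra_simps)
  show "y t \<le> max (z t) (z' t)" using a(3,4) unfolding y by (simp add: algebra_simps)
qed

lemma seg_image:
  shows "connected (seg z z' ` {0..1})" "z \<in> seg z z' ` {0..1}" "z' \<in> seg z z' ` {0..1}"
proof -
  show "connected (seg z z' ` {0..1})" using connected_path_image[OF path_seg] by (simp add: path_image_def)
  show "z \<in> seg z z' ` {0..1}" by (rule image_eqI[of _ _ 0]) simp_all
  show "z' \<in> seg z z' ` {0..1}" by (rule image_eqI[of _ _ 1]) simp_all
qed

context single
begin

lemma N_nonempty: "N \<noteq> {}"
proof
  assume "N = {}"
  then have "cp ` D = {}" using lf_image by simp
  then show False using D by (simp add: drawing_def)
qed

lemma edge_X: "{s, t} \<in> L \<Longrightarrow> z \<in> cs {s, t} \<Longrightarrow> z \<notin> N \<Longrightarrow> z \<in> X"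
  using edge_D by (auto simp: realization_def)

lemma edge_node: "y \<in> N \<Longrightarrow> y \<in> cs {s, t} \<Longrightarrow> supp y = {s, t}"
proof -
  assume y: "y \<in> N" "y \<in> cs {s, t}"
  obtain a where a: "a \<in> D" "y \<in> ends a" using y(1) by (auto simp: N_def)
  have "card {s, t} \<le> card (supp y)" unfolding node_supp(2)[OF a] by (simp add: card_insert_if)
  then show "supp y = {s, t}" using card_seteq[OF _ supp_closed[OF y(2)]] by simp
qed

lemma seg_connected:
  assumes e: "{s, t} \<in> L" and z: "z \<in> cs {s, t}" "z' \<in> cs {s, t}"
    and no: "\<And>y. y \<in> N \<Longrightarrow> supp y = {s, t} \<Longrightarrow> \<not> (min (z t) (z' t) \<le> y t \<and> y t \<le> max (z t) (z' t))"
  shows "connected_component X z z'"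
proof -
  have "seg z z' ` {0..1} \<subseteq> X"
  proof
    fix y assume y: "y \<in> seg z z' ` {0..1}"
    note sy = seg_edge[OF z y]
    have "y \<notin> N" using no[of y] edge_node[OF _ sy(1)] sy(2,3) by blast
    then show "y \<in> X" by (rule edge_X[OF e sy(1)])
  qed
  then show ?thesis unfolding connected_component_def 
    using seg_image(1)[of z z'] seg_image(2)[of z z'] seg_image(3)[of z' z] by (intro exI[of _ "seg z z' ` {0..1}"] conjI)
qed

text \<open>A germ of the complement at the point \<open>x\<close> of the lift: \<open>z\<close>
  comes after \<open>x\<close> on the way to \<open>t\<close>, with no further point of the lift up
  to and including \<open>z\<close>. Exchanging \<open>s\<close> and \<open>t\<close> gives the germ
  on the other side.\<close>

definition gm :: "('v \<Rightarrow> real) \<Rightarrow> 'v \<Rightarrow> 'v \<Rightarrow> ('v \<Rightarrow> real) \<Rightarrow> bool" where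
  "gm x s t z \<longleftrightarrow> x \<in> N \<and> supp x = {s, t} \<and> z \<in> cs {s, t} \<and> x t < z t \<and>
    (\<forall>y\<in>N. supp y = {s, t} \<longrightarrow> \<not> (x t < y t \<and> y t \<le> z t))"

lemma gmD:
  assumes "gm x s t z"
  shows "x \<in> N" "supp x = {s, t}" "z \<in> cs {s, t}" "x t < z t"
    "y \<in> N \<Longrightarrow> supp y = {s, t} \<Longrightarrow> \<not> (x t < y t \<and> y t \<le> z t)"
  using assms unfolding gm_def by simp_all

lemma node_edge_L:
  assumes "x \<in> N" "supp x = {s, t}"
  shows "{s, t} \<in> L"
proof -
  obtain a where a: "a \<in> D" "x \<in> ends a" using assms(1) by (auto simp: N_def)
  then show ?thesis using node_supp(1)[OF a] assms(2) by (simp add: edges_def)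
qed

lemma gm_not_N:
  assumes "gm x s t z"
  shows "z \<notin> N"
proof
  assume "z \<in> N"
  from gmD(5)[OF assms this edge_node[OF this gmD(3)[OF assms]]] gmD(4)[OF assms] show False by simp
qed

lemma gm_X: "gm x s t z \<Longrightarrow> z \<in> X"
  by (rule edge_X[OF node_edge_L[OF gmD(1,2)] gmD(3) gm_not_N])

lemma gm_exists:
  assumes x: "x \<in> N" "supp x = {s, t}"
  shows "\<exists>z. gm x s t z"
proof -
  note ne = node_edge[OF x]
  let ?Y = "{y \<in> N. supp y = {s, t} \<and> x t < y t}"
  have fY: "finite ?Y" by (rule finite_subset[OF _ fin_nodes[of "{s, t}"]]) blast
  define M where "M = Min (insert 1 ((\<lambda>y. y t) ` ?Y))"
  have M: "M \<le> 1" "x t < M" "\<And>y. y \<in> ?Y \<Longrightarrow> M \<le> y t"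
    unfolding M_def using fY ne(4) by auto
  define r where "r = (x t + M) / 2"
  have r: "x t < r" "r < M" "r < 1" using M by (simp_all add: r_def)
  define z where "z = (\<lambda>v. if v = t then r else if v = s then 1 - r else 0)"
  have z: "z \<in> cs {s, t}" "z t = r" using ne(1,3) r by (auto simp: closed_simplex_def z_def)
  have "\<not> (x t < y t \<and> y t \<le> z t)" if "y \<in> N" "supp y = {s, t}" for y
    using M(3)[of y] that r z(2) by fastforce
  then have "gm x s t z" unfolding gm_def using x z r by simp
  then show ?thesis by blast
qed

lemma gm_same:
  assumes "gm x s t z" "gm x s t z'"
  shows "connected_component X z z'"
proof (rule seg_connected[of s t])
  show "{s, t} \<in> L" by (rule node_edge_L[OF gmD(1,2)[OF assms(1)]])
  show "z \<in> cs {s, t}" "z' \<in> cs {s, t}" by (rule gmD(3), rule assms)+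
  fix y assume y: "y \<in> N" "supp y = {s, t}"
  show "\<not> (min (z t) (z' t) \<le> y t \<and> y t \<le> max (z t) (z' t))"
    using gmD(5)[OF assms(1) y] gmD(5)[OF assms(2) y] gmD(4)[OF assms(1)] gmD(4)[OF assms(2)] by linarith
qed

text \<open>Germs on the same side at the two ends of a path \<open>a\<close> are joined in its
  face. By \<open>cell_connected\<close> it suffices that no single path separates them: for
  \<open>a\<close> this is seen from coordinates, and any other path is missed by the route from
  \<open>z\<close> to \<open>x\<close>, along \<open>a\<close>, and on to \<open>z'\<close>.\<close>

lemma gm_nb:
  assumes a: "a \<in> D" and f: "{u, v, w} \<in> faces L" and c: "crossing u v w a x x'"
    and g: "gm x v u z \<and> gm x' w u z' \<or> gm x u v z \<and> gm x' u w z'"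
  shows "connected_component X z z'"
proof -
  note cf = crossingD[OF c]
  interpret tri u v w by (rule cf(1))
  note cs = crossing_sub[OF c]
  have aa: "a \<in> arcs {u, v, w}" using a cf(2) by (simp add: arcs_def)
  have zN: "z \<notin> N" "z' \<notin> N" using g gm_not_N[of x v u z] gm_not_N[of x' w u z'] gm_not_N[of x u v z] gm_not_N[of x' u w z'] by blast+
  have ze: "z \<in> cs {u, v}" "z' \<in> cs {u, w}"
    using g unfolding gm_def by (auto simp: insert_commute)
  have xe: "x \<in> cs {u, v}" "x' \<in> cs {u, w}" using cf(11,12) by (simp_all add: open_simplex_def)
  have zO: "z \<notin> Of" "z' \<notin> Of" using edge_not_open[OF ze(1) face_card[OF f]] edge_not_open[OF ze(2) face_card[OF f]] .
  have zT: "z \<in> Tf - Of" "z' \<in> Tf - Of" using zO ze cf(14,15) by auto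
  have zD: "z \<notin> \<Union>D" "z' \<notin> \<Union>D" using edge_D[OF ze(1)] edge_D[OF ze(2)] zN by blast+
  have zA: "z \<in> Tf - Of - \<Union>(arcs {u, v, w})" "z' \<in> Tf - Of - \<Union>(arcs {u, v, w})" using zT zD by (auto simp: arcs_def)
  have D1: "arcs {u, v, w} \<subseteq> D" by (auto simp: arcs_def)
  have side: "sd b z \<longleftrightarrow> sd b z'" if b: "b \<in> arcs {u, v, w}" for b
  proof (cases "b = a")
    case True
    have n: "sd a z \<longleftrightarrow> near v w x x' z" "sd a z' \<longleftrightarrow> near v w x x' z'"
      using sd_sides(3)[OF c] zA aa by blast+
    have zc: "z u = 1 - z v" "z w = 0" "z' u = 1 - z' w" "z' v = 0"
      using closed_edge(1,4)[OF ze(1) d(1)] closed_edge(1,4)[OF ze(2) d(2)] d by auto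
    have xc: "x u = 1 - x v" "x' u = 1 - x' w"
      using closed_edge(1)[OF xe(1) d(1)] closed_edge(1)[OF xe(2) d(2)] .
    show ?thesis unfolding True n near_def using g zc xc cs(6,9) unfolding gm_def by auto
  next
    case False
    have pb: "path_in_face {u, v, w} b" "b \<in> D" using b by (simp_all add: arcs_def)
    obtain u' v' w' y y' where l: "{u, v, w} = {u', v', w'}" "crossing u' v' w' b y y'"
      using face_crossing[OF pb(1) face_card[OF f]] .
    have xN: "x \<in> N" "x' \<in> N" using cf(3) ends_N[OF a] by blast+
    have seg1: "seg p q ` {0..1} \<subseteq> Tf - b" if h: "{s, t} \<subseteq> {u, v, w}" "gm q s t p" "q \<in> {x, x'}" for p q s t
    proof
      fix r assume r: "r \<in> seg p q ` {0..1}"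
      note e = gmD(3)[OF h(2)] node_edge(2,1)[OF gmD(1,2)[OF h(2)]]
      note sr = seg_edge[OF e(1,2) r]
      have "r \<notin> b"
      proof
        assume rb: "r \<in> b"
        then have rN: "r \<in> N" using edge_D[OF sr(1)] pb(2) by blast
        have "\<not> (q t < r t \<and> r t \<le> p t)" "q t < p t" using gmD(5)[OF h(2) rN edge_node[OF rN sr(1)]] gmD(4)[OF h(2)] .
        then have "r t = q t" using sr(2,3) by linarith
        then have rq: "r = q" by (rule edge_eqI[OF sr(1) e(2,3)])
        have "r \<notin> Of" by (rule edge_not_open[OF sr(1) face_card[OF f]])
        then have "r \<notin> open_simplex {u', v', w'}" using l(1) by simp
        then have "r \<in> {y, y'}" using crossingD(7)[OF l(2)] rb by blast
        then have "r \<in> ends b" using crossingD(3)[OF l(2)] by simp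
        moreover have "r \<in> ends a" using rq h(3) cf(3) by blast
        ultimately show False using arcs_disj[OF f b aa False] by (simp add: disjoint_iff)
      qed
      moreover have "r \<in> Tf" using sr(1) closed_simplex_mono[OF h(1)] by blast
      ultimately show "r \<in> Tf - b" by blast
    qed
    have s1: "seg z x ` {0..1} \<subseteq> Tf - b"
      using g seg1[of v u x z] seg1[of u v x z] by (elim disjE) simp_all
    have s2: "seg z' x' ` {0..1} \<subseteq> Tf - b"
      using g seg1[of w u x' z'] seg1[of u w x' z'] by (elim disjE) simp_all
    have s3: "a \<subseteq> Tf - b" using nx[OF f a pb(2) cf(2) pb(1)] False cf(10) by blast
    let ?C = "seg z x ` {0..1} \<union> a \<union> seg z' x' ` {0..1}"
    have "connected (seg z x ` {0..1} \<union> a)"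
      by (rule connected_Un[OF seg_image(1) cf(13)]) (use seg_image(3)[of x z] cf(8) in blast)
    then have "connected ?C"
      by (rule connected_Un[OF _ seg_image(1)]) (use seg_image(3)[of x' z'] cf(9) in blast)
    moreover have "?C \<subseteq> Tf - b" using s1 s2 s3 by blast
    moreover have "z \<in> ?C" "z' \<in> ?C" using seg_image(2) by blast+
    ultimately show ?thesis using sd_connected[OF l(2)] l(1) by metis
  qed
  have "connected_component (Tf - \<Union>(arcs {u, v, w})) z z'"
  proof (rule cell_connected[OF arcs_fin[OF f] _ _ zA])
    show "path_in_face {u, v, w} b" if "b \<in> arcs {u, v, w}" for b using that by (simp add: arcs_def)
    show "b \<inter> b' = {}" if "b \<in> arcs {u, v, w}" "b' \<in> arcs {u, v, w}" "b \<noteq> b'" for b b'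
      using nx[OF f _ _ _ _ \<open>b \<noteq> b'\<close>] that(1,2) by (simp add: arcs_def)
    fix b u' v' w' y y' assume b: "b \<in> arcs {u, v, w}" "{u, v, w} = {u', v', w'}" "crossing u' v' w' b y y'"
    have "z \<in> cs {u', v', w'} - open_simplex {u', v', w'} - b" "z' \<in> cs {u', v', w'} - open_simplex {u', v', w'} - b"
      using zA b(1) unfolding b(2)[symmetric] by blast+
    then show "near v' w' y y' z = near v' w' y y' z'" using sd_sides(3)[OF b(3)] side[OF b(1)] by blast
  qed
  moreover have "Tf - \<Union>(arcs {u, v, w}) \<subseteq> X"
  proof -
    have "Tf \<subseteq> realization L" using face_L[OF f] by (auto simp: realization_def)
    then show ?thesis using arcs_Union[OF f] by blast
  qed
  ultimately show ?thesis by (rule connected_component_of_subset)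
qed

lemma edge_germ:
  assumes z: "z \<in> cs {s, t}" "z \<notin> N" and ne: "{y \<in> N. supp y = {s, t}} \<noteq> {}"
  shows "\<exists>x s t. gm x s t z"
proof -
  have st: "s \<noteq> t" using ne node_edge(1) by blast
  have cmp: "y t < z t \<or> y s < z s" if y: "y \<in> N" "supp y = {s, t}" for y
  proof -
    have c: "y \<in> cs {s, t}" using node_edge(2)[OF y] .
    have "y t \<noteq> z t" using edge_eqI[OF c z(1) st] y(1) z(2) by blast
    then show ?thesis using closed_edge(1)[OF c st] closed_edge(1)[OF z(1) st] by linarith
  qed
  have main: "\<exists>x. gm x p q z" if pq: "{p, q} = {s, t}" and h: "{y \<in> N. supp y = {p, q} \<and> y q < z q} \<noteq> {}" for p q
  proof -
    let ?Y = "{y \<in> N. supp y = {p, q} \<and> y q < z q}"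
    have fY: "finite ?Y" by (rule finite_subset[OF _ fin_nodes[of "{p, q}"]]) blast
    obtain x where x: "x \<in> ?Y" "\<And>y. y \<in> ?Y \<Longrightarrow> y q \<le> x q"
    proof -
      have "Max ((\<lambda>y. y q) ` ?Y) \<in> (\<lambda>y. y q) ` ?Y" using fY h by (intro Max_in) simp_all
      then obtain x where x: "x \<in> ?Y" "Max ((\<lambda>y. y q) ` ?Y) = x q" by blast
      have "y q \<le> x q" if "y \<in> ?Y" for y
        unfolding x(2)[symmetric] using fY that by (intro Max_ge) simp_all
      with x(1) show thesis by (rule that)
    qed
    have zpq: "z \<in> cs {p, q}" using z(1) pq by simp
    have "p \<noteq> q" using pq st by (auto simp: doubleton_eq_iff)
    have "\<not> (x q < y q \<and> y q \<le> z q)" if y: "y \<in> N" "supp y = {p, q}" for y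
    proof
      assume l: "x q < y q \<and> y q \<le> z q"
      have "y q \<noteq> z q" using edge_eqI[OF node_edge(2)[OF y] zpq \<open>p \<noteq> q\<close>] y(1) z(2) by blast
      then have "y \<in> ?Y" using y l by simp
      then show False using x(2)[of y] l by simp
    qed
    then show ?thesis unfolding gm_def using x(1) zpq by (intro exI[of _ x]) simp
  qed
  obtain y where y: "y \<in> N" "supp y = {s, t}" using ne by blast
  from cmp[OF y] show ?thesis
  proof
    assume "y t < z t"
    then have "{y \<in> N. supp y = {s, t} \<and> y t < z t} \<noteq> {}" using y by blast
    from main[OF refl this] show ?thesis by blast
  next
    assume "y s < z s"
    then have "{y \<in> N. supp y = {t, s} \<and> y s < z s} \<noteq> {}" using y by (auto simp: insert_commute)
    from main[OF insert_commute this] show ?thesis by blast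
  qed
qed

lemma node_exists:
  obtains x s t where "x \<in> N" "supp x = {s, t}"
proof -
  obtain x where x: "x \<in> N" using N_nonempty by blast
  then obtain a where a: "a \<in> D" "x \<in> ends a" by (auto simp: N_def)
  show ?thesis using that[OF x] node_supp(2)[OF a] by (auto simp: card_2_iff)
qed

text \<open>By induction backwards along a walk from \<open>v\<close> to an end of an edge met by
  the lift: an edge not met joins its ends in the complement, and a vertex of an edge that is met is
  itself a germ.\<close>

lemma vertex_germ:
  assumes "v \<in> \<Union>L"
  shows "\<exists>x s t z. gm x s t z \<and> connected_component X (vp v) z"
proof -
  obtain x0 s0 t0 where x0: "x0 \<in> N" and st0: "supp x0 = {s0, t0}" using node_exists .
  have e0: "{s0, t0} \<in> L" by (rule node_edge_L[OF x0 st0])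
  then have "s0 \<in> \<Union>L" by blast
  from par.walk_exists[OF sc assms this] obtain w m where w: "par.walk w m" "w 0 = v" "w m = s0" by blast
  have vX: "vp r \<in> X" if "{r, q} \<in> L" for r q
    by (rule edge_X[OF that _ vertex_not_node]) (rule vertex_point_in; simp)
  have self: "\<exists>x s t z. gm x s t z \<and> connected_component X (vp r) z"
    if rq: "{r, q} \<in> L" "{y \<in> N. supp y = {r, q}} \<noteq> {}" for r q
  proof -
    have "vp r \<in> cs {r, q}" by (rule vertex_point_in) simp_all
    from edge_germ[OF this vertex_not_node rq(2)] obtain x s t where "gm x s t (vp r)" by blast
    moreover have "connected_component X (vp r) (vp r)" using vX[OF rq(1)] by simp
    ultimately show ?thesis by blast
  qed
  have "\<exists>x s t z. gm x s t z \<and> connected_component X (vp (w (m - i))) z" if "i \<le> m" for i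
    using that
  proof (induction i)
    case 0
    have "{y \<in> N. supp y = {s0, t0}} \<noteq> {}" using x0 st0 by blast
    from self[OF e0 this] show ?case using w(3) by simp
  next
    case (Suc i)
    then have i: "Suc (m - Suc i) = m - i" "m - Suc i < m" by simp_all
    let ?r = "w (m - Suc i)" and ?q = "w (m - i)"
    have e: "{?r, ?q} \<in> L" using w(1) i unfolding par.walk_def by metis
    show ?case
    proof (cases "{y \<in> N. supp y = {?r, ?q}} = {}")
      case True
      have "vp ?r \<in> cs {?r, ?q}" "vp ?q \<in> cs {?r, ?q}"
        by (rule vertex_point_in; simp)+
      from seg_connected[OF e this] have "connected_component X (vp ?r) (vp ?q)" using True by blast
      then have rq: "connected_component X (vp ?r) (vp ?q)" .
      obtain x s t z where "gm x s t z" "connected_component X (vp ?q) z" using Suc by auto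
      then show ?thesis using connected_component_trans[OF rq] by blast
    next
      case False
      from self[OF e False] show ?thesis .
    qed
  qed
  from this[of m] show ?thesis using w(2) by simp
qed

lemma edge_reach:
  assumes e: "{s, t} \<in> L" and z: "z \<in> cs {s, t}" "z \<notin> N"
  shows "\<exists>x s t z'. gm x s t z' \<and> connected_component X z z'"
proof (cases "{y \<in> N. supp y = {s, t}} = {}")
  case True
  have "vp s \<in> cs {s, t}" by (rule vertex_point_in) simp_all
  from seg_connected[OF e z(1) this] have "connected_component X z (vp s)" using True by blast
  then have zs: "connected_component X z (vp s)" .
  obtain x s' t' z' where "gm x s' t' z'" "connected_component X (vp s) z'"
    using vertex_germ[of s] e by blast
  then show ?thesis using connected_component_trans[OF zs] by blast
next
  case False
  from edge_germ[OF z False] obtain x s' t' where "gm x s' t' z" by blast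
  moreover have "connected_component X z z" using edge_X[OF e z] by simp
  ultimately show ?thesis by blast
qed

lemma reach:
  assumes z: "z \<in> X"
  shows "\<exists>x s t z'. gm x s t z' \<and> connected_component X z z'"
proof -
  obtain s where s: "s \<in> L" "z \<in> cs s" using z by (auto simp: realization_def)
  have zN: "z \<notin> N" using z N_D by blast
  show ?thesis
  proof (cases "card s = 3")
    case True
    then have f: "s \<in> faces L" using s(1) by (simp add: faces_def)
    obtain u v w where uvw: "s = {u, v, w}" "u \<noteq> v" "u \<noteq> w" "v \<noteq> w" using True by (auto simp: card_3_iff)
    interpret tri u v w using uvw by unfold_locales
    have "\<exists>q\<in>Tf - Of - \<Union>(arcs s). connected_component (Tf - \<Union>(arcs s)) z q"
    proof (rule to_boundary[OF arcs_fin[OF f]])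
      show "path_in_face {u, v, w} b" if "b \<in> arcs s" for b using that uvw(1) by (simp add: arcs_def)
      show "b \<inter> b' = {}" if "b \<in> arcs s" "b' \<in> arcs s" "b \<noteq> b'" for b b'
        using nx[OF f _ _ _ _ \<open>b \<noteq> b'\<close>] that(1,2) by (simp add: arcs_def)
      show "z \<in> Tf - \<Union>(arcs s)" using s(2) z uvw(1) by (auto simp: arcs_def)
    qed
    then obtain q where q: "q \<in> Tf - Of - \<Union>(arcs s)" "connected_component (Tf - \<Union>(arcs s)) z q" by blast
    have sub: "Tf - \<Union>(arcs s) \<subseteq> X"
    proof -
      have "Tf \<subseteq> realization L" using s(1) uvw(1) by (auto simp: realization_def)
      then show ?thesis using arcs_Union[OF f] uvw(1) by blast
    qed
    have q1: "q \<in> cs s" "q \<notin> open_simplex s" "q \<in> X" using q(1) uvw(1) sub by blast+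
    obtain p r where pr: "{p, r} \<subseteq> s" "p \<noteq> r" "q \<in> cs {p, r}" using boundary_edge[OF True q1(1,2)] .
    have "{p, r} \<in> L" using abstract_face[OF L s(1) pr(1)] by simp
    from edge_reach[OF this pr(3)] obtain x s' t' z' where g: "gm x s' t' z'" "connected_component X q z'"
      using q1(3) N_D by blast
    have "connected_component X z q" using connected_component_of_subset[OF q(2) sub] .
    then have "connected_component X z z'" by (rule connected_component_trans[OF _ g(2)])
    then show ?thesis using g(1) by blast
  next
    case False
    then obtain p q where "s = {p, q}" using small_simplex[OF s(1)] by blast
    then show ?thesis using edge_reach[of p q z] s zN by blast
  qed
qed

text \<open>Germs can be carried along the lift, which is connected, so every germ is joined to one
  of the two germs at a single point \<open>x0\<close>. By \<open>reach\<close> this holds for every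
  point of the complement.\<close>

lemma two_sides:
  obtains p q where "p \<in> X" "q \<in> X" "sg p \<noteq> sg q" "\<forall>z\<in>X. connected_component X z p \<or> connected_component X z q"
proof -
  obtain x0 s0 t0 where x0: "x0 \<in> N" and st0: "supp x0 = {s0, t0}" using node_exists .
  obtain a where a: "a \<in> D" "x0 \<in> ends a" using x0 by (auto simp: N_def)
  have ts0: "supp x0 = {t0, s0}" using st0 by (simp add: insert_commute)
  obtain p where p: "gm x0 s0 t0 p" using gm_exists[OF x0 st0] by blast
  obtain q where q: "gm x0 t0 s0 q" using gm_exists[OF x0 ts0] by blast
  have all: "connected_component X z p \<or> connected_component X z q"
    if xx: "(x0, x) \<in> {(x, nb f x) | x f. x \<in> N \<and> f \<in> faces L \<and> supp x \<subseteq> f}\<^sup>*" and zz: "gm x s t z" for x s t z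
    using xx zz
  proof (induction arbitrary: s t z)
    case base
    have "supp x0 = {s, t}" by (rule gmD(2)[OF base])
    then have "s = s0 \<and> t = t0 \<or> s = t0 \<and> t = s0" using st0 by (auto simp: doubleton_eq_iff)
    then show ?case
    proof
      assume "s = s0 \<and> t = t0"
      then show ?thesis using gm_same[of x0 s0 t0 z p] base p by blast
    next
      assume "s = t0 \<and> t = s0"
      then show ?thesis using gm_same[of x0 t0 s0 z q] base q by blast
    qed
  next
    case (step x x')
    obtain f where f: "x \<in> N" "f \<in> faces L" "supp x \<subseteq> f" "x' = nb f x" using step(2) by blast
    obtain u v w where c: "f = {u, v, w}" "crossing u v w (arc_at f x) x x'"
      using arc_at_crossing[OF f(1-3)] f(4) by metis
    note cf = crossingD[OF c(2)]
    have aD: "arc_at f x \<in> D" using arc_at_D(1)[OF f(1-3)] .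
    have fL: "{u, v, w} \<in> faces L" using f(2) c(1) by simp
    have "supp x' = {s, t}" by (rule gmD(2)[OF step.prems])
    then have "s = w \<and> t = u \<or> s = u \<and> t = w" using cf(5) by (auto simp: doubleton_eq_iff)
    then show ?case
    proof
      assume h: "s = w \<and> t = u"
      have "supp x = {v, u}" using cf(4) by (simp add: insert_commute)
      then obtain y where y: "gm x v u y" using gm_exists[OF f(1)] by blast
      have "connected_component X y z" by (rule gm_nb[OF aD fL c(2)]) (use y step.prems h in simp)
      note zy = connected_component_sym[OF this]
      from step.IH[OF y] show ?thesis using connected_component_trans[OF zy, of p] connected_component_trans[OF zy, of q] by argo
    next
      assume h: "s = u \<and> t = w"
      obtain y where y: "gm x u v y" using gm_exists[OF f(1) cf(4)] by blast
      have "connected_component X y z" by (rule gm_nb[OF aD fL c(2)]) (use y step.prems h in simp)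
      note zy = connected_component_sym[OF this]
      from step.IH[OF y] show ?thesis using connected_component_trans[OF zy, of p] connected_component_trans[OF zy, of q] by argo
    qed
  qed
  have lfx: "lf x = lf x0" if xN: "x \<in> N" for x
  proof -
    obtain b where b: "b \<in> D" "x \<in> ends b" using xN by (auto simp: N_def)
    show ?thesis using lf_eq[OF a] lf_eq[OF b] cp_eq[OF pre[OF a(1) b(1)]] by simp
  qed
  show ?thesis
  proof (rule that[of p q])
    show "p \<in> X" "q \<in> X" using gm_X p q by blast+
    show "\<forall>z\<in>X. connected_component X z p \<or> connected_component X z q"
    proof
      fix z assume "z \<in> X"
      obtain x s t z' where g: "gm x s t z'" "connected_component X z z'" using reach[OF \<open>z \<in> X\<close>] by blast
      have xN: "x \<in> N" by (rule gmD(1)[OF g(1)])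
      have "connected_component X z' p \<or> connected_component X z' q"
        by (rule all[OF nb_conn[OF x0 xN] g(1)]) (simp add: lfx[OF xN])
      then show "connected_component X z p \<or> connected_component X z q" using connected_component_trans[OF g(2)] by blast
    qed
    have e: "{s0, t0} \<in> L" by (rule node_edge_L[OF x0 st0])
    have st: "s0 \<noteq> t0" using node_edge(1)[OF x0 st0] .
    have pc: "p \<in> cs {s0, t0}" by (rule gmD(3)[OF p])
    have qc: "q \<in> cs {s0, t0}" using gmD(3)[OF q] by (simp add: insert_commute)
    have xc: "x0 \<in> cs {s0, t0}" using node_edge(2)[OF x0 st0] .
    have pq: "sg p = se s0 t0 p" "sg q = se s0 t0 q"
      using sg_edge[OF e pc gm_not_N[OF p]] sg_edge[OF e qc gm_not_N[OF q]] .
    have qx: "q t0 < x0 t0"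
      using gmD(4)[OF q] closed_edge(1)[OF qc st] closed_edge(1)[OF xc st] by simp
    have xp: "x0 t0 < p t0" by (rule gmD(4)[OF p])
    \<comment> \<open>Between the two germs lies exactly one point of the lift, so the colour
      switches once.\<close>
    have "bf s0 t0 p = insert x0 (bf s0 t0 q)"
    proof (intro equalityI subsetI)
      fix y assume "y \<in> bf s0 t0 p"
      then have y: "y \<in> N" "supp y = {s0, t0}" "y t0 < p t0" by (auto simp: bf_def)
      have yc: "y \<in> cs {s0, t0}" using node_edge(2)[OF y(1,2)] .
      have "\<not> (x0 t0 < y t0 \<and> y t0 \<le> p t0)" by (rule gmD(5)[OF p y(1,2)])
      then have "y t0 \<le> x0 t0" using y(3) by linarith
      moreover have "supp y = {t0, s0}" using y(2) by (simp add: insert_commute)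
      then have "\<not> (x0 s0 < y s0 \<and> y s0 \<le> q s0)" by (rule gmD(5)[OF q y(1)])
      ultimately have "y t0 = x0 t0 \<or> y t0 < q t0"
        using closed_edge(1)[OF qc st] closed_edge(1)[OF xc st] closed_edge(1)[OF yc st] by linarith
      then show "y \<in> insert x0 (bf s0 t0 q)" using edge_eqI[OF yc xc st] y(1,2) by (auto simp: bf_def)
    next
      fix y assume "y \<in> insert x0 (bf s0 t0 q)"
      then show "y \<in> bf s0 t0 p" using x0 st0 xp qx by (auto simp: bf_def)
    qed
    moreover have "x0 \<notin> bf s0 t0 q" using qx by (simp add: bf_def)
    ultimately have "card (bf s0 t0 p) = Suc (card (bf s0 t0 q))" using fin_bf by simp
    then show "sg p \<noteq> sg q" unfolding pq se_def by simp
  qed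
qed

text \<open>The complement has two components, distinguished by \<open>sg\<close>, and at vertices
  \<open>sg\<close> is the colouring \<open>c\<close>. So the halfspaces depend only on the parities
  \<open>\<theta>\<close>.\<close>

lemma halfspaces_eq: "halfspaces L D = {{w \<in> \<Union>L. c w}, {w \<in> \<Union>L. \<not> c w}}"
proof -
  obtain p q where pq: "p \<in> X" "q \<in> X" "sg p \<noteq> sg q"
    "\<forall>z\<in>X. connected_component X z p \<or> connected_component X z q" using two_sides .
  have sgc: "sg y = sg z" if yz: "connected_component X y z" for y z
  proof -
    obtain C where "connected C" "C \<subseteq> X" "y \<in> C" "z \<in> C" using yz unfolding connected_component_def by blast
    then show ?thesis by (rule sg_connected)
  qed
  have cc: "connected_component X r z \<longleftrightarrow> sg z = sg r" if r: "r = p \<or> r = q" "z \<in> X" for r z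
  proof
    show "connected_component X r z \<Longrightarrow> sg z = sg r" using sgc[of r z] by simp
    assume s: "sg z = sg r"
    have "connected_component X z r"
      using bspec[OF pq(4) r(2)]
    proof
      assume "connected_component X z p"
      then show ?thesis using sgc[of z p] s r(1) pq(3) by auto
    next
      assume "connected_component X z q"
      then show ?thesis using sgc[of z q] s r(1) pq(3) by auto
    qed
    then show "connected_component X r z" by (rule connected_component_sym)
  qed
  have "components X = {connected_component_set X p, connected_component_set X q}"
  proof (intro equalityI subsetI)
    fix C assume "C \<in> components X"
    then obtain z where z: "z \<in> X" "C = connected_component_set X z" by (auto simp: components_def)
    from bspec[OF pq(4) z(1)] show "C \<in> {connected_component_set X p, connected_component_set X q}"
    proof
      assume "connected_component X z p"
      then have "connected_component_set X p = connected_component_set X z" by (intro connected_component_eq) simp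
      then show ?thesis using z(2) by simp
    next
      assume "connected_component X z q"
      then have "connected_component_set X q = connected_component_set X z" by (intro connected_component_eq) simp
      then show ?thesis using z(2) by simp
    qed
  qed (use pq(1,2) in \<open>auto simp: components_def\<close>)
  then have img: "halfspaces L D = (\<lambda>C. {w \<in> \<Union>L. vp w \<in> C}) ` {connected_component_set X p, connected_component_set X q}"
    unfolding halfspaces_def by (simp only: setcompr_eq_image Collect_mem_eq)
  have vs: "{w \<in> \<Union>L. vp w \<in> connected_component_set X r} = {w \<in> \<Union>L. c w = sg r}" if r: "r = p \<or> r = q" for r
  proof -
    have "connected_component X r (vp w) \<longleftrightarrow> c w = sg r" if w: "w \<in> \<Union>L" for w
    proof -
      have e: "{w, w} \<in> L" using vertex_realization(2)[OF L w] by simp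
      have v: "vp w \<in> cs {w, w}" by (rule vertex_point_in) simp_all
      have "vp w \<in> X" by (rule edge_X[OF e v vertex_not_node])
      then show ?thesis using cc[OF r] sg_edge[OF e v vertex_not_node] se_vertex[OF e, of w] by simp
    qed
    then show ?thesis by auto
  qed
  have "halfspaces L D = {{w \<in> \<Union>L. c w = sg p}, {w \<in> \<Union>L. c w = sg q}}"
    unfolding img image_insert image_empty by (simp only: vs[of p] vs[of q] simp_thms)
  then show ?thesis using pq(3) by (cases "sg p"; cases "sg q") auto
qed

text \<open>Equal edge counts give equal parities, and parities determine the colouring up to a
  global negation, which merely exchanges the two halfspaces. Applied with the identity in
  \<open>halfspaces_count\<close> and with a deck transformation in
  \<open>halfspaces_deck\<close>.\<close>

lemma halfspaces_map:
  assumes "single L D'" and g: "bij_betw g (\<Union>L) (\<Union>L)" "\<And>u v. {u, v} \<in> L \<Longrightarrow> {g u, g v} \<in> L"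
    and cnt: "\<And>u v. {u, v} \<in> L \<Longrightarrow> card {x \<in> N. supp x = {u, v}} = card {x \<in> drw.N D'. supp x = {g u, g v}}"
  shows "halfspaces L D' = image g ` halfspaces L D"
proof -
  interpret s: single L D' by (rule assms(1))
  have st: "(c u = s.c (g u)) = (c v = s.c (g v))" if uv: "{u, v} \<in> L" for u v
  proof -
    have "\<theta> u v = s.\<theta> (g u) (g v)" using cnt[OF uv] by (simp add: \<theta>_def s.\<theta>_def)
    then show ?thesis using c[OF uv] s.c[OF g(2)[OF uv]] by argo
  qed
  have eq: "(c u = s.c (g u)) = (c v = s.c (g v))" if uv: "u \<in> \<Union>L" "v \<in> \<Union>L" for u v
  proof -
    obtain w m where w: "par.walk w m" "w 0 = u" "w m = v" using par.walk_exists[OF sc uv] by blast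
    have "(c u = s.c (g u)) = (c (w i) = s.c (g (w i)))" if "i \<le> m" for i
      using that
    proof (induction i)
      case (Suc i)
      have "{w i, w (Suc i)} \<in> L" using w(1) Suc.prems unfolding par.walk_def by simp
      from st[OF this] Suc show ?case by simp
    qed (simp add: w(2))
    from this[of m] show ?thesis using w(3) by simp
  qed
  have im: "{w \<in> \<Union>L. Q w} = g ` {w \<in> \<Union>L. Q (g w)}" for Q
  proof (intro equalityI subsetI)
    fix w assume w: "w \<in> {w \<in> \<Union>L. Q w}"
    then have "w \<in> g ` \<Union>L" using bij_betw_imp_surj_on[OF g(1)] by simp
    then show "w \<in> g ` {w \<in> \<Union>L. Q (g w)}" using w by auto
  next
    fix w assume "w \<in> g ` {w \<in> \<Union>L. Q (g w)}"
    then obtain v where "v \<in> \<Union>L" "Q (g v)" "w = g v" by blast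
    then show "w \<in> {w \<in> \<Union>L. Q w}" using bij_betwE[OF g(1), rule_format, of v] by simp
  qed
  have "(\<forall>w\<in>\<Union>L. c w = s.c (g w)) \<or> (\<forall>w\<in>\<Union>L. c w = (\<not> s.c (g w)))"
  proof (cases "\<exists>w\<in>\<Union>L. c w = s.c (g w)")
    case True
    then obtain w where w: "w \<in> \<Union>L" "c w = s.c (g w)" by blast
    have "c w' = s.c (g w')" if "w' \<in> \<Union>L" for w' using eq[OF that w(1)] w(2) by simp
    then show ?thesis by blast
  qed blast
  then show ?thesis
  proof
    assume h: "\<forall>w\<in>\<Union>L. c w = s.c (g w)"
    have "{w \<in> \<Union>L. c w} = {w \<in> \<Union>L. s.c (g w)}" "{w \<in> \<Union>L. \<not> c w} = {w \<in> \<Union>L. \<not> s.c (g w)}" using h by blast+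
    then show ?thesis unfolding halfspaces_eq s.halfspaces_eq im[of s.c] im[of "\<lambda>w. \<not> s.c w"] by simp
  next
    assume h: "\<forall>w\<in>\<Union>L. c w = (\<not> s.c (g w))"
    have "{w \<in> \<Union>L. c w} = {w \<in> \<Union>L. \<not> s.c (g w)}" "{w \<in> \<Union>L. \<not> c w} = {w \<in> \<Union>L. s.c (g w)}" using h by blast+
    then show ?thesis unfolding halfspaces_eq s.halfspaces_eq im[of s.c] im[of "\<lambda>w. \<not> s.c w"] by (simp add: insert_commute)
  qed
qed

text \<open>Coming from \<open>u\<close> and coming from \<open>v\<close> one reaches
  \<open>x\<close> from opposite sides of the lift.\<close>

lemma se_flip:
  assumes x: "x \<in> N" "supp x = {u, v}"
  shows "se u v x \<longleftrightarrow> \<not> se v u x"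
proof -
  note ne = node_edge[OF x]
  have e: "{u, v} \<in> L" by (rule node_edge_L[OF x])
  have cmp: "y u < x u \<longleftrightarrow> x v < y v" if y: "y \<in> N" "supp y = {u, v}" for y
    using closed_edge(1)[OF ne(2,1)] closed_edge(1)[OF node_edge(2)[OF y] ne(1)] by auto
  have vu: "{v, u} = {u, v}" by (rule insert_commute)
  have bvu: "bf v u x = {y \<in> N. supp y = {u, v} \<and> x v < y v}"
  proof -
    have "bf v u x = {y \<in> N. supp y = {u, v} \<and> y u < x u}" using vu by (simp add: bf_def)
    then show ?thesis using cmp by auto
  qed
  have split: "{y \<in> N. supp y = {u, v}} = insert x (bf u v x \<union> bf v u x)"
  proof (intro equalityI subsetI)
    fix y assume y: "y \<in> {y \<in> N. supp y = {u, v}}"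
    have "y \<in> cs {u, v}" using node_edge(2)[of y u v] y by simp
    then have "y = x" if "y v = x v" using edge_eqI[of y u v x] ne(1,2) that by blast
    then show "y \<in> insert x (bf u v x \<union> bf v u x)" using y unfolding bvu by (auto simp: bf_def)
  next
    fix y assume "y \<in> insert x (bf u v x \<union> bf v u x)"
    then show "y \<in> {y \<in> N. supp y = {u, v}}" using x unfolding bvu by (auto simp: bf_def)
  qed
  have "bf u v x \<inter> bf v u x = {}" "x \<notin> bf u v x \<union> bf v u x" unfolding bvu by (auto simp: bf_def)
  then have "card {y \<in> N. supp y = {u, v}} = Suc (card (bf u v x) + card (bf v u x))"
    unfolding split using fin_bf card_Un_disjoint[OF fin_bf fin_bf] by simp
  then have "\<theta> u v \<longleftrightarrow> (even (card (bf u v x)) \<longleftrightarrow> even (card (bf v u x)))" unfolding \<theta>_def by simp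
  then show ?thesis unfolding se_def using c[OF e] by argo
qed

text \<open>The path \<open>a\<close> does not count at its own endpoints, since only points
  strictly before are counted. No other path separates \<open>x\<close> from \<open>x'\<close>,
  because \<open>a\<close> joins them and misses it.\<close>

lemma se_nb:
  assumes a: "a \<in> D" and f: "{u, v, w} \<in> faces L" and c: "crossing u v w a x x'"
  shows "se u v x \<longleftrightarrow> se u w x'"
proof -
  note cf = crossingD[OF c]
  have d: "u \<noteq> v" "u \<noteq> w" "v \<noteq> w" using cf(1) by (simp_all add: tri_def)
  let ?A = "arcs {u, v, w} - {a}"
  have aa: "a \<in> arcs {u, v, w}" using a cf(2) by (simp add: arcs_def)
  have fin: "finite ?A" using arcs_fin[OF f] by simp
  have pf: "path_in_face {u, v, w} b" if "b \<in> ?A" for b using that by (simp add: arcs_def)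
  have dis: "ends b \<inter> ends b' = {}" if "b \<in> ?A" "b' \<in> ?A" "b \<noteq> b'" for b b'
    using arcs_disj[OF f] that by blast
  have nd: "z \<notin> (\<Union>b\<in>?A. ends b)" if z: "z \<in> {x, x'}" for z
  proof
    assume "z \<in> (\<Union>b\<in>?A. ends b)"
    then obtain b where b: "b \<in> arcs {u, v, w}" "b \<noteq> a" "z \<in> ends b" by blast
    then show False using arcs_disj[OF f aa b(1)] cf(3) z by blast
  qed
  have par: "odd (card (bf u r z)) \<longleftrightarrow> odd (card {b \<in> ?A. sd b (vp u) \<noteq> sd b z})"
    if h: "r = v \<and> z = x \<or> r = w \<and> z = x'" for r z
  proof -
    have r: "{u, r} \<subseteq> {u, v, w}" "u \<noteq> r" using h d by auto
    have z: "z \<in> cs {u, r}" "z \<in> {x, x'}" using h cf(11,12) by (auto simp: open_simplex_def)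
    have no: "y \<notin> {x, x'}" if "supp y = {u, r}" "y r < z r" for y
      using that h cf(4,5) d by (auto simp: doubleton_eq_iff)
    have "bf u r z = {y \<in> (\<Union>b\<in>?A. ends b). supp y = {u, r} \<and> y r < z r}"
      unfolding bf_def nodes_arcs[OF f r(1)] using no cf(3) by blast
    then show ?thesis using face_parity[OF fin face_card[OF f] pf dis r z(1) nd[OF z(2)]] by simp
  qed
  have same: "sd b x \<longleftrightarrow> sd b x'" if b: "b \<in> ?A" for b
  proof -
    have b1: "b \<in> D" "path_in_face {u, v, w} b" "a \<noteq> b" using b by (auto simp: arcs_def)
    obtain u' v' w' y y' where l: "{u, v, w} = {u', v', w'}" "crossing u' v' w' b y y'"
      using face_crossing[OF b1(2) face_card[OF f]] .
    have "a \<subseteq> cs {u, v, w} - b" using nx[OF f a b1(1) cf(2) b1(2,3)] cf(10) by blast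
    then show ?thesis using sd_connected[OF l(2) cf(13) _ cf(8,9)] l(1) by simp
  qed
  have "{b \<in> ?A. sd b (vp u) \<noteq> sd b x} = {b \<in> ?A. sd b (vp u) \<noteq> sd b x'}" using same by auto
  then show ?thesis unfolding se_def using par[of v x] par[of w x'] by simp
qed

end

section \<open>Lifts and deck transformations\<close>

text \<open>\<open>A\<close> is the renaming of barycentric coordinates induced by the vertex map \<open>q\<close> on the simplex \<open>t\<close>.\<close>

definition transports :: "('v \<Rightarrow> 'w) \<Rightarrow> (('v \<Rightarrow> real) \<Rightarrow> 'w \<Rightarrow> real) \<Rightarrow> 'v set \<Rightarrow> bool" where
  "transports q A t \<longleftrightarrow> inj_on q t \<and> finite t \<and>
     (\<forall>x\<in>cs t. (\<forall>z\<in>t. A x (q z) = x z) \<and> (\<forall>z. z \<notin> q ` t \<longrightarrow> A x z = 0))"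

lemma transportsD:
  assumes "transports q A t"
  shows "inj_on q t" "finite t" "x \<in> cs t \<Longrightarrow> z \<in> t \<Longrightarrow> A x (q z) = x z"
    "x \<in> cs t \<Longrightarrow> z' \<notin> q ` t \<Longrightarrow> A x z' = 0"
  using assms unfolding transports_def by blast+

lemma transports_inj:
  assumes "transports q A t"
  shows "inj_on A (cs t)"
proof (rule inj_onI, rule ext)
  fix x y v assume h: "x \<in> cs t" "y \<in> cs t" "A x = A y"
  show "x v = y v"
  proof (cases "v \<in> t")
    case True
    then show ?thesis using transportsD(3)[OF assms h(1) True] transportsD(3)[OF assms h(2) True] h(3) by simp
  next
    case False
    then show ?thesis using h(1,2) by (simp add: closed_simplex_def)
  qed
qed

lemma transports_supp:
  assumes T: "transports q A t" and x: "x \<in> cs t"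
  shows "supp (A x) = q ` supp x"
proof (intro equalityI subsetI)
  fix z assume z: "z \<in> supp (A x)"
  then have "z \<in> q ` t" using transportsD(4)[OF T x] by (auto simp: supp_def)
  then obtain v where v: "v \<in> t" "z = q v" by blast
  then have "x v \<noteq> 0" using z transportsD(3)[OF T x v(1)] by (simp add: supp_def)
  then show "z \<in> q ` supp x" using v by (simp add: supp_def)
next
  fix z assume "z \<in> q ` supp x"
  then obtain v where v: "x v \<noteq> 0" "z = q v" by (auto simp: supp_def)
  then have "v \<in> t" using x by (auto simp: closed_simplex_def)
  then show "z \<in> supp (A x)" using transportsD(3)[OF T x] v by (simp add: supp_def)
qed

lemma transports_closed:
  assumes T: "transports q A t" and x: "x \<in> cs t"
  shows "A x \<in> cs (q ` t)"
proof -
  have "0 \<le> A x z" for z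
  proof (cases "z \<in> q ` t")
    case True
    then obtain v where "v \<in> t" "z = q v" by blast
    then show ?thesis using transportsD(3)[OF T x] x by (simp add: closed_simplex_def)
  next
    case False
    then show ?thesis using transportsD(4)[OF T x] by simp
  qed
  moreover have "sum (A x) (q ` t) = sum x t"
    unfolding sum.reindex[OF transportsD(1)[OF T]] using transportsD(3)[OF T x] by (intro sum.cong) simp_all
  ultimately show ?thesis using transportsD(4)[OF T x] x by (simp add: closed_simplex_def)
qed

lemma transports_open:
  assumes T: "transports q A t" and x: "x \<in> open_simplex s" "s \<subseteq> t"
  shows "A x \<in> open_simplex (q ` s)"
proof -
  have xt: "x \<in> cs t" using x closed_simplex_mono[OF x(2) transportsD(2)[OF T]] by (auto simp: open_simplex_def)
  have "A x \<in> open_simplex (supp (A x))"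
    by (rule open_supp[OF transports_closed[OF T xt]]) (simp add: transportsD(2)[OF T])
  then show ?thesis using transports_supp[OF T xt] supp_open[OF x(1)] by simp
qed

lemma transports_cont:
  assumes T: "transports q A t"
  shows "continuous_on (cs t) A"
proof (rule continuous_on_coordinatewise_then_product)
  fix z
  show "continuous_on (cs t) (\<lambda>x. A x z)"
  proof (cases "z \<in> q ` t")
    case True
    then obtain v where v: "v \<in> t" "z = q v" by blast
    have "continuous_on (cs t) (\<lambda>x. x v)" by (rule continuous_on_coord)
    then show ?thesis by (rule continuous_on_eq) (use transportsD(3)[OF T _ v(1)] v(2) in simp)
  next
    case False
    have "continuous_on (cs t) (\<lambda>x. 0 :: real)" by (rule continuous_on_const)
    then show ?thesis by (rule continuous_on_eq) (use transportsD(4)[OF T _ False] in simp)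
  qed
qed

lemma crossing_transport:
  assumes T: "transports q A {u, v, w}" and c: "crossing u v w a x y"
  shows "crossing (q u) (q v) (q w) (A ` a) (A x) (A y)"
proof -
  note cf = crossingD[OF c]
  have d: "u \<noteq> v" "u \<noteq> w" "v \<noteq> w" using cf(1) by (simp_all add: tri_def)
  obtain g where g: "arc g" "path_image g = a" "pathstart g = x" "pathfinish g = y"
    "\<forall>t. 0 < t \<and> t < 1 \<longrightarrow> g t \<in> open_simplex {u, v, w}" using c unfolding crossing_def by blast
  have gi: "g ` {0..1} \<subseteq> cs {u, v, w}" using cf(10) g(2) by (simp add: path_image_def)
  have "path (A \<circ> g)" unfolding path_def
  proof (rule continuous_on_compose)
    show "continuous_on {0..1} g" using g(1) by (simp add: arc_def path_def)
    show "continuous_on (g ` {0..1}) A" by (rule continuous_on_subset[OF transports_cont[OF T] gi])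
  qed
  moreover have "inj_on (A \<circ> g) {0..1}"
    by (rule comp_inj_on) (use g(1) inj_on_subset[OF transports_inj[OF T] gi] in \<open>simp_all add: arc_def\<close>)
  ultimately have "arc (A \<circ> g)" by (simp add: arc_def)
  moreover have "path_image (A \<circ> g) = A ` a" using g(2) by (auto simp: path_image_def)
  moreover have "pathstart (A \<circ> g) = A x" "pathfinish (A \<circ> g) = A y" using g(3,4) by (auto simp: pathstart_def pathfinish_def)
  moreover have "A x \<in> open_simplex {q u, q v}" "A y \<in> open_simplex {q u, q w}"
    using transports_open[OF T cf(11)] transports_open[OF T cf(12)] by simp_all
  moreover have "(A \<circ> g) t \<in> open_simplex {q u, q v, q w}" if "0 < t \<and> t < 1" for t
    using transports_open[OF T, of "g t" "{u, v, w}"] g(5) that by simp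
  moreover have "q u \<noteq> q v" "q u \<noteq> q w" "q v \<noteq> q w" using transportsD(1)[OF T] d by (auto simp: inj_on_def)
  ultimately show ?thesis unfolding crossing_def by blast
qed

lemma path_in_face_transport:
  assumes T: "transports q A f" and a: "path_in_face f a" "card f = 3"
  shows "path_in_face (q ` f) (A ` a)" "ends (A ` a) = A ` ends a"
proof -
  obtain u v w x y where c: "f = {u, v, w}" "crossing u v w a x y" using face_crossing[OF a] .
  have c2: "crossing (q u) (q v) (q w) (A ` a) (A x) (A y)" using crossing_transport[OF _ c(2)] T c(1) by simp
  show "path_in_face (q ` f) (A ` a)" using crossingD(2)[OF c2] c(1) by simp
  show "ends (A ` a) = A ` ends a" using crossingD(3)[OF c2] crossingD(3)[OF c(2)] by simp
qed

lemma path_in_face_closed: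
  assumes "path_in_face f a" "card f = 3"
  shows "a \<subseteq> cs f" "a \<noteq> {}" "ends a \<subseteq> a" "ends a \<noteq> {}"
proof -
  obtain u v w x y where c: "f = {u, v, w}" "crossing u v w a x y" using face_crossing[OF assms] .
  show "a \<subseteq> cs f" "a \<noteq> {}" "ends a \<subseteq> a" "ends a \<noteq> {}"
    using crossingD(3,8,9,10)[OF c(2)] c(1) by auto
qed

section \<open>Preimages of drawings and the action of deck transformations\<close>

context ucover
begin

text \<open>The inverse of \<open>rm\<close> from the closed simplex below back to the closed
  simplex of \<open>f\<close>.\<close>

definition lam :: "'w set \<Rightarrow> ('v \<Rightarrow> real) \<Rightarrow> 'w \<Rightarrow> real" where "lam f y = (\<lambda>w. if w \<in> f then y (p w) else 0)"

lemma transports_rm: "s \<in> Kt \<Longrightarrow> transports p rm s"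
  unfolding transports_def using inj_p fin_Kt rm_inj rm_out by blast

lemma transports_lam:
  assumes s: "s \<in> Kt"
  shows "transports (inv_into s p) (lam s) (p ` s)"
proof -
  have i: "inv_into s p ` p ` s = s" using inv_into_image_cancel[OF inj_p[OF s], of s] by simp
  have m: "inv_into s p z \<in> s" "p (inv_into s p z) = z" if "z \<in> p ` s" for z
    using inv_into_into[OF that] f_inv_into_f[OF that] .
  show ?thesis unfolding transports_def i
    using inj_on_inv_into[of "p ` s" p s] fin_Kt[OF s] m by (auto simp: lam_def)
qed

lemma lam_rm:
  assumes "s \<in> Kt" "x \<in> cs s"
  shows "lam s (rm x) = x"
proof
  fix w show "lam s (rm x) w = x w"
    using rm_inj[OF assms(2,1)] assms(2) by (simp add: lam_def closed_simplex_def)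
qed

lemma lam_closed: "s \<in> Kt \<Longrightarrow> y \<in> cs (p ` s) \<Longrightarrow> lam s y \<in> cs s"
  using transports_closed[OF transports_lam] inv_into_image_cancel[OF inj_p, of s s] by fastforce

lemma rm_lam:
  assumes "s \<in> Kt" "y \<in> cs (p ` s)"
  shows "rm (lam s y) = y"
proof (rule rm_eqI[OF lam_closed[OF assms] assms(1)])
  show "y (p w) = lam s y w" if "w \<in> s" for w using that by (simp add: lam_def)
  show "y v = 0" if "v \<notin> p ` s" for v using assms(2) that by (simp add: closed_simplex_def)
qed

lemma card_p: "s \<in> Kt \<Longrightarrow> card (p ` s) = card s"
  using card_image[OF inj_p] .

lemma p_faces: "f \<in> faces Kt \<Longrightarrow> p ` f \<in> faces K"
  using card_p p_simp by (simp add: faces_def)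

lemma faces_Kt: "f \<in> faces Kt \<Longrightarrow> f \<in> Kt" "f \<in> faces Kt \<Longrightarrow> card f = 3" "f \<in> faces Kt \<Longrightarrow> card (p ` f) = 3"
  using card_p by (simp_all add: faces_def)

abbreviation pre where "pre \<equiv> drawing_preimage Kt p"

text \<open>Describes the preimage through paths in faces of the cover whose images belong to
  \<open>D\<close>. In this form invariance under deck transformations is immediate, as they do not
  change the image.\<close>

lemma pre_iff: "a \<in> pre D \<longleftrightarrow> (\<exists>f\<in>faces Kt. path_in_face f a \<and> rm ` a \<in> D)"
proof
  assume "a \<in> pre D"
  then obtain f b where f: "f \<in> faces Kt" and b: "b \<in> D" "path_in_face (p ` f) b" and a: "a = cs f \<inter> rm -` b"
    unfolding drawing_preimage_def by blast
  note fk = faces_Kt[OF f]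
  have bs: "b \<subseteq> cs (p ` f)" by (rule path_in_face_closed(1)[OF b(2) fk(3)])
  have al: "a = lam f ` b"
  proof (intro equalityI subsetI)
    fix x assume "x \<in> a"
    then have "x \<in> cs f" "rm x \<in> b" unfolding a by blast+
    then show "x \<in> lam f ` b" using lam_rm[OF fk(1), of x] by (metis imageI)
  next
    fix x assume "x \<in> lam f ` b"
    then obtain y where "y \<in> b" "x = lam f y" by blast
    then show "x \<in> a" unfolding a using lam_closed[OF fk(1), of y] rm_lam[OF fk(1), of y] bs by auto
  qed
  have "inv_into f p ` p ` f = f" using inv_into_image_cancel[OF inj_p[OF fk(1)], of f] by simp
  then have "path_in_face f a" using path_in_face_transport(1)[OF transports_lam[OF fk(1)] b(2) fk(3)] al by simp
  moreover have "rm ` a = b"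
  proof -
    have "rm (lam f y) = y" if "y \<in> b" for y using rm_lam[OF fk(1)] bs that by blast
    then show ?thesis unfolding al by (simp add: image_image)
  qed
  ultimately show "\<exists>f\<in>faces Kt. path_in_face f a \<and> rm ` a \<in> D" using f b(1) by blast
next
  assume "\<exists>f\<in>faces Kt. path_in_face f a \<and> rm ` a \<in> D"
  then obtain f where f: "f \<in> faces Kt" "path_in_face f a" "rm ` a \<in> D" by blast
  note fk = faces_Kt[OF f(1)]
  have as: "a \<subseteq> cs f" by (rule path_in_face_closed(1)[OF f(2) fk(2)])
  have "a = cs f \<inter> rm -` (rm ` a)"
  proof (intro equalityI subsetI)
    fix x assume "x \<in> cs f \<inter> rm -` (rm ` a)"
    then obtain y where "x \<in> cs f" "y \<in> a" "rm x = rm y" by blast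
    then show "x \<in> a" using lam_rm[OF fk(1), of x] lam_rm[OF fk(1), of y] as by auto
  qed (use as in blast)
  moreover have "path_in_face (p ` f) (rm ` a)" using path_in_face_transport(1)[OF transports_rm[OF fk(1)] f(2) fk(2)] .
  ultimately show "a \<in> pre D" unfolding drawing_preimage_def using f(1,3) by blast
qed

lemma pre_lift:
  assumes f: "f \<in> faces Kt" and b: "b \<in> D" "path_in_face (p ` f) b"
  shows "lam f ` b \<in> pre D" "path_in_face f (lam f ` b)" "rm ` lam f ` b = b" "ends (lam f ` b) = lam f ` ends b"
proof -
  note fk = faces_Kt[OF f]
  have bs: "b \<subseteq> cs (p ` f)" by (rule path_in_face_closed(1)[OF b(2) fk(3)])
  have "inv_into f p ` p ` f = f" using inv_into_image_cancel[OF inj_p[OF fk(1)], of f] by simp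
  then show pf: "path_in_face f (lam f ` b)" using path_in_face_transport(1)[OF transports_lam[OF fk(1)] b(2) fk(3)] by simp
  have "rm (lam f y) = y" if "y \<in> b" for y using rm_lam[OF fk(1)] bs that by blast
  then show r: "rm ` lam f ` b = b" by (simp add: image_image)
  show "lam f ` b \<in> pre D" unfolding pre_iff using f pf r b(1) by auto
  show "ends (lam f ` b) = lam f ` ends b"
    by (rule path_in_face_transport(2)[OF transports_lam[OF fk(1)] b(2) fk(3)])
qed

lemma rm_arc:
  assumes f: "f \<in> faces Kt" and a: "path_in_face f a"
  shows "path_in_face (p ` f) (rm ` a)" "ends (rm ` a) = rm ` ends a" "lam f ` rm ` a = a"
proof -
  note fk = faces_Kt[OF f]
  show "path_in_face (p ` f) (rm ` a)" "ends (rm ` a) = rm ` ends a"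
    by (rule path_in_face_transport[OF transports_rm[OF fk(1)] a fk(2)])+
  have "lam f (rm x) = x" if "x \<in> a" for x
    using lam_rm[OF fk(1)] path_in_face_closed(1)[OF a fk(2)] that by blast
  then show "lam f ` rm ` a = a" by (simp add: image_image)
qed

lemma face_lift:
  assumes f: "f \<in> faces K" and w: "w \<in> \<Union>Kt" "p w \<in> f"
  shows "\<exists>s\<in>faces Kt. w \<in> s \<and> p ` s = f"
proof -
  have "f \<in> K" using f by (simp add: faces_def)
  from lift_exists[OF w(1) this w(2)] obtain s where s: "s \<in> Kt" "w \<in> s" "p ` s = f" by blast
  then have "card s = 3" using card_p[OF s(1)] f by (simp add: faces_def)
  then show ?thesis using s by (auto simp: faces_def)
qed

text \<open>All conditions are checked after projecting. For continuation across an edge, the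
  continuing path below is lifted by \<open>lam f\<close>, which takes the image of the endpoint
  back to the endpoint itself.\<close>

lemma pre_drawing:
  assumes D: "drawing K D"
  shows "drawing Kt (pre D)"
  unfolding drawing_def
proof (intro conjI ballI impI)
  interpret b: drw K D by unfold_locales (use K D in auto)
  show "pre D \<noteq> {}"
  proof -
    obtain a where a: "a \<in> D" using D by (auto simp: drawing_def)
    obtain f where f: "f \<in> faces K" "path_in_face f a" using b.D_face[OF a] by blast
    have "f \<noteq> {}" "f \<in> K" using f(1) by (auto simp: faces_def)
    then obtain v where v: "v \<in> f" "v \<in> \<Union>K" by blast
    obtain w where w: "w \<in> \<Union>Kt" "p w = v" using p_surj[OF v(2)] by blast
    obtain s where s: "s \<in> faces Kt" "p ` s = f" using face_lift[OF f(1) w(1)] w(2) v(1) by blast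
    then show ?thesis using pre_lift(1)[OF s(1) a] f(2) by auto
  qed
  show "\<exists>f\<in>faces Kt. path_in_face f a" if "a \<in> pre D" for a using that unfolding pre_iff by blast
  show "finite {a \<in> pre D. path_in_face f a}" if f: "f \<in> faces Kt" for f
  proof -
    have "{a \<in> pre D. path_in_face f a} \<subseteq> image (lam f) ` {a \<in> D. path_in_face (p ` f) a}"
    proof
      fix a assume a: "a \<in> {a \<in> pre D. path_in_face f a}"
      then have "rm ` a \<in> D" unfolding pre_iff by blast
      moreover have "path_in_face (p ` f) (rm ` a)" "lam f ` rm ` a = a" using rm_arc[OF f] a by blast+
      ultimately show "a \<in> image (lam f) ` {a \<in> D. path_in_face (p ` f) a}" by (metis (mono_tags, lifting) imageI mem_Collect_eq)
    qed
    then show ?thesis by (rule finite_subset) (simp add: b.D_fin[OF p_faces[OF f]])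
  qed
  show "ends a \<inter> ends b = {}" if f: "f \<in> faces Kt" and ab: "a \<in> pre D" "b \<in> pre D"
    "path_in_face f a \<and> path_in_face f b \<and> a \<noteq> b" for f a b
  proof -
    have pf: "path_in_face f a" "path_in_face f b" "a \<noteq> b" using ab(3) by blast+
    have "rm ` a \<in> D" "rm ` b \<in> D" using ab(1,2) unfolding pre_iff by blast+
    moreover have "rm ` a \<noteq> rm ` b" using rm_arc(3)[OF f pf(1)] rm_arc(3)[OF f pf(2)] pf(3) by metis
    ultimately have "ends (rm ` a) \<inter> ends (rm ` b) = {}"
      using b.D_disj[OF p_faces[OF f]] rm_arc(1)[OF f pf(1)] rm_arc(1)[OF f pf(2)] by blast
    then show ?thesis unfolding rm_arc(2)[OF f pf(1)] rm_arc(2)[OF f pf(2)] by blast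
  qed
  fix e x f assume h: "e \<in> edges Kt" "x \<in> cs e" "\<exists>a\<in>pre D. x \<in> ends a" "f \<in> faces Kt" "e \<subseteq> f"
  then obtain a where a: "a \<in> pre D" "x \<in> ends a" by blast
  obtain f' where f': "f' \<in> faces Kt" "path_in_face f' a" "rm ` a \<in> D" using a(1) unfolding pre_iff by blast
  have eK: "e \<in> Kt" using h(1) by (simp add: edges_def)
  have 1: "p ` e \<in> edges K" using eK h(1) card_p[OF eK] p_simp by (simp add: edges_def)
  have 2: "rm x \<in> cs (p ` e)" by (rule rm_closed[OF h(2) eK])
  have 3: "rm x \<in> ends (rm ` a)" unfolding rm_arc(2)[OF f'(1,2)] using a(2) by blast
  obtain b where b: "b \<in> D" "path_in_face (p ` f) b" "rm x \<in> ends b"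
    using b.D_ext[OF 1 2 f'(3) 3 p_faces[OF h(4)]] h(5) by blast
  note fk = faces_Kt[OF h(4)]
  have "x \<in> cs f" using closed_simplex_mono[OF h(5) fin_Kt[OF fk(1)]] h(2) by blast
  then have "lam f (rm x) = x" by (rule lam_rm[OF fk(1)])
  then have "x \<in> ends (lam f ` b)" unfolding pre_lift(4)[OF h(4) b(1,2)] using b(3) by (metis imageI)
  then show "\<exists>b\<in>pre D. path_in_face f b \<and> x \<in> ends b" using pre_lift(1,2)[OF h(4) b(1,2)] by blast
qed

definition deckp :: "('w \<Rightarrow> 'w) \<Rightarrow> bool" where
  "deckp g \<longleftrightarrow> bij_betw g (\<Union>Kt) (\<Union>Kt) \<and> (\<forall>v\<in>\<Union>Kt. p (g v) = p v) \<and> (\<forall>s. s \<subseteq> \<Union>Kt \<longrightarrow> (g ` s \<in> Kt \<longleftrightarrow> s \<in> Kt))"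

lemma deckp_exists:
  assumes "w \<in> \<Union>Kt" "w' \<in> \<Union>Kt" "p w = p w'"
  obtains g where "deckp g" "g w = w'"
proof -
  obtain g where "g w = w'" "bij_betw g (\<Union>Kt) (\<Union>Kt)" "\<And>v. v \<in> \<Union>Kt \<Longrightarrow> p (g v) = p v"
    "\<And>s. s \<subseteq> \<Union>Kt \<Longrightarrow> g ` s \<in> Kt \<longleftrightarrow> s \<in> Kt" using deck[OF assms] by metis
  then show ?thesis using that[of g] unfolding deckp_def by blast
qed

lemma deckpD:
  assumes "deckp g"
  shows "bij_betw g (\<Union>Kt) (\<Union>Kt)" "v \<in> \<Union>Kt \<Longrightarrow> p (g v) = p v" "s \<in> Kt \<Longrightarrow> g ` s \<in> Kt" "s \<in> Kt \<Longrightarrow> inj_on g s"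
    "s \<in> Kt \<Longrightarrow> card (g ` s) = card s" "s \<in> Kt \<Longrightarrow> p ` g ` s = p ` s"
proof -
  show b: "bij_betw g (\<Union>Kt) (\<Union>Kt)" using assms by (simp add: deckp_def)
  show pv: "p (g v) = p v" if "v \<in> \<Union>Kt" for v using assms that unfolding deckp_def by blast
  show "g ` s \<in> Kt" if "s \<in> Kt" for s using assms \<open>s \<in> Kt\<close> unfolding deckp_def by blast
  show i: "inj_on g s" if "s \<in> Kt" for s using b \<open>s \<in> Kt\<close> by (meson Union_upper bij_betw_def inj_on_subset)
  show "card (g ` s) = card s" if "s \<in> Kt" for s using card_image[OF i[OF that]] .
  show "p ` g ` s = p ` s" if "s \<in> Kt" for s
    unfolding image_image by (rule image_cong) (use pv \<open>s \<in> Kt\<close> in auto)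
qed

lemma deckp_inv:
  assumes g: "deckp g"
  shows "deckp (inv_into (\<Union>Kt) g)"
proof -
  let ?h = "inv_into (\<Union>Kt) g"
  note b = deckpD(1)[OF g]
  have gh: "g (?h v) = v" if "v \<in> \<Union>Kt" for v using bij_betw_inv_into_right[OF b that] .
  have hK: "?h v \<in> \<Union>Kt" if "v \<in> \<Union>Kt" for v using bij_betwE[OF bij_betw_inv_into[OF b]] that by blast
  have "p (?h v) = p v" if "v \<in> \<Union>Kt" for v using deckpD(2)[OF g hK[OF that]] gh[OF that] by simp
  moreover have "?h ` s \<in> Kt \<longleftrightarrow> s \<in> Kt" if s: "s \<subseteq> \<Union>Kt" for s
  proof -
    have "g ` ?h ` s = s" unfolding image_image using gh s by (simp add: subset_iff)
    moreover have "?h ` s \<subseteq> \<Union>Kt" using hK s by blast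
    ultimately show ?thesis using g unfolding deckp_def by metis
  qed
  ultimately show ?thesis unfolding deckp_def using bij_betw_inv_into[OF b] by blast
qed

lemma transports_deck: "deckp g \<Longrightarrow> s \<in> Kt \<Longrightarrow> transports g (realization_map g) s"
  unfolding transports_def
  using deckpD(4)[of g s] fin_Kt[of s] realization_map_inj[of _ s g] by simp

lemma rm_deck:
  assumes g: "deckp g" and s: "s \<in> Kt" "x \<in> cs s"
  shows "rm (realization_map g x) = rm x"
proof (rule rm_eqI[OF transports_closed[OF transports_deck[OF g s(1)] s(2)] deckpD(3)[OF g s(1)]])
  fix w assume "w \<in> g ` s"
  then obtain v where v: "v \<in> s" "w = g v" by blast
  have "p w = p v" using deckpD(2)[OF g, of v] v s(1) by blast
  then show "rm x (p w) = realization_map g x w"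
    using rm_inj[OF s(2,1) v(1)] transportsD(3)[OF transports_deck[OF g s(1)] s(2) v(1)] v(2) by simp
next
  fix v assume "v \<notin> p ` g ` s"
  then show "rm x v = 0" using rm_out[OF s(2,1)] deckpD(6)[OF g s(1)] by simp
qed

text \<open>Both points lie in one closed simplex and have the same image under \<open>rm\<close>,
  which is injective there.\<close>

lemma deck_cancel:
  assumes g: "deckp g" "deckp h" and s: "s \<in> Kt" "x \<in> cs s" and hg: "\<And>v. v \<in> s \<Longrightarrow> h (g v) = v"
  shows "realization_map h (realization_map g x) = x"
proof -
  have gs: "g ` s \<in> Kt" by (rule deckpD(3)[OF g(1) s(1)])
  have gx: "realization_map g x \<in> cs (g ` s)" by (rule transports_closed[OF transports_deck[OF g(1) s(1)] s(2)])
  have "h ` g ` s = s" using hg by (simp add: image_image)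
  with transports_closed[OF transports_deck[OF g(2) gs] gx]
  have c: "realization_map h (realization_map g x) \<in> cs s" by simp
  have "rm (realization_map h (realization_map g x)) = rm x" using rm_deck[OF g(2) gs gx] rm_deck[OF g(1) s] by simp
  then show ?thesis using lam_rm[OF s(1) c] lam_rm[OF s] by simp
qed

lemma deck_inverse:
  assumes g: "deckp g" and s: "s \<in> Kt" "x \<in> cs s"
  shows "realization_map (inv_into (\<Union>Kt) g) (realization_map g x) = x"
    "realization_map g (realization_map (inv_into (\<Union>Kt) g) x) = x"
proof -
  have v: "v \<in> \<Union>Kt" if "v \<in> s" for v using that s(1) by blast
  show "realization_map (inv_into (\<Union>Kt) g) (realization_map g x) = x"
    by (rule deck_cancel[OF g deckp_inv[OF g] s bij_betw_inv_into_left[OF deckpD(1)[OF g] v]])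
  show "realization_map g (realization_map (inv_into (\<Union>Kt) g) x) = x"
    by (rule deck_cancel[OF deckp_inv[OF g] g s bij_betw_inv_into_right[OF deckpD(1)[OF g] v]])
qed

lemma deck_pre:
  assumes g: "deckp g" and f: "f \<in> faces Kt" "path_in_face f a"
  shows "g ` f \<in> faces Kt" "path_in_face (g ` f) (realization_map g ` a)"
    "ends (realization_map g ` a) = realization_map g ` ends a"
    "rm ` realization_map g ` a = rm ` a"
    "realization_map (inv_into (\<Union>Kt) g) ` realization_map g ` a = a"
proof -
  note fk = faces_Kt[OF f(1)]
  show "g ` f \<in> faces Kt" using deckpD(3,5)[OF g fk(1)] fk(2) by (simp add: faces_def)
  show "path_in_face (g ` f) (realization_map g ` a)" "ends (realization_map g ` a) = realization_map g ` ends a"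
    by (rule path_in_face_transport[OF transports_deck[OF g fk(1)] f(2) fk(2)])+
  have s: "x \<in> cs f" if "x \<in> a" for x using path_in_face_closed(1)[OF f(2) fk(2)] that by blast
  show "rm ` realization_map g ` a = rm ` a"
    unfolding image_image by (rule image_cong[OF refl rm_deck[OF g fk(1) s]])
  show "realization_map (inv_into (\<Union>Kt) g) ` realization_map g ` a = a"
    unfolding image_image using deck_inverse(1)[OF g fk(1) s] by simp
qed

end

section \<open>Lifts of the tracks of a pattern\<close>

locale pat = ucover K Kt p for K :: "'v set set" and Kt :: "'w set set" and p +
  fixes d :: nat and P
  assumes dp: "d_pattern d K Kt p P" and finK: "finite K" and dim2: "two_dimensional K"
begin

abbreviation act where "act \<equiv> realization_map"

lemma P_track: "t \<in> P \<Longrightarrow> track K Kt p t" and P_drawing: "drawing K (\<Union>P)"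
  using dp by (simp_all add: d_pattern_def pattern_def)

sublocale k: drw K "\<Union>P" using K P_drawing by unfold_locales
sublocale t: drw Kt "pre (\<Union>P)" using Kt pre_drawing[OF P_drawing] by unfold_locales

lemma P_pretrack: "t \<in> P \<Longrightarrow> pretrack K t" "t \<in> P \<Longrightarrow> drawing K t"
  using P_track by (simp_all add: track_def pretrack_def)

lemma track_unique:
  assumes "t \<in> P" "t' \<in> P" "a \<in> t" "a \<in> t'"
  shows "t = t'"
  using k.pretrack_cp[OF P_pretrack(1)[OF assms(1)] Union_upper[OF assms(1)] assms(3)]
    k.pretrack_cp[OF P_pretrack(1)[OF assms(2)] Union_upper[OF assms(2)] assms(4)] by simp

lemma pre_mono: "t \<in> P \<Longrightarrow> pre t \<subseteq> pre (\<Union>P)"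
  by (auto simp: pre_iff)

lemma pre_track: "a \<in> pre (\<Union>P) \<Longrightarrow> \<exists>t\<in>P. a \<in> pre t"
  by (auto simp: pre_iff)

text \<open>Components are taken in the preimage of the whole pattern. The preimage of a single
  track is a sub-drawing of it, hence by \<open>drawing_cp\<close> a union of such components, so
  all lifts can be handled inside one drawing.\<close>

lemma lifts_eq:
  assumes t: "t \<in> P"
  shows "lifts Kt p t = t.cp ` pre t"
proof (intro equalityI subsetI)
  fix s assume "s \<in> lifts Kt p t"
  then have s: "s \<subseteq> pre t" "pretrack Kt s" by (auto simp: lifts_def)
  then obtain a where a: "a \<in> s" by (auto simp: pretrack_def drawing_def)
  have "s = t.cp a" using t.pretrack_cp[OF s(2) _ a] s(1) pre_mono[OF t] by blast
  then show "s \<in> t.cp ` pre t" using a s(1) by blast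
next
  fix s assume "s \<in> t.cp ` pre t"
  then obtain a where a: "a \<in> pre t" "s = t.cp a" by blast
  have "s \<subseteq> pre t" unfolding a(2) by (rule t.drawing_cp[OF pre_drawing[OF P_pretrack(2)[OF t]] pre_mono[OF t] a(1)])
  moreover have "pretrack Kt s" unfolding a(2) by (rule t.cp_pretrack) (use a(1) pre_mono[OF t] in blast)
  ultimately show "s \<in> lifts Kt p t" by (simp add: lifts_def)
qed

lemma lifts_unique:
  assumes "t \<in> P" "t' \<in> P" "l \<in> lifts Kt p t" "l \<in> lifts Kt p t'"
  shows "t = t'"
proof -
  have l: "l \<subseteq> pre t" "l \<subseteq> pre t'" "pretrack Kt l" using assms(3,4) by (auto simp: lifts_def)
  then obtain a where "a \<in> l" by (auto simp: pretrack_def drawing_def)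
  then have "rm ` a \<in> t" "rm ` a \<in> t'" using l(1,2) by (auto simp: pre_iff)
  then show ?thesis by (rule track_unique[OF assms(1,2)])
qed

definition tk where "tk l = (THE t. t \<in> P \<and> l \<in> lifts Kt p t)"

lemma tk: "t \<in> P \<Longrightarrow> l \<in> lifts Kt p t \<Longrightarrow> tk l = t"
  unfolding tk_def by (rule the_equality) (use lifts_unique[of _ t l] in blast)+

lemma lf_lifts: "l \<in> t.lf ` t.N \<Longrightarrow> \<exists>t\<in>P. l \<in> lifts Kt p t"
  unfolding t.lf_image using pre_track lifts_eq by blast

lemma lifts_lf: "t \<in> P \<Longrightarrow> l \<in> lifts Kt p t \<Longrightarrow> l \<in> t.lf ` t.N"
  unfolding t.lf_image using lifts_eq[of t] pre_mono[of t] by blast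

lemma lifts_cp:
  assumes "t \<in> P" "l \<in> lifts Kt p t"
  obtains a where "a \<in> pre t" "a \<in> pre (\<Union>P)" "l = t.cp a"
  using assms lifts_eq[OF assms(1)] pre_mono[OF assms(1)] by blast

lemma star_finite:
  assumes "v \<in> \<Union>Kt"
  shows "finite {s \<in> Kt. v \<in> s}"
proof -
  have "inj_on (image p) {s \<in> Kt. v \<in> s}"
  proof (rule inj_onI)
    fix s s' assume "s \<in> {s \<in> Kt. v \<in> s}" "s' \<in> {s \<in> Kt. v \<in> s}" "p ` s = p ` s'"
    then show "s = s'" using lift_unique[of s s' v] by simp
  qed
  moreover have "image p ` {s \<in> Kt. v \<in> s} \<subseteq> K" using p_simp by blast
  ultimately show ?thesis using finK by (metis finite_imageD finite_subset)
qed

text \<open>If two paths of a lift met within a face, they would do so in its interior, as their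
  endpoints are disjoint; this is excluded for lifts of a track.\<close>

lemma single:
  assumes t: "t \<in> P" and l: "l \<in> lifts Kt p t"
  shows "single Kt l"
proof -
  have pl: "pretrack Kt l" "l \<subseteq> pre (\<Union>P)" using l pre_mono[OF t] by (auto simp: lifts_def)
  then interpret l: drw Kt l by unfold_locales (simp_all add: Kt pretrack_def)
  show ?thesis
  proof unfold_locales
    show "b \<in> l.cp a" if "a \<in> l" "b \<in> l" for a b
      using l.pretrack_cp[OF pl(1) order_refl that(1)] that(2) by simp
    show "a \<inter> b = {}" if h: "f \<in> faces Kt" "a \<in> l" "b \<in> l" "path_in_face f a" "path_in_face f b" "a \<noteq> b" for f a b
    proof (rule equals0I)
      fix z assume "z \<in> a \<inter> b"
      then have z: "z \<in> a" "z \<in> b" by blast+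
      have "z \<in> open_simplex f" by (rule arcs_meet[OF h(4,5) faces_Kt(2)[OF h(1)] l.D_disj[OF h] z])
      then have "self_intersecting Kt l" unfolding self_intersecting_def using h z by blast
      then show False using P_track[OF t] l by (simp add: track_def)
    qed
    show "simply_connected (realization Kt)" by (rule sc)
    show "finite {s \<in> Kt. v \<in> s}" if "v \<in> \<Union>Kt" for v by (rule star_finite[OF that])
    show "card s \<le> 3" if "s \<in> Kt" for s
    proof -
      have "card (p ` s) \<le> 3" using p_simp[OF that] dim2 unfolding two_dimensional_def by blast
      then show ?thesis using card_p[OF that] by simp
    qed
  qed
qed

lemma N_lift:
  assumes t: "t \<in> P" and l: "l \<in> lifts Kt p t"
  shows "drw.N l = {x \<in> t.N. t.lf x = l}"
proof -
  interpret l: single Kt l by (rule single[OF t l])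
  obtain a where a: "a \<in> pre (\<Union>P)" "l = t.cp a" using lifts_cp[OF t l] by blast
  show ?thesis
  proof (intro equalityI subsetI)
    fix x assume "x \<in> l.N"
    then obtain b where b: "b \<in> l" "x \<in> ends b" by (auto simp: l.N_def)
    have bD: "b \<in> pre (\<Union>P)" using t.cp_D[OF a(1)] a(2) b(1) by blast
    have "t.lf x = t.cp b" by (rule t.lf_eq[OF bD b(2)])
    also have "\<dots> = l" unfolding a(2) by (rule t.cp_eq) (use b(1) a(2) in simp)
    finally show "x \<in> {x \<in> t.N. t.lf x = l}" using bD b(2) by (auto simp: t.N_def)
  next
    fix x assume x: "x \<in> {x \<in> t.N. t.lf x = l}"
    then obtain b where b: "b \<in> pre (\<Union>P)" "x \<in> ends b" by (auto simp: t.N_def)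
    have "b \<in> l" using t.lf_eq[OF b] x t.cp_self[of b] by simp
    then show "x \<in> l.N" using b(2) by (auto simp: l.N_def)
  qed
qed

lemma halfspaces_count:
  assumes "t \<in> P" "l \<in> lifts Kt p t" "t' \<in> P" "l' \<in> lifts Kt p t'"
    and "\<And>e. card {x \<in> t.N. supp x = e \<and> t.lf x = l} = card {x \<in> t.N. supp x = e \<and> t.lf x = l'}"
  shows "halfspaces Kt l' = halfspaces Kt l"
proof -
  interpret l: single Kt l by (rule single[OF assms(1,2)])
  have s: "{x \<in> {x \<in> t.N. t.lf x = m}. supp x = e} = {x \<in> t.N. supp x = e \<and> t.lf x = m}" for m e by blast
  have "halfspaces Kt l' = image id ` halfspaces Kt l"
  proof (rule l.halfspaces_map[OF single[OF assms(3,4)] bij_betw_id])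
    show "card {x \<in> l.N. supp x = {u, v}} = card {x \<in> drw.N l'. supp x = {id u, id v}}" for u v
      unfolding N_lift[OF assms(1,2)] N_lift[OF assms(3,4)] s id_apply by (rule assms(5))
  qed simp
  then show ?thesis by simp
qed

lemma arc_simplex:
  assumes "a \<in> pre D"
  shows "\<exists>s\<in>Kt. a \<subseteq> cs s \<and> ends a \<subseteq> cs s"
proof -
  obtain f where f: "f \<in> faces Kt" "path_in_face f a" using assms by (auto simp: pre_iff)
  show ?thesis using path_in_face_closed(1,3)[OF f(2) faces_Kt(2)[OF f(1)]] faces_Kt(1)[OF f(1)] by blast
qed

lemma deck_pre_mem:
  assumes g: "deckp g" and a: "a \<in> pre D"
  shows "act g ` a \<in> pre D" "ends (act g ` a) = act g ` ends a"
    "act (inv_into (\<Union>Kt) g) ` act g ` a = a" "act g ` act (inv_into (\<Union>Kt) g) ` a = a"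
proof -
  obtain f where f: "f \<in> faces Kt" "path_in_face f a" "rm ` a \<in> D" using a by (auto simp: pre_iff)
  show "act g ` a \<in> pre D" unfolding pre_iff using deck_pre(1,2,4)[OF g f(1,2)] f(3) by auto
  show "ends (act g ` a) = act g ` ends a" by (rule deck_pre(3)[OF g f(1,2)])
  show "act (inv_into (\<Union>Kt) g) ` act g ` a = a" by (rule deck_pre(5)[OF g f(1,2)])
  obtain s where s: "s \<in> Kt" "a \<subseteq> cs s" using arc_simplex[OF a] by blast
  have "act g (act (inv_into (\<Union>Kt) g) x) = x" if "x \<in> a" for x
    using deck_inverse(2)[OF g s(1)] s(2) that by blast
  then show "act g ` act (inv_into (\<Union>Kt) g) ` a = a" by (simp add: image_image)
qed

lemma deck_cp_sub:
  assumes g: "deckp g" and a: "a \<in> pre (\<Union>P)"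
  shows "image (act g) ` t.cp a \<subseteq> t.cp (act g ` a)"
proof
  fix b' assume "b' \<in> image (act g) ` t.cp a"
  then obtain b where b: "(a, b) \<in> t.R\<^sup>*" "b' = act g ` b" by (auto simp: t.cp_def)
  from b(1) have "(act g ` a, act g ` b) \<in> t.R\<^sup>*"
  proof (induction)
    case (step b c)
    have bc: "b \<in> pre (\<Union>P)" "c \<in> pre (\<Union>P)" "ends b \<inter> ends c \<noteq> {}" using step(2) by (auto simp: t.R_def)
    have "ends (act g ` b) \<inter> ends (act g ` c) \<noteq> {}"
      unfolding deck_pre_mem(2)[OF g bc(1)] deck_pre_mem(2)[OF g bc(2)] using bc(3) by blast
    then have "(act g ` b, act g ` c) \<in> t.R"
      using deck_pre_mem(1)[OF g bc(1)] deck_pre_mem(1)[OF g bc(2)] by (simp add: t.R_def)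
    with step.IH show ?case by (rule rtrancl_into_rtrancl)
  qed simp
  then show "b' \<in> t.cp (act g ` a)" using b(2) by (simp add: t.cp_def)
qed

lemma deck_cp:
  assumes g: "deckp g" and a: "a \<in> pre (\<Union>P)"
  shows "image (act g) ` t.cp a = t.cp (act g ` a)"
proof (rule equalityI[OF deck_cp_sub[OF g a]], rule subsetI)
  let ?h = "inv_into (\<Union>Kt) g"
  fix b assume b: "b \<in> t.cp (act g ` a)"
  note ga = deck_pre_mem(1,3)[OF g a]
  have bD: "b \<in> pre (\<Union>P)" using t.cp_D[OF ga(1)] b by blast
  have "act ?h ` b \<in> t.cp (act ?h ` act g ` a)" using deck_cp_sub[OF deckp_inv[OF g] ga(1)] b by blast
  then have "act ?h ` b \<in> t.cp a" unfolding ga(2) .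
  moreover have "b = act g ` act ?h ` b" using deck_pre_mem(4)[OF g bD] by simp
  ultimately show "b \<in> image (act g) ` t.cp a" by blast
qed

lemma lifts_deck:
  assumes g: "deckp g" and t: "t \<in> P" and l: "l \<in> lifts Kt p t"
  shows "image (act g) ` l \<in> lifts Kt p t"
proof -
  obtain a where a: "a \<in> pre t" "a \<in> pre (\<Union>P)" "l = t.cp a" using lifts_cp[OF t l] .
  show ?thesis unfolding lifts_eq[OF t] a(3) deck_cp[OF g a(2)] using deck_pre_mem(1)[OF g a(1)] by blast
qed

lemma node_simplex: "x \<in> t.N \<Longrightarrow> \<exists>s\<in>Kt. x \<in> cs s"
  using arc_simplex unfolding t.N_def by blast

lemma deck_node:
  assumes g: "deckp g" and x: "x \<in> t.N"
  shows "act g x \<in> t.N" "supp (act g x) = g ` supp x" "t.lf (act g x) = image (act g) ` t.lf x"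
    "act (inv_into (\<Union>Kt) g) (act g x) = x" "act g (act (inv_into (\<Union>Kt) g) x) = x" "v \<in> supp x \<Longrightarrow> act g x (g v) = x v"
proof -
  obtain a where a: "a \<in> pre (\<Union>P)" "x \<in> ends a" using x by (auto simp: t.N_def)
  note ga = deck_pre_mem(1,2)[OF g a(1)]
  have e: "act g x \<in> ends (act g ` a)" unfolding ga(2) using a(2) by blast
  then show "act g x \<in> t.N" using ga(1) by (auto simp: t.N_def)
  show "t.lf (act g x) = image (act g) ` t.lf x" unfolding t.lf_eq[OF a] t.lf_eq[OF ga(1) e] deck_cp[OF g a(1)] ..
  obtain s where s: "s \<in> Kt" "x \<in> cs s" using node_simplex[OF x] by blast
  show "supp (act g x) = g ` supp x" by (rule transports_supp[OF transports_deck[OF g s(1)] s(2)])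
  show "act (inv_into (\<Union>Kt) g) (act g x) = x" by (rule deck_inverse(1)[OF g s])
  show "act g (act (inv_into (\<Union>Kt) g) x) = x" by (rule deck_inverse(2)[OF g s])
  show "act g x (g v) = x v" if "v \<in> supp x"
    by (rule transportsD(3)[OF transports_deck[OF g s(1)] s(2)]) (use that supp_closed[OF s(2)] in blast)
qed

lemma deck_nodes_bij:
  assumes g: "deckp g" and e: "e \<subseteq> \<Union>Kt"
  shows "bij_betw (act g) {x \<in> t.N. supp x = e} {x \<in> t.N. supp x = g ` e}"
proof (rule bij_betwI)
  let ?h = "inv_into (\<Union>Kt) g"
  have he: "?h ` g ` e = e" using inv_into_image_cancel[OF bij_betw_imp_inj_on[OF deckpD(1)[OF g]] e] .
  show "act g \<in> {x \<in> t.N. supp x = e} \<rightarrow> {x \<in> t.N. supp x = g ` e}" using deck_node(1,2)[OF g] by auto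
  show "act ?h \<in> {x \<in> t.N. supp x = g ` e} \<rightarrow> {x \<in> t.N. supp x = e}" using deck_node(1,2)[OF deckp_inv[OF g]] he by auto
  show "act ?h (act g x) = x" if "x \<in> {x \<in> t.N. supp x = e}" for x using deck_node(4)[OF g] that by blast
  show "act g (act ?h y) = y" if "y \<in> {x \<in> t.N. supp x = g ` e}" for y using deck_node(5)[OF g] that by blast
qed

lemma deck_lf_iff:
  assumes g: "deckp g" and x: "x \<in> t.N" "y \<in> t.N"
  shows "t.lf (act g x) = t.lf (act g y) \<longleftrightarrow> t.lf x = t.lf y"
proof
  assume h: "t.lf (act g x) = t.lf (act g y)"
  have "t.lf (act (inv_into (\<Union>Kt) g) (act g z)) = image (act (inv_into (\<Union>Kt) g)) ` t.lf (act g z)" if "z \<in> t.N" for z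
    by (rule deck_node(3)[OF deckp_inv[OF g] deck_node(1)[OF g that]])
  then show "t.lf x = t.lf y" using h deck_node(4)[OF g x(1)] deck_node(4)[OF g x(2)] x by metis
qed (simp add: deck_node(3)[OF g x(1)] deck_node(3)[OF g x(2)])

lemma halfspaces_deck:
  assumes g: "deckp g" and t: "t \<in> P" and l: "l \<in> lifts Kt p t"
  shows "halfspaces Kt (image (act g) ` l) = image g ` halfspaces Kt l"
proof -
  interpret l: single Kt l by (rule single[OF t l])
  have l': "image (act g) ` l \<in> lifts Kt p t" by (rule lifts_deck[OF g t l])
  obtain x0 where x0: "x0 \<in> t.N" "t.lf x0 = l" using lifts_lf[OF t l] by blast
  show ?thesis
  proof (rule l.halfspaces_map[OF single[OF t l'] deckpD(1)[OF g]])
    show "{g u, g v} \<in> Kt" if "{u, v} \<in> Kt" for u v using deckpD(3)[OF g that] by simp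
    fix u v assume uv: "{u, v} \<in> Kt"
    have sub: "{u, v} \<subseteq> \<Union>Kt" using uv by blast
    note b = deck_nodes_bij[OF g sub]
    have iff: "t.lf (act g x) = image (act g) ` l \<longleftrightarrow> t.lf x = l" if "x \<in> t.N" for x
      using deck_lf_iff[OF g that x0(1)] deck_node(3)[OF g x0(1)] x0(2) by simp
    have "act g ` {x \<in> {x \<in> t.N. supp x = {u, v}}. t.lf x = l} =
        {y \<in> act g ` {x \<in> t.N. supp x = {u, v}}. t.lf y = image (act g) ` l}" using iff by blast
    also have "\<dots> = {y \<in> {x \<in> t.N. supp x = g ` {u, v}}. t.lf y = image (act g) ` l}" using b by (simp add: bij_betw_def)
    finally have im: "act g ` {x \<in> {x \<in> t.N. supp x = {u, v}}. t.lf x = l} =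
        {y \<in> {x \<in> t.N. supp x = g ` {u, v}}. t.lf y = image (act g) ` l}" .
    have "inj_on (act g) {x \<in> {x \<in> t.N. supp x = {u, v}}. t.lf x = l}"
      by (rule inj_on_subset[OF bij_betw_imp_inj_on[OF b]]) blast
    from card_image[OF this] have "card {y \<in> {x \<in> t.N. supp x = g ` {u, v}}. t.lf y = image (act g) ` l} =
        card {x \<in> {x \<in> t.N. supp x = {u, v}}. t.lf x = l}" unfolding im .
    moreover have "{x \<in> {x \<in> t.N. t.lf x = m}. supp x = e} = {x \<in> {x \<in> t.N. supp x = e}. t.lf x = m}" for m e by blast
    ultimately show "card {x \<in> l.N. supp x = {u, v}} = card {x \<in> drw.N (image (act g) ` l). supp x = {g u, g v}}"
      unfolding N_lift[OF t l] N_lift[OF t l'] by simp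
  qed
qed

text \<open>The image of a lift is again a drawing: a continuation demanded below is found above, in
  the lift of the demanded face at the same endpoint. Being contained in \<open>t\<close>, it is all
  of \<open>t\<close> by minimality.\<close>

lemma lift_projection:
  assumes t: "t \<in> P" and s: "s \<in> lifts Kt p t"
  shows "image rm ` s = t"
proof -
  have sp: "s \<subseteq> pre t" "pretrack Kt s" using s by (auto simp: lifts_def)
  interpret s: drw Kt s using sp(2) by unfold_locales (simp_all add: Kt pretrack_def)
  have sub: "image rm ` s \<subseteq> t" using sp(1) by (auto simp: pre_iff)
  have subP: "image rm ` s \<subseteq> \<Union>P" using sub t by blast
  have "drawing K (image rm ` s)"
    unfolding drawing_def
  proof (intro conjI ballI impI)
    show "image rm ` s \<noteq> {}" using s.D by (simp add: drawing_def)
    show "\<exists>f\<in>faces K. path_in_face f a" if "a \<in> image rm ` s" for a by (rule k.D_face[OF subsetD[OF subP that]])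
    show "finite {a \<in> image rm ` s. path_in_face f a}" if "f \<in> faces K" for f
    proof (rule finite_subset[OF _ k.D_fin[OF that]], rule subsetI)
      fix a assume "a \<in> {a \<in> image rm ` s. path_in_face f a}"
      then have "a \<in> image rm ` s" "path_in_face f a" by simp_all
      then show "a \<in> {a \<in> \<Union>P. path_in_face f a}" using subsetD[OF subP] by simp
    qed
    show "ends a \<inter> ends b = {}" if "f \<in> faces K" "a \<in> image rm ` s" "b \<in> image rm ` s"
      "path_in_face f a \<and> path_in_face f b \<and> a \<noteq> b" for f a b
    proof -
      have "path_in_face f a" "path_in_face f b" "a \<noteq> b" using that(4) by simp_all
      then show ?thesis by (rule k.D_disj[OF that(1) subsetD[OF subP that(2)] subsetD[OF subP that(3)]])
    qed
    fix e x f assume h: "e \<in> edges K" "x \<in> cs e" "\<exists>a\<in>image rm ` s. x \<in> ends a" "f \<in> faces K" "e \<subseteq> f"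
    then obtain a where a: "a \<in> s" "x \<in> ends (rm ` a)" by blast
    obtain f' where f': "f' \<in> faces Kt" "path_in_face f' a" using s.D_face[OF a(1)] by blast
    note fk = faces_Kt[OF f'(1)]
    obtain y where y: "y \<in> ends a" "x = rm y" using a(2) unfolding rm_arc(2)[OF f'] by blast
    have yN: "y \<in> s.N" using a(1) y(1) by (auto simp: s.N_def)
    have yc: "y \<in> cs f'" using path_in_face_closed(1,3)[OF f'(2) fk(2)] y(1) by blast
    have sy: "p ` supp y \<subseteq> f"
      using transports_supp[OF transports_rm[OF fk(1)] yc] supp_closed[OF h(2)] h(5) y(2) by simp
    have yK: "supp y \<in> Kt" using s.node_supp(1)[OF a(1) y(1)] by (simp add: edges_def)
    obtain w where "w \<in> supp y" using ne_Kt[OF yK] by blast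
    then have w: "w \<in> supp y" "w \<in> \<Union>Kt" using yK by blast+
    have "p w \<in> f" using sy w(1) by blast
    from face_lift[OF h(4) w(2) this] obtain f2 where f2: "f2 \<in> faces Kt" "w \<in> f2" "p ` f2 = f" by blast
    \<comment> \<open>The part of \<open>f2\<close> over the image of the edge carrying
      \<open>y\<close>. It shares \<open>w\<close> with that edge, so \<open>lift_unique\<close>
      identifies the two, and \<open>f2\<close> contains the edge itself.\<close>
    let ?e = "{v \<in> f2. p v \<in> p ` supp y}"
    have we: "w \<in> ?e" using f2(2) w(1) by blast
    have eK: "?e \<in> Kt" by (rule abstract_face[OF Kt faces_Kt(1)[OF f2(1)]]) (use we in blast)+
    have "p ` supp y \<subseteq> p ` f2" using sy f2(3) by simp
    have pe: "p ` ?e = p ` supp y"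
    proof (rule equalityI; rule subsetI)
      fix z assume "z \<in> p ` supp y"
      then have "z \<in> p ` f2" by (rule subsetD[OF \<open>p ` supp y \<subseteq> p ` f2\<close>])
      then obtain v where v: "v \<in> f2" "z = p v" by (rule imageE)
      then have "v \<in> ?e" using \<open>z \<in> p ` supp y\<close> by simp
      then show "z \<in> p ` ?e" unfolding v(2) by (rule imageI)
    next
      fix z assume "z \<in> p ` ?e"
      then obtain v where "v \<in> ?e" "z = p v" by (rule imageE)
      then show "z \<in> p ` supp y" by simp
    qed
    have yf: "supp y \<subseteq> f2" 
      by (rule ord_eq_le_trans[OF lift_unique[OF eK yK we w(1) pe, THEN sym] Collect_subset])
    from s.D_cont[OF yN f2(1) yf] obtain b where b: "b \<in> s" "path_in_face f2 b" "y \<in> ends b" by blast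
    have "path_in_face f (rm ` b)" "x \<in> ends (rm ` b)"
      using rm_arc(1,2)[OF f2(1) b(2)] f2(3) y(2) b(3) by auto
    then show "\<exists>b\<in>image rm ` s. path_in_face f b \<and> x \<in> ends b" using b(1) by blast
  qed
  then show ?thesis using P_pretrack(1)[OF t] sub unfolding pretrack_def by (metis psubsetI)
qed

text \<open>Both lifts contain a path over one and the same path of \<open>t\<close>. The deck
  transformation that matches a vertex of the two faces matches the faces, then these paths, and
  then their components.\<close>

lemma lifts_related:
  assumes t: "t \<in> P" and s: "s \<in> lifts Kt p t" and r: "r \<in> lifts Kt p t"
  obtains g where "deckp g" "r = image (act g) ` s"
proof -
  obtain a where a: "a \<in> pre t" "a \<in> pre (\<Union>P)" "s = t.cp a" using lifts_cp[OF t s] .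
  have "a \<in> s" using a(3) t.cp_self by simp
  then have "rm ` a \<in> image rm ` s" by (rule imageI)
  then have "rm ` a \<in> image rm ` r" using lift_projection[OF t s] lift_projection[OF t r] by simp
  then obtain b where b: "b \<in> r" "rm ` b = rm ` a" by blast
  obtain c where c: "c \<in> pre (\<Union>P)" "r = t.cp c" using lifts_cp[OF t r] by blast
  have bP: "b \<in> pre (\<Union>P)" using t.cp_D[OF c(1)] b(1) c(2) by blast
  have rb: "r = t.cp b" using t.cp_eq[of b c] b(1) c(2) by simp
  obtain f where f: "f \<in> faces Kt" "path_in_face f a" using a(2) by (auto simp: pre_iff)
  obtain f' where f': "f' \<in> faces Kt" "path_in_face f' b" using bP by (auto simp: pre_iff)
  have pf: "p ` f' = p ` f" using path_in_face_unique rm_arc(1)[OF f] rm_arc(1)[OF f'] b(2) by simp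
  obtain w where w: "w \<in> f" using ne_Kt[OF faces_Kt(1)[OF f(1)]] by blast
  then have "p w \<in> p ` f'" unfolding pf by blast
  then obtain w' where w': "w' \<in> f'" "p w = p w'" by blast
  have wK: "w \<in> \<Union>Kt" "w' \<in> \<Union>Kt" using w w' faces_Kt(1) f(1) f'(1) by blast+
  obtain g where g: "deckp g" "g w = w'" using deckp_exists[OF wK w'(2)] .
  have gf: "g ` f = f'"
  proof (rule lift_unique[of _ _ w'])
    show "g ` f \<in> Kt" "f' \<in> Kt" "w' \<in> f'" using deckpD(3)[OF g(1) faces_Kt(1)[OF f(1)]] faces_Kt(1)[OF f'(1)] w'(1) .
    show "w' \<in> g ` f" using w g(2) by blast
    show "p ` g ` f = p ` f'" using deckpD(6)[OF g(1) faces_Kt(1)[OF f(1)]] pf by simp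
  qed
  note dg = deck_pre(2,4)[OF g(1) f]
  have "act g ` a = b"
    using rm_arc(3)[OF f'(1) dg(1)[unfolded gf]] rm_arc(3)[OF f'] dg(2) b(2) by simp
  then have "r = image (act g) ` s" unfolding rb a(3) deck_cp[OF g(1) a(2)] by simp
  then show ?thesis using that g(1) by blast
qed

text \<open>An invariant of the track that turns parallelism into an equality: since deck
  transformations permute the lifts of a track transitively, a single common pair of halfspaces
  already forces equal sets.\<close>

definition H where "H t = halfspaces Kt ` lifts Kt p t"

lemma H_sub:
  assumes t: "t \<in> P" "t' \<in> P" and s: "s \<in> lifts Kt p t" "s' \<in> lifts Kt p t'" "halfspaces Kt s = halfspaces Kt s'"
  shows "H t \<subseteq> H t'"
proof
  fix h assume "h \<in> H t"
  then obtain r where r: "r \<in> lifts Kt p t" "h = halfspaces Kt r" by (auto simp: H_def)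
  obtain g where g: "deckp g" "r = image (act g) ` s" using lifts_related[OF t(1) s(1) r(1)] .
  have "h = halfspaces Kt (image (act g) ` s')"
    unfolding r(2) g(2) halfspaces_deck[OF g(1) t(1) s(1)] halfspaces_deck[OF g(1) t(2) s(2)] s(3) ..
  then show "h \<in> H t'" using lifts_deck[OF g(1) t(2) s(2)] by (auto simp: H_def)
qed

lemma H_eq:
  assumes t: "t \<in> P" "t' \<in> P" and s: "s \<in> lifts Kt p t" "s' \<in> lifts Kt p t'" "halfspaces Kt s = halfspaces Kt s'"
  shows "H t = H t'"
  using H_sub[OF t s] H_sub[OF t(2,1) s(2,1) s(3)[symmetric]] by blast

end

lemma triple_distinct: "card {u, v, w} = 3 \<Longrightarrow> u \<noteq> v \<and> u \<noteq> w \<and> v \<noteq> w"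
  by (auto simp: card_insert_if split: if_splits)

section \<open>The pattern as a track system\<close>

context pat
begin

abbreviation I where "I l l' \<equiv> \<Union>l \<inter> \<Union>l' \<noteq> {}"

definition U where "U x u v = single.se Kt (t.lf x) u v x"

definition col where "col l = H (tk l)"

definition flags where "flags = {(u, v, w). {u, v, w} \<in> faces K}"

text \<open>One ordered face of the cover over each ordered face of \<open>K\<close>;
  \<open>flag_rep\<close> shows that deck transformations move every ordered face of the cover to
  one of these.\<close>

definition flag_lift :: "'v \<times> 'v \<times> 'v \<Rightarrow> 'w \<times> 'w \<times> 'w" where
  "flag_lift = (\<lambda>(u, v, w). SOME (u', v', w'). {u', v', w'} \<in> faces Kt \<and> p u' = u \<and> p v' = v \<and> p w' = w)"

lemma flag_lift:
  assumes "(u, v, w) \<in> flags"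
  obtains u' v' w' where "flag_lift (u, v, w) = (u', v', w')" "{u', v', w'} \<in> faces Kt" "p u' = u" "p v' = v" "p w' = w"
proof -
  have f: "{u, v, w} \<in> faces K" using assms by (simp add: flags_def)
  then have "u \<in> \<Union>K" by (auto simp: faces_def)
  from p_surj[OF this] obtain u0 where u0: "u0 \<in> \<Union>Kt" "p u0 = u" by (elim bexE)
  have "p u0 \<in> {u, v, w}" using u0(2) by simp
  from face_lift[OF f u0(1) this] obtain s where s: "s \<in> faces Kt" "p ` s = {u, v, w}" by blast
  have "u \<in> p ` s" "v \<in> p ` s" "w \<in> p ` s" using s(2) by simp_all
  obtain a where a: "u = p a" "a \<in> s" using \<open>u \<in> p ` s\<close> by (rule imageE)
  obtain b where b: "v = p b" "b \<in> s" using \<open>v \<in> p ` s\<close> by (rule imageE)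
  obtain c where c: "w = p c" "c \<in> s" using \<open>w \<in> p ` s\<close> by (rule imageE)
  note abc = a(2) b(2) c(2) a(1)[symmetric] b(1)[symmetric] c(1)[symmetric]
  have "u \<noteq> v \<and> u \<noteq> w \<and> v \<noteq> w" by (rule triple_distinct) (use f in \<open>simp add: faces_def\<close>)
  then have "a \<noteq> b \<and> a \<noteq> c \<and> b \<noteq> c" using a(1) b(1) c(1) by auto
  then have "card {a, b, c} = 3" by simp
  then have "{a, b, c} = s"
    using card_seteq[of s "{a, b, c}"] abc(1-3) faces_Kt(2)[OF s(1)] fin_Kt[OF faces_Kt(1)[OF s(1)]] by simp
  then have ex: "\<exists>x. case x of (u', v', w') \<Rightarrow> {u', v', w'} \<in> faces Kt \<and> p u' = u \<and> p v' = v \<and> p w' = w"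
    using s(1) abc(4-6) by (intro exI[of _ "(a, b, c)"]) simp
  obtain u' v' w' where e: "flag_lift (u, v, w) = (u', v', w')" using prod_cases3 by blast
  have "case flag_lift (u, v, w) of (u', v', w') \<Rightarrow> {u', v', w'} \<in> faces Kt \<and> p u' = u \<and> p v' = v \<and> p w' = w"
    unfolding flag_lift_def prod.case by (rule someI_ex[OF ex])
  then show ?thesis using that[OF e] unfolding e by simp
qed

lemma finite_flags: "finite flags"
proof (rule finite_subset)
  show "flags \<subseteq> \<Union>K \<times> \<Union>K \<times> \<Union>K" by (auto simp: flags_def faces_def)
  show "finite (\<Union>K \<times> \<Union>K \<times> \<Union>K)" using finK K by (auto simp: abstract_complex_def)
qed

text \<open>Paths of a single lift in a common face are disjoint, so paths that meet belong to
  different lifts, which then intersect.\<close>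

lemma lift_disjoint:
  assumes f: "f \<in> faces Kt" and ab: "a \<in> pre (\<Union>P)" "b \<in> pre (\<Union>P)" "path_in_face f a" "path_in_face f b" "a \<noteq> b" "a \<inter> b \<noteq> {}"
  shows "t.cp a \<noteq> t.cp b" "I (t.cp a) (t.cp b)"
proof -
  show "I (t.cp a) (t.cp b)" using ab(6) t.cp_self by blast
  show "t.cp a \<noteq> t.cp b"
  proof
    assume e: "t.cp a = t.cp b"
    obtain t where t: "t \<in> P" "a \<in> pre t" using pre_track[OF ab(1)] by blast
    have l: "t.cp a \<in> lifts Kt p t" using lifts_eq[OF t(1)] t(2) by blast
    interpret s: single Kt "t.cp a" by (rule single[OF t(1) l])
    have "a \<inter> b = {}" by (rule s.nx[OF f _ _ ab(3-5)]) (use e t.cp_self[of a] t.cp_self[of b] in simp_all)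
    then show False using ab(6) by blast
  qed
qed

lemma near_meet:
  assumes f: "{u, v, w} \<in> faces Kt" and a: "a \<in> pre (\<Union>P)" "b \<in> pre (\<Union>P)" and c: "crossing u v w b y y'"
    and x: "path_in_face {u, v, w} a" "ends a = {x, x'}" and n: "near v w y y' x \<noteq> near v w y y' x'"
  shows "t.cp a \<noteq> t.cp b \<and> I (t.cp a) (t.cp b)"
proof -
  note cf = crossingD[OF c]
  interpret tri u v w by (rule cf(1))
  have "a \<inter> b \<noteq> {}"
  proof
    assume "a \<inter> b = {}"
    then have "near v w y y' x \<longleftrightarrow> near v w y y' x'" using disjoint_near[OF c x(1)] x(2) by blast
    then show False using n by blast
  qed
  moreover have "a \<noteq> b"
  proof
    assume "a = b"
    then have "{x, x'} = {y, y'}" using x(2) cf(3) by simp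
    then have "x = y \<and> x' = y' \<or> x = y' \<and> x' = y" by (auto simp: doubleton_eq_iff)
    moreover have "\<not> near v w y y' y" "\<not> near v w y y' y'"
      using crossing_sub[OF c] by (auto simp: near_def)
    ultimately show False using n by blast
  qed
  ultimately show ?thesis using lift_disjoint[OF f a x(1) cf(2)] by blast
qed

lemma node_coords:
  assumes "x \<in> t.N" "supp x = {u, v}"
  shows "u \<noteq> v" "x \<in> cs {u, v}" "0 < x v" "0 < x u"
proof -
  obtain a where a: "a \<in> pre (\<Union>P)" "x \<in> ends a" using assms(1) by (auto simp: t.N_def)
  show "u \<noteq> v" using t.node_supp(2)[OF a] assms(2) by auto
  have "x \<in> open_simplex {u, v}" using t.node_supp(3)[OF a] assms(2) by simp
  then show "x \<in> cs {u, v}" "0 < x v" "0 < x u" by (auto simp: open_simplex_def)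
qed

text \<open>Serves both crossing axioms of \<open>track_system\<close>. With respect to the path at
  \<open>y\<close>, the point \<open>x\<close> lies on the side of the corner \<open>u\<close>, and
  in either case the other end of its path does not.\<close>

lemma cross_interleaved:
  assumes x: "x \<in> t.N" "y \<in> t.N" and f: "{u, v, w} \<in> faces Kt" and s: "supp x = {u, v}" "supp y = {u, v}"
    and lt: "x v < y v" and ny: "supp (t.nb {u, v, w} y) = {u, w}"
    and nx: "supp (t.nb {u, v, w} x) = {v, w} \<or> supp (t.nb {u, v, w} x) = {u, w} \<and> t.nb {u, v, w} y w < t.nb {u, v, w} x w"
  shows "t.lf x \<noteq> t.lf y \<and> I (t.lf x) (t.lf y)"
proof -
  let ?f = "{u, v, w}" and ?x = "t.nb {u, v, w} x" and ?y = "t.nb {u, v, w} y"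
  have sx: "supp x \<subseteq> ?f" and sy: "supp y \<subseteq> ?f" using s by blast+
  have c: "crossing u v w (t.arc_at ?f y) y ?y" by (rule t.nb_crossing[OF x(2) f s(2) ny])
  have d: "u \<noteq> v" "u \<noteq> w" "v \<noteq> w" using crossingD(1)[OF c] by (simp_all add: tri_def)
  have xc: "x \<in> cs {u, v}" by (rule node_coords(2)[OF x(1) s(1)])
  have "near v w y ?y x" using lt closed_edge(4)[OF xc d(1), of w] d by (simp add: near_def)
  moreover have "\<not> near v w y ?y ?x"
    using nx
  proof
    assume h: "supp ?x = {v, w}"
    show ?thesis using node_coords(3,4)[OF t.nb(1)[OF x(1) f sx] h] by (simp add: near_def)
  next
    assume h: "supp ?x = {u, w} \<and> ?y w < ?x w"
    note nc = node_coords[OF t.nb(1)[OF x(1) f sx] conjunct1[OF h]]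
    show ?thesis using nc(3) h by (simp add: near_def)
  qed
  ultimately have n: "near v w y ?y x \<noteq> near v w y ?y ?x" by blast
  show ?thesis
    unfolding t.lf_arc_at[OF x(1) f sx] t.lf_arc_at[OF x(2) f sy]
    by (rule near_meet[OF f t.arc_at_D(1)[OF x(1) f sx] t.arc_at_D(1)[OF x(2) f sy] c t.arc_at_D(2)[OF x(1) f sx] t.nb(6)[OF x(1) f sx] n])
qed

lemma deck_nb:
  assumes g: "deckp g" and x: "x \<in> t.N" "f \<in> faces Kt" "supp x \<subseteq> f"
  shows "t.nb (g ` f) (act g x) = act g (t.nb f x)"
proof -
  obtain u v w where c: "f = {u, v, w}" "crossing u v w (t.arc_at f x) x (t.nb f x)" using t.arc_at_crossing[OF x] .
  have T: "transports g (act g) {u, v, w}" using transports_deck[OF g faces_Kt(1)[OF x(2)]] c(1) by simp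
  note c2 = crossing_transport[OF T c(2)]
  note dp = deck_pre(1,2)[OF g x(2) t.arc_at_D(2)[OF x]]
  have "t.arc_at (g ` f) (act g x) = act g ` t.arc_at f x"
    by (rule t.arc_at_eq[OF dp(1) deck_pre_mem(1)[OF g t.arc_at_D(1)[OF x]] dp(2)])
      (use crossingD(3)[OF c2] in simp)
  then show ?thesis unfolding t.nb_def[of "g ` f"] using opp_crossing[OF c2] by simp
qed

lemma deck_I:
  assumes g: "deckp g" and l: "l \<subseteq> pre (\<Union>P)" "l' \<subseteq> pre (\<Union>P)"
  shows "I (image (act g) ` l) (image (act g) ` l') \<longleftrightarrow> I l l'"
proof
  assume "I (image (act g) ` l) (image (act g) ` l')"
  then obtain x x' where x: "x \<in> \<Union>l" "x' \<in> \<Union>l'" "act g x = act g x'" by auto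
  have inv: "act (inv_into (\<Union>Kt) g) (act g z) = z" if z: "z \<in> \<Union>(pre (\<Union>P))" for z
  proof -
    obtain a where "a \<in> pre (\<Union>P)" "z \<in> a" using z by blast
    then obtain s where "s \<in> Kt" "z \<in> cs s" using arc_simplex by blast
    then show ?thesis by (rule deck_inverse(1)[OF g])
  qed
  have "x = x'" using inv[of x] inv[of x'] x l by (metis Union_mono subsetD)
  then show "I l l'" using x(1,2) by blast
next
  assume "I l l'"
  then obtain a b x where "a \<in> l" "b \<in> l'" "x \<in> a" "x \<in> b" by blast
  then have "act g x \<in> \<Union>(image (act g) ` l) \<inter> \<Union>(image (act g) ` l')" by blast
  then show "I (image (act g) ` l) (image (act g) ` l')" by blast
qed

lemma lf_pre: "x \<in> t.N \<Longrightarrow> t.lf x \<subseteq> pre (\<Union>P)"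
  using t.lf_eq t.cp_D unfolding t.N_def by blast

text \<open>The deck transformation taking \<open>u\<close> to \<open>u'\<close> takes the whole
  face to its representative by uniqueness of lifts, and respects the order of the vertices because
  \<open>p\<close> is injective on a face.\<close>

lemma flag_rep:
  assumes f: "{u, v, w} \<in> faces Kt"
  shows "\<exists>u' v' w' g. (u', v', w') \<in> flag_lift ` flags \<and>
      bij_betw g {x \<in> t.N. supp x = {u, v}} {x \<in> t.N. supp x = {u', v'}} \<and>
      (\<forall>x y. x \<in> t.N \<and> supp x = {u, v} \<and> y \<in> t.N \<and> supp y = {u, v} \<longrightarrow>
        (g x v' < g y v' \<longleftrightarrow> x v < y v) \<and>
        (t.lf (g x) = t.lf (g y) \<longleftrightarrow> t.lf x = t.lf y) \<and> (I (t.lf (g x)) (t.lf (g y)) \<longleftrightarrow> I (t.lf x) (t.lf y)) \<and>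
        (supp (t.nb {u', v', w'} (g x)) = {u', w'} \<longleftrightarrow> supp (t.nb {u, v, w} x) = {u, w}) \<and>
        col (t.lf (g x)) = col (t.lf x))"
proof -
  note fk = faces_Kt[OF f]
  have F: "(p u, p v, p w) \<in> flags" using p_faces[OF f] by (simp add: flags_def)
  obtain u' v' w' where L: "flag_lift (p u, p v, p w) = (u', v', w')" "{u', v', w'} \<in> faces Kt" "p u' = p u" "p v' = p v" "p w' = p w"
    using flag_lift[OF F] .
  have uK: "u \<in> \<Union>Kt" "u' \<in> \<Union>Kt" using fk(1) faces_Kt(1)[OF L(2)] by blast+
  obtain g where g: "deckp g" "g u = u'" using deckp_exists[OF uK L(3)[symmetric]] .
  have gK: "g ` {u, v, w} \<in> Kt" by (rule deckpD(3)[OF g(1) fk(1)])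
  have gf: "g ` {u, v, w} = {u', v', w'}"
  proof (rule lift_unique[OF gK faces_Kt(1)[OF L(2)]])
    show "u' \<in> g ` {u, v, w}" using g(2) by blast
    show "u' \<in> {u', v', w'}" by blast
    show "p ` g ` {u, v, w} = p ` {u', v', w'}" unfolding deckpD(6)[OF g(1) fk(1)] using L(3-5) by simp
  qed
  have vK: "v \<in> \<Union>Kt" "w \<in> \<Union>Kt" using fk(1) by blast+
  have inj: "inj_on p {u', v', w'}" by (rule inj_p[OF faces_Kt(1)[OF L(2)]])
  have m: "g v \<in> {u', v', w'}" "g w \<in> {u', v', w'}" "v' \<in> {u', v', w'}" "w' \<in> {u', v', w'}" using gf by blast+
  have gv: "g v = v'" by (rule inj_onD[OF inj _ m(1,3)]) (simp add: deckpD(2)[OF g(1) vK(1)] L(4))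
  have gw: "g w = w'" by (rule inj_onD[OF inj _ m(2,4)]) (simp add: deckpD(2)[OF g(1) vK(2)] L(5))
  show ?thesis
  proof (rule exI[of _ u'], rule exI[of _ v'], rule exI[of _ w'], rule exI[of _ "act g"], intro conjI allI impI)
    show "(u', v', w') \<in> flag_lift ` flags" using L(1) F by (metis imageI)
    have "{u, v} \<subseteq> \<Union>Kt" using uK vK by blast
    from deck_nodes_bij[OF g(1) this] show "bij_betw (act g) {x \<in> t.N. supp x = {u, v}} {x \<in> t.N. supp x = {u', v'}}"
      using g(2) gv by simp
    fix x y assume h: "x \<in> t.N \<and> supp x = {u, v} \<and> y \<in> t.N \<and> supp y = {u, v}"
    then have x: "x \<in> t.N" "supp x = {u, v}" and y: "y \<in> t.N" "supp y = {u, v}" by blast+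
    have "act g x v' = x v" "act g y v' = y v"
      using deck_node(6)[OF g(1) x(1), of v] deck_node(6)[OF g(1) y(1), of v] x(2) y(2) gv by simp_all
    then show "act g x v' < act g y v' \<longleftrightarrow> x v < y v" by simp
    show "t.lf (act g x) = t.lf (act g y) \<longleftrightarrow> t.lf x = t.lf y" by (rule deck_lf_iff[OF g(1) x(1) y(1)])
    show "I (t.lf (act g x)) (t.lf (act g y)) \<longleftrightarrow> I (t.lf x) (t.lf y)"
      unfolding deck_node(3)[OF g(1) x(1)] deck_node(3)[OF g(1) y(1)]
      by (rule deck_I[OF g(1) lf_pre[OF x(1)] lf_pre[OF y(1)]])
    have sx: "supp x \<subseteq> {u, v, w}" using x(2) by blast
    note nb = t.nb(1,2)[OF x(1) f sx]
    have "t.nb {u', v', w'} (act g x) = act g (t.nb {u, v, w} x)"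
      using deck_nb[OF g(1) x(1) f sx] gf by simp
    then have s: "supp (t.nb {u', v', w'} (act g x)) = g ` supp (t.nb {u, v, w} x)"
      using deck_node(2)[OF g(1) nb(1)] by simp
    have "{u', w'} = g ` {u, w}" using g(2) gw by simp
    moreover have "g ` supp (t.nb {u, v, w} x) = g ` {u, w} \<longleftrightarrow> supp (t.nb {u, v, w} x) = {u, w}"
      by (rule inj_on_image_eq_iff[OF deckpD(4)[OF g(1) fk(1)] nb(2)]) blast
    ultimately show "supp (t.nb {u', v', w'} (act g x)) = {u', w'} \<longleftrightarrow> supp (t.nb {u, v, w} x) = {u, w}"
      unfolding s by simp
    obtain t where t: "t \<in> P" "t.lf x \<in> lifts Kt p t" using lf_lifts[OF imageI[OF x(1)]] by blast
    show "col (t.lf (act g x)) = col (t.lf x)"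
      unfolding col_def deck_node(3)[OF g(1) x(1)] tk[OF t] tk[OF t(1) lifts_deck[OF g(1) t]] ..
  qed
qed

lemma track_system: "track_system t.N supp (\<lambda>x. x) (faces Kt) t.nb t.lf I d U col (flag_lift ` flags)"
proof
  show "card (supp x) = 2" if "x \<in> t.N" for x using that t.node_supp(2) by (auto simp: t.N_def)
  show "x u = 1 - x v" if "x \<in> t.N" "supp x = {u, v}" for x u v
    by (rule closed_edge(1)[OF node_coords(2,1)[OF that]])
  show "x = y" if "x \<in> t.N" "y \<in> t.N" "supp x = {u, v}" "supp y = {u, v}" "x v = y v" for x y u v
    by (rule edge_eqI[OF node_coords(2)[OF that(1,3)] node_coords(2)[OF that(2,4)] node_coords(1)[OF that(1,3)] that(5)])
  show "finite {x \<in> t.N. supp x = e}" for e by (rule t.fin_nodes)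
  show "card f = 3" if "f \<in> faces Kt" for f by (rule faces_Kt(2)[OF that])
  show "\<exists>f\<in>faces Kt. supp x \<subseteq> f" if "x \<in> t.N" for x by (rule t.node_face[OF that])
  show "t.nb f x \<in> t.N \<and> supp (t.nb f x) \<subseteq> f \<and> supp (t.nb f x) \<noteq> supp x \<and> t.nb f (t.nb f x) = x \<and> t.lf (t.nb f x) = t.lf x"
    if "x \<in> t.N" "f \<in> faces Kt" "supp x \<subseteq> f" for x f
    using t.nb[OF that] t.lf_nb[OF that] by simp
  show "(x, y) \<in> {(x, t.nb f x) | x f. x \<in> t.N \<and> f \<in> faces Kt \<and> supp x \<subseteq> f}\<^sup>*"
    if "x \<in> t.N" "y \<in> t.N" "t.lf x = t.lf y" for x y by (rule t.nb_conn[OF that])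
  show "I l' l" if "I l l'" for l l' using that by blast
  show "card S \<le> d" if S: "finite S" "S \<subseteq> t.lf ` t.N" "\<And>l l'. l \<in> S \<Longrightarrow> l' \<in> S \<Longrightarrow> l \<noteq> l' \<Longrightarrow> I l l'" for S
  proof -
    have "S \<subseteq> (\<Union>t\<in>P. lifts Kt p t)"
    proof
      fix l assume "l \<in> S"
      then have "l \<in> t.lf ` t.N" using S(2) by blast
      from lf_lifts[OF this] show "l \<in> (\<Union>t\<in>P. lifts Kt p t)" by simp
    qed
    moreover have "pairwise (\<lambda>s s'. \<Union>s \<inter> \<Union>s' \<noteq> {}) S" by (rule pairwiseI) (rule S(3))
    ultimately show ?thesis using dp unfolding d_pattern_def by blast
  qed
  show "t.lf x \<noteq> t.lf y \<and> I (t.lf x) (t.lf y)"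
    if "x \<in> t.N" "y \<in> t.N" "{u, v, w} \<in> faces Kt" "supp x = {u, v}" "supp y = {u, v}" "x v < y v"
      "supp (t.nb {u, v, w} x) = {v, w}" "supp (t.nb {u, v, w} y) = {u, w}" for x y u v w
    by (rule cross_interleaved[OF that(1-6) that(8)]) (simp add: that(7))
  show "t.lf x \<noteq> t.lf y \<and> I (t.lf x) (t.lf y)"
    if "x \<in> t.N" "y \<in> t.N" "{u, v, w} \<in> faces Kt" "supp x = {u, v}" "supp y = {u, v}" "x v < y v"
      "supp (t.nb {u, v, w} x) = {u, w}" "supp (t.nb {u, v, w} y) = {u, w}"
      "t.nb {u, v, w} y w < t.nb {u, v, w} x w" for x y u v w
    by (rule cross_interleaved[OF that(1-6) that(8)]) (simp add: that(7,9))
  show "U x u v \<longleftrightarrow> \<not> U x v u" if x: "x \<in> t.N" "supp x = {u, v}" for x u v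
  proof -
    obtain t where t: "t \<in> P" "t.lf x \<in> lifts Kt p t" using lf_lifts[OF imageI[OF x(1)]] by blast
    interpret s: single Kt "t.lf x" by (rule single[OF t])
    have "x \<in> s.N" unfolding N_lift[OF t] using x(1) by simp
    then show ?thesis unfolding U_def using s.se_flip x(2) by blast
  qed
  show "U (t.nb {u, v, w} x) u w \<longleftrightarrow> U x u v"
    if x: "x \<in> t.N" "{u, v, w} \<in> faces Kt" "supp x = {u, v}" "supp (t.nb {u, v, w} x) = {u, w}" for x u v w
  proof -
    have sx: "supp x \<subseteq> {u, v, w}" using x(3) by blast
    obtain t where t: "t \<in> P" "t.lf x \<in> lifts Kt p t" using lf_lifts[OF imageI[OF x(1)]] by blast
    interpret s: single Kt "t.lf x" by (rule single[OF t])
    have "t.arc_at {u, v, w} x \<in> t.lf x" unfolding t.lf_arc_at[OF x(1,2) sx] by (rule t.cp_self)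
    from s.se_nb[OF this x(2) t.nb_crossing[OF x]] show ?thesis
      unfolding U_def t.lf_nb[OF x(1,2) sx] by simp
  qed
  show "col l = col l'" if l: "l \<in> t.lf ` t.N" "l' \<in> t.lf ` t.N"
    "\<And>e. card {x \<in> t.N. supp x = e \<and> t.lf x = l} = card {x \<in> t.N. supp x = e \<and> t.lf x = l'}" for l l'
  proof -
    obtain t where t: "t \<in> P" "l \<in> lifts Kt p t" using lf_lifts[OF l(1)] by blast
    obtain t' where t': "t' \<in> P" "l' \<in> lifts Kt p t'" using lf_lifts[OF l(2)] by blast
    have "halfspaces Kt l' = halfspaces Kt l" by (rule halfspaces_count[OF t t' l(3)])
    then show ?thesis unfolding col_def tk[OF t] tk[OF t'] using H_eq[OF t(1) t'(1) t(2) t'(2)] by simp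
  qed
  show "finite (flag_lift ` flags)" using finite_flags by simp
  show "{u, v, w} \<in> faces Kt" if uvw: "(u, v, w) \<in> flag_lift ` flags" for u v w
  proof -
    obtain a b c where abc: "(a, b, c) \<in> flags" "flag_lift (a, b, c) = (u, v, w)" using uvw by (metis imageE prod_cases3)
    from flag_lift[OF abc(1)] abc(2) show ?thesis by (metis prod.inject)
  qed
qed (rule flag_rep)

lemma lifts_nonempty: "t \<in> P \<Longrightarrow> lifts Kt p t \<noteq> {}"
  using pre_drawing[OF P_pretrack(2)] by (simp add: lifts_eq drawing_def)

text \<open>On \<open>P\<close>, parallelism is equality of \<open>H\<close>. The classes are
  therefore the fibres of \<open>H\<close>, and every value of \<open>H\<close> is a colour in the
  sense of \<open>card_colours\<close>.\<close>

lemma classes_bound: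
  "finite (parallelism_classes Kt p P) \<and> card (parallelism_classes Kt p P) \<le> card flags * (d * d + 2 * stab_const d)"
proof -
  let ?R = "{(t, t'). t \<in> P \<and> t' \<in> P \<and> parallel_tracks Kt p t t'}"
  let ?B = "card (flag_lift ` flags) * (d * d + 2 * stab_const d)"
  have col: "finite (col ` t.lf ` t.N)" "card (col ` t.lf ` t.N) \<le> ?B"
    using track_system.card_colours[OF track_system] by blast+
  have HP: "H ` P \<subseteq> col ` t.lf ` t.N"
  proof
    fix h assume "h \<in> H ` P"
    then obtain t where t: "t \<in> P" "h = H t" by blast
    obtain l where l: "l \<in> lifts Kt p t" using lifts_nonempty[OF t(1)] by blast
    have "h = col l" unfolding col_def tk[OF t(1) l] t(2) ..
    then show "h \<in> col ` t.lf ` t.N" using lifts_lf[OF t(1) l] by blast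
  qed
  have par: "parallel_tracks Kt p t t' \<longleftrightarrow> H t = H t'" if t: "t \<in> P" "t' \<in> P" for t t'
  proof
    assume "parallel_tracks Kt p t t'"
    then show "H t = H t'" unfolding parallel_tracks_def using H_eq[OF t] by blast
  next
    assume h: "H t = H t'"
    obtain l where l: "l \<in> lifts Kt p t" using lifts_nonempty[OF t(1)] by blast
    then have "halfspaces Kt l \<in> H t'" using h by (auto simp: H_def)
    then show "parallel_tracks Kt p t t'" unfolding parallel_tracks_def H_def using l by blast
  qed
  have "parallelism_classes Kt p P \<subseteq> (\<lambda>h. {t \<in> P. h = H t}) ` H ` P"
  proof
    fix c assume "c \<in> parallelism_classes Kt p P"
    then obtain t where t: "t \<in> P" "c = ?R `` {t}" unfolding parallelism_classes_def by (rule quotientE)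
    have "c = {t' \<in> P. H t = H t'}" unfolding t(2) using par[OF t(1)] t(1) by auto
    then show "c \<in> (\<lambda>h. {t \<in> P. h = H t}) ` H ` P" using t(1) by blast
  qed
  moreover have fH: "finite (H ` P)" "card (H ` P) \<le> ?B"
    using finite_subset[OF HP col(1)] card_mono[OF col(1) HP] col(2) by simp_all
  ultimately have "finite (parallelism_classes Kt p P)" "card (parallelism_classes Kt p P) \<le> card (H ` P)"
    using finite_subset card_mono[of "(\<lambda>h. {t \<in> P. h = H t}) ` H ` P"] card_image_le[OF fH(1), of "\<lambda>h. {t \<in> P. h = H t}"]
    by (meson finite_imageI, meson finite_imageI le_trans)
  moreover have "?B \<le> card flags * (d * d + 2 * stab_const d)"
    by (rule mult_right_mono[OF card_image_le[OF finite_flags]]) simp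
  ultimately show ?thesis using fH(2) by linarith
qed

end

theorem theorem1p2:
  fixes K :: "'v set set" and d :: nat
  assumes "abstract_complex K" and "finite K" and "two_dimensional K"
    and "connected (realization K)"
  shows "\<exists>C::nat. \<forall>(Kt :: 'w set set) (p :: 'w \<Rightarrow> 'v) P.
           universal_cover K Kt p \<and> d_pattern d K Kt p P \<longrightarrow>
             finite (parallelism_classes Kt p P) \<and> card (parallelism_classes Kt p P) \<le> C"
proof (intro exI allI impI)
  fix Kt :: "'w set set" and p :: "'w \<Rightarrow> 'v" and P
  assume h: "universal_cover K Kt p \<and> d_pattern d K Kt p P"
  interpret pat K Kt p d P by unfold_locales (use assms h in auto)
  \<comment> \<open>The constant is formed from the ordered faces of \<open>K\<close> and from
    \<open>d\<close> alone, so it can be fixed before the cover and the pattern.\<close>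
  show "finite (parallelism_classes Kt p P) \<and>
      card (parallelism_classes Kt p P) \<le> card {(u, v, w). {u, v, w} \<in> faces K} * (d * d + 2 * stab_const d)"
    using classes_bound unfolding flags_def .
qed

end
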